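(* Fix $\gamma\ge1$ and let $L_n\sim\mu_n$. Let $N_n$ be deterministic positive integers with $n^{-1}\log N_n\to r$. (a) Consider direct search procedures (see context) making at most $N_n$ queries in which each query law, conditional on the history and $L_n$, is a law on $L_n$ at total variation distance at most $\epsilon_n$ from $D_{L_n,s_n(c_j)}$, this bound holding for every query history on a common set of lattices of probability tending to one. If for some $\delta>0$ $$\epsilon_n=o\bigl(e^{-n(K_\gamma^*+\delta)}\bigr),$$ then: if $r<K_\gamma^*$, the joint success probability of any such procedure tends to $0$; if $r>K_\gamma^*$, making $N_n$ queries with $c_j=e^{-1}$ for all $j$ and returning the shortest nonzero sample gives joint success probability tending to $1$. (b) Fix $0<c<1$ and suppose all queries use $c_j=c$, with query laws accurate within $\epsilon_n$ as in (a), where $\epsilon_n=o(e^{-n(K_\gamma(c)+\delta)})$ for some $\delta>0$. Then the conditional probability $q$ that a query returns $V$ with $0<\|V\|\le\gamma\lambda_1(L_n)$ satisfies $-\frac1n\log q\to K_\gamma(c)$ in probability, and the joint probability that at least one of $N_n$ queries does so tends to $0$ if $r<K_\gamma(c)$ and to $1$ if $r>K_\gamma(c)$.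
   Context: All logarithms are natural; limits are as $n\to\infty$. $\mu_n$ is the $\mathrm{SL}(n,\mathbb R)$-invariant probability measure on $\mathrm{SL}(n,\mathbb Z)\backslash\mathrm{SL}(n,\mathbb R)$, identified with the space of lattices of covolume $1$ in $\mathbb R^n$. $\lambda_1(L)$ is the length of a shortest nonzero vector of $L$; $v_n$ is the volume of the Euclidean unit ball in $\mathbb R^n$; $\mathrm{GH}_n=v_n^{-1/n}$; for $c>0$, $s_n(c)>0$ is given by $s_n(c)^2=2\pi\,\mathrm{GH}_n^2/(cn)$. $D_{L,s}$ is the probability law on $L$ (zero included) with $D_{L,s}(v)\propto e^{-\pi\|v\|^2/s^2}$. Every nonzero $v\in L$ is uniquely $v=mw$ with integer $m\ge1$ and $w\in L$ primitive; put $P_L(v)=w$, $P_L(0)=0$. Rates: $K_\gamma^*=\gamma^2/(2e)-\log\gamma$ for $1\le\gamma<\sqrt e$ and $K_\gamma^*=0$ for $\gamma\ge\sqrt e$. For $0<c<1$, $K_\gamma(c)=\max\{0,\frac{1+\log c}2\}+D_\gamma(c)$, where $D_\gamma(c)=\frac12\{c\gamma^2-1-\log(c\gamma^2)\}$ if $c<\gamma^{-2}$ and $D_\gamma(c)=0$ if $\gamma^{-2}\le c<1$. Direct search procedure: at query $j$ it chooses any $c_j>0$ measurably from $L_n$, its internal randomness, and the previous outputs, and receives a sample from the query law. At the end it returns one of its nonzero samples, optionally after applying $P_{L_n}$, or reports failure. It succeeds if it returns a nonzero vector of length at most $\gamma\lambda_1(L_n)$. Joint probability is over $L_n\sim\mu_n$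 and all sampling and internal randomness. *)

theory Defs
  imports
    "HOL-Probability.Probability"
    "HOL-Library.Landau_Symbols"
    "Jordan_Normal_Form.Determinant"
begin

hide_const (open) Finite_Cartesian_Product.vec Determinants.det

section \<open>The space of unimodular lattices\<close>

text \<open>Since the dimension tends to infinity, vectors and matrices are the carrier-based ones of
  Jordan_Normal_Form: \<open>carrier_vec n\<close> is $\mathbf{R}^n$ and \<open>carrier_mat n n\<close> the square matrices.\<close>

definition vec_len :: "real vec \<Rightarrow> real" where
  "vec_len v = sqrt (scalar_prod v v)"

definition vec_borel :: "nat \<Rightarrow> real vec measure" where
  "vec_borel n = vimage_algebra (carrier_vec n) (\<lambda>v. \<lambda>i\<in>{..<n}. vec_index v i)
     (Pi\<^sub>M {..<n} (\<lambda>_. borel))"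

definition SL :: "nat \<Rightarrow> real mat set" where
  "SL n = {g \<in> carrier_mat n n. det g = 1}"

definition SL_borel :: "nat \<Rightarrow> real mat measure" where
  "SL_borel n = vimage_algebra (SL n)
     (\<lambda>g. \<lambda>ij\<in>{..<n} \<times> {..<n}. index_mat g ij)
     (Pi\<^sub>M ({..<n} \<times> {..<n}) (\<lambda>_. borel))"

text \<open>The lattice spanned over the integers by the rows of \<open>g\<close>. Two elements of \<open>SL n\<close> give the
  same lattice iff they lie in the same coset $\mathrm{SL}(n,\mathbf{Z})\,g$.\<close>

definition row_lattice :: "real mat \<Rightarrow> real vec set" where
  "row_lattice g =
     {transpose_mat g *\<^sub>v map_vec real_of_int z | z. z \<in> carrier_vec (dim_row g)}"

text \<open>The space of lattices of covolume 1 with the quotient (final) sigma-algebra along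
  \<open>SL n \<rightarrow> SL(n,Z) \ SL n\<close>. As the quotient is by a discrete group, this is the Borel
  sigma-algebra of the quotient topology.\<close>

definition lattice_space :: "nat \<Rightarrow> real vec set measure" where
  "lattice_space n = sigma (row_lattice ` SL n)
     {A. A \<subseteq> row_lattice ` SL n \<and> row_lattice -` A \<inter> SL n \<in> sets (SL_borel n)}"

text \<open>Right translation $g \mapsto gh$ on cosets is the map $L \mapsto h^T L$ on lattices; \<open>h\<close> and
  its transpose range over the same group.\<close>

definition SL_invariant_prob :: "nat \<Rightarrow> real vec set measure \<Rightarrow> bool" where
  "SL_invariant_prob n M \<longleftrightarrow> prob_space M \<and> sets M = sets (lattice_space n) \<and>
     (\<forall>h\<in>SL n. distr M M (\<lambda>L. (\<lambda>v. transpose_mat h *\<^sub>v v) ` L) = M)"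

definition lambda1 :: "nat \<Rightarrow> real vec set \<Rightarrow> real" where
  "lambda1 n L = Inf (vec_len ` (L - {0\<^sub>v n}))"

definition primitive_in :: "nat \<Rightarrow> real vec set \<Rightarrow> real vec \<Rightarrow> bool" where
  "primitive_in n L w \<longleftrightarrow> w \<in> L \<and> w \<noteq> 0\<^sub>v n \<and>
     (\<forall>u\<in>L. \<forall>m::nat. w = real m \<cdot>\<^sub>v u \<longrightarrow> m = 1)"

definition prim_part :: "nat \<Rightarrow> real vec set \<Rightarrow> real vec \<Rightarrow> real vec" where
  "prim_part n L v = (if v = 0\<^sub>v n then 0\<^sub>v n
     else (THE w. primitive_in n L w \<and> (\<exists>m::nat. 1 \<le> m \<and> v = real m \<cdot>\<^sub>v w)))"

definition short_vec :: "nat \<Rightarrow> real \<Rightarrow> real vec set \<Rightarrow> real vec \<Rightarrow> bool" where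
  "short_vec n \<gamma> L v \<longleftrightarrow> v \<noteq> 0\<^sub>v n \<and> vec_len v \<le> \<gamma> * lambda1 n L"

section \<open>Discrete Gaussians\<close>

definition GH :: "nat \<Rightarrow> real" where
  "GH n = unit_ball_vol (real n) powr (- 1 / real n)"

definition s_param :: "nat \<Rightarrow> real \<Rightarrow> real" where
  "s_param n c = sqrt (2 * pi * (GH n)\<^sup>2 / (c * real n))"

definition gauss_weight :: "real \<Rightarrow> real vec \<Rightarrow> real" where
  "gauss_weight s v = exp (- pi * (vec_len v)\<^sup>2 / s\<^sup>2)"

definition disc_gauss :: "real vec set \<Rightarrow> real \<Rightarrow> real vec pmf" where
  "disc_gauss L s = embed_pmf (\<lambda>v. if v \<in> L
     then gauss_weight s v / (\<Sum>\<^sub>\<infinity>w\<in>L. gauss_weight s w) else 0)"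

definition tv_dist :: "'a pmf \<Rightarrow> 'a pmf \<Rightarrow> real" where
  "tv_dist p q = (SUP A. \<bar>measure_pmf.prob p A - measure_pmf.prob q A\<bar>)"

section \<open>Direct search procedures\<close>

text \<open>A history is the list of previous outputs, oldest first. The internal randomness is a point
  \<open>\<omega>\<close> of a probability space \<open>R\<close>, independent of the lattice and drawn in advance; the whole
  of it may influence every decision. The earlier parameters are functions of the lattice, \<open>\<omega>\<close>
  and the outputs, so they need not be recorded.\<close>

type_synonym 'w choice_fun = "real vec set \<Rightarrow> 'w \<Rightarrow> real vec list \<Rightarrow> real"
type_synonym 'w halt_fun = "real vec set \<Rightarrow> 'w \<Rightarrow> real vec list \<Rightarrow> bool"
type_synonym 'w query_fun = "real vec set \<Rightarrow> 'w \<Rightarrow> real vec list \<Rightarrow> real vec pmf"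

text \<open>\<open>Some (j, b)\<close>: return sample number \<open>j\<close>, replaced by its primitive part if \<open>b\<close>;
  \<open>None\<close>: report failure.\<close>

type_synonym 'w return_fun = "real vec set \<Rightarrow> 'w \<Rightarrow> real vec list \<Rightarrow> (nat \<times> bool) option"

definition hist_space ::
  "real vec set measure \<Rightarrow> 'w measure \<Rightarrow> nat \<Rightarrow> nat
   \<Rightarrow> (real vec set \<times> 'w \<times> (nat \<Rightarrow> real vec)) measure" where
  "hist_space M R n k = M \<Otimes>\<^sub>M (R \<Otimes>\<^sub>M Pi\<^sub>M {..<k} (\<lambda>_. vec_borel n))"

text \<open>\<open>h\<close> is a history after which a further query is made, at most \<open>N\<close> queries being
  allowed and the procedure not having halted.\<close>

definition query_history ::
  "nat \<Rightarrow> 'w halt_fun \<Rightarrow> real vec set \<Rightarrow> 'w \<Rightarrow> real vec list \<Rightarrow> bool" where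
  "query_history N halt L \<omega> h \<longleftrightarrow>
     set h \<subseteq> L \<and> length h < N \<and> (\<forall>k\<le>length h. \<not> halt L \<omega> (take k h))"

definition never_halt :: "'w halt_fun" where
  "never_halt = (\<lambda>L \<omega> h. False)"

definition direct_search ::
  "nat \<Rightarrow> nat \<Rightarrow> real vec set measure \<Rightarrow> 'w measure
   \<Rightarrow> 'w halt_fun \<Rightarrow> 'w choice_fun \<Rightarrow> 'w return_fun \<Rightarrow> bool" where
  "direct_search n N M R halt par ret \<longleftrightarrow>
     (\<forall>k<N. (\<lambda>(L, \<omega>, h). halt L \<omega> (map h [0..<k]))
        \<in> measurable (hist_space M R n k) (count_space UNIV)) \<and>
     (\<forall>k<N. (\<lambda>(L, \<omega>, h). par L \<omega> (map h [0..<k]))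
        \<in> borel_measurable (hist_space M R n k)) \<and>
     (\<forall>k\<le>N. (\<lambda>(L, \<omega>, h). ret L \<omega> (map h [0..<k]))
        \<in> measurable (hist_space M R n k) (count_space UNIV)) \<and>
     (\<forall>L\<in>space M. \<forall>\<omega>\<in>space R. \<forall>h. query_history N halt L \<omega> h \<longrightarrow> 0 < par L \<omega> h) \<and>
     (\<forall>L\<in>space M. \<forall>\<omega>\<in>space R. \<forall>h j b. set h \<subseteq> L \<longrightarrow> length h \<le> N \<longrightarrow>
        ret L \<omega> h = Some (j, b) \<longrightarrow> j < length h \<and> h ! j \<noteq> 0\<^sub>v n)"

definition returned ::
  "nat \<Rightarrow> 'w return_fun \<Rightarrow> real vec set \<Rightarrow> 'w \<Rightarrow> real vec list \<Rightarrow> real vec option" where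
  "returned n ret L \<omega> h = (case ret L \<omega> h of None \<Rightarrow> None
     | Some (j, b) \<Rightarrow> Some (if b then prim_part n L (h ! j) else h ! j))"

definition succeeds ::
  "nat \<Rightarrow> real \<Rightarrow> 'w return_fun \<Rightarrow> real vec set \<Rightarrow> 'w \<Rightarrow> real vec list \<Rightarrow> bool" where
  "succeeds n \<gamma> ret L \<omega> h \<longleftrightarrow> (\<exists>v. returned n ret L \<omega> h = Some v \<and> short_vec n \<gamma> L v)"

definition returns_shortest ::
  "nat \<Rightarrow> nat \<Rightarrow> real vec set measure \<Rightarrow> 'w measure \<Rightarrow> 'w return_fun \<Rightarrow> bool" where
  "returns_shortest n N M R ret \<longleftrightarrow>
     (\<forall>L\<in>space M. \<forall>\<omega>\<in>space R. \<forall>h. set h \<subseteq> L \<longrightarrow> length h \<le> N \<longrightarrow>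
        (if set h \<subseteq> {0\<^sub>v n} then ret L \<omega> h = None
         else \<exists>j<length h. ret L \<omega> h = Some (j, False) \<and> h ! j \<noteq> 0\<^sub>v n \<and>
           (\<forall>v\<in>set h. v \<noteq> 0\<^sub>v n \<longrightarrow> vec_len (h ! j) \<le> vec_len v)))"

text \<open>The query laws, conditional on the lattice, the internal randomness and the previous outputs:
  Markov kernels whose values are laws on the lattice.\<close>

definition query_kernels ::
  "nat \<Rightarrow> nat \<Rightarrow> real vec set measure \<Rightarrow> 'w measure \<Rightarrow> 'w halt_fun \<Rightarrow> 'w query_fun \<Rightarrow> bool" where
  "query_kernels n N M R halt Q \<longleftrightarrow>
     (\<forall>k<N. \<forall>B\<in>sets (vec_borel n).
        (\<lambda>(L, \<omega>, h). measure_pmf.prob (Q L \<omega> (map h [0..<k])) B)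
          \<in> borel_measurable (hist_space M R n k)) \<and>
     (\<forall>L\<in>space M. \<forall>\<omega>\<in>space R. \<forall>h. query_history N halt L \<omega> h \<longrightarrow> set_pmf (Q L \<omega> h) \<subseteq> L)"

definition accurate ::
  "(nat \<Rightarrow> real vec set measure) \<Rightarrow> (nat \<Rightarrow> 'w measure) \<Rightarrow> (nat \<Rightarrow> nat) \<Rightarrow> (nat \<Rightarrow> real)
   \<Rightarrow> (nat \<Rightarrow> 'w halt_fun) \<Rightarrow> (nat \<Rightarrow> 'w choice_fun) \<Rightarrow> (nat \<Rightarrow> 'w query_fun) \<Rightarrow> bool" where
  "accurate M R N \<epsilon> halt par Q \<longleftrightarrow>
     (\<exists>G. (\<forall>n>0. G n \<in> sets (M n)) \<and> (\<lambda>n. measure (M n) (G n)) \<longlonglongrightarrow> 1 \<and>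
        (\<forall>n>0. \<forall>L\<in>G n. \<forall>\<omega>\<in>space (R n). \<forall>h. query_history (N n) (halt n) L \<omega> h \<longrightarrow>
           tv_dist (Q n L \<omega> h) (disc_gauss L (s_param n (par n L \<omega> h))) \<le> \<epsilon> n))"

text \<open>The law of the list of all outputs, when \<open>h\<close> has already been observed and at most \<open>k\<close>
  further queries are allowed.\<close>

fun transcript ::
  "'w halt_fun \<Rightarrow> 'w query_fun \<Rightarrow> real vec set \<Rightarrow> 'w \<Rightarrow> nat \<Rightarrow> real vec list \<Rightarrow> real vec list pmf" where
  "transcript halt Q L \<omega> 0 h = return_pmf h"
| "transcript halt Q L \<omega> (Suc k) h = (if halt L \<omega> h then return_pmf h
     else bind_pmf (Q L \<omega> h) (\<lambda>v. transcript halt Q L \<omega> k (h @ [v])))"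

definition joint_prob ::
  "real vec set measure \<Rightarrow> 'w measure \<Rightarrow> nat \<Rightarrow> 'w halt_fun \<Rightarrow> 'w query_fun
   \<Rightarrow> (real vec set \<Rightarrow> 'w \<Rightarrow> real vec list \<Rightarrow> bool) \<Rightarrow> real" where
  "joint_prob M R N halt Q E =
     (\<integral>(L, \<omega>). measure_pmf.prob (transcript halt Q L \<omega> N []) {h. E L \<omega> h} \<partial>(M \<Otimes>\<^sub>M R))"

section \<open>Rates\<close>

definition K_star :: "real \<Rightarrow> real" where
  "K_star \<gamma> = (if \<gamma> < sqrt (exp 1) then \<gamma>\<^sup>2 / (2 * exp 1) - ln \<gamma> else 0)"

definition D_rate :: "real \<Rightarrow> real \<Rightarrow> real" where
  "D_rate \<gamma> c = (if c < 1 / \<gamma>\<^sup>2 then (c * \<gamma>\<^sup>2 - 1 - ln (c * \<gamma>\<^sup>2)) / 2 else 0)"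

definition K_rate :: "real \<Rightarrow> real \<Rightarrow> real" where
  "K_rate \<gamma> c = max 0 ((1 + ln c) / 2) + D_rate \<gamma> c"

end

theory Submission
  imports Defs "HOL-Number_Theory.Number_Theory" "HOL-Real_Asymp.Real_Asymp"
begin

text \<open>An invariant probability on the space of lattices is unique (its lift to \<open>SL n\<close> is right
  invariant, and Halmos' argument compares two such lifts), so Hecke operators of prime index preserve
  it. Averaging over Hecke neighbours turns integrals of lattice counts into counts of integer vectors
  modulo \<open>p\<close>; as \<open>p\<close> grows this gives Siegel's first moment bound, and a second moment bound for
  primitive vectors then gives a lower tail. Hence with probability tending to one the shortest vector
  has length close to \<open>GH n\<close> and there are about \<open>t\<^sup>n\<close> lattice vectors of length at most
  \<open>t GH n\<close> for every \<open>t > 1\<close>. Summing Gaussian weights over shells, with a theta series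
  bounded below for every unimodular lattice, yields the rate \<open>K_rate \<gamma> c\<close>.

  If primitive parts are returned, a query succeeds exactly on the multiples of short vectors. Among all
  parameters the mass of such a set is exponentially largest near \<open>c = 1 / e\<close>, which is the rate
  \<open>K_star \<gamma>\<close>. Both thresholds follow by a union bound over the queries and by the geometric
  decay of the probability that all of them miss.\<close>

text \<open>The measures are known only through invariance, so every quantitative fact must come
  from an identity that invariance forces; Hecke averaging is one. A first moment upper bound and a
  lower tail with crude constants suffice, because all later statements are exponential rates and
  absorb constants.

  In (a) the obstacle is the order of quantifiers: the parameter is chosen after the lattice and the
  history are seen, so one event must control all c > 0. The normalising constant is bounded below
  deterministically, and the weight of each short vector at c is compared with its weight at 1/e;
  this leaves one random sum, at 1/e, and bounds on the shortest length. The value 1/e is where the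
  two parts of the normalising constant balance: the zero vector has rate 0, the remaining vectors
  have rate -(1 + log c)/2.

  Joint probabilities are Bochner integrals, which vanish for nonintegrable integrands. This is
  harmless for the limits 0 but forces a measurability proof for the limits 1.\<close>

section \<open>Unimodular matrices and the bases of a lattice\<close>

lemma mat_mult_index_sum:
  assumes "A \<in> carrier_mat n n" "B \<in> carrier_mat n n" "i < n" "j < n"
  shows "(A * B) $$ (i,j) = (\<Sum>k<n. A $$ (i,k) * B $$ (k,j))"
proof -
  have "(A * B) $$ (i,j) = row A i \<bullet> col B j" using assms by auto
  also have "\<dots> = (\<Sum>k<n. A $$ (i,k) * B $$ (k,j))"
    unfolding scalar_prod_def atLeast0LessThan using assms by (intro sum.cong) auto
  finally show ?thesis .
qed

lemma SL_carrier: "g \<in> SL n \<Longrightarrow> g \<in> carrier_mat n n"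
  by (simp add: SL_def)

lemma SL_det: "g \<in> SL n \<Longrightarrow> det g = 1"
  by (simp add: SL_def)

lemma SL_mult: "g \<in> SL n \<Longrightarrow> h \<in> SL n \<Longrightarrow> g * h \<in> SL n"
  by (auto simp: SL_def det_mult)

lemma SL_one: "1\<^sub>m n \<in> SL n"
  by (auto simp: SL_def)

text \<open>With determinant 1 the adjugate is the inverse. It is polynomial in the entries, so the
  same term serves over the integers and over the reals, for measurability, and for norm bounds on
  inverses.\<close>

lemma adj_mat_inverse:
  fixes g :: "'a :: idom mat"
  assumes "g \<in> carrier_mat n n" "det g = 1"
  shows "adj_mat g \<in> carrier_mat n n" "g * adj_mat g = 1\<^sub>m n" "adj_mat g * g = 1\<^sub>m n"
    "det (adj_mat g) = 1"
proof -
  note a = adj_mat[OF assms(1)]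
  show c: "adj_mat g \<in> carrier_mat n n" by (rule a(1))
  show e: "g * adj_mat g = 1\<^sub>m n" using a(2) assms by auto
  show "adj_mat g * g = 1\<^sub>m n" using a(3) assms by auto
  have "det g * det (adj_mat g) = 1" using det_mult[OF assms(1) c] e by simp
  thus "det (adj_mat g) = 1" using assms by simp
qed

lemma SL_adj:
  assumes "g \<in> SL n"
  shows "adj_mat g \<in> SL n" "g * adj_mat g = 1\<^sub>m n" "adj_mat g * g = 1\<^sub>m n"
  using adj_mat_inverse[of g n] assms by (auto simp: SL_def)

lemma SL_cancel_left:
  assumes "g \<in> SL n" "h \<in> carrier_mat n n"
  shows "adj_mat g * (g * h) = h" "g * (adj_mat g * h) = h"
proof -
  have c: "g \<in> carrier_mat n n" "adj_mat g \<in> carrier_mat n n"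
    using SL_carrier SL_adj(1) assms(1) by blast+
  show "adj_mat g * (g * h) = h"
    using assoc_mult_mat[OF c(2) c(1) assms(2)] SL_adj(3)[OF assms(1)] assms(2) by simp
  show "g * (adj_mat g * h) = h"
    using assoc_mult_mat[OF c(1) c(2) assms(2)] SL_adj(2)[OF assms(1)] assms(2) by simp
qed

lemma SL_cancel_right:
  assumes "g \<in> SL n" "h \<in> carrier_mat n n"
  shows "(h * g) * adj_mat g = h" "(h * adj_mat g) * g = h"
proof -
  have c: "g \<in> carrier_mat n n" "adj_mat g \<in> carrier_mat n n"
    using SL_carrier SL_adj(1) assms(1) by blast+
  show "(h * g) * adj_mat g = h"
    using assoc_mult_mat[OF assms(2) c(1) c(2)] SL_adj(2)[OF assms(1)] assms(2) by simp
  show "(h * adj_mat g) * g = h"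
    using assoc_mult_mat[OF assms(2) c(2) c(1)] SL_adj(3)[OF assms(1)] assms(2) by simp
qed

lemma adj_mat_mult:
  assumes "g \<in> SL n" "h \<in> SL n"
  shows "adj_mat (g * h) = adj_mat h * adj_mat g"
proof -
  have c: "g \<in> carrier_mat n n" "h \<in> carrier_mat n n" "adj_mat g \<in> carrier_mat n n"
     "adj_mat h \<in> carrier_mat n n" "adj_mat (g*h) \<in> carrier_mat n n"
    using SL_carrier SL_adj(1) SL_mult assms by blast+
  have "(adj_mat h * adj_mat g) * (g * h) = adj_mat h * (adj_mat g * (g * h))"
    using c by (intro assoc_mult_mat) auto
  also have "\<dots> = 1\<^sub>m n" using SL_cancel_left(1)[OF assms(1) c(2)] SL_adj(3)[OF assms(2)] by simp
  finally have e: "(adj_mat h * adj_mat g) * (g * h) = 1\<^sub>m n" .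
  have "adj_mat h * adj_mat g = (adj_mat h * adj_mat g) * (g * h) * adj_mat (g * h)"
    using SL_cancel_right(1)[OF SL_mult[OF assms], of "adj_mat h * adj_mat g"] c by simp
  also have "\<dots> = adj_mat (g * h)" unfolding e using c by simp
  finally show ?thesis ..
qed

definition SLZ :: "nat \<Rightarrow> int mat set" where
  "SLZ n = {A \<in> carrier_mat n n. det A = 1}"

abbreviation rmat :: "int mat \<Rightarrow> real mat" where
  "rmat A \<equiv> map_mat real_of_int A"

lemma rmat_mult:
  assumes "A \<in> carrier_mat n n" "B \<in> carrier_mat n n"
  shows "rmat (A * B) = rmat A * rmat B"
  using of_int_hom.mat_hom_mult[OF assms] .

lemma rmat_det: "det (rmat A) = real_of_int (det A)"
  by (rule of_int_hom.hom_det)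

lemma rmat_SL: "A \<in> SLZ n \<Longrightarrow> rmat A \<in> SL n"
  by (auto simp: SLZ_def SL_def rmat_det)

lemma rmat_inj: "rmat A = rmat B \<Longrightarrow> A = B"
  by (metis of_int_hom.mat_hom_inj)

lemma SLZ_countable: "countable (SLZ n)"
proof -
  have "SLZ n \<subseteq> range (mat_of_rows_list n :: int list list \<Rightarrow> int mat)"
  proof
    fix A assume "A \<in> SLZ n"
    hence "A \<in> carrier_mat n n" by (simp add: SLZ_def)
    hence "A = mat_of_rows_list n (mat_to_list A)"
      by (intro eq_matI) (auto simp: mat_of_rows_list_def mat_to_list_def)
    thus "A \<in> range (mat_of_rows_list n)" by blast
  qed
  thus ?thesis by (rule countable_subset) (intro countable_image countableI_type)
qed

lemma row_lattice_SL:
  "g \<in> SL n \<Longrightarrow> row_lattice g = (\<lambda>z. transpose_mat g *\<^sub>v map_vec real_of_int z) ` carrier_vec n"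
  unfolding row_lattice_def using SL_carrier[of g n] by auto

lemma map_vec_mult_mat:
  assumes "A \<in> carrier_mat n n" "z \<in> carrier_vec n"
  shows "map_vec real_of_int (A *\<^sub>v z) = rmat A *\<^sub>v map_vec real_of_int z"
  by (rule of_int_hom.mult_mat_vec_hom[OF assms])

lemma row_lattice_SLZ_subset:
  assumes "g \<in> SL n" "A \<in> carrier_mat n n" "rmat A * g \<in> SL n"
  shows "row_lattice (rmat A * g) \<subseteq> row_lattice g"
proof
  fix v assume "v \<in> row_lattice (rmat A * g)"
  then obtain z where z: "z \<in> carrier_vec n"
    "v = transpose_mat (rmat A * g) *\<^sub>v map_vec real_of_int z"
    unfolding row_lattice_SL[OF assms(3)] by auto
  have c: "g \<in> carrier_mat n n" "rmat A \<in> carrier_mat n n" using assms SL_carrier by auto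
  have "v = (transpose_mat g * transpose_mat (rmat A)) *\<^sub>v map_vec real_of_int z"
    using z transpose_mult[OF c(2) c(1)] by simp
  also have "\<dots> = transpose_mat g *\<^sub>v (transpose_mat (rmat A) *\<^sub>v map_vec real_of_int z)"
    using c z by (intro assoc_mult_mat_vec) auto
  also have "transpose_mat (rmat A) = rmat (transpose_mat A)"
    by (rule eq_matI) auto
  also have "rmat (transpose_mat A) *\<^sub>v map_vec real_of_int z = map_vec real_of_int (transpose_mat A *\<^sub>v z)"
    using assms z by (intro map_vec_mult_mat[symmetric]) auto
  finally show "v \<in> row_lattice g"
    unfolding row_lattice_SL[OF assms(1)] using assms(2) z by auto
qed

lemma row_lattice_SLZ:
  assumes "g \<in> SL n" "A \<in> SLZ n"
  shows "row_lattice (rmat A * g) = row_lattice g"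
proof
  have A: "A \<in> carrier_mat n n" "det A = 1" using assms by (auto simp: SLZ_def)
  note B = adj_mat_inverse[OF A]
  have s: "rmat A * g \<in> SL n" using assms by (intro SL_mult rmat_SL)
  show "row_lattice (rmat A * g) \<subseteq> row_lattice g"
    by (rule row_lattice_SLZ_subset[OF assms(1) A(1) s])
  have "rmat (adj_mat A) * (rmat A * g) = rmat (adj_mat A * A) * g"
    unfolding rmat_mult[OF B(1) A(1)] using A(1) B(1) SL_carrier[OF assms(1)]
    by (intro assoc_mult_mat[symmetric]) auto
  also have "\<dots> = g" using SL_carrier[OF assms(1)] unfolding B(3) by (simp add: of_int_hom.mat_hom_one)
  finally have e: "rmat (adj_mat A) * (rmat A * g) = g" .
  show "row_lattice g \<subseteq> row_lattice (rmat A * g)"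
    using row_lattice_SLZ_subset[OF s B(1)] unfolding e using assms(1) by blast
qed

lemma transpose_mult_vec_index:
  assumes "g \<in> carrier_mat n n" "z \<in> carrier_vec n" "j < n"
  shows "(transpose_mat g *\<^sub>v z) $ j = (\<Sum>i<n. g $$ (i,j) * z $ i)"
proof -
  have "(transpose_mat g *\<^sub>v z) $ j = col g j \<bullet> z" using assms by auto
  also have "\<dots> = (\<Sum>i<n. g $$ (i,j) * z $ i)"
    unfolding scalar_prod_def atLeast0LessThan using assms by (intro sum.cong) auto
  finally show ?thesis .
qed

lemma row_in_row_lattice:
  assumes "g \<in> SL n" "i < n"
  shows "row g i \<in> row_lattice g"
proof -
  have c: "g \<in> carrier_mat n n" using assms SL_carrier by auto
  have "row g i = transpose_mat g *\<^sub>v map_vec real_of_int (unit_vec n i)"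
  proof (rule eq_vecI)
    fix j assume "j < dim_vec (transpose_mat g *\<^sub>v map_vec real_of_int (unit_vec n i))"
    hence j: "j < n" using c by auto
    have "(transpose_mat g *\<^sub>v map_vec real_of_int (unit_vec n i)) $ j
        = (\<Sum>k<n. g $$ (k,j) * map_vec real_of_int (unit_vec n i) $ k)"
      by (rule transpose_mult_vec_index[OF c _ j]) auto
    also have "\<dots> = (\<Sum>k<n. if k = i then g $$ (i,j) else 0)"
      by (intro sum.cong) (auto simp: unit_vec_def)
    also have "\<dots> = g $$ (i,j)" using assms by simp
    finally show "row g i $ j = (transpose_mat g *\<^sub>v map_vec real_of_int (unit_vec n i)) $ j"
      using c assms j by auto
  qed (use c in auto)
  thus ?thesis unfolding row_lattice_SL[OF assms(1)] by auto
qed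

text \<open>The integer coordinates of the rows of \<open>h\<close> in the basis \<open>g\<close>
  are the rows of \<open>A\<close>; both determinants being 1 forces
  \<open>det A = 1\<close>.\<close>

lemma row_lattice_eqD:
  assumes "g \<in> SL n" "h \<in> SL n" "row_lattice h = row_lattice g"
  shows "\<exists>A\<in>SLZ n. h = rmat A * g"
proof -
  have c: "g \<in> carrier_mat n n" "h \<in> carrier_mat n n" using assms SL_carrier by auto
  have "\<forall>i. \<exists>z. i < n \<longrightarrow> z \<in> carrier_vec n \<and> row h i = transpose_mat g *\<^sub>v map_vec real_of_int z"
    using row_in_row_lattice[OF assms(2)] unfolding assms(3) row_lattice_SL[OF assms(1)] by blast
  then obtain z where z: "\<And>i. i < n \<Longrightarrow> z i \<in> carrier_vec n \<and> row h i = transpose_mat g *\<^sub>v map_vec real_of_int (z i)"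
    by metis
  define A where "A = mat n n (\<lambda>(i,j). z i $ j)"
  have A: "A \<in> carrier_mat n n" by (simp add: A_def)
  have e: "h = rmat A * g"
  proof (rule eq_matI)
    fix i j assume "i < dim_row (rmat A * g)" "j < dim_col (rmat A * g)"
    hence ij: "i < n" "j < n" using A c by auto
    have "h $$ (i,j) = row h i $ j" using c ij by auto
    also have "\<dots> = (\<Sum>k<n. g $$ (k,j) * map_vec real_of_int (z i) $ k)"
      using z[OF ij(1)] transpose_mult_vec_index[OF c(1) _ ij(2), of "map_vec real_of_int (z i)"] by simp
    also have "\<dots> = (\<Sum>k<n. rmat A $$ (i,k) * g $$ (k,j))"
      using z[OF ij(1)] ij by (intro sum.cong) (auto simp: A_def)
    also have "\<dots> = (rmat A * g) $$ (i,j)"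
      using A c ij by (intro mat_mult_index_sum[symmetric]) auto
    finally show "h $$ (i,j) = (rmat A * g) $$ (i,j)" .
  qed (use A c in auto)
  have "det h = det (rmat A) * det g" unfolding e using A c by (intro det_mult) auto
  hence "det A = 1" using assms SL_det by (auto simp: rmat_det)
  thus ?thesis using A e by (auto simp: SLZ_def)
qed

lemma row_lattice_mult:
  assumes "g \<in> SL n" "h \<in> SL n"
  shows "row_lattice (g * h) = (\<lambda>v. transpose_mat h *\<^sub>v v) ` row_lattice g"
proof -
  have c: "g \<in> carrier_mat n n" "h \<in> carrier_mat n n" using assms SL_carrier by auto
  have "transpose_mat (g * h) *\<^sub>v map_vec real_of_int z = transpose_mat h *\<^sub>v (transpose_mat g *\<^sub>v map_vec real_of_int z)"
    if "z \<in> carrier_vec n" for z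
    using transpose_mult[OF c] assoc_mult_mat_vec[of "transpose_mat h" n n "transpose_mat g" n "map_vec real_of_int z"] c that by simp
  thus ?thesis unfolding row_lattice_SL[OF assms(1)] row_lattice_SL[OF SL_mult[OF assms]] image_image
    by (intro image_cong) auto
qed

text \<open>Freeness of the action of SL(n,Z) on bases: sums over all bases of a lattice become sums
  over \<open>SLZ n\<close> once one basis is fixed.\<close>

lemma row_lattice_fibre:
  assumes "g \<in> SL n"
  shows "bij_betw (\<lambda>A. rmat A * g) (SLZ n) {h \<in> SL n. row_lattice h = row_lattice g}"
  unfolding bij_betw_def
proof
  show "inj_on (\<lambda>A. rmat A * g) (SLZ n)"
  proof (rule inj_onI)
    fix A B assume AB: "A \<in> SLZ n" "B \<in> SLZ n" "rmat A * g = rmat B * g"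
    hence "rmat A * g * adj_mat g = rmat B * g * adj_mat g" by simp
    moreover have "rmat A \<in> carrier_mat n n" "rmat B \<in> carrier_mat n n"
      using AB by (simp_all add: SLZ_def)
    ultimately have "rmat A = rmat B"
      using SL_cancel_right(1)[OF assms] by metis
    thus "A = B" by (rule rmat_inj)
  qed
  show "(\<lambda>A. rmat A * g) ` SLZ n = {h \<in> SL n. row_lattice h = row_lattice g}"
    using row_lattice_SLZ[OF assms] row_lattice_eqD[OF assms] SL_mult[OF rmat_SL assms] by blast
qed

subsection \<open>Measurability\<close>

lemma space_SL_borel [simp]: "space (SL_borel n) = SL n"
  by (simp add: SL_borel_def)

lemma measurable_SL_entry [measurable]:
  assumes "i < n" "j < n"
  shows "(\<lambda>g. g $$ (i,j)) \<in> borel_measurable (SL_borel n)"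
proof -
  have 1: "(\<lambda>g. \<lambda>ij\<in>{..<n} \<times> {..<n}. g $$ ij) \<in> SL_borel n \<rightarrow>\<^sub>M (Pi\<^sub>M ({..<n} \<times> {..<n}) (\<lambda>_. borel :: real measure))"
    unfolding SL_borel_def by (rule measurable_vimage_algebra1) (auto simp: space_PiM)
  have 2: "(\<lambda>f. f (i,j)) \<in> (Pi\<^sub>M ({..<n} \<times> {..<n}) (\<lambda>_. borel :: real measure)) \<rightarrow>\<^sub>M borel"
    using assms by (intro measurable_component_singleton) auto
  show ?thesis using measurable_comp[OF 1 2] assms by (simp add: comp_def)
qed

lemma measurable_into_SL:
  assumes "f \<in> space N \<rightarrow> SL n" "\<And>i j. i < n \<Longrightarrow> j < n \<Longrightarrow> (\<lambda>x. f x $$ (i,j)) \<in> borel_measurable N"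
  shows "f \<in> N \<rightarrow>\<^sub>M SL_borel n"
  unfolding SL_borel_def
  using assms by (intro measurable_vimage_algebra2 measurable_restrict) auto

lemma measurable_SL_mult:
  assumes [measurable]: "f \<in> N \<rightarrow>\<^sub>M SL_borel n" "g \<in> N \<rightarrow>\<^sub>M SL_borel n"
  shows "(\<lambda>x. f x * g x) \<in> N \<rightarrow>\<^sub>M SL_borel n"
proof (rule measurable_into_SL)
  have sp: "f x \<in> SL n" "g x \<in> SL n" if "x \<in> space N" for x
    using measurable_space[OF assms(1) that] measurable_space[OF assms(2) that] by auto
  thus "(\<lambda>x. f x * g x) \<in> space N \<rightarrow> SL n" by (auto intro: SL_mult)
  fix i j assume ij: "i < n" "j < n"
  have "(\<lambda>x. \<Sum>k<n. f x $$ (i,k) * g x $$ (k,j)) \<in> borel_measurable N"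
    using ij by (intro borel_measurable_sum borel_measurable_times
       measurable_compose[OF assms(1) measurable_SL_entry] measurable_compose[OF assms(2) measurable_SL_entry]) auto
  thus "(\<lambda>x. (f x * g x) $$ (i,j)) \<in> borel_measurable N"
    by (subst measurable_cong[OF mat_mult_index_sum]) (use sp SL_carrier ij in auto)
qed

lemma measurable_det:
  assumes "f \<in> space N \<rightarrow> carrier_mat n n"
    "\<And>i j. i < n \<Longrightarrow> j < n \<Longrightarrow> (\<lambda>x. f x $$ (i,j)) \<in> borel_measurable N"
  shows "(\<lambda>x. det (f x) :: real) \<in> borel_measurable N"
proof -
  have "(\<lambda>x. \<Sum>p\<in>{p. p permutes {0..<n}}. signof p * (\<Prod>i = 0..<n. f x $$ (i, p i))) \<in> borel_measurable N"
    using permutes_in_image[of _ "{0..<n}"]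
    by (intro borel_measurable_sum borel_measurable_times borel_measurable_const borel_measurable_prod assms) fastforce+
  thus ?thesis
    by (subst measurable_cong[OF det_def']) (use assms(1) in auto)
qed

lemma measurable_SL_adj: "adj_mat \<in> SL_borel n \<rightarrow>\<^sub>M SL_borel n"
proof (rule measurable_into_SL)
  show "adj_mat \<in> space (SL_borel n) \<rightarrow> SL n" using SL_adj by auto
  fix i j assume ij: "i < n" "j < n"
  have "(\<lambda>g. (-1)^(j+i) * det (mat_delete g j i) :: real) \<in> borel_measurable (SL_borel n)"
  proof (intro borel_measurable_times borel_measurable_const measurable_det[where n="n-1"])
    show "(\<lambda>g. mat_delete g j i) \<in> space (SL_borel n) \<rightarrow> carrier_mat (n-1) (n-1)"
      by (auto simp: mat_delete_def SL_def)
    fix k l assume kl: "k < n - 1" "l < n - 1"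
    have "(\<lambda>g. g $$ (insert_index j k, insert_index i l)) \<in> borel_measurable (SL_borel n)"
      using kl by (intro measurable_SL_entry) (auto simp: insert_index_def)
    thus "(\<lambda>g. mat_delete g j i $$ (k, l)) \<in> borel_measurable (SL_borel n)"
      by (rule subst[OF measurable_cong, rotated])
         (use kl in \<open>auto simp: mat_delete_def insert_index_def dest!: SL_carrier\<close>)
  qed
  thus "(\<lambda>g. adj_mat g $$ (i,j)) \<in> borel_measurable (SL_borel n)"
    by (rule subst[OF measurable_cong, rotated]) (use ij in \<open>auto simp: adj_mat_def cofactor_def dest!: SL_carrier\<close>)
qed

lemma space_lattice_space [simp]: "space (lattice_space n) = row_lattice ` SL n"
  by (simp add: lattice_space_def space_measure_of_conv)

lemma sets_lattice_space:
  "sets (lattice_space n) = {A. A \<subseteq> row_lattice ` SL n \<and> row_lattice -` A \<inter> SL n \<in> sets (SL_borel n)}"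
    (is "_ = ?S")
proof -
  have "sigma_algebra (row_lattice ` SL n) ?S"
    unfolding sigma_algebra_iff2
  proof (intro conjI ballI allI impI)
    fix s assume s: "s \<in> ?S"
    have "row_lattice -` (row_lattice ` SL n - s) \<inter> SL n = SL n - (row_lattice -` s \<inter> SL n)" by auto
    also have "\<dots> \<in> sets (SL_borel n)" using s sets.compl_sets[of _ "SL_borel n"] by auto
    finally show "row_lattice ` SL n - s \<in> ?S" by auto
  next
    fix A :: "nat \<Rightarrow> real vec set set" assume A: "range A \<subseteq> ?S"
    have "row_lattice -` (\<Union>i. A i) \<inter> SL n = (\<Union>i. row_lattice -` A i \<inter> SL n)" by auto
    also have "\<dots> \<in> sets (SL_borel n)" using A by (intro sets.countable_UN) auto
    finally show "(\<Union>i. A i) \<in> ?S" using A by auto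
  qed auto
  from sigma_algebra.sigma_sets_eq[OF this] show ?thesis unfolding lattice_space_def
    by (subst sets_measure_of) auto
qed

lemma measurable_row_lattice: "row_lattice \<in> SL_borel n \<rightarrow>\<^sub>M lattice_space n"
  by (rule measurableI) (auto simp: sets_lattice_space)

text \<open>The universal property of the final sigma-algebra. All measurability on the space of
  lattices is obtained by pulling back to matrices in this way.\<close>

lemma measurable_lattice_spaceI:
  assumes "F \<in> row_lattice ` SL n \<rightarrow> space N" "(\<lambda>g. F (row_lattice g)) \<in> SL_borel n \<rightarrow>\<^sub>M N"
  shows "F \<in> lattice_space n \<rightarrow>\<^sub>M N"
proof (rule measurableI)
  fix x assume "x \<in> space (lattice_space n)" thus "F x \<in> space N" using assms by auto
next
  fix B assume B: "B \<in> sets N"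
  have "row_lattice -` (F -` B \<inter> row_lattice ` SL n) \<inter> SL n = (\<lambda>g. F (row_lattice g)) -` B \<inter> space (SL_borel n)"
    by auto
  also have "\<dots> \<in> sets (SL_borel n)" using measurable_sets[OF assms(2) B] .
  finally show "F -` B \<inter> space (lattice_space n) \<in> sets (lattice_space n)"
    by (auto simp: sets_lattice_space)
qed

lemma measurable_translate_lattice:
  assumes h: "h \<in> SL n"
  shows "(\<lambda>L. (\<lambda>v. transpose_mat h *\<^sub>v v) ` L) \<in> lattice_space n \<rightarrow>\<^sub>M lattice_space n"
proof (rule measurable_lattice_spaceI)
  show "(`) ((*\<^sub>v) (transpose_mat h)) \<in> row_lattice ` SL n \<rightarrow> space (lattice_space n)"
    using row_lattice_mult[OF _ h] SL_mult[OF _ h] by (fastforce)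
  have "(\<lambda>g. row_lattice (g * h)) \<in> SL_borel n \<rightarrow>\<^sub>M lattice_space n"
    using h by (intro measurable_compose[OF _ measurable_row_lattice] measurable_SL_mult) auto
  thus "(\<lambda>g. (*\<^sub>v) (transpose_mat h) ` row_lattice g) \<in> SL_borel n \<rightarrow>\<^sub>M lattice_space n"
    by (rule subst[OF measurable_cong, rotated]) (use row_lattice_mult[OF _ h] in auto)
qed

subsection \<open>Mixtures of measures\<close>

text \<open>Composition of a measure with a kernel of arbitrary mass. It is applied to counting
  measures on the set of bases of a lattice, which are in general infinite, as well as to
  probability kernels.\<close>

definition mixture :: "'a measure \<Rightarrow> 'b measure \<Rightarrow> ('a \<Rightarrow> 'b measure) \<Rightarrow> 'b measure" where
  "mixture M N K = measure_of (space N) (sets N) (\<lambda>A. \<integral>\<^sup>+x. emeasure (K x) A \<partial>M)"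

lemma sets_mixture [simp, measurable_cong]: "sets (mixture M N K) = sets N"
  by (simp add: mixture_def)

lemma space_mixture [simp]: "space (mixture M N K) = space N"
  by (simp add: mixture_def)

lemma emeasure_mixture:
  assumes "\<And>x. x \<in> space M \<Longrightarrow> sets (K x) = sets N"
    "\<And>A. A \<in> sets N \<Longrightarrow> (\<lambda>x. emeasure (K x) A) \<in> borel_measurable M" "A \<in> sets N"
  shows "emeasure (mixture M N K) A = (\<integral>\<^sup>+x. emeasure (K x) A \<partial>M)"
  unfolding mixture_def
proof (rule emeasure_measure_of_sigma)
  show "sigma_algebra (space N) (sets N)" ..
  show "positive (sets N) (\<lambda>A. \<integral>\<^sup>+x. emeasure (K x) A \<partial>M)" by (simp add: positive_def)
  show "countably_additive (sets N) (\<lambda>A. \<integral>\<^sup>+x. emeasure (K x) A \<partial>M)"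
  proof (rule countably_additiveI)
    fix A :: "nat \<Rightarrow> 'b set" assume A: "range A \<subseteq> sets N" "disjoint_family A"
    have "(\<Sum>i. \<integral>\<^sup>+x. emeasure (K x) (A i) \<partial>M) = (\<integral>\<^sup>+x. (\<Sum>i. emeasure (K x) (A i)) \<partial>M)"
      using A assms by (intro nn_integral_suminf[symmetric]) auto
    also have "\<dots> = (\<integral>\<^sup>+x. emeasure (K x) (\<Union>i. A i) \<partial>M)"
      using A assms(1) by (intro nn_integral_cong suminf_emeasure) auto
    finally show "(\<Sum>i. \<integral>\<^sup>+x. emeasure (K x) (A i) \<partial>M) = \<dots>" .
  qed
qed fact

text \<open>Measurability and value are proved together, since the induction step for sums and
  suprema of integrands needs the measurability of the inner integrals.\<close>

lemma nn_integral_mixture_aux: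
  assumes K: "\<And>x. x \<in> space M \<Longrightarrow> sets (K x) = sets N"
    "\<And>A. A \<in> sets N \<Longrightarrow> (\<lambda>x. emeasure (K x) A) \<in> borel_measurable M"
    and f: "f \<in> borel_measurable N"
  shows "(\<lambda>x. \<integral>\<^sup>+y. f y \<partial>K x) \<in> borel_measurable M \<and>
    (\<integral>\<^sup>+y. f y \<partial>mixture M N K) = (\<integral>\<^sup>+x. \<integral>\<^sup>+y. f y \<partial>K x \<partial>M)"
  using f
proof induction
  case (cong f g)
  have "(\<integral>\<^sup>+y. f y \<partial>K x) = (\<integral>\<^sup>+y. g y \<partial>K x)" if "x \<in> space M" for x
    using cong(3) sets_eq_imp_space_eq[OF K(1)[OF that]] by (intro nn_integral_cong) auto
  moreover have "(\<integral>\<^sup>+y. f y \<partial>mixture M N K) = (\<integral>\<^sup>+y. g y \<partial>mixture M N K)"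
    using cong(3) by (intro nn_integral_cong) auto
  ultimately show ?case using cong(4)
    by (simp cong: measurable_cong nn_integral_cong)
next
  case (set A)
  have "(\<integral>\<^sup>+y. indicator A y \<partial>K x) = emeasure (K x) A" if "x \<in> space M" for x
    using set K(1)[OF that] by simp
  thus ?case using set K emeasure_mixture[OF K set(1)]
    by (simp cong: measurable_cong nn_integral_cong)
next
  case (mult u c)
  have "(\<integral>\<^sup>+y. c * u y \<partial>K x) = c * (\<integral>\<^sup>+y. u y \<partial>K x)" if "x \<in> space M" for x
    using mult(2) K(1)[OF that] by (intro nn_integral_cmult) (simp cong: measurable_cong_sets)
  moreover have "(\<integral>\<^sup>+y. c * u y \<partial>mixture M N K) = c * (\<integral>\<^sup>+y. u y \<partial>mixture M N K)"
    using mult(2) by (intro nn_integral_cmult) (simp cong: measurable_cong_sets)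
  moreover have "(\<lambda>x. c * (\<integral>\<^sup>+y. u y \<partial>K x)) \<in> borel_measurable M"
    using mult(4) by (intro borel_measurable_times_ennreal borel_measurable_const) auto
  ultimately show ?case using mult(4)
    by (simp add: nn_integral_cmult cong: measurable_cong nn_integral_cong)
next
  case (add u v)
  have "(\<integral>\<^sup>+y. v y + u y \<partial>K x) = (\<integral>\<^sup>+y. v y \<partial>K x) + (\<integral>\<^sup>+y. u y \<partial>K x)" if "x \<in> space M" for x
    using add.hyps K(1)[OF that] by (intro nn_integral_add) (simp_all cong: measurable_cong_sets)
  moreover have "(\<integral>\<^sup>+y. v y + u y \<partial>mixture M N K) = (\<integral>\<^sup>+y. v y \<partial>mixture M N K) + (\<integral>\<^sup>+y. u y \<partial>mixture M N K)"
    using add.hyps by (intro nn_integral_add) (simp_all cong: measurable_cong_sets)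
  moreover have "(\<lambda>x. (\<integral>\<^sup>+y. v y \<partial>K x) + (\<integral>\<^sup>+y. u y \<partial>K x)) \<in> borel_measurable M"
    using add.IH by (intro borel_measurable_add) auto
  ultimately show ?case using add.IH
    by (simp add: nn_integral_add cong: measurable_cong nn_integral_cong)
next
  case (seq U)
  have "(\<integral>\<^sup>+y. (SUP i. U i) y \<partial>K x) = (SUP i. \<integral>\<^sup>+y. U i y \<partial>K x)" if "x \<in> space M" for x
    unfolding SUP_apply using seq.hyps K(1)[OF that]
    by (intro nn_integral_monotone_convergence_SUP) (simp_all cong: measurable_cong_sets)
  moreover have "(\<integral>\<^sup>+y. (SUP i. U i) y \<partial>mixture M N K) = (SUP i. \<integral>\<^sup>+y. U i y \<partial>mixture M N K)"
    unfolding SUP_apply using seq.hyps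
    by (intro nn_integral_monotone_convergence_SUP) (simp_all cong: measurable_cong_sets)
  moreover have "(\<integral>\<^sup>+x. (SUP i. \<integral>\<^sup>+y. U i y \<partial>K x) \<partial>M) = (SUP i. \<integral>\<^sup>+x. \<integral>\<^sup>+y. U i y \<partial>K x \<partial>M)"
    using seq.hyps seq.IH by (intro nn_integral_monotone_convergence_SUP) (auto simp: incseq_def le_fun_def intro!: nn_integral_mono)
  moreover have "(\<lambda>x. SUP i. \<integral>\<^sup>+y. U i y \<partial>K x) \<in> borel_measurable M"
    using seq.IH by (intro borel_measurable_SUP) auto
  ultimately show ?case using seq.IH
    by (simp cong: measurable_cong nn_integral_cong)
qed

lemma nn_integral_mixture:
  assumes "\<And>x. x \<in> space M \<Longrightarrow> sets (K x) = sets N"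
    "\<And>A. A \<in> sets N \<Longrightarrow> (\<lambda>x. emeasure (K x) A) \<in> borel_measurable M" "f \<in> borel_measurable N"
  shows "(\<integral>\<^sup>+y. f y \<partial>mixture M N K) = (\<integral>\<^sup>+x. \<integral>\<^sup>+y. f y \<partial>K x \<partial>M)"
  using nn_integral_mixture_aux[OF assms] by blast

section \<open>Lifting a measure on lattices to the matrix group\<close>

text \<open>Counting measure on the bases of \<open>L\<close>. The push-forward along the identity
  only replaces the power set by the Borel sets of the group, so that all fibres share one
  sigma-algebra.\<close>

definition fibre :: "nat \<Rightarrow> real vec set \<Rightarrow> real mat measure" where
  "fibre n L = distr (count_space {h \<in> SL n. row_lattice h = L}) (SL_borel n) (\<lambda>h. h)"

lemma sets_fibre [simp]: "sets (fibre n L) = sets (SL_borel n)"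
  by (simp add: fibre_def)

lemma nn_integral_fibre:
  assumes "f \<in> borel_measurable (SL_borel n)" "g \<in> SL n"
  shows "(\<integral>\<^sup>+x. f x \<partial>fibre n (row_lattice g)) = (\<integral>\<^sup>+A. f (rmat A * g) \<partial>count_space (SLZ n))"
proof -
  have "(\<integral>\<^sup>+x. f x \<partial>fibre n (row_lattice g)) = (\<integral>\<^sup>+x. f x \<partial>count_space {h \<in> SL n. row_lattice h = row_lattice g})"
    unfolding fibre_def using assms by (intro nn_integral_distr) auto
  also have "\<dots> = (\<integral>\<^sup>+A. f (rmat A * g) \<partial>count_space (SLZ n))"
    by (rule nn_integral_bij_count_space[OF row_lattice_fibre[OF assms(2)], symmetric])
  finally show ?thesis .
qed

lemma measurable_sum_SLZ:
  assumes "f \<in> borel_measurable (SL_borel n)"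
  shows "(\<lambda>g. \<integral>\<^sup>+A. f (rmat A * g) \<partial>count_space (SLZ n)) \<in> borel_measurable (SL_borel n)"
proof -
  interpret sigma_finite_measure "count_space (SLZ n)"
    by (rule sigma_finite_measure_count_space_countable[OF SLZ_countable])
  show ?thesis
  proof (rule borel_measurable_nn_integral)
    have "(\<lambda>(A, g). f (rmat A * g)) \<in> borel_measurable (count_space (SLZ n) \<Otimes>\<^sub>M SL_borel n)"
    proof (rule measurable_pair_measure_countable1[OF SLZ_countable])
      fix A assume "A \<in> SLZ n"
      hence "(\<lambda>g. rmat A * g) \<in> SL_borel n \<rightarrow>\<^sub>M SL_borel n"
        by (intro measurable_SL_mult measurable_const) (auto intro: rmat_SL)
      from measurable_compose[OF this assms]
      show "(\<lambda>y. case (A, y) of (A, g) \<Rightarrow> f (rmat A * g)) \<in> borel_measurable (SL_borel n)" by simp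
    qed
    from measurable_compose[OF measurable_pair_swap' this]
    show "(\<lambda>(g, A). f (rmat A * g)) \<in> borel_measurable (SL_borel n \<Otimes>\<^sub>M count_space (SLZ n))"
      by (simp add: case_prod_beta)
  qed
qed

lemma measurable_nn_integral_fibre:
  assumes "f \<in> borel_measurable (SL_borel n)"
  shows "(\<lambda>L. \<integral>\<^sup>+x. f x \<partial>fibre n L) \<in> borel_measurable (lattice_space n)"
proof (rule measurable_lattice_spaceI)
  show "(\<lambda>g. \<integral>\<^sup>+x. f x \<partial>fibre n (row_lattice g)) \<in> borel_measurable (SL_borel n)"
    by (subst measurable_cong[OF nn_integral_fibre[OF assms]]) (simp_all add: measurable_sum_SLZ[OF assms])
qed auto

text \<open>The unfolding of \<open>M\<close>: integrate over lattices the sum over all bases. For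
  an invariant \<open>M\<close> this is a right Haar measure, sigma-finite but in general
  infinite.\<close>

definition SL_lift :: "nat \<Rightarrow> real vec set measure \<Rightarrow> real mat measure" where
  "SL_lift n M = mixture M (SL_borel n) (fibre n)"

lemma sets_SL_lift [simp, measurable_cong]: "sets (SL_lift n M) = sets (SL_borel n)"
  by (simp add: SL_lift_def)

lemma space_SL_lift [simp]: "space (SL_lift n M) = SL n"
  by (simp add: SL_lift_def)

lemma nn_integral_SL_lift:
  assumes "sets M = sets (lattice_space n)" "f \<in> borel_measurable (SL_borel n)"
  shows "(\<integral>\<^sup>+x. f x \<partial>SL_lift n M) = (\<integral>\<^sup>+L. \<integral>\<^sup>+x. f x \<partial>fibre n L \<partial>M)"
  unfolding SL_lift_def
proof (rule nn_integral_mixture[OF _ _ assms(2)])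
  fix A assume A: "A \<in> sets (SL_borel n)"
  have "(\<lambda>L. emeasure (fibre n L) A) \<in> borel_measurable (lattice_space n)"
    using measurable_nn_integral_fibre[of "indicator A" n] A by simp
  thus "(\<lambda>L. emeasure (fibre n L) A) \<in> borel_measurable M"
    using assms(1) by (simp cong: measurable_cong_sets)
qed simp

lemma SL_invariantD:
  assumes "SL_invariant_prob n M"
  shows "prob_space M" "sets M = sets (lattice_space n)" "space M = row_lattice ` SL n"
    "\<And>h. h \<in> SL n \<Longrightarrow> distr M M (\<lambda>L. (\<lambda>v. transpose_mat h *\<^sub>v v) ` L) = M"
  using assms sets_eq_imp_space_eq[of M "lattice_space n"] by (auto simp: SL_invariant_prob_def)

text \<open>Right translation by \<open>h\<close> carries the bases of \<open>L\<close> to the bases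
  of the translated lattice, so it only moves the outer variable, where invariance of
  \<open>M\<close> absorbs it.\<close>

lemma SL_lift_right_invariant:
  assumes M: "SL_invariant_prob n M" and f: "f \<in> borel_measurable (SL_borel n)" and h: "h \<in> SL n"
  shows "(\<integral>\<^sup>+x. f (x * h) \<partial>SL_lift n M) = (\<integral>\<^sup>+x. f x \<partial>SL_lift n M)"
proof -
  note MD = SL_invariantD[OF M]
  have fh: "(\<lambda>x. f (x * h)) \<in> borel_measurable (SL_borel n)"
    using h by (intro measurable_compose[OF _ f] measurable_SL_mult) auto
  have step: "(\<integral>\<^sup>+x. f (x * h) \<partial>fibre n L) = (\<integral>\<^sup>+x. f x \<partial>fibre n ((\<lambda>v. transpose_mat h *\<^sub>v v) ` L))"
    if L: "L \<in> space M" for L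
  proof -
    obtain g where g: "g \<in> SL n" "L = row_lattice g" using L MD(3) by auto
    have "(\<integral>\<^sup>+x. f (x * h) \<partial>fibre n L) = (\<integral>\<^sup>+A. f (rmat A * g * h) \<partial>count_space (SLZ n))"
      unfolding g(2) by (rule nn_integral_fibre[OF fh g(1)])
    also have "\<dots> = (\<integral>\<^sup>+A. f (rmat A * (g * h)) \<partial>count_space (SLZ n))"
      using SL_carrier[OF g(1)] SL_carrier[OF h]
      by (intro nn_integral_cong) (auto simp: SLZ_def assoc_mult_mat[of _ n n _ n _ n])
    also have "\<dots> = (\<integral>\<^sup>+x. f x \<partial>fibre n (row_lattice (g * h)))"
      by (rule nn_integral_fibre[OF f SL_mult[OF g(1) h], symmetric])
    finally show ?thesis unfolding g(2) row_lattice_mult[OF g(1) h] .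
  qed
  have T: "(\<lambda>L. (\<lambda>v. transpose_mat h *\<^sub>v v) ` L) \<in> M \<rightarrow>\<^sub>M M"
    using measurable_translate_lattice[OF h] MD(2) by (simp cong: measurable_cong_sets)
  have F: "(\<lambda>L. \<integral>\<^sup>+x. f x \<partial>fibre n L) \<in> borel_measurable M"
    using measurable_nn_integral_fibre[OF f] MD(2) by (simp cong: measurable_cong_sets)
  have "(\<integral>\<^sup>+x. f (x * h) \<partial>SL_lift n M) = (\<integral>\<^sup>+L. \<integral>\<^sup>+x. f (x * h) \<partial>fibre n L \<partial>M)"
    by (rule nn_integral_SL_lift[OF MD(2) fh])
  also have "\<dots> = (\<integral>\<^sup>+L. \<integral>\<^sup>+x. f x \<partial>fibre n ((\<lambda>v. transpose_mat h *\<^sub>v v) ` L) \<partial>M)"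
    by (intro nn_integral_cong step)
  also have "\<dots> = (\<integral>\<^sup>+L. \<integral>\<^sup>+x. f x \<partial>fibre n L \<partial>distr M M (\<lambda>L. (\<lambda>v. transpose_mat h *\<^sub>v v) ` L))"
    by (rule nn_integral_distr[OF T, symmetric]) (simp add: F)
  also have "\<dots> = (\<integral>\<^sup>+x. f x \<partial>SL_lift n M)"
    unfolding MD(4)[OF h] by (rule nn_integral_SL_lift[OF MD(2) f, symmetric])
  finally show ?thesis .
qed

subsection \<open>Right-invariant measures on the special linear group\<close>

text \<open>The substitution \<open>(x, y) \<mapsto> (x y, x\<^sup>-\<^sup>1)\<close> preserves the product of two
  right-invariant measures (Halmos).\<close>

lemma right_invariant_product:
  assumes s1: "sets m1 = sets (SL_borel n)" and s2: "sets m2 = sets (SL_borel n)"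
    and "sigma_finite_measure m1" "sigma_finite_measure m2"
    and i1: "\<And>f h. f \<in> borel_measurable (SL_borel n) \<Longrightarrow> h \<in> SL n \<Longrightarrow> (\<integral>\<^sup>+x. f (x * h) \<partial>m1) = (\<integral>\<^sup>+x. f x \<partial>m1)"
    and i2: "\<And>f h. f \<in> borel_measurable (SL_borel n) \<Longrightarrow> h \<in> SL n \<Longrightarrow> (\<integral>\<^sup>+x. f (x * h) \<partial>m2) = (\<integral>\<^sup>+x. f x \<partial>m2)"
    and f: "f \<in> borel_measurable (SL_borel n)" and g: "g \<in> borel_measurable (SL_borel n)"
  shows "(\<integral>\<^sup>+x. f x \<partial>m1) * (\<integral>\<^sup>+x. g x \<partial>m2) = (\<integral>\<^sup>+x. g (adj_mat x) * (\<integral>\<^sup>+y. f (x * y) \<partial>m2) \<partial>m1)"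
proof -
  interpret m1: sigma_finite_measure m1 by fact
  interpret m2: sigma_finite_measure m2 by fact
  interpret pair_sigma_finite m1 m2 ..
  have sp: "space m1 = SL n" "space m2 = SL n"
    using sets_eq_imp_space_eq[OF s1] sets_eq_imp_space_eq[OF s2] by auto
  note s1[measurable_cong] s2[measurable_cong]
  have p1: "fst \<in> m1 \<Otimes>\<^sub>M m2 \<rightarrow>\<^sub>M SL_borel n" and p2: "snd \<in> m1 \<Otimes>\<^sub>M m2 \<rightarrow>\<^sub>M SL_borel n"
    using measurable_fst[of m1 m2] measurable_snd[of m1 m2] by (simp_all cong: measurable_cong_sets add: s1 s2)
  have adj_adj: "adj_mat (adj_mat y) = y" if y: "y \<in> SL n" for y
  proof -
    have "adj_mat (adj_mat y) = adj_mat (adj_mat y) * (adj_mat y * y)"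
      unfolding SL_adj(3)[OF y]
      by (rule right_mult_one_mat[symmetric], rule SL_carrier, rule SL_adj(1)[OF SL_adj(1)[OF y]])
    also have "\<dots> = y" using SL_cancel_left(1)[OF SL_adj(1)[OF y] SL_carrier[OF y]] .
    finally show ?thesis .
  qed
  have fm: "(\<lambda>p. f (fst p * snd p)) \<in> borel_measurable (m1 \<Otimes>\<^sub>M m2)"
    by (intro measurable_compose[OF _ f] measurable_SL_mult p1 p2)
  have gm: "(\<lambda>p. g (adj_mat (fst p))) \<in> borel_measurable (m1 \<Otimes>\<^sub>M m2)"
    by (intro measurable_compose[OF _ g] measurable_compose[OF p1 measurable_SL_adj])
  have F: "(\<lambda>(x,y). g (adj_mat x) * f (x * y)) \<in> borel_measurable (m1 \<Otimes>\<^sub>M m2)"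
    using fm gm by (simp add: case_prod_beta borel_measurable_times_ennreal)
  have gm2: "(\<lambda>p. g (snd p * adj_mat (fst p))) \<in> borel_measurable (m1 \<Otimes>\<^sub>M m2)"
    by (intro measurable_compose[OF _ g] measurable_SL_mult measurable_compose[OF p1 measurable_SL_adj] p2)
  have fm2: "(\<lambda>p. f (fst p)) \<in> borel_measurable (m1 \<Otimes>\<^sub>M m2)"
    by (intro measurable_compose[OF p1 f])
  have G: "(\<lambda>(x,y). f x * g (y * adj_mat x)) \<in> borel_measurable (m1 \<Otimes>\<^sub>M m2)"
    using fm2 gm2 by (simp add: case_prod_beta borel_measurable_times_ennreal)
  have "(\<integral>\<^sup>+x. g (adj_mat x) * (\<integral>\<^sup>+y. f (x * y) \<partial>m2) \<partial>m1) = (\<integral>\<^sup>+x. \<integral>\<^sup>+y. g (adj_mat x) * f (x * y) \<partial>m2 \<partial>m1)"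
  proof (intro nn_integral_cong nn_integral_cmult[symmetric])
    fix x assume "x \<in> space m1"
    thus "(\<lambda>y. f (x * y)) \<in> borel_measurable m2"
      using sp by (intro measurable_compose[OF _ f] measurable_SL_mult) (auto simp: s2 cong: measurable_cong_sets)
  qed
  also have "\<dots> = (\<integral>\<^sup>+y. \<integral>\<^sup>+x. g (adj_mat x) * f (x * y) \<partial>m1 \<partial>m2)"
    using Fubini'[OF F] by simp
  \<comment> \<open>Right translation of x by the inverse of y, for fixed y. After Fubini,
    translating y by the inverse of x turns the factor \<open>g (y * adj_mat x)\<close> into
    \<open>g y\<close> and separates the variables.\<close>
  also have "\<dots> = (\<integral>\<^sup>+y. \<integral>\<^sup>+x. f x * g (y * adj_mat x) \<partial>m1 \<partial>m2)"
  proof (rule nn_integral_cong)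
    fix y assume y': "y \<in> space m2"
    hence y: "y \<in> SL n" using sp by simp
    have m: "(\<lambda>x. g (adj_mat x) * f (x * y)) \<in> borel_measurable (SL_borel n)"
      using y by (intro borel_measurable_times_ennreal measurable_compose[OF measurable_SL_adj g]
          measurable_compose[OF _ f] measurable_SL_mult) auto
    have "(\<integral>\<^sup>+x. g (adj_mat x) * f (x * y) \<partial>m1) = (\<integral>\<^sup>+x. g (adj_mat (x * adj_mat y)) * f (x * adj_mat y * y) \<partial>m1)"
      by (rule i1[OF m SL_adj(1)[OF y], symmetric])
    also have "\<dots> = (\<integral>\<^sup>+x. f x * g (y * adj_mat x) \<partial>m1)"
    proof (rule nn_integral_cong)
      fix x assume "x \<in> space m1"
      hence x: "x \<in> SL n" using sp by simp
      show "g (adj_mat (x * adj_mat y)) * f (x * adj_mat y * y) = f x * g (y * adj_mat x)"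
        using SL_cancel_right(2)[OF y SL_carrier[OF x]] adj_mat_mult[OF x SL_adj(1)[OF y]] adj_adj[OF y]
        by (simp add: mult.commute)
    qed
    finally show "(\<integral>\<^sup>+x. g (adj_mat x) * f (x * y) \<partial>m1) = \<dots>" .
  qed
  also have "\<dots> = (\<integral>\<^sup>+x. \<integral>\<^sup>+y. f x * g (y * adj_mat x) \<partial>m2 \<partial>m1)"
    using Fubini'[OF G] by simp
  also have "\<dots> = (\<integral>\<^sup>+x. f x * (\<integral>\<^sup>+y. g y \<partial>m2) \<partial>m1)"
  proof (rule nn_integral_cong)
    fix x assume "x \<in> space m1"
    hence x: "adj_mat x \<in> SL n" using sp SL_adj by simp
    have "(\<integral>\<^sup>+y. f x * g (y * adj_mat x) \<partial>m2) = f x * (\<integral>\<^sup>+y. g (y * adj_mat x) \<partial>m2)"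
      using x by (intro nn_integral_cmult measurable_compose[OF _ g] measurable_SL_mult)
        (auto simp: s2 cong: measurable_cong_sets)
    thus "(\<integral>\<^sup>+y. f x * g (y * adj_mat x) \<partial>m2) = f x * (\<integral>\<^sup>+y. g y \<partial>m2)"
      unfolding i2[OF g x] .
  qed
  also have "\<dots> = (\<integral>\<^sup>+x. f x \<partial>m1) * (\<integral>\<^sup>+x. g x \<partial>m2)"
    using f s1 by (intro nn_integral_multc) (simp cong: measurable_cong_sets)
  finally show ?thesis ..
qed

section \<open>Orbits of SL(n,Z) in norm balls and a summable weight\<close>

definition mat_norm :: "real mat \<Rightarrow> real" where
  "mat_norm A = (\<Sum>i<dim_row A. \<Sum>j<dim_col A. \<bar>A $$ (i,j)\<bar>)"

lemma mat_norm_nonneg: "0 \<le> mat_norm A"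
  by (simp add: mat_norm_def sum_nonneg)

lemma entry_le_mat_norm:
  assumes "A \<in> carrier_mat n n" "i < n" "j < n"
  shows "\<bar>A $$ (i,j)\<bar> \<le> mat_norm A"
proof -
  have "\<bar>A $$ (i,j)\<bar> \<le> (\<Sum>j<n. \<bar>A $$ (i,j)\<bar>)"
    using assms by (intro member_le_sum) auto
  also have "\<dots> \<le> mat_norm A"
    unfolding mat_norm_def using assms
    by (auto intro!: member_le_sum[of i "{..<n}" "\<lambda>i. \<Sum>j<n. \<bar>A $$ (i,j)\<bar>"] sum_nonneg)
  finally show ?thesis .
qed

lemma mat_norm_mult:
  assumes A: "A \<in> carrier_mat n n" and B: "B \<in> carrier_mat n n"
  shows "mat_norm (A * B) \<le> mat_norm A * mat_norm B"
proof -
  have "mat_norm (A * B) = (\<Sum>i<n. \<Sum>j<n. \<bar>\<Sum>k<n. A $$ (i,k) * B $$ (k,j)\<bar>)"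
    unfolding mat_norm_def using A B mat_mult_index_sum[OF A B] by (auto intro!: sum.cong)
  also have "\<dots> \<le> (\<Sum>i<n. \<Sum>j<n. \<Sum>k<n. \<bar>A $$ (i,k)\<bar> * \<bar>B $$ (k,j)\<bar>)"
    by (intro sum_mono order_trans[OF sum_abs]) (simp add: abs_mult)
  also have "\<dots> = (\<Sum>i<n. \<Sum>k<n. \<bar>A $$ (i,k)\<bar> * (\<Sum>j<n. \<bar>B $$ (k,j)\<bar>))"
    by (rule sum.cong[OF refl], subst sum.swap) (simp add: sum_distrib_left)
  also have "\<dots> \<le> (\<Sum>i<n. \<Sum>k<n. \<bar>A $$ (i,k)\<bar> * mat_norm B)"
    unfolding mat_norm_def using B
    by (intro sum_mono mult_left_mono)
       (auto intro!: member_le_sum[of _ "{..<n}" "\<lambda>i. \<Sum>j<n. \<bar>B $$ (i,j)\<bar>"] sum_nonneg)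
  also have "\<dots> = mat_norm A * mat_norm B"
    unfolding mat_norm_def[of A] using A by (simp add: sum_distrib_right)
  finally show ?thesis .
qed

lemma det_le_of_entries_le:
  assumes A: "A \<in> carrier_mat m m" and K: "\<And>i j. i < m \<Longrightarrow> j < m \<Longrightarrow> \<bar>A $$ (i,j)\<bar> \<le> K" and "0 \<le> K"
  shows "\<bar>det A :: real\<bar> \<le> fact m * K ^ m"
proof -
  have "\<bar>det A\<bar> \<le> (\<Sum>p\<in>{p. p permutes {0..<m}}. \<bar>signof p * (\<Prod>i = 0..<m. A $$ (i, p i))\<bar>)"
    unfolding det_def'[OF A] by (rule sum_abs)
  also have "\<dots> \<le> (\<Sum>p\<in>{p. p permutes {0..<m}}. K ^ m)"
  proof (rule sum_mono)
    fix p assume "p \<in> {p. p permutes {0..<m}}"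
    hence p: "p permutes {0..<m}" by simp
    have "(\<Prod>i = 0..<m. \<bar>A $$ (i, p i)\<bar>) \<le> (\<Prod>i = 0..<m. K)"
      using permutes_in_image[OF p] by (intro prod_mono) (auto intro!: K)
    thus "\<bar>signof p * (\<Prod>i = 0..<m. A $$ (i, p i))\<bar> \<le> K ^ m"
      by (auto simp: abs_mult abs_prod sign_def)
  qed
  also have "\<dots> = fact m * K ^ m" by (simp add: card_permutations)
  finally show ?thesis .
qed

text \<open>The entries of the adjugate are minors of size n - 1, bounded by the Leibniz formula.
  Hence in \<open>SL n\<close> a bound on a matrix bounds its inverse.\<close>

lemma mat_norm_adj_le:
  assumes g: "g \<in> carrier_mat n n" and K: "mat_norm g \<le> K"
  shows "mat_norm (adj_mat g) \<le> real n * real n * (fact (n-1) * K ^ (n-1))"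
proof -
  have "mat_norm (adj_mat g) = (\<Sum>i<n. \<Sum>j<n. \<bar>cofactor g j i\<bar>)"
    unfolding mat_norm_def adj_mat_def using g by auto
  also have "\<dots> \<le> (\<Sum>i<n. \<Sum>j<n. fact (n-1) * K ^ (n-1))"
  proof (intro sum_mono)
    fix i j assume ij: "i \<in> {..<n}" "j \<in> {..<n}"
    have "\<bar>det (mat_delete g j i)\<bar> \<le> fact (n-1) * K ^ (n-1)"
    proof (rule det_le_of_entries_le)
      show "mat_delete g j i \<in> carrier_mat (n-1) (n-1)" using g by (auto simp: mat_delete_def)
      fix k l assume kl: "k < n - 1" "l < n - 1"
      have "mat_delete g j i $$ (k,l) = g $$ (insert_index j k, insert_index i l)"
        using kl g by (auto simp: mat_delete_def insert_index_def)
      thus "\<bar>mat_delete g j i $$ (k,l)\<bar> \<le> K"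
        using order_trans[OF entry_le_mat_norm[OF g, of "insert_index j k" "insert_index i l"] K] kl
        by (auto simp: insert_index_def split: if_splits)
    qed (use K mat_norm_nonneg[of g] in linarith)
    thus "\<bar>cofactor g j i\<bar> \<le> fact (n-1) * K ^ (n-1)"
      by (simp add: cofactor_def abs_mult)
  qed
  also have "\<dots> = real n * real n * (fact (n-1) * K ^ (n-1))" by simp
  finally show ?thesis .
qed

lemma finite_SLZ_bounded: "finite {A \<in> SLZ n. mat_norm (rmat A) \<le> K}"
proof -
  have "{A \<in> SLZ n. mat_norm (rmat A) \<le> K} \<subseteq> (\<lambda>f. mat n n f) ` (({..<n} \<times> {..<n}) \<rightarrow>\<^sub>E {-\<lceil>K\<rceil>..\<lceil>K\<rceil>})"
  proof
    fix A assume A: "A \<in> {A \<in> SLZ n. mat_norm (rmat A) \<le> K}"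
    hence c: "A \<in> carrier_mat n n" by (simp add: SLZ_def)
    have "A $$ ij \<in> {-\<lceil>K\<rceil>..\<lceil>K\<rceil>}" if ijn: "ij \<in> {..<n} \<times> {..<n}" for ij
    proof -
      obtain i j where ij: "ij = (i,j)" "i < n" "j < n" using ijn by (cases ij) auto
      have "\<bar>real_of_int (A $$ (i,j))\<bar> \<le> K"
        using entry_le_mat_norm[of "rmat A" n i j] c ij A by auto
      thus ?thesis unfolding ij by (auto simp: le_ceiling_iff) linarith+
    qed
    hence "restrict (\<lambda>ij. A $$ ij) ({..<n} \<times> {..<n}) \<in> ({..<n} \<times> {..<n}) \<rightarrow>\<^sub>E {-\<lceil>K\<rceil>..\<lceil>K\<rceil>}" by auto
    moreover have "A = mat n n (restrict (\<lambda>ij. A $$ ij) ({..<n} \<times> {..<n}))"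
      using c by (intro eq_matI) auto
    ultimately show "A \<in> (\<lambda>f. mat n n f) ` (({..<n} \<times> {..<n}) \<rightarrow>\<^sub>E {-\<lceil>K\<rceil>..\<lceil>K\<rceil>})" by blast
  qed
  thus ?thesis by (rule finite_subset) (intro finite_imageI finite_PiE, auto)
qed

text \<open>The bound is uniform in \<open>g\<close>. If the orbit of \<open>g\<close> meets the
  ball of radius k at all, it may be based at such a point \<open>h\<close>; the inverse of
  \<open>h\<close> is then bounded in terms of k alone, so all integer matrices moving
  \<open>h\<close> within the ball lie in a ball of radius \<open>R k\<close>, which contains
  finitely many.\<close>

lemma SLZ_orbit_bound:
  "\<exists>b :: nat \<Rightarrow> nat. mono b \<and> (\<forall>k. \<forall>g\<in>SL n. finite {A \<in> SLZ n. mat_norm (rmat A * g) \<le> real k} \<and>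
       card {A \<in> SLZ n. mat_norm (rmat A * g) \<le> real k} \<le> b k)"
proof (intro exI conjI allI ballI)
  define R where "R k = real k * (real n * real n * (fact (n-1) * real k ^ (n-1)))" for k :: nat
  define b where "b k = card {A \<in> SLZ n. mat_norm (rmat A) \<le> R k}" for k
  have "mono R" unfolding R_def by (intro monoI mult_mono power_mono) auto
  thus "mono b" unfolding b_def
    by (intro monoI card_mono finite_SLZ_bounded) (auto dest: monoD)
  fix k :: nat and g assume g: "g \<in> SL n"
  let ?S = "{A \<in> SLZ n. mat_norm (rmat A * g) \<le> real k}"
  have "finite ?S \<and> card ?S \<le> b k"
  proof (cases "?S = {}")
    case False
    then obtain B where B: "B \<in> SLZ n" "mat_norm (rmat B * g) \<le> real k" by auto
    have Bc: "B \<in> carrier_mat n n" "det B = 1" using B by (auto simp: SLZ_def)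
    note adjB = adj_mat_inverse[OF Bc]
    let ?h = "rmat B * g"
    have h: "?h \<in> SL n" using SL_mult[OF rmat_SL[OF B(1)] g] .
    have inj: "inj_on (\<lambda>A. A * adj_mat B) ?S"
    proof (rule inj_onI)
      fix A A' assume A: "A \<in> ?S" "A' \<in> ?S" "A * adj_mat B = A' * adj_mat B"
      have c: "A \<in> carrier_mat n n" "A' \<in> carrier_mat n n" using A by (auto simp: SLZ_def)
      have "A = A * adj_mat B * B" "A' = A' * adj_mat B * B"
        using assoc_mult_mat[OF c(1) adjB(1) Bc(1)] assoc_mult_mat[OF c(2) adjB(1) Bc(1)] adjB(3) c by auto
      thus "A = A'" using A(3) by simp
    qed
    have "(\<lambda>A. A * adj_mat B) ` ?S \<subseteq> {A \<in> SLZ n. mat_norm (rmat A) \<le> R k}"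
    proof clarify
      fix A assume A: "A \<in> SLZ n" "mat_norm (rmat A * g) \<le> real k"
      have Ac: "A \<in> carrier_mat n n" "det A = 1" using A by (auto simp: SLZ_def)
      have gc: "g \<in> carrier_mat n n" using SL_carrier[OF g] .
      have AB: "A * adj_mat B \<in> SLZ n" using Ac adjB by (auto simp: SLZ_def det_mult[of _ n])
      have Ag: "rmat A * g \<in> carrier_mat n n" using Ac gc by auto
      have hc: "adj_mat ?h \<in> carrier_mat n n" using SL_adj(1)[OF h] SL_carrier by auto
      have "rmat (A * adj_mat B) * ?h = rmat A * (rmat (adj_mat B) * (rmat B * g))"
        unfolding rmat_mult[OF Ac(1) adjB(1)] using Ac adjB gc Bc by (intro assoc_mult_mat) auto
      also have "rmat (adj_mat B) * (rmat B * g) = rmat (adj_mat B * B) * g"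
        unfolding rmat_mult[OF adjB(1) Bc(1)] using adjB gc Bc by (intro assoc_mult_mat[symmetric]) auto
      also have "\<dots> = g" unfolding adjB(3) using gc by (simp add: of_int_hom.mat_hom_one)
      finally have e: "rmat (A * adj_mat B) * ?h = rmat A * g" .
      have "rmat (A * adj_mat B) = (rmat A * g) * adj_mat ?h"
        using SL_cancel_right(1)[OF h, of "rmat (A * adj_mat B)"] AB unfolding e by (auto simp: SLZ_def)
      also have "mat_norm \<dots> \<le> mat_norm (rmat A * g) * mat_norm (adj_mat ?h)"
        by (rule mat_norm_mult[OF Ag hc])
      also have "\<dots> \<le> R k"
        unfolding R_def using A(2) mat_norm_adj_le[OF SL_carrier[OF h] B(2)]
        by (intro mult_mono mat_norm_nonneg) auto
      finally show "A * adj_mat B \<in> SLZ n \<and> mat_norm (rmat (A * adj_mat B)) \<le> R k" using AB by blast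
    qed
    thus ?thesis unfolding b_def
      using inj_on_finite[OF inj _ finite_SLZ_bounded] card_inj_on_le[OF inj _ finite_SLZ_bounded] by blast
  next
    case True
    show ?thesis unfolding True by simp
  qed
  thus "finite ?S" "card ?S \<le> b k" by auto
qed

lemma measurable_mat_norm: "mat_norm \<in> borel_measurable (SL_borel n)"
proof -
  have "(\<lambda>g. \<Sum>i<n. \<Sum>j<n. \<bar>g $$ (i,j)\<bar>) \<in> borel_measurable (SL_borel n)"
    by (intro borel_measurable_sum borel_measurable_abs measurable_SL_entry) auto
  thus ?thesis by (rule subst[OF measurable_cong, rotated]) (auto simp: mat_norm_def dest!: SL_carrier)
qed


lemma emeasure_fibre_bounded:
  assumes b: "\<And>k g. g \<in> SL n \<Longrightarrow> finite {A \<in> SLZ n. mat_norm (rmat A * g) \<le> real k} \<and>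
       card {A \<in> SLZ n. mat_norm (rmat A * g) \<le> real k} \<le> b k" and g: "g \<in> SL n"
    and S: "\<And>A. A \<in> SLZ n \<Longrightarrow> rmat A * g \<in> S \<Longrightarrow> mat_norm (rmat A * g) \<le> real k"
  shows "(\<integral>\<^sup>+A. indicator S (rmat A * g) \<partial>count_space (SLZ n)) \<le> of_nat (b k)"
proof -
  have "(\<integral>\<^sup>+A. indicator S (rmat A * g) \<partial>count_space (SLZ n))
      \<le> (\<integral>\<^sup>+A. indicator {A \<in> SLZ n. mat_norm (rmat A * g) \<le> real k} A \<partial>count_space (SLZ n))"
    using S by (intro nn_integral_mono) (auto simp: indicator_def)
  also have "\<dots> = emeasure (count_space (SLZ n)) {A \<in> SLZ n. mat_norm (rmat A * g) \<le> real k}"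
    by (intro nn_integral_indicator) auto
  also have "\<dots> = of_nat (card {A \<in> SLZ n. mat_norm (rmat A * g) \<le> real k})"
    using b[OF g, of k] by (intro emeasure_count_space_finite) auto
  also have "\<dots> \<le> of_nat (b k)" using b[OF g, of k] by simp
  finally show ?thesis .
qed

text \<open>A strictly positive integrable weight to divide by. Its orbit sums must stay bounded
  after left translation by any fixed x, because the product identity for two invariant measures
  produces the integral of \<open>f (x * y)\<close> in y.\<close>

lemma SL_weight_exists:
  "\<exists>f :: real mat \<Rightarrow> ennreal. f \<in> borel_measurable (SL_borel n) \<and> (\<forall>x\<in>SL n. 0 < f x \<and>
    (\<exists>B. \<forall>g\<in>SL n. (\<integral>\<^sup>+A. f (x * (rmat A * g)) \<partial>count_space (SLZ n)) \<le> ennreal B))"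
proof -
  obtain b where b0: "mono b" "\<forall>k. \<forall>g\<in>SL n. finite {A \<in> SLZ n. mat_norm (rmat A * g) \<le> real k} \<and>
       card {A \<in> SLZ n. mat_norm (rmat A * g) \<le> real k} \<le> b k"
    using SLZ_orbit_bound[of n] by blast
  note b = b0(1) b0(2)[rule_format]
  \<comment> \<open>Left translation by x turns a ball of radius k into a subset of one of radius C
    k, with C depending on x. For k at least C this is at most k k, so dividing by the orbit count
    at radius k k leaves a geometric series for every x.\<close>
  define c :: "nat \<Rightarrow> real" where "c k = (1/2)^k / (1 + real (b (k * k)))" for k
  define S where "S k = {x \<in> SL n. mat_norm x \<le> real k}" for k
  define f :: "real mat \<Rightarrow> ennreal" where "f x = (\<Sum>k. ennreal (c k) * indicator (S k) x)" for x
  have c0: "0 < c k" for k by (simp add: c_def add_pos_nonneg)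
  have S: "S k \<in> sets (SL_borel n)" for k
  proof -
    have "S k = mat_norm -` {..real k} \<inter> space (SL_borel n)" by (auto simp: S_def)
    also have "\<dots> \<in> sets (SL_borel n)" by (intro measurable_sets[OF measurable_mat_norm]) auto
    finally show ?thesis .
  qed
  show ?thesis
  proof (intro exI[of _ f] conjI ballI)
    show "f \<in> borel_measurable (SL_borel n)"
      unfolding f_def using S by (intro borel_measurable_suminf_order borel_measurable_times_ennreal) auto
  next
    fix x assume x: "x \<in> SL n"
    obtain k where k: "mat_norm x \<le> real k" using real_arch_simple by blast
    have "0 < (\<Sum>k\<in>{k}. ennreal (c k) * indicator (S k) x)" using c0[of k] x k by (auto simp: S_def)
    also have "\<dots> \<le> f x" unfolding f_def by (intro sum_le_suminf) auto
    finally show "0 < f x" .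
  next
    fix x assume x: "x \<in> SL n"
    obtain C :: nat where C: "mat_norm (adj_mat x) \<le> real C" using real_arch_simple by blast
    define B where "B = (\<Sum>k. c k * real (b (C * k)))"
    have sm: "summable (\<lambda>k. c k * real (b (C * k)))"
    proof (rule summable_comparison_test'[of "\<lambda>k. (1/2::real)^k" C])
      show "summable (\<lambda>k. (1/2::real)^k)" by (rule summable_geometric) simp
      fix k assume k: "C \<le> k"
      have "real (b (C * k)) \<le> 1 + real (b (k * k))" using monoD[OF b(1), of "C*k" "k*k"] k by simp
      hence "real (b (C * k)) / (1 + real (b (k * k))) \<le> 1" by (simp add: divide_le_eq_1 add_pos_nonneg)
      hence "(1/2)^k * (real (b (C * k)) / (1 + real (b (k * k)))) \<le> (1/2::real)^k * 1"
        by (intro mult_left_mono) auto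
      thus "norm (c k * real (b (C * k))) \<le> (1/2)^k" unfolding c_def by simp
    qed
    have "(\<integral>\<^sup>+A. f (x * (rmat A * g)) \<partial>count_space (SLZ n)) \<le> ennreal B" if g: "g \<in> SL n" for g
    proof -
      have "(\<integral>\<^sup>+A. f (x * (rmat A * g)) \<partial>count_space (SLZ n))
          = (\<Sum>k. \<integral>\<^sup>+A. ennreal (c k) * indicator (S k) (x * (rmat A * g)) \<partial>count_space (SLZ n))"
        unfolding f_def by (intro nn_integral_suminf) auto
      also have "\<dots> \<le> (\<Sum>k. ennreal (c k * real (b (C * k))))"
      proof (intro suminf_le summableI)
        fix k
        have "(\<integral>\<^sup>+A. ennreal (c k) * indicator (S k) (x * (rmat A * g)) \<partial>count_space (SLZ n))
          = ennreal (c k) * (\<integral>\<^sup>+A. indicator {y. x * y \<in> S k} (rmat A * g) \<partial>count_space (SLZ n))"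
          by (subst nn_integral_cmult[symmetric]) (auto simp: indicator_def)
        also have "\<dots> \<le> ennreal (c k) * of_nat (b (C * k))"
        proof (intro mult_left_mono emeasure_fibre_bounded[OF b(2) g])
          fix A assume A: "A \<in> SLZ n" "rmat A * g \<in> {y. x * y \<in> S k}"
          have Ag: "rmat A * g \<in> SL n" using SL_mult[OF rmat_SL[OF A(1)] g] .
          have "rmat A * g = adj_mat x * (x * (rmat A * g))"
            by (rule SL_cancel_left(1)[OF x SL_carrier[OF Ag], symmetric])
          also have "mat_norm \<dots> \<le> mat_norm (adj_mat x) * mat_norm (x * (rmat A * g))"
            using SL_carrier[OF SL_adj(1)[OF x]] SL_carrier[OF SL_mult[OF x Ag]] by (rule mat_norm_mult)
          also have "\<dots> \<le> real C * real k"
            using C A(2) by (intro mult_mono mat_norm_nonneg) (auto simp: S_def)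
          finally show "mat_norm (rmat A * g) \<le> real (C * k)" by simp
        qed auto
        also have "\<dots> = ennreal (c k * real (b (C * k)))"
          using c0[of k] by (simp add: ennreal_mult ennreal_of_nat_eq_real_of_nat)
        finally show "(\<integral>\<^sup>+A. ennreal (c k) * indicator (S k) (x * (rmat A * g)) \<partial>count_space (SLZ n)) \<le> \<dots>" .
      qed
      also have "\<dots> = ennreal B" unfolding B_def
        using c0 by (intro suminf_ennreal2 sm) (simp add: less_imp_le)
      finally show ?thesis .
    qed
    thus "\<exists>B. \<forall>g\<in>SL n. (\<integral>\<^sup>+A. f (x * (rmat A * g)) \<partial>count_space (SLZ n)) \<le> ennreal B" by blast
  qed
qed

lemma SLZ_one: "1\<^sub>m n \<in> SLZ n"
  by (simp add: SLZ_def)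

text \<open>Each fibre sum contains the positive term of the basis itself and is bounded uniformly;
  both facts survive integration because \<open>M\<close> is a probability.\<close>

lemma nn_integral_SL_lift_pos_finite:
  assumes M: "SL_invariant_prob n M" and f: "f \<in> borel_measurable (SL_borel n)"
    and pos: "\<And>x. x \<in> SL n \<Longrightarrow> 0 < f x"
    and bd: "\<And>g. g \<in> SL n \<Longrightarrow> (\<integral>\<^sup>+A. f (rmat A * g) \<partial>count_space (SLZ n)) \<le> ennreal B"
  shows "0 < (\<integral>\<^sup>+x. f x \<partial>SL_lift n M)" "(\<integral>\<^sup>+x. f x \<partial>SL_lift n M) < \<infinity>"
    "\<And>L. L \<in> space M \<Longrightarrow> 0 < (\<integral>\<^sup>+x. f x \<partial>fibre n L)"
    "\<And>L. L \<in> space M \<Longrightarrow> (\<integral>\<^sup>+x. f x \<partial>fibre n L) < \<infinity>"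
proof -
  note MD = SL_invariantD[OF M]
  interpret prob_space M by (rule MD(1))
  have b: "(\<integral>\<^sup>+x. f x \<partial>fibre n L) \<le> ennreal B" and p: "0 < (\<integral>\<^sup>+x. f x \<partial>fibre n L)" if L: "L \<in> space M" for L
  proof -
    obtain g where g: "g \<in> SL n" "L = row_lattice g" using L MD(3) by auto
    show "(\<integral>\<^sup>+x. f x \<partial>fibre n L) \<le> ennreal B"
      unfolding g(2) nn_integral_fibre[OF f g(1)] by (rule bd[OF g(1)])
    have "0 < f (rmat (1\<^sub>m n) * g)" by (intro pos SL_mult g rmat_SL SLZ_one)
    also have "\<dots> \<le> (\<integral>\<^sup>+A. f (rmat A * g) \<partial>count_space (SLZ n))"
      by (rule nn_integral_ge_point[OF SLZ_one])
    finally show "0 < (\<integral>\<^sup>+x. f x \<partial>fibre n L)" unfolding g(2) nn_integral_fibre[OF f g(1)] .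
  qed
  have m: "(\<lambda>L. \<integral>\<^sup>+x. f x \<partial>fibre n L) \<in> borel_measurable M"
    using measurable_nn_integral_fibre[OF f] MD(2) by (simp cong: measurable_cong_sets)
  show "\<And>L. L \<in> space M \<Longrightarrow> 0 < (\<integral>\<^sup>+x. f x \<partial>fibre n L)" by (rule p)
  show "\<And>L. L \<in> space M \<Longrightarrow> (\<integral>\<^sup>+x. f x \<partial>fibre n L) < \<infinity>"
    using le_less_trans[OF b ennreal_less_top] by simp
  have "(\<integral>\<^sup>+x. f x \<partial>SL_lift n M) \<le> (\<integral>\<^sup>+L. ennreal B \<partial>M)"
    unfolding nn_integral_SL_lift[OF MD(2) f] by (intro nn_integral_mono b)
  also have "\<dots> < \<infinity>" by (simp add: emeasure_space_1)
  finally show "(\<integral>\<^sup>+x. f x \<partial>SL_lift n M) < \<infinity>" .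
  have "\<not> (AE L in M. (\<integral>\<^sup>+x. f x \<partial>fibre n L) = 0)"
  proof
    assume "AE L in M. (\<integral>\<^sup>+x. f x \<partial>fibre n L) = 0"
    hence "AE L in M. False" by (rule AE_mp) (intro AE_I2, use p in force)
    thus False by (simp add: AE_False)
  qed
  hence "(\<integral>\<^sup>+L. \<integral>\<^sup>+x. f x \<partial>fibre n L \<partial>M) \<noteq> 0"
    using nn_integral_0_iff_AE[OF m] by simp
  thus "0 < (\<integral>\<^sup>+x. f x \<partial>SL_lift n M)"
    unfolding nn_integral_SL_lift[OF MD(2) f] by (simp add: zero_less_iff_neq_zero)
qed

lemma sigma_finite_SL_lift:
  assumes M: "SL_invariant_prob n M"
  shows "sigma_finite_measure (SL_lift n M)"
proof
  note MD = SL_invariantD[OF M]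
  interpret prob_space M by (rule MD(1))
  obtain b where b0: "mono b" "\<forall>k. \<forall>g\<in>SL n. finite {A \<in> SLZ n. mat_norm (rmat A * g) \<le> real k} \<and>
       card {A \<in> SLZ n. mat_norm (rmat A * g) \<le> real k} \<le> b k"
    using SLZ_orbit_bound[of n] by blast
  note b = b0(1) b0(2)[rule_format]
  define S where "S k = {x \<in> SL n. mat_norm x \<le> real k}" for k :: nat
  have S: "S k \<in> sets (SL_borel n)" for k
  proof -
    have "S k = mat_norm -` {..real k} \<inter> space (SL_borel n)" by (auto simp: S_def)
    also have "\<dots> \<in> sets (SL_borel n)" by (intro measurable_sets[OF measurable_mat_norm]) auto
    finally show ?thesis .
  qed
  show "\<exists>A. countable A \<and> A \<subseteq> sets (SL_lift n M) \<and> \<Union> A = space (SL_lift n M) \<and> (\<forall>a\<in>A. emeasure (SL_lift n M) a \<noteq> \<infinity>)"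
  proof (intro exI[of _ "range S"] conjI ballI)
    show "\<Union> (range S) = space (SL_lift n M)"
      using real_arch_simple by (auto simp: S_def)
    fix a assume "a \<in> range S"
    then obtain k where k: "a = S k" by auto
    have "emeasure (SL_lift n M) (S k) = (\<integral>\<^sup>+x. indicator (S k) x \<partial>SL_lift n M)" using S by simp
    also have "\<dots> = (\<integral>\<^sup>+L. \<integral>\<^sup>+x. indicator (S k) x \<partial>fibre n L \<partial>M)"
      using S by (intro nn_integral_SL_lift[OF MD(2)]) auto
    also have "\<dots> \<le> (\<integral>\<^sup>+L. of_nat (b k) \<partial>M)"
    proof (rule nn_integral_mono)
      fix L assume "L \<in> space M"
      then obtain g where g: "g \<in> SL n" "L = row_lattice g" using MD(3) by auto
      have ind: "indicator (S k) \<in> borel_measurable (SL_borel n)" using S by simp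
      show "(\<integral>\<^sup>+x. indicator (S k) x \<partial>fibre n L) \<le> of_nat (b k)"
        unfolding g(2) nn_integral_fibre[OF ind g(1)]
        by (rule emeasure_fibre_bounded[OF b(2) g(1)]) (auto simp: S_def)
    qed
    also have "\<dots> < \<infinity>" by (simp add: emeasure_space_1 ennreal_of_nat_eq_real_of_nat)
    finally show "emeasure (SL_lift n M) a \<noteq> \<infinity>" unfolding k by simp
  qed (use S in auto)
qed

text \<open>For suitable \<open>g\<close> the product identity writes the integral of any
  \<open>h\<close> over either lift as the integral of \<open>f\<close> over that lift times the
  same integral of \<open>g\<close>; so the two lifts are proportional. The lift is undone with a
  partition of unity along the fibres, and total mass 1 determines the factor.\<close>

theorem SL_invariant_prob_unique:
  assumes M1: "SL_invariant_prob n M1" and M2: "SL_invariant_prob n M2"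
  shows "M1 = M2"
proof (rule measure_eqI)
  note D1 = SL_invariantD[OF M1] and D2 = SL_invariantD[OF M2]
  show "sets M1 = sets M2" using D1(2) D2(2) by simp
  obtain f where f0: "f \<in> borel_measurable (SL_borel n)"
    "\<forall>x\<in>SL n. 0 < f x \<and> (\<exists>B. \<forall>g\<in>SL n. (\<integral>\<^sup>+A. f (x * (rmat A * g)) \<partial>count_space (SLZ n)) \<le> ennreal B)"
    using SL_weight_exists[of n] by blast
  have f: "f \<in> borel_measurable (SL_borel n)" "\<And>x. x \<in> SL n \<Longrightarrow> 0 < f x"
    "\<And>x. x \<in> SL n \<Longrightarrow> \<exists>B::real. \<forall>g\<in>SL n. (\<integral>\<^sup>+A. f (x * (rmat A * g)) \<partial>count_space (SLZ n)) \<le> ennreal B"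
    using f0 by auto
  let ?m1 = "SL_lift n M1" and ?m2 = "SL_lift n M2"
  define D where "D x = (\<integral>\<^sup>+y. f (x * y) \<partial>?m2)" for x
  have fx: "(\<lambda>y. f (x * y)) \<in> borel_measurable (SL_borel n)" if "x \<in> SL n" for x
    using that by (intro measurable_compose[OF _ f(1)] measurable_SL_mult) auto
  have D: "0 < D x" "D x < \<infinity>" if x: "x \<in> SL n" for x
  proof -
    obtain B where "\<forall>g\<in>SL n. (\<integral>\<^sup>+A. f (x * (rmat A * g)) \<partial>count_space (SLZ n)) \<le> ennreal B"
      using f(3)[OF x] by blast
    from nn_integral_SL_lift_pos_finite[OF M2 fx[OF x] _ bspec[OF this]]
    show "0 < D x" "D x < \<infinity>" unfolding D_def using f(2) SL_mult[OF x] by auto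
  qed
  obtain C where bd: "\<And>g. g \<in> SL n \<Longrightarrow> (\<integral>\<^sup>+A. f (rmat A * g) \<partial>count_space (SLZ n)) \<le> ennreal C"
  proof -
    obtain B where B: "\<forall>g\<in>SL n. (\<integral>\<^sup>+A. f (1\<^sub>m n * (rmat A * g)) \<partial>count_space (SLZ n)) \<le> ennreal B"
      using f(3)[OF SL_one] by blast
    have e: "(\<integral>\<^sup>+A. f (rmat A * g) \<partial>count_space (SLZ n)) = (\<integral>\<^sup>+A. f (1\<^sub>m n * (rmat A * g)) \<partial>count_space (SLZ n))"
      if "g \<in> SL n" for g
    proof (rule nn_integral_cong)
      fix A assume "A \<in> space (count_space (SLZ n))"
      hence "rmat A * g \<in> carrier_mat n n" using SL_carrier[OF that] by (auto simp: SLZ_def)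
      from left_mult_one_mat[OF this] show "f (rmat A * g) = f (1\<^sub>m n * (rmat A * g))" by (rule arg_cong[OF sym])
    qed
    show ?thesis
    proof (rule that)
      fix g assume "g \<in> SL n"
      thus "(\<integral>\<^sup>+A. f (rmat A * g) \<partial>count_space (SLZ n)) \<le> ennreal B"
        unfolding e[OF \<open>g \<in> SL n\<close>] using B by blast
    qed
  qed
  note F1 = nn_integral_SL_lift_pos_finite[OF M1 f(1,2) bd]
  interpret m2: sigma_finite_measure ?m2 by (rule sigma_finite_SL_lift[OF M2])
  have Dm: "D \<in> borel_measurable (SL_borel n)"
  proof -
    have "(\<lambda>(x,y). f (x * y)) \<in> borel_measurable (SL_borel n \<Otimes>\<^sub>M ?m2)"
      unfolding case_prod_beta
      by (intro measurable_compose[OF _ f(1)] measurable_SL_mult measurable_fst)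
         (simp cong: measurable_cong_sets)
    thus ?thesis unfolding D_def by (rule m2.borel_measurable_nn_integral)
  qed
  have key: "(\<integral>\<^sup>+x. h x \<partial>?m1) * (\<integral>\<^sup>+x. f x \<partial>?m2) = (\<integral>\<^sup>+x. h x \<partial>?m2) * (\<integral>\<^sup>+x. f x \<partial>?m1)"
    if h: "h \<in> borel_measurable (SL_borel n)" for h
  proof -
    \<comment> \<open>Chosen so that the inner integral \<open>D\<close> in the product identity
      cancels and leaves \<open>h\<close>.\<close>
    define g where "g x = h (adj_mat x) / D (adj_mat x)" for x
    have g: "g \<in> borel_measurable (SL_borel n)"
      unfolding g_def by (intro borel_measurable_divide_ennreal measurable_compose[OF measurable_SL_adj] h Dm)
    have adj_adj: "adj_mat (adj_mat y) = y" if y: "y \<in> SL n" for y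
    proof -
      have "adj_mat (adj_mat y) = adj_mat (adj_mat y) * (adj_mat y * y)"
        unfolding SL_adj(3)[OF y]
        by (rule right_mult_one_mat[symmetric], rule SL_carrier, rule SL_adj(1)[OF SL_adj(1)[OF y]])
      also have "\<dots> = y" using SL_cancel_left(1)[OF SL_adj(1)[OF y] SL_carrier[OF y]] .
      finally show ?thesis .
    qed
    have hh: "g (adj_mat x) * D x = h x" if x: "x \<in> SL n" for x
      unfolding g_def adj_adj[OF x] using D[OF x]
      using ennreal_mult_divide_eq[of "D x" "h x"] by (simp add: ennreal_times_divide mult.commute)
    have "(\<integral>\<^sup>+x. f x \<partial>?m1) * (\<integral>\<^sup>+x. g x \<partial>?m2) = (\<integral>\<^sup>+x. g (adj_mat x) * (\<integral>\<^sup>+y. f (x * y) \<partial>?m2) \<partial>?m1)"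
      by (rule right_invariant_product[where n=n]) (simp_all add: sigma_finite_SL_lift M1 M2 SL_lift_right_invariant f(1) g)
    also have "\<dots> = (\<integral>\<^sup>+x. h x \<partial>?m1)" by (intro nn_integral_cong) (simp add: hh D_def[symmetric])
    finally have e1: "(\<integral>\<^sup>+x. h x \<partial>?m1) = (\<integral>\<^sup>+x. f x \<partial>?m1) * (\<integral>\<^sup>+x. g x \<partial>?m2)" ..
    have "(\<integral>\<^sup>+x. f x \<partial>?m2) * (\<integral>\<^sup>+x. g x \<partial>?m2) = (\<integral>\<^sup>+x. g (adj_mat x) * (\<integral>\<^sup>+y. f (x * y) \<partial>?m2) \<partial>?m2)"
      by (rule right_invariant_product[where n=n]) (simp_all add: sigma_finite_SL_lift M1 M2 SL_lift_right_invariant f(1) g)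
    also have "\<dots> = (\<integral>\<^sup>+x. h x \<partial>?m2)" by (intro nn_integral_cong) (simp add: hh D_def[symmetric])
    finally have e2: "(\<integral>\<^sup>+x. h x \<partial>?m2) = (\<integral>\<^sup>+x. f x \<partial>?m2) * (\<integral>\<^sup>+x. g x \<partial>?m2)" ..
    show ?thesis unfolding e1 e2 by (simp only: mult_ac)
  qed
  \<comment> \<open>Dividing \<open>f\<close> by its fibre sum gives a function whose sum over the
    bases of every lattice is 1; integrating it against a lift recovers the measure on
    lattices.\<close>
  define F where "F L = (\<integral>\<^sup>+x. f x \<partial>fibre n L)" for L
  have Fm: "F \<in> borel_measurable (lattice_space n)"
    unfolding F_def by (rule measurable_nn_integral_fibre[OF f(1)])
  have meas: "(\<integral>\<^sup>+x. f x / F (row_lattice x) * indicator B (row_lattice x) \<partial>SL_lift n M) = emeasure M B"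
    and hm: "(\<lambda>x. f x / F (row_lattice x) * indicator B (row_lattice x)) \<in> borel_measurable (SL_borel n)"
    if M: "SL_invariant_prob n M" and B: "B \<in> sets (lattice_space n)" for M B
  proof -
    note MD = SL_invariantD[OF M]
    show hm: "(\<lambda>x. f x / F (row_lattice x) * indicator B (row_lattice x)) \<in> borel_measurable (SL_borel n)"
      using B by (intro borel_measurable_times_ennreal borel_measurable_divide_ennreal f(1)
          measurable_compose[OF measurable_row_lattice] Fm) auto
    have "(\<integral>\<^sup>+x. f x / F (row_lattice x) * indicator B (row_lattice x) \<partial>SL_lift n M)
        = (\<integral>\<^sup>+L. \<integral>\<^sup>+x. f x / F (row_lattice x) * indicator B (row_lattice x) \<partial>fibre n L \<partial>M)"
      by (rule nn_integral_SL_lift[OF MD(2) hm])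
    also have "\<dots> = (\<integral>\<^sup>+L. indicator B L \<partial>M)"
    proof (rule nn_integral_cong)
      fix L assume L: "L \<in> space M"
      obtain g where g: "g \<in> SL n" "L = row_lattice g" using L MD(3) by auto
      have FL: "0 < F L" "F L < \<infinity>"
        using nn_integral_SL_lift_pos_finite(3,4)[OF M f(1,2) bd L] unfolding F_def by auto
      have "(\<integral>\<^sup>+x. f x / F (row_lattice x) * indicator B (row_lattice x) \<partial>fibre n L)
          = (\<integral>\<^sup>+A. f (rmat A * g) * (indicator B L / F L) \<partial>count_space (SLZ n))"
        unfolding g(2) nn_integral_fibre[OF hm g(1)]
        by (intro nn_integral_cong) (simp add: row_lattice_SLZ[OF g(1)] ennreal_times_divide mult.commute)
      also have "\<dots> = F L * (indicator B L / F L)"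
        unfolding g(2) F_def nn_integral_fibre[OF f(1) g(1)] by (rule nn_integral_multc) auto
      also have "\<dots> = indicator B L"
        using FL ennreal_mult_divide_eq[of "F L" "indicator B L"] by (simp add: ennreal_times_divide mult.commute)
      finally show "(\<integral>\<^sup>+x. f x / F (row_lattice x) * indicator B (row_lattice x) \<partial>fibre n L) = indicator B L" .
    qed
    also have "\<dots> = emeasure M B" using B MD(2) by simp
    finally show "(\<integral>\<^sup>+x. f x / F (row_lattice x) * indicator B (row_lattice x) \<partial>SL_lift n M) = emeasure M B" .
  qed
  have mult_eq: "emeasure M1 B * (\<integral>\<^sup>+x. f x \<partial>?m2) = emeasure M2 B * (\<integral>\<^sup>+x. f x \<partial>?m1)"
    if B: "B \<in> sets (lattice_space n)" for B
    using key[OF hm[OF M1 B]] unfolding meas[OF M1 B] meas[OF M2 B] .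
  have "emeasure M1 (space (lattice_space n)) = 1" "emeasure M2 (space (lattice_space n)) = 1"
    using prob_space.emeasure_space_1[OF D1(1)] prob_space.emeasure_space_1[OF D2(1)] D1(3) D2(3) by auto
  hence c: "(\<integral>\<^sup>+x. f x \<partial>?m2) = (\<integral>\<^sup>+x. f x \<partial>?m1)" using mult_eq[OF sets.top] by simp
  fix A assume "A \<in> sets M1"
  hence "A \<in> sets (lattice_space n)" using D1(2) by simp
  from mult_eq[OF this] have e: "emeasure M1 A * (\<integral>\<^sup>+x. f x \<partial>?m1) = emeasure M2 A * (\<integral>\<^sup>+x. f x \<partial>?m1)" unfolding c .
  have "emeasure M1 A * (\<integral>\<^sup>+x. f x \<partial>?m1) / (\<integral>\<^sup>+x. f x \<partial>?m1) = emeasure M1 A"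
    "emeasure M2 A * (\<integral>\<^sup>+x. f x \<partial>?m1) / (\<integral>\<^sup>+x. f x \<partial>?m1) = emeasure M2 A"
    using F1(1,2) by (auto intro!: ennreal_mult_divide_eq)
  thus "emeasure M1 A = emeasure M2 A" unfolding e by simp
qed

section \<open>Hecke neighbours of prime index\<close>

definition residue_vecs :: "nat \<Rightarrow> nat \<Rightarrow> int vec set" where
  "residue_vecs n p = {a \<in> carrier_vec n. \<forall>i<n. a $ i \<in> {0..<int p}}"

text \<open>Labels are nonzero vectors modulo p and not lines, so for prime p each sublattice occurs
  p - 1 times. Averages are the same, and counting labels is simpler.\<close>

definition hecke_labels :: "nat \<Rightarrow> nat \<Rightarrow> int vec set" where
  "hecke_labels n p = residue_vecs n p - {0\<^sub>v n}"

definition hecke_scale :: "nat \<Rightarrow> nat \<Rightarrow> real" where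
  "hecke_scale n p = real p powr (- 1 / real n)"

text \<open>For prime p and a nonzero label the congruence cuts out a sublattice of index p; the
  factor \<open>hecke_scale n p\<close> restores covolume 1.\<close>

definition hecke_nbr :: "nat \<Rightarrow> nat \<Rightarrow> real mat \<Rightarrow> int vec \<Rightarrow> real vec set" where
  "hecke_nbr n p g a = (\<lambda>z. hecke_scale n p \<cdot>\<^sub>v (transpose_mat g *\<^sub>v map_vec real_of_int z)) `
     {z \<in> carrier_vec n. int p dvd scalar_prod a z}"

lemma finite_residue_vecs: "finite (residue_vecs n p)" and card_residue_vecs: "card (residue_vecs n p) = p ^ n"
proof -
  have bij: "bij_betw (\<lambda>f. vec n f) ({..<n} \<rightarrow>\<^sub>E {0..<int p}) (residue_vecs n p)"
    unfolding bij_betw_def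
  proof
    show "inj_on (\<lambda>f. vec n f) ({..<n} \<rightarrow>\<^sub>E {0..<int p})"
    proof (rule inj_onI)
      fix f g assume f: "f \<in> {..<n} \<rightarrow>\<^sub>E {0..<int p}" and g: "g \<in> {..<n} \<rightarrow>\<^sub>E {0..<int p}" and e: "vec n f = vec n g"
      have "f i = g i" if "i < n" for i using arg_cong[OF e, of "\<lambda>v. v $ i"] that by simp
      thus "f = g" using PiE_ext[OF f g] by blast
    qed
    show "(\<lambda>f. vec n f) ` ({..<n} \<rightarrow>\<^sub>E {0..<int p}) = residue_vecs n p"
    proof (intro equalityI subsetI)
      fix a assume a: "a \<in> residue_vecs n p"
      hence "a = vec n (restrict (\<lambda>i. a $ i) {..<n})" by (intro eq_vecI) (auto simp: residue_vecs_def)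
      moreover have "restrict (\<lambda>i. a $ i) {..<n} \<in> {..<n} \<rightarrow>\<^sub>E {0..<int p}" using a by (auto simp: residue_vecs_def)
      ultimately show "a \<in> (\<lambda>f. vec n f) ` ({..<n} \<rightarrow>\<^sub>E {0..<int p})" by blast
    next
      fix a assume "a \<in> (\<lambda>f. vec n f) ` ({..<n} \<rightarrow>\<^sub>E {0..<int p})"
      then obtain f where f: "f \<in> {..<n} \<rightarrow>\<^sub>E {0..<int p}" "a = vec n f" by blast
      have "f i \<in> {0..<int p}" if "i < n" for i using PiE_mem[OF f(1)] that by simp
      thus "a \<in> residue_vecs n p" unfolding f(2) residue_vecs_def by simp
    qed
  qed
  show "finite (residue_vecs n p)" using bij_betw_finite[OF bij] by (simp add: finite_PiE)
  show "card (residue_vecs n p) = p ^ n" using bij_betw_same_card[OF bij] by (simp add: card_PiE)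
qed

lemma zero_residue_vecs: "0 < p \<Longrightarrow> 0\<^sub>v n \<in> residue_vecs n p"
  by (auto simp: residue_vecs_def)

lemma finite_hecke_labels: "finite (hecke_labels n p)"
  by (simp add: hecke_labels_def finite_residue_vecs)

lemma card_hecke_labels: "0 < p \<Longrightarrow> card (hecke_labels n p) = p ^ n - 1"
  unfolding hecke_labels_def using zero_residue_vecs[of p n] finite_residue_vecs[of n p] card_residue_vecs[of n p] by simp

lemma card_hecke_labels_pos: "1 < p \<Longrightarrow> 0 < n \<Longrightarrow> 0 < card (hecke_labels n p)"
  using one_less_power[of p n] by (simp add: card_hecke_labels)

lemma int_scalar_prod_sum:
  "z \<in> carrier_vec n \<Longrightarrow> scalar_prod a z = (\<Sum>i<n. a $ i * z $ i)"
  by (auto simp: scalar_prod_def atLeast0LessThan)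

lemma hecke_scale_power:
  assumes "0 < p" "0 < n"
  shows "hecke_scale n p ^ n = 1 / real p" "0 < hecke_scale n p"
proof -
  show "0 < hecke_scale n p" using assms by (simp add: hecke_scale_def)
  have "hecke_scale n p ^ n = (real p powr (- 1 / real n)) powr real n"
    unfolding hecke_scale_def using assms by (subst powr_realpow) auto
  also have "\<dots> = real p powr (- 1)" using assms by (simp add: powr_powr)
  finally show "hecke_scale n p ^ n = 1 / real p" using assms by (simp add: powr_minus_divide)
qed

text \<open>A basis of the index \<open>p\<close> sublattice \<open>{z. p dvd a \<bullet> z}\<close> of the integer lattice.\<close>

lemma hecke_basis:
  assumes p: "prime p" and a: "a \<in> hecke_labels n p"
  shows "\<exists>A\<in>carrier_mat n n. det A = int p \<and>
    (\<lambda>z. transpose_mat A *\<^sub>v z) ` carrier_vec n = {z \<in> carrier_vec n. int p dvd scalar_prod a z}"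
proof -
  have ac: "a \<in> carrier_vec n" and ar: "\<And>i. i < n \<Longrightarrow> 0 \<le> a $ i \<and> a $ i < int p" and a0: "a \<noteq> 0\<^sub>v n"
    using a by (auto simp: hecke_labels_def residue_vecs_def)
  obtain i where i: "i < n" "a $ i \<noteq> 0"
  proof (rule ccontr)
    assume "\<not> thesis"
    hence "\<forall>i<n. a $ i = 0" using that by blast
    hence "a = 0\<^sub>v n" using ac by (intro eq_vecI) auto
    thus False using a0 by simp
  qed
  have "\<not> int p dvd a $ i" using ar[OF i(1)] i(2) zdvd_not_zless by force
  hence "coprime (a $ i) (int p)" using p prime_imp_coprime[of "int p" "a $ i"] by (simp add: coprime_commute)
  then obtain u where u: "[a $ i * u = 1] (mod int p)" using cong_solve_coprime_int by blast
  \<comment> \<open>With \<open>u\<close> inverse to the i-th entry of \<open>a\<close> modulo p,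
    the rows are p e_i and e_j - u a_j e_i for j other than i. Each has scalar product with
    \<open>a\<close> divisible by p, and the determinant is visibly p.\<close>
  define A where "A = mat n n (\<lambda>(j,k). if j = i then (if k = i then int p else 0)
     else if k = j then 1 else if k = i then - (u * a $ j) else 0)"
  have A: "A \<in> carrier_mat n n" by (simp add: A_def)
  have det: "det A = int p"
  proof -
    have md: "mat_delete A i i = 1\<^sub>m (n-1)"
      using i(1) by (intro eq_matI) (auto simp: mat_delete_def A_def)
    have "det A = (\<Sum>k<n. A $$ (i,k) * cofactor A i k)" by (rule laplace_expansion_row[OF A i(1)])
    also have "\<dots> = (\<Sum>k<n. if k = i then int p * cofactor A i i else 0)"
      using i(1) by (intro sum.cong) (auto simp: A_def)
    also have "\<dots> = int p * cofactor A i i" using i(1) by simp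
    also have "cofactor A i i = 1" unfolding cofactor_def md by simp
    finally show ?thesis by simp
  qed
  have AT: "(transpose_mat A *\<^sub>v z) $ k = (if k = i then int p * z $ i - (\<Sum>j\<in>{..<n}-{i}. u * a $ j * z $ j) else z $ k)"
    if z: "z \<in> carrier_vec n" and k: "k < n" for z k
  proof -
    have "(transpose_mat A *\<^sub>v z) $ k = (\<Sum>j<n. A $$ (j,k) * z $ j)"
      using A z k unfolding scalar_prod_def atLeast0LessThan[symmetric] by (auto simp: scalar_prod_def intro!: sum.cong)
    also have "\<dots> = A $$ (i,k) * z $ i + (\<Sum>j\<in>{..<n}-{i}. A $$ (j,k) * z $ j)"
      using i by (intro sum.remove) auto
    also have "\<dots> = (if k = i then int p * z $ i - (\<Sum>j\<in>{..<n}-{i}. u * a $ j * z $ j) else z $ k)"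
    proof (cases "k = i")
      case True
      have "(\<Sum>j\<in>{..<n}-{i}. A $$ (j,k) * z $ j) = (\<Sum>j\<in>{..<n}-{i}. - (u * a $ j * z $ j))"
        using True i by (intro sum.cong) (auto simp: A_def)
      thus ?thesis using True i by (simp add: A_def sum_negf)
    next
      case False
      have "(\<Sum>j\<in>{..<n}-{i}. A $$ (j,k) * z $ j) = (\<Sum>j\<in>{..<n}-{i}. if j = k then z $ k else 0)"
        using False i k by (intro sum.cong) (auto simp: A_def)
      thus ?thesis using False i k by (simp add: A_def)
    qed
    finally show ?thesis .
  qed
  have "(\<lambda>z. transpose_mat A *\<^sub>v z) ` carrier_vec n = {z \<in> carrier_vec n. int p dvd scalar_prod a z}"
  proof (intro equalityI subsetI)
    fix w assume "w \<in> (\<lambda>z. transpose_mat A *\<^sub>v z) ` carrier_vec n"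
    then obtain z where z: "z \<in> carrier_vec n" "w = transpose_mat A *\<^sub>v z" by auto
    have w: "w \<in> carrier_vec n" using z A by auto
    let ?S = "\<Sum>j\<in>{..<n}-{i}. a $ j * z $ j"
    have "scalar_prod a w = a $ i * w $ i + (\<Sum>j\<in>{..<n}-{i}. a $ j * w $ j)"
      unfolding int_scalar_prod_sum[OF w] using i by (intro sum.remove) auto
    also have "(\<Sum>j\<in>{..<n}-{i}. a $ j * w $ j) = ?S"
      using AT[OF z(1)] z(2) by (intro sum.cong) auto
    also have "w $ i = int p * z $ i - u * ?S"
      using AT[OF z(1) i(1)] z(2) by (simp add: sum_distrib_left mult.assoc)
    finally have e: "scalar_prod a w = int p * (a $ i * z $ i) + (1 - a $ i * u) * ?S" by (simp add: algebra_simps)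
    have "int p dvd 1 - a $ i * u" using cong_sym[OF u] by (simp add: cong_iff_dvd_diff)
    hence "int p dvd scalar_prod a w" unfolding e by (intro dvd_add dvd_triv_left dvd_mult2)
    thus "w \<in> {z \<in> carrier_vec n. int p dvd scalar_prod a z}" using w by simp
  next
    fix w assume w': "w \<in> {z \<in> carrier_vec n. int p dvd scalar_prod a z}"
    hence w: "w \<in> carrier_vec n" and d: "int p dvd scalar_prod a w" by auto
    let ?S = "\<Sum>j\<in>{..<n}-{i}. a $ j * w $ j"
    have "scalar_prod a w = a $ i * w $ i + ?S"
      unfolding int_scalar_prod_sum[OF w] using i by (intro sum.remove) auto
    hence "int p dvd u * (a $ i * w $ i + ?S)" using d by simp
    moreover have "int p dvd (1 - a $ i * u) * w $ i" using cong_sym[OF u] by (simp add: cong_iff_dvd_diff)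
    ultimately have "int p dvd u * (a $ i * w $ i + ?S) + (1 - a $ i * u) * w $ i" by (rule dvd_add)
    hence "int p dvd w $ i + u * ?S" by (simp add: algebra_simps)
    then obtain t where t: "w $ i + u * ?S = int p * t" by (auto elim: dvdE)
    define z where "z = vec n (\<lambda>k. if k = i then t else w $ k)"
    have z: "z \<in> carrier_vec n" by (simp add: z_def)
    have "w = transpose_mat A *\<^sub>v z"
    proof (rule eq_vecI)
      fix k assume "k < dim_vec (transpose_mat A *\<^sub>v z)"
      hence k: "k < n" using A by simp
      have "(\<Sum>j\<in>{..<n}-{i}. u * a $ j * z $ j) = u * ?S"
        unfolding sum_distrib_left by (intro sum.cong) (auto simp: z_def)
      thus "w $ k = (transpose_mat A *\<^sub>v z) $ k"
        using AT[OF z k] t k by (auto simp: z_def)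
    qed (use w A in auto)
    thus "w \<in> (\<lambda>z. transpose_mat A *\<^sub>v z) ` carrier_vec n" using z by blast
  qed
  thus ?thesis using A det by blast
qed

text \<open>The matrix depends on the label but not on \<open>g\<close>. It multiplies on the left,
  so forming neighbours commutes with right translations; this yields both measurability and the
  invariance of the averaged measure.\<close>

lemma hecke_matrix:
  assumes p: "prime p" and a: "a \<in> hecke_labels n p" and n: "0 < n"
  shows "\<exists>\<beta>\<in>SL n. \<forall>g\<in>SL n. hecke_nbr n p g a = row_lattice (\<beta> * g)"
proof -
  obtain A where A: "A \<in> carrier_mat n n" "det A = int p"
    "(\<lambda>z. transpose_mat A *\<^sub>v z) ` carrier_vec n = {z \<in> carrier_vec n. int p dvd scalar_prod a z}"
    using hecke_basis[OF p a] by blast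
  let ?s = "hecke_scale n p"
  let ?\<beta> = "?s \<cdot>\<^sub>m rmat A"
  have p0: "0 < p" using p prime_gt_0_nat by blast
  have \<beta>: "?\<beta> \<in> SL n"
    using A hecke_scale_power(1)[OF p0 n] p0 by (auto simp: SL_def rmat_det)
  have "hecke_nbr n p g a = row_lattice (?\<beta> * g)" if g: "g \<in> SL n" for g
  proof -
    have gc: "g \<in> carrier_mat n n" using SL_carrier[OF g] .
    have "?s \<cdot>\<^sub>v (transpose_mat g *\<^sub>v map_vec real_of_int (transpose_mat A *\<^sub>v z))
        = transpose_mat (?\<beta> * g) *\<^sub>v map_vec real_of_int z" if z: "z \<in> carrier_vec n" for z
    proof -
      have zr: "map_vec real_of_int z \<in> carrier_vec n" using z by simp
      have "map_vec real_of_int (transpose_mat A *\<^sub>v z) = rmat (transpose_mat A) *\<^sub>v map_vec real_of_int z"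
        using A z by (intro map_vec_mult_mat) auto
      also have "rmat (transpose_mat A) = transpose_mat (rmat A)" by (rule eq_matI) auto
      finally have 1: "map_vec real_of_int (transpose_mat A *\<^sub>v z) = transpose_mat (rmat A) *\<^sub>v map_vec real_of_int z" .
      have "transpose_mat (?\<beta> * g) *\<^sub>v map_vec real_of_int z = (transpose_mat g * transpose_mat ?\<beta>) *\<^sub>v map_vec real_of_int z"
        using transpose_mult[of ?\<beta> n n g n] A gc by simp
      also have "\<dots> = transpose_mat g *\<^sub>v (transpose_mat ?\<beta> *\<^sub>v map_vec real_of_int z)"
        using A gc zr by (intro assoc_mult_mat_vec) auto
      also have "transpose_mat ?\<beta> = ?s \<cdot>\<^sub>m transpose_mat (rmat A)" by (rule eq_matI) auto
      also have "(?s \<cdot>\<^sub>m transpose_mat (rmat A)) *\<^sub>v map_vec real_of_int z = ?s \<cdot>\<^sub>v (transpose_mat (rmat A) *\<^sub>v map_vec real_of_int z)"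
        using A zr by (intro eq_vecI) (auto simp: scalar_prod_def sum_distrib_left mult.assoc intro!: sum.cong)
      also have "transpose_mat g *\<^sub>v \<dots> = ?s \<cdot>\<^sub>v (transpose_mat g *\<^sub>v (transpose_mat (rmat A) *\<^sub>v map_vec real_of_int z))"
        using A zr gc by (intro mult_mat_vec) auto
      finally show ?thesis unfolding 1 ..
    qed
    thus ?thesis
      unfolding hecke_nbr_def A(3)[symmetric] row_lattice_SL[OF SL_mult[OF \<beta> g]] image_image
      by (intro image_cong) auto
  qed
  thus ?thesis using \<beta> by blast
qed

definition vec_mod :: "nat \<Rightarrow> int vec \<Rightarrow> int vec" where
  "vec_mod p v = map_vec (\<lambda>x. x mod int p) v"

lemma vec_mod_residue: "0 < p \<Longrightarrow> v \<in> carrier_vec n \<Longrightarrow> vec_mod p v \<in> residue_vecs n p"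
  by (auto simp: vec_mod_def residue_vecs_def)

lemma vec_mod_id: "a \<in> residue_vecs n p \<Longrightarrow> vec_mod p a = a"
  by (intro eq_vecI) (auto simp: vec_mod_def residue_vecs_def)

lemma vec_mod_mult:
  assumes "A \<in> carrier_mat n n" "v \<in> carrier_vec n"
  shows "vec_mod p (A *\<^sub>v vec_mod p v) = vec_mod p (A *\<^sub>v v)"
proof (rule eq_vecI)
  fix i assume "i < dim_vec (vec_mod p (A *\<^sub>v v))"
  hence i: "i < n" using assms by (simp add: vec_mod_def)
  have 1: "(A *\<^sub>v w) $ i = (\<Sum>j<n. A $$ (i,j) * w $ j)" if "w \<in> carrier_vec n" for w
    using assms i that by (auto simp: scalar_prod_def atLeast0LessThan intro!: sum.cong)
  have v': "vec_mod p v \<in> carrier_vec n" using assms by (simp add: vec_mod_def)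
  have "(A *\<^sub>v vec_mod p v) $ i mod int p = (\<Sum>j<n. (A $$ (i,j) * (v $ j mod int p)) mod int p) mod int p"
    unfolding 1[OF v'] mod_sum_eq using assms by (auto simp: vec_mod_def intro!: arg_cong[of _ _ "\<lambda>x. x mod int p"] sum.cong)
  also have "\<dots> = (\<Sum>j<n. (A $$ (i,j) * v $ j) mod int p) mod int p"
    by (simp add: mod_mult_right_eq)
  also have "\<dots> = (A *\<^sub>v v) $ i mod int p" unfolding 1[OF assms(2)] mod_sum_eq ..
  finally show "vec_mod p (A *\<^sub>v vec_mod p v) $ i = vec_mod p (A *\<^sub>v v) $ i"
    using assms i by (simp add: vec_mod_def)
qed (use assms in \<open>auto simp: vec_mod_def\<close>)

lemma dvd_scalar_prod_vec_mod:
  assumes "v \<in> carrier_vec n" "z \<in> carrier_vec n"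
  shows "int p dvd scalar_prod (vec_mod p v) z \<longleftrightarrow> int p dvd scalar_prod v z"
proof -
  have "scalar_prod (vec_mod p v) z mod int p = (\<Sum>i<n. ((v $ i mod int p) * z $ i) mod int p) mod int p"
    unfolding int_scalar_prod_sum[OF assms(2)] mod_sum_eq using assms
    by (auto simp: vec_mod_def intro!: arg_cong[of _ _ "\<lambda>x. x mod int p"] sum.cong)
  also have "\<dots> = (\<Sum>i<n. (v $ i * z $ i) mod int p) mod int p" by (simp add: mod_mult_left_eq)
  also have "\<dots> = scalar_prod v z mod int p"
    unfolding int_scalar_prod_sum[OF assms(2)] mod_sum_eq ..
  finally show ?thesis by (simp add: dvd_eq_mod_eq_0)
qed

lemma hecke_nbr_SLZ:
  assumes "0 < p" "g \<in> SL n" "A \<in> SLZ n" "a \<in> residue_vecs n p"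
  shows "hecke_nbr n p (rmat A * g) a = hecke_nbr n p g (vec_mod p (adj_mat A *\<^sub>v a))"
proof -
  have A: "A \<in> carrier_mat n n" "det A = 1" using assms by (auto simp: SLZ_def)
  note B = adj_mat_inverse[OF A]
  have gc: "g \<in> carrier_mat n n" and ac: "a \<in> carrier_vec n"
    using SL_carrier[OF assms(2)] assms(4) by (auto simp: residue_vecs_def)
  have 1: "transpose_mat (rmat A * g) *\<^sub>v map_vec real_of_int z = transpose_mat g *\<^sub>v map_vec real_of_int (transpose_mat A *\<^sub>v z)"
    if z: "z \<in> carrier_vec n" for z
  proof -
    have "transpose_mat (rmat A * g) *\<^sub>v map_vec real_of_int z = (transpose_mat g * transpose_mat (rmat A)) *\<^sub>v map_vec real_of_int z"
      using transpose_mult[of "rmat A" n n g n] A gc by simp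
    also have "\<dots> = transpose_mat g *\<^sub>v (transpose_mat (rmat A) *\<^sub>v map_vec real_of_int z)"
      using A gc z by (intro assoc_mult_mat_vec) auto
    also have "transpose_mat (rmat A) = rmat (transpose_mat A)" by (rule eq_matI) auto
    also have "rmat (transpose_mat A) *\<^sub>v map_vec real_of_int z = map_vec real_of_int (transpose_mat A *\<^sub>v z)"
      using A z by (intro map_vec_mult_mat[symmetric]) auto
    finally show ?thesis .
  qed
  have 2: "transpose_mat (adj_mat A) *\<^sub>v (transpose_mat A *\<^sub>v z) = z" "transpose_mat A *\<^sub>v (transpose_mat (adj_mat A) *\<^sub>v z) = z"
    if z: "z \<in> carrier_vec n" for z
  proof -
    have t: "transpose_mat (adj_mat A) * transpose_mat A = 1\<^sub>m n" "transpose_mat A * transpose_mat (adj_mat A) = 1\<^sub>m n"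
      unfolding transpose_mult[OF A(1) B(1), symmetric] transpose_mult[OF B(1) A(1), symmetric] B(2,3) by simp_all
    have "transpose_mat (adj_mat A) *\<^sub>v (transpose_mat A *\<^sub>v z) = (transpose_mat (adj_mat A) * transpose_mat A) *\<^sub>v z"
      using A B z by (intro assoc_mult_mat_vec[symmetric]) auto
    thus "transpose_mat (adj_mat A) *\<^sub>v (transpose_mat A *\<^sub>v z) = z" using t z by simp
    have "transpose_mat A *\<^sub>v (transpose_mat (adj_mat A) *\<^sub>v z) = (transpose_mat A * transpose_mat (adj_mat A)) *\<^sub>v z"
      using A B z by (intro assoc_mult_mat_vec[symmetric]) auto
    thus "transpose_mat A *\<^sub>v (transpose_mat (adj_mat A) *\<^sub>v z) = z" using t z by simp
  qed
  have 3: "int p dvd scalar_prod (vec_mod p (adj_mat A *\<^sub>v a)) w \<longleftrightarrow> int p dvd scalar_prod a (transpose_mat (adj_mat A) *\<^sub>v w)"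
    if w: "w \<in> carrier_vec n" for w
  proof -
    have "scalar_prod (adj_mat A *\<^sub>v a) w = scalar_prod a (transpose_mat (adj_mat A) *\<^sub>v w)"
      using transpose_vec_mult_scalar[of "transpose_mat (adj_mat A)" n n w a] B(1) w ac by simp
    thus ?thesis using dvd_scalar_prod_vec_mod[of "adj_mat A *\<^sub>v a" n w p] B(1) ac w by simp
  qed
  have im: "(\<lambda>z. transpose_mat A *\<^sub>v z) ` {z \<in> carrier_vec n. int p dvd scalar_prod a z}
      = {w \<in> carrier_vec n. int p dvd scalar_prod (vec_mod p (adj_mat A *\<^sub>v a)) w}"
  proof (intro equalityI subsetI)
    fix w assume "w \<in> {w \<in> carrier_vec n. int p dvd scalar_prod (vec_mod p (adj_mat A *\<^sub>v a)) w}"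
    hence w: "w \<in> carrier_vec n" "int p dvd scalar_prod a (transpose_mat (adj_mat A) *\<^sub>v w)" using 3 by auto
    have "transpose_mat (adj_mat A) *\<^sub>v w \<in> carrier_vec n" using B(1) w by auto
    thus "w \<in> (\<lambda>z. transpose_mat A *\<^sub>v z) ` {z \<in> carrier_vec n. int p dvd scalar_prod a z}"
      using 2(2)[OF w(1)] w(2) by (intro image_eqI[of _ _ "transpose_mat (adj_mat A) *\<^sub>v w"]) auto
  next
    fix w assume "w \<in> (\<lambda>z. transpose_mat A *\<^sub>v z) ` {z \<in> carrier_vec n. int p dvd scalar_prod a z}"
    then obtain z where z: "z \<in> carrier_vec n" "int p dvd scalar_prod a z" "w = transpose_mat A *\<^sub>v z" by auto
    have w: "w \<in> carrier_vec n" using z A by auto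
    show "w \<in> {w \<in> carrier_vec n. int p dvd scalar_prod (vec_mod p (adj_mat A *\<^sub>v a)) w}"
      using w 3[OF w] 2(1)[OF z(1)] z by simp
  qed
  show ?thesis
    unfolding hecke_nbr_def im[symmetric] image_image by (intro image_cong) (simp_all add: 1)
qed

text \<open>A change of basis permutes the labels, by \<open>adj_mat A\<close> acting modulo p. So
  the sum over all labels depends only on the lattice, although a single neighbour depends on the
  basis.\<close>

lemma sum_hecke_nbr_SLZ:
  assumes p: "0 < p" and g: "g \<in> SL n" and A: "A \<in> SLZ n"
  shows "(\<Sum>a\<in>hecke_labels n p. F (hecke_nbr n p (rmat A * g) a)) = (\<Sum>a\<in>hecke_labels n p. F (hecke_nbr n p g a) :: ennreal)"
proof -
  have A': "A \<in> carrier_mat n n" "det A = 1" using A by (auto simp: SLZ_def)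
  note B = adj_mat_inverse[OF A']
  have cancel: "vec_mod p (C *\<^sub>v vec_mod p (D *\<^sub>v a)) = a"
    if CD: "C \<in> carrier_mat n n" "D \<in> carrier_mat n n" "C * D = 1\<^sub>m n" and a: "a \<in> residue_vecs n p" for C D a
  proof -
    have ac: "a \<in> carrier_vec n" using a by (simp add: residue_vecs_def)
    have "vec_mod p (C *\<^sub>v vec_mod p (D *\<^sub>v a)) = vec_mod p (C *\<^sub>v (D *\<^sub>v a))"
      using CD ac by (intro vec_mod_mult) auto
    also have "C *\<^sub>v (D *\<^sub>v a) = (C * D) *\<^sub>v a" using CD ac by (intro assoc_mult_mat_vec[symmetric]) auto
    also have "\<dots> = a" using CD ac by simp
    finally show ?thesis using vec_mod_id[OF a] by simp
  qed
  have z: "vec_mod p (C *\<^sub>v 0\<^sub>v n) = 0\<^sub>v n" if "C \<in> carrier_mat n n" for C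
    using that by (intro eq_vecI) (auto simp: vec_mod_def)
  have lab: "vec_mod p (D *\<^sub>v a) \<in> hecke_labels n p"
    if CD: "C \<in> carrier_mat n n" "D \<in> carrier_mat n n" "C * D = 1\<^sub>m n" and a: "a \<in> hecke_labels n p" for C D a
  proof -
    have ar: "a \<in> residue_vecs n p" "a \<noteq> 0\<^sub>v n" using a by (auto simp: hecke_labels_def)
    hence "a \<in> carrier_vec n" by (simp add: residue_vecs_def)
    hence "vec_mod p (D *\<^sub>v a) \<in> residue_vecs n p" using CD p by (intro vec_mod_residue) auto
    moreover have "vec_mod p (D *\<^sub>v a) \<noteq> 0\<^sub>v n"
      using cancel[OF CD ar(1)] z[OF CD(1)] ar(2) by auto
    ultimately show ?thesis by (simp add: hecke_labels_def)
  qed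
  show ?thesis
  proof (rule sum.reindex_bij_witness[where i="\<lambda>a. vec_mod p (A *\<^sub>v a)" and j="\<lambda>a. vec_mod p (adj_mat A *\<^sub>v a)"])
    fix a assume a: "a \<in> hecke_labels n p"
    hence ar: "a \<in> residue_vecs n p" by (simp add: hecke_labels_def)
    show "vec_mod p (A *\<^sub>v vec_mod p (adj_mat A *\<^sub>v a)) = a" by (rule cancel[OF A'(1) B(1) B(2) ar])
    show "vec_mod p (adj_mat A *\<^sub>v vec_mod p (A *\<^sub>v a)) = a" by (rule cancel[OF B(1) A'(1) B(3) ar])
    show "vec_mod p (adj_mat A *\<^sub>v a) \<in> hecke_labels n p" by (rule lab[OF A'(1) B(1) B(2) a])
    show "vec_mod p (A *\<^sub>v a) \<in> hecke_labels n p" by (rule lab[OF B(1) A'(1) B(3) a])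
    show "F (hecke_nbr n p g (vec_mod p (adj_mat A *\<^sub>v a))) = F (hecke_nbr n p (rmat A * g) a)"
      unfolding hecke_nbr_SLZ[OF p g A ar] ..
  qed
qed

definition lattice_basis :: "nat \<Rightarrow> real vec set \<Rightarrow> real mat" where
  "lattice_basis n L = (SOME g. g \<in> SL n \<and> row_lattice g = L)"

lemma lattice_basis:
  assumes "L \<in> row_lattice ` SL n"
  shows "lattice_basis n L \<in> SL n" "row_lattice (lattice_basis n L) = L"
proof -
  have "\<exists>g. g \<in> SL n \<and> row_lattice g = L" using assms by auto
  from someI_ex[OF this] show "lattice_basis n L \<in> SL n" "row_lattice (lattice_basis n L) = L"
    unfolding lattice_basis_def by auto
qed

text \<open>The chosen basis need not depend measurably on \<open>L\<close>; measurability comes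
  from independence of the basis and the final sigma-algebra.\<close>

definition hecke_mean :: "nat \<Rightarrow> nat \<Rightarrow> (real vec set \<Rightarrow> ennreal) \<Rightarrow> real vec set \<Rightarrow> ennreal" where
  "hecke_mean n p F L = (\<Sum>a\<in>hecke_labels n p. F (hecke_nbr n p (lattice_basis n L) a)) / of_nat (card (hecke_labels n p))"

lemma hecke_mean_row_lattice:
  assumes p: "0 < p" and g: "g \<in> SL n"
  shows "hecke_mean n p F (row_lattice g) = (\<Sum>a\<in>hecke_labels n p. F (hecke_nbr n p g a)) / of_nat (card (hecke_labels n p))"
proof -
  have L: "row_lattice g \<in> row_lattice ` SL n" using g by simp
  obtain A where A: "A \<in> SLZ n" "lattice_basis n (row_lattice g) = rmat A * g"
    using row_lattice_eqD[OF g lattice_basis[OF L]] by blast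
  show ?thesis unfolding hecke_mean_def A(2) sum_hecke_nbr_SLZ[OF p g A(1)] ..
qed

lemma hecke_nbr_in_space:
  assumes "prime p" "0 < n" "g \<in> SL n" "a \<in> hecke_labels n p"
  shows "hecke_nbr n p g a \<in> row_lattice ` SL n"
  using hecke_matrix[OF assms(1,4,2)] assms(3) SL_mult by fastforce

lemma measurable_hecke_mean:
  assumes p: "prime p" and n: "0 < n" and F: "F \<in> borel_measurable (lattice_space n)"
  shows "hecke_mean n p F \<in> borel_measurable (lattice_space n)"
proof (rule measurable_lattice_spaceI)
  have p0: "0 < p" using p prime_gt_0_nat by blast
  have "(\<lambda>g. F (hecke_nbr n p g a)) \<in> borel_measurable (SL_borel n)" if a: "a \<in> hecke_labels n p" for a
  proof -
    obtain \<beta> where \<beta>: "\<beta> \<in> SL n" "\<forall>g\<in>SL n. hecke_nbr n p g a = row_lattice (\<beta> * g)"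
      using hecke_matrix[OF p a n] by blast
    have "(\<lambda>g. F (row_lattice (\<beta> * g))) \<in> borel_measurable (SL_borel n)"
      using \<beta>(1) by (intro measurable_compose[OF _ F] measurable_compose[OF _ measurable_row_lattice] measurable_SL_mult measurable_const) auto
    moreover have "(\<lambda>g. F (row_lattice (\<beta> * g))) \<in> borel_measurable (SL_borel n) \<longleftrightarrow> (\<lambda>g. F (hecke_nbr n p g a)) \<in> borel_measurable (SL_borel n)"
      using \<beta>(2) by (intro measurable_cong) auto
    ultimately show ?thesis by blast
  qed
  hence m: "(\<lambda>g. (\<Sum>a\<in>hecke_labels n p. F (hecke_nbr n p g a)) / of_nat (card (hecke_labels n p))) \<in> borel_measurable (SL_borel n)"
    by (intro borel_measurable_divide_ennreal borel_measurable_sum borel_measurable_const) auto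
  show "(\<lambda>g. hecke_mean n p F (row_lattice g)) \<in> borel_measurable (SL_borel n)"
    by (subst measurable_cong[OF hecke_mean_row_lattice[OF p0]]) (use m in auto)
qed auto

definition hecke_kernel :: "nat \<Rightarrow> nat \<Rightarrow> real vec set \<Rightarrow> real vec set measure" where
  "hecke_kernel n p L = distr (uniform_count_measure (hecke_labels n p)) (lattice_space n) (hecke_nbr n p (lattice_basis n L))"

lemma hecke_kernel:
  assumes p: "prime p" and n: "0 < n" and L: "L \<in> row_lattice ` SL n"
  shows "sets (hecke_kernel n p L) = sets (lattice_space n)"
    "F \<in> borel_measurable (lattice_space n) \<Longrightarrow> (\<integral>\<^sup>+x. F x \<partial>hecke_kernel n p L) = hecke_mean n p F L"
proof -
  show "sets (hecke_kernel n p L) = sets (lattice_space n)" by (simp add: hecke_kernel_def)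
  assume F: "F \<in> borel_measurable (lattice_space n)"
  have "hecke_nbr n p (lattice_basis n L) \<in> uniform_count_measure (hecke_labels n p) \<rightarrow>\<^sub>M lattice_space n"
    using hecke_nbr_in_space[OF p n lattice_basis(1)[OF L]] by (auto simp: measurable_def sets_uniform_count_measure space_uniform_count_measure)
  hence "(\<integral>\<^sup>+x. F x \<partial>hecke_kernel n p L) = (\<integral>\<^sup>+a. F (hecke_nbr n p (lattice_basis n L) a) \<partial>uniform_count_measure (hecke_labels n p))"
    unfolding hecke_kernel_def by (intro nn_integral_distr) (simp_all add: F)
  also have "\<dots> = (\<Sum>a\<in>hecke_labels n p. ennreal (1 / card (hecke_labels n p)) * F (hecke_nbr n p (lattice_basis n L) a))"
    unfolding uniform_count_measure_def by (rule nn_integral_point_measure_finite[OF finite_hecke_labels])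
  also have "\<dots> = ennreal (1 / card (hecke_labels n p)) * (\<Sum>a\<in>hecke_labels n p. F (hecke_nbr n p (lattice_basis n L) a))"
    by (rule sum_distrib_left[symmetric])
  also have "\<dots> = hecke_mean n p F L"
    using card_hecke_labels_pos[OF prime_gt_1_nat[OF p] n]
    by (simp add: hecke_mean_def divide_ennreal_def ennreal_of_nat_eq_real_of_nat inverse_ennreal divide_inverse mult.commute)
  finally show "(\<integral>\<^sup>+x. F x \<partial>hecke_kernel n p L) = hecke_mean n p F L" .
qed

text \<open>Replacing a random lattice by a uniformly random neighbour gives another invariant
  probability, because neighbours commute with translations. By uniqueness it is \<open>M\<close>
  again.\<close>

theorem nn_integral_hecke_mean:
  assumes M: "SL_invariant_prob n M" and p: "prime p" and n: "0 < n"
    and F: "F \<in> borel_measurable (lattice_space n)"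
  shows "(\<integral>\<^sup>+L. F L \<partial>M) = (\<integral>\<^sup>+L. hecke_mean n p F L \<partial>M)"
proof -
  note MD = SL_invariantD[OF M]
  interpret M: prob_space M by (rule MD(1))
  have p0: "0 < p" "1 < p" using p prime_gt_0_nat prime_gt_1_nat by blast+
  define M' where "M' = mixture M (lattice_space n) (hecke_kernel n p)"
  have ks: "sets (hecke_kernel n p L) = sets (lattice_space n)" if "L \<in> space M" for L
    by (simp add: hecke_kernel_def)
  have km: "(\<lambda>L. emeasure (hecke_kernel n p L) A) \<in> borel_measurable M" if A: "A \<in> sets (lattice_space n)" for A
  proof -
    have "hecke_mean n p (indicator A) \<in> borel_measurable M"
      using measurable_hecke_mean[OF p n, of "indicator A"] A MD(2) by (simp cong: measurable_cong_sets)
    moreover have "emeasure (hecke_kernel n p L) A = hecke_mean n p (indicator A) L" if L: "L \<in> space M" for L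
    proof -
      have "emeasure (hecke_kernel n p L) A = (\<integral>\<^sup>+x. indicator A x \<partial>hecke_kernel n p L)"
        using A ks[OF L] by simp
      also have "\<dots> = hecke_mean n p (indicator A) L"
        using L MD(3) A by (intro hecke_kernel(2)[OF p n]) auto
      finally show ?thesis .
    qed
    ultimately show ?thesis by (subst measurable_cong)
  qed
  have int: "(\<integral>\<^sup>+L. f L \<partial>M') = (\<integral>\<^sup>+L. hecke_mean n p f L \<partial>M)" if f: "f \<in> borel_measurable (lattice_space n)" for f
  proof -
    have "(\<integral>\<^sup>+L. f L \<partial>M') = (\<integral>\<^sup>+L. \<integral>\<^sup>+x. f x \<partial>hecke_kernel n p L \<partial>M)"
      unfolding M'_def by (rule nn_integral_mixture[OF ks km f])
    also have "\<dots> = (\<integral>\<^sup>+L. hecke_mean n p f L \<partial>M)"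
      using MD(3) f by (intro nn_integral_cong hecke_kernel(2)[OF p n]) auto
    finally show ?thesis .
  qed
  have s': "sets M' = sets (lattice_space n)" "space M' = row_lattice ` SL n" by (simp_all add: M'_def)
  have "SL_invariant_prob n M'"
    unfolding SL_invariant_prob_def
  proof (intro conjI ballI s'(1))
    show "prob_space M'"
    proof
      have "emeasure M' (space M') = (\<integral>\<^sup>+L. indicator (space M') L \<partial>M')" by simp
      also have "\<dots> = (\<integral>\<^sup>+L. hecke_mean n p (indicator (space M')) L \<partial>M)"
        using s' by (intro int borel_measurable_indicator) (metis sets.top)
      also have "\<dots> = (\<integral>\<^sup>+L. 1 \<partial>M)"
      proof (rule nn_integral_cong)
        fix L assume "L \<in> space M"
        hence L: "L \<in> row_lattice ` SL n" using MD(3) by simp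
        have "(\<Sum>a\<in>hecke_labels n p. indicator (space M') (hecke_nbr n p (lattice_basis n L) a) :: ennreal) = of_nat (card (hecke_labels n p))"
          using hecke_nbr_in_space[OF p n lattice_basis(1)[OF L]] s'(2) by simp
        thus "hecke_mean n p (indicator (space M')) L = 1"
          unfolding hecke_mean_def using card_hecke_labels_pos[OF p0(2) n]
          by (simp add: ennreal_of_nat_eq_real_of_nat)
      qed
      also have "\<dots> = 1" by (simp add: M.emeasure_space_1)
      finally show "emeasure M' (space M') = 1" .
    qed
    fix h assume h: "h \<in> SL n"
    let ?T = "\<lambda>L. (\<lambda>v. transpose_mat h *\<^sub>v v) ` L"
    have T: "?T \<in> lattice_space n \<rightarrow>\<^sub>M lattice_space n" by (rule measurable_translate_lattice[OF h])
    show "distr M' M' ?T = M'"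
    proof (rule measure_eqI)
      fix A assume "A \<in> sets (distr M' M' ?T)"
      hence A: "A \<in> sets (lattice_space n)" using s' by simp
      have i: "indicator A \<in> borel_measurable (lattice_space n)" using A by simp
      have iT: "(\<lambda>L. indicator A (?T L)) \<in> borel_measurable (lattice_space n)" by (rule measurable_compose[OF T i])
      have "emeasure (distr M' M' ?T) A = (\<integral>\<^sup>+L. indicator A L \<partial>distr M' M' ?T)" using A s' by simp
      also have "\<dots> = (\<integral>\<^sup>+L. indicator A (?T L) \<partial>M')"
        using T i s' by (intro nn_integral_distr) (simp_all cong: measurable_cong_sets)
      also have "\<dots> = (\<integral>\<^sup>+L. hecke_mean n p (\<lambda>L. indicator A (?T L)) L \<partial>M)" by (rule int[OF iT])
      also have "\<dots> = (\<integral>\<^sup>+L. hecke_mean n p (indicator A) (?T L) \<partial>M)"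
      proof (rule nn_integral_cong)
        fix L assume "L \<in> space M"
        then obtain g where g: "g \<in> SL n" "L = row_lattice g" using MD(3) by auto
        have "hecke_mean n p (\<lambda>L. indicator A (?T L)) (row_lattice g)
           = (\<Sum>a\<in>hecke_labels n p. indicator A (?T (hecke_nbr n p g a))) / of_nat (card (hecke_labels n p))"
          by (rule hecke_mean_row_lattice[OF p0(1) g(1)])
        also have "(\<Sum>a\<in>hecke_labels n p. indicator A (?T (hecke_nbr n p g a)) :: ennreal)
           = (\<Sum>a\<in>hecke_labels n p. indicator A (hecke_nbr n p (g * h) a))"
        proof (rule sum.cong[OF refl])
          fix a assume a: "a \<in> hecke_labels n p"
          obtain \<beta> where \<beta>: "\<beta> \<in> SL n" "\<forall>g\<in>SL n. hecke_nbr n p g a = row_lattice (\<beta> * g)"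
            using hecke_matrix[OF p a n] by blast
          have "hecke_nbr n p (g * h) a = row_lattice (\<beta> * (g * h))" using \<beta> SL_mult[OF g(1) h] by blast
          also have "\<beta> * (g * h) = \<beta> * g * h"
            using SL_carrier[OF \<beta>(1)] SL_carrier[OF g(1)] SL_carrier[OF h] by (intro assoc_mult_mat[symmetric])
          also have "row_lattice \<dots> = ?T (row_lattice (\<beta> * g))" by (rule row_lattice_mult[OF SL_mult[OF \<beta>(1) g(1)] h])
          finally show "(indicator A (?T (hecke_nbr n p g a)) :: ennreal) = indicator A (hecke_nbr n p (g * h) a)"
            using \<beta> g by simp
        qed
        also have "\<dots> / of_nat (card (hecke_labels n p)) = hecke_mean n p (indicator A) (row_lattice (g * h))"
          by (rule hecke_mean_row_lattice[OF p0(1) SL_mult[OF g(1) h], symmetric])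
        finally show "hecke_mean n p (\<lambda>L. indicator A (?T L)) L = hecke_mean n p (indicator A) (?T L)"
          unfolding g(2) row_lattice_mult[OF g(1) h] .
      qed
      also have "\<dots> = (\<integral>\<^sup>+L. hecke_mean n p (indicator A) L \<partial>distr M M ?T)"
        using T MD(2) measurable_hecke_mean[OF p n i]
        by (intro nn_integral_distr[symmetric]) (simp_all cong: measurable_cong_sets)
      also have "\<dots> = (\<integral>\<^sup>+L. hecke_mean n p (indicator A) L \<partial>M)" unfolding MD(4)[OF h] ..
      also have "\<dots> = (\<integral>\<^sup>+L. indicator A L \<partial>M')" by (rule int[OF i, symmetric])
      also have "\<dots> = emeasure M' A" using A s' by simp
      finally show "emeasure (distr M' M' ?T) A = emeasure M' A" .
    qed simp
  qed
  hence "M' = M" using M by (rule SL_invariant_prob_unique)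
  thus ?thesis using int[OF F] by simp
qed

section \<open>Lebesgue measure under unimodular linear maps\<close>

abbreviation LB :: "nat \<Rightarrow> (nat \<Rightarrow> real) measure" where
  "LB n \<equiv> Pi\<^sub>M {..<n} (\<lambda>_. lborel)"

definition lin_map :: "nat \<Rightarrow> real mat \<Rightarrow> (nat \<Rightarrow> real) \<Rightarrow> nat \<Rightarrow> real" where
  "lin_map n A x = (\<lambda>i\<in>{..<n}. \<Sum>j<n. A $$ (i,j) * x j)"

lemma measurable_lin_map [measurable]: "lin_map n A \<in> LB n \<rightarrow>\<^sub>M LB n"
  unfolding lin_map_def
proof (rule measurable_restrict)
  fix i assume i: "i \<in> {..<n}"
  have "(\<lambda>x. \<Sum>j<n. A $$ (i,j) * x j) \<in> borel_measurable (LB n)"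
  proof (intro borel_measurable_sum borel_measurable_times borel_measurable_const)
    fix j assume "j \<in> {..<n}"
    hence "(\<lambda>x. x j) \<in> LB n \<rightarrow>\<^sub>M lborel" by (rule measurable_component_singleton)
    thus "(\<lambda>x. x j) \<in> borel_measurable (LB n)" by simp
  qed
  thus "(\<lambda>x. \<Sum>j<n. A $$ (i,j) * x j) \<in> LB n \<rightarrow>\<^sub>M lborel" by simp
qed

lemma lin_map_mult:
  assumes "A \<in> carrier_mat n n" "B \<in> carrier_mat n n"
  shows "lin_map n (A * B) x = lin_map n A (lin_map n B x)"
proof
  fix i
  show "lin_map n (A * B) x i = lin_map n A (lin_map n B x) i"
  proof (cases "i < n")
    case True
    have "(\<Sum>j<n. (A * B) $$ (i,j) * x j) = (\<Sum>j<n. \<Sum>k<n. A $$ (i,k) * (B $$ (k,j) * x j))"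
      using True by (intro sum.cong) (auto simp: mat_mult_index_sum[OF assms] sum_distrib_right mult.assoc)
    also have "\<dots> = (\<Sum>k<n. \<Sum>j<n. A $$ (i,k) * (B $$ (k,j) * x j))" by (rule sum.swap)
    also have "\<dots> = (\<Sum>k<n. A $$ (i,k) * lin_map n B x k)"
      by (intro sum.cong) (auto simp: lin_map_def sum_distrib_left)
    finally show ?thesis using True by (simp add: lin_map_def)
  qed (simp add: lin_map_def)
qed

lemma lin_map_one:
  assumes "x \<in> space (LB n)"
  shows "lin_map n (1\<^sub>m n) x = x"
proof
  fix i
  have e: "x \<in> extensional {..<n}" using assms by (auto simp: space_PiM PiE_def)
  show "lin_map n (1\<^sub>m n) x i = x i"
  proof (cases "i < n")
    case True
    have "(\<Sum>j<n. 1\<^sub>m n $$ (i,j) * x j) = (\<Sum>j<n. if j = i then x i else 0)"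
      using True by (intro sum.cong) auto
    thus ?thesis using True by (simp add: lin_map_def)
  qed (use e in \<open>simp add: lin_map_def extensional_def\<close>)
qed

text \<open>A one-dimensional affine substitution inside Fubini. The condition on \<open>t\<close>
  says that the shift ignores coordinate k; c = 1 gives row additions and t = 0 gives row
  scalings.\<close>

lemma LB_add_coordinate:
  assumes F: "F \<in> borel_measurable (LB n)" and k: "k < n" and c: "c \<noteq> 0"
    and t: "\<And>x y. t (x(k := y)) = t x"
    and m: "(\<lambda>x. F (x(k := t x + c * x k))) \<in> borel_measurable (LB n)"
  shows "(\<integral>\<^sup>+x. F x \<partial>LB n) = ennreal \<bar>c\<bar> * (\<integral>\<^sup>+x. F (x(k := t x + c * x k)) \<partial>LB n)"
proof -
  interpret product_sigma_finite "\<lambda>_. lborel :: real measure" ..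
  let ?J = "{..<n} - {k}"
  have I: "{..<n} = insert k ?J" using k by auto
  have F': "F \<in> borel_measurable (Pi\<^sub>M (insert k ?J) (\<lambda>_. lborel))" using F I by simp
  have m': "(\<lambda>x. F (x(k := t x + c * x k))) \<in> borel_measurable (Pi\<^sub>M (insert k ?J) (\<lambda>_. lborel))" using m I by simp
  have "(\<integral>\<^sup>+x. F x \<partial>LB n) = (\<integral>\<^sup>+x. \<integral>\<^sup>+y. F (x(k := y)) \<partial>lborel \<partial>Pi\<^sub>M ?J (\<lambda>_. lborel))"
    by (subst I) (intro product_nn_integral_insert F', auto)
  also have "\<dots> = (\<integral>\<^sup>+x. ennreal \<bar>c\<bar> * (\<integral>\<^sup>+y. F (x(k := t x + c * y)) \<partial>lborel) \<partial>Pi\<^sub>M ?J (\<lambda>_. lborel))"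
  proof (rule nn_integral_cong)
    fix x assume x: "x \<in> space (Pi\<^sub>M ?J (\<lambda>_. lborel :: real measure))"
    have "(\<lambda>y. x(k := y)) \<in> lborel \<rightarrow>\<^sub>M Pi\<^sub>M (insert k ?J) (\<lambda>_. lborel)"
      using x by (intro measurable_component_update) auto
    from measurable_compose[OF this F'] have "(\<lambda>y. F (x(k := y))) \<in> borel_measurable borel" by simp
    from nn_integral_real_affine[OF this c, of "t x"]
    show "(\<integral>\<^sup>+y. F (x(k := y)) \<partial>lborel) = ennreal \<bar>c\<bar> * (\<integral>\<^sup>+y. F (x(k := t x + c * y)) \<partial>lborel)" .
  qed
  also have "\<dots> = (\<integral>\<^sup>+x. \<integral>\<^sup>+y. ennreal \<bar>c\<bar> * F (x(k := t x + c * y)) \<partial>lborel \<partial>Pi\<^sub>M ?J (\<lambda>_. lborel))"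
  proof (rule nn_integral_cong)
    fix x assume x: "x \<in> space (Pi\<^sub>M ?J (\<lambda>_. lborel :: real measure))"
    have "(\<lambda>y. x(k := y)) \<in> lborel \<rightarrow>\<^sub>M Pi\<^sub>M (insert k ?J) (\<lambda>_. lborel)"
      using x by (intro measurable_component_update) auto
    from measurable_compose[OF this m'] have "(\<lambda>y. F (x(k := t x + c * y))) \<in> borel_measurable lborel" by (simp add: t)
    thus "ennreal \<bar>c\<bar> * (\<integral>\<^sup>+y. F (x(k := t x + c * y)) \<partial>lborel) = (\<integral>\<^sup>+y. ennreal \<bar>c\<bar> * F (x(k := t x + c * y)) \<partial>lborel)"
      by (rule nn_integral_cmult[symmetric])
  qed
  also have "\<dots> = (\<integral>\<^sup>+x. ennreal \<bar>c\<bar> * F (x(k := t x + c * x k)) \<partial>Pi\<^sub>M (insert k ?J) (\<lambda>_. lborel))"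
    by (subst product_nn_integral_insert) (use m' in \<open>auto simp: t\<close>)
  also have "\<dots> = ennreal \<bar>c\<bar> * (\<integral>\<^sup>+x. F (x(k := t x + c * x k)) \<partial>LB n)"
    unfolding I[symmetric] by (rule nn_integral_cmult[OF m])
  finally show ?thesis .
qed

text \<open>Row swaps are left out: a vanishing pivot is repaired by adding another row, so only two
  generators need a substitution rule.\<close>

inductive_set elementary_mats :: "nat \<Rightarrow> real mat set" for n where
  one: "1\<^sub>m n \<in> elementary_mats n"
| addrow: "E \<in> elementary_mats n \<Longrightarrow> k < n \<Longrightarrow> l < n \<Longrightarrow> k \<noteq> l \<Longrightarrow> addrow_mat n a k l * E \<in> elementary_mats n"
| multrow: "E \<in> elementary_mats n \<Longrightarrow> k < n \<Longrightarrow> a \<noteq> 0 \<Longrightarrow> multrow_mat n k a * E \<in> elementary_mats n"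

lemma elementary_mats_carrier: "E \<in> elementary_mats n \<Longrightarrow> E \<in> carrier_mat n n"
  by (induction rule: elementary_mats.induct) auto

lemma elementary_mats_det: "E \<in> elementary_mats n \<Longrightarrow> det E \<noteq> 0"
proof (induction rule: elementary_mats.induct)
  case (addrow E k l a)
  thus ?case using elementary_mats_carrier by (simp add: det_mult[of _ n] det_addrow_mat)
next
  case (multrow E k a)
  thus ?case using elementary_mats_carrier by (simp add: det_mult[of _ n] det_multrow_mat)
qed simp

lemma elementary_mats_mult:
  assumes "E \<in> elementary_mats n" "D \<in> elementary_mats n"
  shows "D * E \<in> elementary_mats n"
  using assms(2)
proof (induction rule: elementary_mats.induct)
  case one
  thus ?case using assms(1) elementary_mats_carrier[OF assms(1)] by simp
next
  case (addrow D k l a)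
  have "addrow_mat n a k l * D * E = addrow_mat n a k l * (D * E)"
    using addrow elementary_mats_carrier assms(1) by (intro assoc_mult_mat[of _ n n _ n _ n]) auto
  thus ?case using addrow by (auto intro: elementary_mats.addrow)
next
  case (multrow D k a)
  have "multrow_mat n k a * D * E = multrow_mat n k a * (D * E)"
    using multrow elementary_mats_carrier assms(1) by (intro assoc_mult_mat[of _ n n _ n _ n]) auto
  thus ?case using multrow by (auto intro: elementary_mats.multrow)
qed

lemma lin_map_addrow:
  assumes x: "x \<in> space (LB n)" and kl: "k < n" "l < n" "k \<noteq> l"
  shows "lin_map n (addrow_mat n a k l) x = x(k := a * x l + 1 * x k)"
proof
  fix i
  have e: "x \<in> extensional {..<n}" using x by (auto simp: space_PiM PiE_def)
  show "lin_map n (addrow_mat n a k l) x i = (x(k := a * x l + 1 * x k)) i"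
  proof (cases "i < n")
    case True
    have "(\<Sum>j<n. addrow_mat n a k l $$ (i,j) * x j) = (\<Sum>j<n. (if j = i then x i else 0) + (if j = l then (if i = k then a * x l else 0) else 0))"
      using True kl by (intro sum.cong) auto
    also have "\<dots> = x i + (if i = k then a * x l else 0)"
      using True kl by (simp add: sum.distrib)
    finally show ?thesis using True by (simp add: lin_map_def)
  qed (use e kl in \<open>simp add: lin_map_def extensional_def\<close>)
qed

lemma lin_map_multrow:
  assumes x: "x \<in> space (LB n)" and k: "k < n"
  shows "lin_map n (multrow_mat n k a) x = x(k := 0 + a * x k)"
proof
  fix i
  have e: "x \<in> extensional {..<n}" using x by (auto simp: space_PiM PiE_def)
  show "lin_map n (multrow_mat n k a) x i = (x(k := 0 + a * x k)) i"
  proof (cases "i < n")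
    case True
    have "(\<Sum>j<n. multrow_mat n k a $$ (i,j) * x j) = (\<Sum>j<n. if j = i then (if i = k then a * x k else x i) else 0)"
      using True k by (intro sum.cong) auto
    thus ?thesis using True by (simp add: lin_map_def)
  qed (use e k in \<open>simp add: lin_map_def extensional_def\<close>)
qed

lemma nn_integral_elementary:
  assumes "E \<in> elementary_mats n"
  shows "F \<in> borel_measurable (LB n) \<Longrightarrow> (\<integral>\<^sup>+x. F x \<partial>LB n) = ennreal \<bar>det E\<bar> * (\<integral>\<^sup>+x. F (lin_map n E x) \<partial>LB n)"
  using assms
proof (induction arbitrary: F rule: elementary_mats.induct)
  case one
  have "(\<integral>\<^sup>+x. F (lin_map n (1\<^sub>m n) x) \<partial>LB n) = (\<integral>\<^sup>+x. F x \<partial>LB n)"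
    by (intro nn_integral_cong arg_cong[of _ _ F] lin_map_one)
  thus ?case by simp
next
  case (addrow E k l a)
  let ?A = "addrow_mat n a k l"
  have Fm: "(\<lambda>x. F (lin_map n ?A x)) \<in> borel_measurable (LB n)"
    by (rule measurable_compose[OF measurable_lin_map addrow.prems])
  have eq: "F (lin_map n ?A x) = F (x(k := a * x l + 1 * x k))" if "x \<in> space (LB n)" for x
    unfolding lin_map_addrow[OF that addrow.hyps(2-4)] ..
  have m: "(\<lambda>x. F (x(k := a * x l + 1 * x k))) \<in> borel_measurable (LB n)"
    using Fm by (subst measurable_cong[OF eq[symmetric]])
  have "(\<integral>\<^sup>+x. F x \<partial>LB n) = ennreal \<bar>1\<bar> * (\<integral>\<^sup>+x. F (x(k := a * x l + 1 * x k)) \<partial>LB n)"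
    by (rule LB_add_coordinate[OF addrow.prems addrow.hyps(2) _ _ m]) (use addrow.hyps in auto)
  also have "\<dots> = (\<integral>\<^sup>+x. F (lin_map n ?A x) \<partial>LB n)"
    unfolding abs_one ennreal_1 mult_1_left[of "nn_integral _ _"] by (rule nn_integral_cong) (rule eq[symmetric])
  also have "\<dots> = ennreal \<bar>det E\<bar> * (\<integral>\<^sup>+x. F (lin_map n ?A (lin_map n E x)) \<partial>LB n)"
    by (rule addrow.IH[OF Fm])
  also have "(\<lambda>x. F (lin_map n ?A (lin_map n E x))) = (\<lambda>x. F (lin_map n (?A * E) x))"
    using elementary_mats_carrier[OF addrow.hyps(1)] by (subst lin_map_mult) auto
  also have "det E = det (?A * E)"
    using elementary_mats_carrier[OF addrow.hyps(1)] addrow.hyps by (simp add: det_mult[of _ n] det_addrow_mat)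
  finally show ?case .
next
  case (multrow E k a)
  let ?A = "multrow_mat n k a"
  have Fm: "(\<lambda>x. F (lin_map n ?A x)) \<in> borel_measurable (LB n)"
    by (rule measurable_compose[OF measurable_lin_map multrow.prems])
  have eq: "F (lin_map n ?A x) = F (x(k := 0 + a * x k))" if "x \<in> space (LB n)" for x
    unfolding lin_map_multrow[OF that multrow.hyps(2)] ..
  have m: "(\<lambda>x. F (x(k := 0 + a * x k))) \<in> borel_measurable (LB n)"
    using Fm by (subst measurable_cong[OF eq[symmetric]])
  have "(\<integral>\<^sup>+x. F x \<partial>LB n) = ennreal \<bar>a\<bar> * (\<integral>\<^sup>+x. F (x(k := 0 + a * x k)) \<partial>LB n)"
    by (rule LB_add_coordinate[OF multrow.prems multrow.hyps(2,3) _ m]) auto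
  also have "\<dots> = ennreal \<bar>a\<bar> * (\<integral>\<^sup>+x. F (lin_map n ?A x) \<partial>LB n)"
    by (intro arg_cong[of _ _ "\<lambda>u. _ * u"] nn_integral_cong) (rule eq[symmetric])
  also have "(\<integral>\<^sup>+x. F (lin_map n ?A x) \<partial>LB n) = ennreal \<bar>det E\<bar> * (\<integral>\<^sup>+x. F (lin_map n ?A (lin_map n E x)) \<partial>LB n)"
    by (rule multrow.IH[OF Fm])
  also have "(\<lambda>x. F (lin_map n ?A (lin_map n E x))) = (\<lambda>x. F (lin_map n (?A * E) x))"
    using elementary_mats_carrier[OF multrow.hyps(1)] by (subst lin_map_mult) auto
  also have "ennreal \<bar>a\<bar> * (ennreal \<bar>det E\<bar> * (\<integral>\<^sup>+x. F (lin_map n (?A * E) x) \<partial>LB n))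
      = ennreal \<bar>det (?A * E)\<bar> * (\<integral>\<^sup>+x. F (lin_map n (?A * E) x) \<partial>LB n)"
    using elementary_mats_carrier[OF multrow.hyps(1)] multrow.hyps
    by (simp add: det_mult[of _ n] det_multrow_mat abs_mult ennreal_mult mult.assoc)
  finally show ?case .
qed

text \<open>Induction over the rows to be cleared. Row k vanishes in the columns before k, so adding
  multiples of it does not spoil the part already reduced.\<close>

lemma eliminate_column:
  assumes B: "B \<in> carrier_mat n n" and k: "k < n" and kk: "B $$ (k,k) = 1"
    and good: "\<And>i j. i < n \<Longrightarrow> j < k \<Longrightarrow> B $$ (i,j) = (if i = j then 1 else 0)"
    and S: "finite S" "S \<subseteq> {..<n} - {k}"
  shows "\<exists>P\<in>elementary_mats n. (\<forall>i<n. \<forall>j<k. (P * B) $$ (i,j) = (if i = j then 1 else 0)) \<and>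
    (\<forall>j<n. (P * B) $$ (k,j) = B $$ (k,j)) \<and> (\<forall>i\<in>S. (P * B) $$ (i,k) = 0)"
  using S
proof (induction S rule: finite_induct)
  case empty
  show ?case using B good by (intro bexI[of _ "1\<^sub>m n"] elementary_mats.one) auto
next
  case (insert r S)
  have "S \<subseteq> {..<n} - {k}" using insert.prems by simp
  from insert.IH[OF this] obtain P where P0: "P \<in> elementary_mats n"
    "(\<forall>i<n. \<forall>j<k. (P * B) $$ (i,j) = (if i = j then 1 else 0)) \<and>
     (\<forall>j<n. (P * B) $$ (k,j) = B $$ (k,j)) \<and> (\<forall>i\<in>S. (P * B) $$ (i,k) = 0)" by (rule bexE)
  note P = P0(1) P0(2)[THEN conjunct1, rule_format] P0(2)[THEN conjunct2, THEN conjunct1, rule_format]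
    P0(2)[THEN conjunct2, THEN conjunct2, rule_format]
  have r: "r < n" "r \<noteq> k" using insert.prems by auto
  have Pc: "P \<in> carrier_mat n n" by (rule elementary_mats_carrier[OF P(1)])
  let ?a = "- (P * B) $$ (r,k)"
  let ?Q = "addrow_mat n ?a r k"
  have PB: "P * B \<in> carrier_mat n n" using Pc B by auto
  have e: "?Q * P * B = addrow ?a r k (P * B)"
    using Pc B addrow_mat[OF PB k, of ?a r] by (simp add: assoc_mult_mat[of _ n n _ n _ n])
  have dim: "dim_row (P * B) = n" "dim_col (P * B) = n" using PB by auto
  show ?case
  proof (intro bexI[of _ "?Q * P"] conjI allI ballI impI elementary_mats.addrow P(1) r k)
    fix i j assume ij: "i < n" "j < k"
    thus "(?Q * P * B) $$ (i,j) = (if i = j then 1 else 0)"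
      unfolding e using k dim P(2)[of i j] P(2)[of k j] by (auto simp: index_mat_addrow simp del: index_mult_mat)
  next
    fix j assume "j < n"
    thus "(?Q * P * B) $$ (k,j) = B $$ (k,j)"
      unfolding e using k r dim P(3)[of j] by (simp add: index_mat_addrow del: index_mult_mat)
  next
    fix i assume i: "i \<in> insert r S"
    hence "i < n" using insert.prems by auto
    thus "(?Q * P * B) $$ (i,k) = 0"
      unfolding e using i k dim P(3)[OF k] P(4)[of i] kk by (auto simp: index_mat_addrow simp del: index_mult_mat)
  qed
qed

lemma gauss_elimination:
  assumes A: "A \<in> carrier_mat n n" and det: "det A \<noteq> 0"
  shows "\<exists>P\<in>elementary_mats n. P * A = 1\<^sub>m n"
proof -
  have "\<exists>P\<in>elementary_mats n. \<forall>i<n. \<forall>j<k. (P * A) $$ (i,j) = (if i = j then 1 else 0)" if "k \<le> n" for k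
    using that
  proof (induction k)
    case 0
    show ?case by (intro bexI[of _ "1\<^sub>m n"] elementary_mats.one) auto
  next
    case (Suc k)
    then obtain P where P: "P \<in> elementary_mats n"
      "\<And>i j. i < n \<Longrightarrow> j < k \<Longrightarrow> (P * A) $$ (i,j) = (if i = j then 1 else 0)" by auto
    have k: "k < n" using Suc.prems by simp
    let ?B = "P * A"
    have Pc: "P \<in> carrier_mat n n" by (rule elementary_mats_carrier[OF P(1)])
    have B: "?B \<in> carrier_mat n n" using Pc A by auto
    have dB: "det ?B \<noteq> 0" using det_mult[OF Pc A] det elementary_mats_det[OF P(1)] by simp
    have "\<exists>r<n. k \<le> r \<and> ?B $$ (r,k) \<noteq> 0"
    proof (rule ccontr)
      assume "\<not> ?thesis"
      hence z: "\<And>r. r < n \<Longrightarrow> k \<le> r \<Longrightarrow> ?B $$ (r,k) = 0" by blast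
      \<comment> \<open>If no pivot is left, column k is a combination of the first k unit columns;
        \<open>v\<close> is the resulting kernel vector.\<close>
      define v where "v = vec n (\<lambda>j. if j = k then 1 else if j < k then - ?B $$ (j,k) else 0)"
      have v: "v \<in> carrier_vec n" by (simp add: v_def)
      have "v $ k \<noteq> 0\<^sub>v n $ k" using k by (simp add: v_def)
      hence v0: "v \<noteq> 0\<^sub>v n" by metis
      have "?B *\<^sub>v v = 0\<^sub>v n"
      proof (rule eq_vecI)
        fix i assume "i < dim_vec (0\<^sub>v n)"
        hence i: "i < n" by simp
        have "(?B *\<^sub>v v) $ i = (\<Sum>j<n. ?B $$ (i,j) * v $ j)"
          using B v i by (auto simp: scalar_prod_def atLeast0LessThan simp del: index_mult_mat intro!: sum.cong)
        also have "\<dots> = (\<Sum>j<n. (if j = k then ?B $$ (i,k) else 0) + (if j = i then (if i < k then - ?B $$ (i,k) else 0) else 0))"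
        proof (rule sum.cong[OF refl])
          fix j assume "j \<in> {..<n}"
          hence "j < n" by simp
          thus "?B $$ (i,j) * v $ j = (if j = k then ?B $$ (i,k) else 0) + (if j = i then (if i < k then - ?B $$ (i,k) else 0) else 0)"
            using P(2)[OF i, of j] k by (cases "j < k"; cases "j = k") (auto simp: v_def simp del: index_mult_mat)
        qed
        also have "\<dots> = ?B $$ (i,k) + (if i < k then - ?B $$ (i,k) else 0)"
          using k i by (simp add: sum.distrib del: index_mult_mat)
        also have "\<dots> = 0" using z[OF i] by (auto simp del: index_mult_mat)
        finally show "(?B *\<^sub>v v) $ i = 0\<^sub>v n $ i" using i by simp
      qed (use B in auto)
      hence "det ?B = 0" using det_0_iff_vec_prod_zero_field[OF B] v v0 by blast
      thus False using dB by simp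
    qed
    then obtain r where r: "r < n" "k \<le> r" "?B $$ (r,k) \<noteq> 0" by blast
    have dim: "dim_row ?B = n" "dim_col ?B = n" using B by auto
    obtain Q where Q: "Q \<in> elementary_mats n" "(Q * ?B) $$ (k,k) = 1"
      "\<And>i j. i < n \<Longrightarrow> j < k \<Longrightarrow> (Q * ?B) $$ (i,j) = (if i = j then 1 else 0)"
    proof (cases "r = k")
      case True
      let ?Q = "multrow_mat n k (1 / ?B $$ (k,k))"
      have e: "?Q * ?B = multrow k (1 / ?B $$ (k,k)) ?B" by (rule multrow_mat[OF B, symmetric])
      have "?Q * 1\<^sub>m n \<in> elementary_mats n" using True r k by (intro elementary_mats.multrow elementary_mats.one) auto
      hence "?Q \<in> elementary_mats n" by simp
      thus ?thesis
        using True r k dim P(2) by (intro that[of ?Q]) (auto simp: e simp del: index_mult_mat)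
    next
      case False
      \<comment> \<open>This multiple of row r makes the pivot in row k equal to 1 at once, whether
        or not it was zero before.\<close>
      let ?a = "(1 - ?B $$ (k,k)) / ?B $$ (r,k)"
      let ?Q = "addrow_mat n ?a k r"
      have e: "?Q * ?B = addrow ?a k r ?B" by (rule addrow_mat[OF B r(1), symmetric])
      have "?Q * 1\<^sub>m n \<in> elementary_mats n" using False r k by (intro elementary_mats.addrow elementary_mats.one) auto
      hence "?Q \<in> elementary_mats n" by simp
      moreover have "(?Q * ?B) $$ (k,k) = 1" unfolding e using k dim r by (simp add: index_mat_addrow del: index_mult_mat)
      moreover have "(?Q * ?B) $$ (i,j) = (if i = j then 1 else 0)" if "i < n" "j < k" for i j
        unfolding e using k dim r that P(2)[of i j] P(2)[of r j] by (auto simp: index_mat_addrow simp del: index_mult_mat)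
      ultimately show ?thesis by (rule that)
    qed
    have Qc: "Q \<in> carrier_mat n n" by (rule elementary_mats_carrier[OF Q(1)])
    have QB: "Q * ?B \<in> carrier_mat n n" using Qc B by auto
    have "finite ({..<n} - {k})" "{..<n} - {k} \<subseteq> {..<n} - {k}" by auto
    from eliminate_column[OF QB k Q(2) Q(3) this] obtain R where R0: "R \<in> elementary_mats n"
      "(\<forall>i<n. \<forall>j<k. (R * (Q * ?B)) $$ (i,j) = (if i = j then 1 else 0)) \<and>
       (\<forall>j<n. (R * (Q * ?B)) $$ (k,j) = (Q * ?B) $$ (k,j)) \<and> (\<forall>i\<in>{..<n} - {k}. (R * (Q * ?B)) $$ (i,k) = 0)"
      by (rule bexE)
    note R = R0(1) R0(2)[THEN conjunct1, rule_format] R0(2)[THEN conjunct2, THEN conjunct1, rule_format]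
      R0(2)[THEN conjunct2, THEN conjunct2, rule_format]
    have Rc: "R \<in> carrier_mat n n" by (rule elementary_mats_carrier[OF R(1)])
    have "R * Q * P * A = R * (Q * ?B)"
      using Rc Qc Pc A by (simp add: assoc_mult_mat[of _ n n _ n _ n])
    moreover have "(R * (Q * ?B)) $$ (i,j) = (if i = j then 1 else 0)" if "i < n" "j < Suc k" for i j
    proof (cases "j < k")
      case True thus ?thesis using R(2) that by blast
    next
      case False
      hence "j = k" using that by simp
      thus ?thesis using R(3)[OF k] R(4)[of i] Q(2) that by (cases "i = k") (auto simp del: index_mult_mat)
    qed
    moreover have "R * Q * P \<in> elementary_mats n" by (intro elementary_mats_mult R Q P)
    ultimately show ?case by (metis (no_types, lifting))
  qed
  from this[of n] obtain P where P: "P \<in> elementary_mats n"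
    "\<And>i j. i < n \<Longrightarrow> j < n \<Longrightarrow> (P * A) $$ (i,j) = (if i = j then 1 else 0)" by auto
  have "P * A = 1\<^sub>m n" using P elementary_mats_carrier[OF P(1)] A by (intro eq_matI) auto
  thus ?thesis using P(1) by blast
qed

text \<open>The substitution rule is applied to the product of elementary matrices that inverts
  \<open>g\<close>; its determinant is 1.\<close>

lemma nn_integral_SL:
  assumes g: "g \<in> SL n" and F: "F \<in> borel_measurable (LB n)"
  shows "(\<integral>\<^sup>+x. F (lin_map n g x) \<partial>LB n) = (\<integral>\<^sup>+x. F x \<partial>LB n)"
proof -
  have gc: "g \<in> carrier_mat n n" using SL_carrier[OF g] .
  obtain P where P: "P \<in> elementary_mats n" "P * g = 1\<^sub>m n"
    using gauss_elimination[OF gc] SL_det[OF g] by auto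
  have Pc: "P \<in> carrier_mat n n" by (rule elementary_mats_carrier[OF P(1)])
  have "g * P = 1\<^sub>m n" by (rule mat_mult_left_right_inverse[OF Pc gc P(2)])
  have "det P = 1" using det_mult[OF Pc gc] P(2) SL_det[OF g] by simp
  have "(\<integral>\<^sup>+x. F (lin_map n g x) \<partial>LB n) = ennreal \<bar>det P\<bar> * (\<integral>\<^sup>+x. F (lin_map n g (lin_map n P x)) \<partial>LB n)"
    by (rule nn_integral_elementary[OF P(1) measurable_compose[OF measurable_lin_map F]])
  also have "\<dots> = (\<integral>\<^sup>+x. F (lin_map n g (lin_map n P x)) \<partial>LB n)" using \<open>det P = 1\<close> by simp
  also have "\<dots> = (\<integral>\<^sup>+x. F x \<partial>LB n)"
    unfolding lin_map_mult[OF gc Pc, symmetric] \<open>g * P = 1\<^sub>m n\<close>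
    by (intro nn_integral_cong) (simp add: lin_map_one)
  finally show ?thesis .
qed

subsection \<open>Counting lattice points in balls\<close>

definition lat_pt :: "real mat \<Rightarrow> int vec \<Rightarrow> real vec" where
  "lat_pt g z = transpose_mat g *\<^sub>v map_vec real_of_int z"

lemma row_lattice_eq_lat_pt: "g \<in> SL n \<Longrightarrow> row_lattice g = lat_pt g ` carrier_vec n"
  unfolding row_lattice_SL lat_pt_def ..

lemma SL_transpose: "g \<in> SL n \<Longrightarrow> transpose_mat g \<in> SL n"
  by (auto simp: SL_def det_transpose)

lemma vec_len_L2_set: "v \<in> carrier_vec n \<Longrightarrow> vec_len v = L2_set (\<lambda>i. v $ i) {..<n}"
  by (auto simp: vec_len_def scalar_prod_def L2_set_def power2_eq_square atLeast0LessThan)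

lemma vec_len_lat_pt:
  assumes "g \<in> SL n" "z \<in> carrier_vec n"
  shows "vec_len (lat_pt g z) = L2_set (lin_map n (transpose_mat g) (\<lambda>i. real_of_int (z $ i))) {..<n}"
proof -
  have gc: "g \<in> carrier_mat n n" using SL_carrier assms(1) by blast
  have c: "lat_pt g z \<in> carrier_vec n" using gc assms by (auto simp: lat_pt_def)
  have "lat_pt g z $ i = lin_map n (transpose_mat g) (\<lambda>i. real_of_int (z $ i)) i" if "i < n" for i
    unfolding lat_pt_def lin_map_def using transpose_mult_vec_index[OF gc, of "map_vec real_of_int z" i] assms gc that
    by (simp add: mult.commute)
  thus ?thesis unfolding vec_len_L2_set[OF c] by (intro L2_set_cong) auto
qed

definition unit_cube :: "nat \<Rightarrow> int vec \<Rightarrow> (nat \<Rightarrow> real) set" where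
  "unit_cube n z = PiE {..<n} (\<lambda>i. {real_of_int (z $ i)..<real_of_int (z $ i) + 1})"

lemma unit_cube: "unit_cube n z \<in> sets (LB n)" "emeasure (LB n) (unit_cube n z) = 1"
proof -
  interpret product_sigma_finite "\<lambda>_. lborel :: real measure" ..
  show "unit_cube n z \<in> sets (LB n)" unfolding unit_cube_def by (intro sets_PiM_I_finite) auto
  have "emeasure (LB n) (unit_cube n z) = (\<Prod>i<n. emeasure lborel {real_of_int (z $ i)..<real_of_int (z $ i) + 1})"
    unfolding unit_cube_def by (rule emeasure_PiM) auto
  also have "\<dots> = 1" by simp
  finally show "emeasure (LB n) (unit_cube n z) = 1" .
qed

lemma unit_cube_floor:
  assumes "x \<in> space (LB n)"
  shows "x \<in> unit_cube n z \<longleftrightarrow> (\<forall>i<n. z $ i = \<lfloor>x i\<rfloor>)"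
proof -
  have "x i \<in> {real_of_int (z $ i)..<real_of_int (z $ i) + 1} \<longleftrightarrow> z $ i = \<lfloor>x i\<rfloor>" for i
    using floor_eq_iff[of "x i" "z $ i"] by auto
  thus ?thesis using assms by (auto simp: unit_cube_def PiE_iff space_PiM)
qed

definition ellipsoid :: "nat \<Rightarrow> real mat \<Rightarrow> real \<Rightarrow> (nat \<Rightarrow> real) set" where
  "ellipsoid n g \<rho> = {x \<in> space (LB n). L2_set (lin_map n (transpose_mat g) x) {..<n} \<le> \<rho>}"

lemma emeasure_ellipsoid:
  assumes g: "g \<in> SL n" and \<rho>: "0 < \<rho>"
  shows "ellipsoid n g \<rho> \<in> sets (LB n)"
    "emeasure (LB n) (ellipsoid n g \<rho>) = ennreal (unit_ball_vol (real n) * \<rho> ^ n)"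
proof -
  let ?B = "{f. sqrt (\<Sum>i\<in>{..<n}. (f i)\<^sup>2) \<le> \<rho>} \<inter> space (LB n)"
  have B: "?B \<in> sets (LB n)"
  proof -
    have "(\<lambda>f. \<Sum>i\<in>{..<n}. (f i)\<^sup>2) \<in> borel_measurable (LB n)"
    proof (intro borel_measurable_sum borel_measurable_power)
      fix i assume "i \<in> {..<n}"
      hence "(\<lambda>x. x i) \<in> LB n \<rightarrow>\<^sub>M lborel" by (rule measurable_component_singleton)
      thus "(\<lambda>x. x i) \<in> borel_measurable (LB n)" by simp
    qed
    hence "(\<lambda>f. sqrt (\<Sum>i\<in>{..<n}. (f i)\<^sup>2)) \<in> borel_measurable (LB n)"
      by (rule measurable_compose) simp
    from measurable_sets[OF this, of "{..\<rho>}"]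
    have "(\<lambda>f. sqrt (\<Sum>i\<in>{..<n}. (f i)\<^sup>2)) -` {..\<rho>} \<inter> space (LB n) \<in> sets (LB n)" by simp
    also have "(\<lambda>f. sqrt (\<Sum>i\<in>{..<n}. (f i)\<^sup>2)) -` {..\<rho>} \<inter> space (LB n) = ?B" by auto
    finally show ?thesis .
  qed
  have lm: "lin_map n (transpose_mat g) x \<in> space (LB n)" for x
    by (auto simp: lin_map_def space_PiM)
  have e: "ellipsoid n g \<rho> = lin_map n (transpose_mat g) -` ?B \<inter> space (LB n)"
    unfolding ellipsoid_def L2_set_def using lm by auto
  show s: "ellipsoid n g \<rho> \<in> sets (LB n)" unfolding e by (rule measurable_sets[OF measurable_lin_map B])
  have "emeasure (LB n) (ellipsoid n g \<rho>) = (\<integral>\<^sup>+x. indicator (ellipsoid n g \<rho>) x \<partial>LB n)"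
    using s by simp
  also have "\<dots> = (\<integral>\<^sup>+x. indicator ?B (lin_map n (transpose_mat g) x) \<partial>LB n)"
    by (intro nn_integral_cong) (auto simp: e indicator_def)
  also have "\<dots> = (\<integral>\<^sup>+x. indicator ?B x \<partial>LB n)"
    by (rule nn_integral_SL[OF SL_transpose[OF g]]) (use B in simp)
  also have "\<dots> = emeasure (LB n) ?B" using B by simp
  also have "\<dots> = ennreal (unit_ball_vol (real n) * \<rho> ^ n)"
    using emeasure_cball_aux[of "{..<n}" \<rho>] \<rho> by simp
  finally show "emeasure (LB n) (ellipsoid n g \<rho>) = ennreal (unit_ball_vol (real n) * \<rho> ^ n)" .
qed

definition int_ball :: "nat \<Rightarrow> real mat \<Rightarrow> real \<Rightarrow> int vec set" where
  "int_ball n g \<rho> = {z \<in> carrier_vec n. vec_len (lat_pt g z) \<le> \<rho>}"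

lemma L2_set_lin_map_cube:
  assumes g: "g \<in> SL n" and z: "z \<in> carrier_vec n" and x: "x \<in> unit_cube n z"
  shows "\<bar>L2_set (lin_map n (transpose_mat g) x) {..<n} - vec_len (lat_pt g z)\<bar> \<le> mat_norm g"
proof -
  have gc: "g \<in> carrier_mat n n" using SL_carrier[OF g] .
  let ?l = "lin_map n (transpose_mat g)"
  define d where "d i = x i - real_of_int (z $ i)" for i
  have d: "\<bar>d i\<bar> \<le> 1" if "i < n" for i
  proof -
    have "x i \<in> {real_of_int (z $ i)..<real_of_int (z $ i) + 1}"
      using PiE_mem[OF x[unfolded unit_cube_def], of i] that by simp
    thus ?thesis by (simp add: d_def)
  qed
  have "L2_set (?l d) {..<n} \<le> (\<Sum>i<n. \<bar>?l d i\<bar>)" by (rule L2_set_le_sum_abs)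
  also have "\<dots> \<le> (\<Sum>i<n. \<Sum>j<n. \<bar>g $$ (j,i)\<bar>)"
  proof (rule sum_mono)
    fix i assume i: "i \<in> {..<n}"
    have "\<bar>?l d i\<bar> \<le> (\<Sum>j<n. \<bar>transpose_mat g $$ (i,j) * d j\<bar>)"
      unfolding lin_map_def using i by (simp add: sum_abs)
    also have "\<dots> \<le> (\<Sum>j<n. \<bar>g $$ (j,i)\<bar>)"
    proof (rule sum_mono)
      fix j assume j: "j \<in> {..<n}"
      have "\<bar>g $$ (j,i)\<bar> * \<bar>d j\<bar> \<le> \<bar>g $$ (j,i)\<bar> * 1" using d[of j] j by (intro mult_left_mono) auto
      thus "\<bar>transpose_mat g $$ (i,j) * d j\<bar> \<le> \<bar>g $$ (j,i)\<bar>" using i j gc by (simp add: abs_mult)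
    qed
    finally show "\<bar>?l d i\<bar> \<le> (\<Sum>j<n. \<bar>g $$ (j,i)\<bar>)" .
  qed
  also have "\<dots> = mat_norm g" unfolding mat_norm_def using gc by (subst sum.swap) simp
  finally have D: "L2_set (?l d) {..<n} \<le> mat_norm g" .
  have lx: "?l x i = ?l (\<lambda>i. real_of_int (z $ i)) i + ?l d i" "?l (\<lambda>i. real_of_int (z $ i)) i = ?l x i + - ?l d i" if "i < n" for i
    unfolding lin_map_def d_def using that by (simp_all add: sum.distrib[symmetric] sum_negf[symmetric] algebra_simps sum_subtractf)
  have e1: "L2_set (?l x) {..<n} = L2_set (\<lambda>i. ?l (\<lambda>i. real_of_int (z $ i)) i + ?l d i) {..<n}"
    by (intro L2_set_cong refl lx(1)) simp
  have e2: "L2_set (?l (\<lambda>i. real_of_int (z $ i))) {..<n} = L2_set (\<lambda>i. ?l x i + - ?l d i) {..<n}"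
    by (intro L2_set_cong refl lx(2)) simp
  have 1: "L2_set (?l x) {..<n} \<le> vec_len (lat_pt g z) + L2_set (?l d) {..<n}"
    unfolding vec_len_lat_pt[OF g z] e1 by (rule L2_set_triangle_ineq)
  have "L2_set (\<lambda>i. - ?l d i) {..<n} = L2_set (?l d) {..<n}" by (simp add: L2_set_def)
  hence 2: "vec_len (lat_pt g z) \<le> L2_set (?l x) {..<n} + L2_set (?l d) {..<n}"
    using L2_set_triangle_ineq[of "?l x" "\<lambda>i. - ?l d i" "{..<n}"] unfolding vec_len_lat_pt[OF g z] e2 by simp
  show ?thesis using 1 2 D by linarith
qed

lemma disjoint_unit_cubes: "disjoint_family_on (unit_cube n) (carrier_vec n)"
proof (unfold disjoint_family_on_def, intro ballI impI)
  fix z w :: "int vec" assume zw: "z \<in> carrier_vec n" "w \<in> carrier_vec n" "z \<noteq> w"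
  show "unit_cube n z \<inter> unit_cube n w = {}"
  proof (rule ccontr)
    assume "unit_cube n z \<inter> unit_cube n w \<noteq> {}"
    then obtain x where x: "x \<in> unit_cube n z" "x \<in> unit_cube n w" by auto
    have "x \<in> space (LB n)" using x(1) unit_cube(1)[of n z] sets.sets_into_space by blast
    hence "\<forall>i<n. z $ i = w $ i" using x unit_cube_floor by metis
    thus False using zw by (auto intro: eq_vecI)
  qed
qed

text \<open>Gauss's cube argument in the coordinates of the basis: unit cubes at the points of the
  ball are disjoint and lie in the ellipsoid of radius enlarged by \<open>mat_norm g + 1\<close>,
  and they cover the one shrunk by it. Unimodularity gives both ellipsoids the volume of
  balls.\<close>

lemma int_ball_count:
  assumes g: "g \<in> SL n" and \<rho>: "0 \<le> \<rho>"
  shows "finite (int_ball n g \<rho>)"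
    "real (card (int_ball n g \<rho>)) \<le> unit_ball_vol (real n) * (\<rho> + (mat_norm g + 1)) ^ n"
    "mat_norm g + 1 < \<rho> \<Longrightarrow> unit_ball_vol (real n) * (\<rho> - (mat_norm g + 1)) ^ n \<le> real (card (int_ball n g \<rho>))"
proof -
  let ?C = "mat_norm g + 1"
  have C: "0 < ?C" using mat_norm_nonneg[of g] by simp
  let ?U = "unit_ball_vol (real n) * (\<rho> + ?C) ^ n"
  have U0: "0 \<le> ?U" using C \<rho> by (intro mult_nonneg_nonneg) auto
  have fin: "real (card S) \<le> ?U" if S: "finite S" "S \<subseteq> int_ball n g \<rho>" for S
  proof -
    have Sc: "S \<subseteq> carrier_vec n" using S by (auto simp: int_ball_def)
    have "emeasure (LB n) (\<Union>z\<in>S. unit_cube n z) = (\<Sum>z\<in>S. emeasure (LB n) (unit_cube n z))"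
      using S unit_cube(1) disjoint_family_on_mono[OF Sc disjoint_unit_cubes]
      by (intro sum_emeasure[symmetric]) auto
    also have "\<dots> = of_nat (card S)" by (simp add: unit_cube(2))
    finally have "of_nat (card S) = emeasure (LB n) (\<Union>z\<in>S. unit_cube n z)" ..
    also have "\<dots> \<le> emeasure (LB n) (ellipsoid n g (\<rho> + ?C))"
    proof (rule emeasure_mono)
      show "(\<Union>z\<in>S. unit_cube n z) \<subseteq> ellipsoid n g (\<rho> + ?C)"
      proof
        fix x assume "x \<in> (\<Union>z\<in>S. unit_cube n z)"
        then obtain z where z: "z \<in> S" "x \<in> unit_cube n z" by auto
        have zz: "z \<in> carrier_vec n" "vec_len (lat_pt g z) \<le> \<rho>" using z S by (auto simp: int_ball_def)
        have "x \<in> space (LB n)" using z(2) unit_cube(1)[of n z] sets.sets_into_space by blast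
        thus "x \<in> ellipsoid n g (\<rho> + ?C)"
          using L2_set_lin_map_cube[OF g zz(1) z(2)] zz(2) unfolding ellipsoid_def by auto
      qed
    qed (use emeasure_ellipsoid(1)[OF g, of "\<rho> + ?C"] C \<rho> in auto)
    also have "\<dots> = ennreal ?U" using C \<rho> by (intro emeasure_ellipsoid(2)[OF g]) auto
    finally have "ennreal (real (card S)) \<le> ennreal ?U" by (simp add: ennreal_of_nat_eq_real_of_nat)
    thus ?thesis using U0 by (simp only: ennreal_le_iff)
  qed
  show f: "finite (int_ball n g \<rho>)"
  proof (rule ccontr)
    assume "infinite (int_ball n g \<rho>)"
    then obtain S where S: "finite S" "card S = nat \<lceil>?U\<rceil> + 1" "S \<subseteq> int_ball n g \<rho>"
      using infinite_arbitrarily_large by blast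
    have "real (nat \<lceil>?U\<rceil> + 1) \<le> ?U" using fin[OF S(1,3)] S(2) by simp
    thus False using U0 by linarith
  qed
  show "real (card (int_ball n g \<rho>)) \<le> ?U" by (rule fin[OF f order_refl])
  assume \<rho>C: "?C < \<rho>"
  have "ennreal (unit_ball_vol (real n) * (\<rho> - ?C) ^ n) = emeasure (LB n) (ellipsoid n g (\<rho> - ?C))"
    using \<rho>C by (intro emeasure_ellipsoid(2)[OF g, symmetric]) auto
  also have "\<dots> \<le> emeasure (LB n) (\<Union>z\<in>int_ball n g \<rho>. unit_cube n z)"
  proof (rule emeasure_mono)
    show "ellipsoid n g (\<rho> - ?C) \<subseteq> (\<Union>z\<in>int_ball n g \<rho>. unit_cube n z)"
    proof
      fix x assume "x \<in> ellipsoid n g (\<rho> - ?C)"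
      hence x: "x \<in> space (LB n)" "L2_set (lin_map n (transpose_mat g) x) {..<n} \<le> \<rho> - ?C" by (auto simp: ellipsoid_def)
      let ?z = "vec n (\<lambda>i. \<lfloor>x i\<rfloor>)"
      have z: "?z \<in> carrier_vec n" by simp
      have xz: "x \<in> unit_cube n ?z" using unit_cube_floor[OF x(1), of ?z] by simp
      have "?z \<in> int_ball n g \<rho>" using L2_set_lin_map_cube[OF g z xz] x(2) z unfolding int_ball_def by auto
      thus "x \<in> (\<Union>z\<in>int_ball n g \<rho>. unit_cube n z)" using xz by blast
    qed
    show "(\<Union>z\<in>int_ball n g \<rho>. unit_cube n z) \<in> sets (LB n)"
      using f unit_cube(1) by (intro sets.finite_UN) auto
  qed
  also have "\<dots> \<le> (\<Sum>z\<in>int_ball n g \<rho>. emeasure (LB n) (unit_cube n z))"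
    using f unit_cube(1) by (intro emeasure_subadditive_finite) auto
  also have "\<dots> = ennreal (real (card (int_ball n g \<rho>)))"
    by (simp add: unit_cube(2) ennreal_of_nat_eq_real_of_nat)
  finally show "unit_ball_vol (real n) * (\<rho> - ?C) ^ n \<le> real (card (int_ball n g \<rho>))"
    by (subst (asm) ennreal_le_iff) auto
qed

unbundle no vec_syntax

lemma lat_pt_carrier: "g \<in> SL n \<Longrightarrow> lat_pt g z \<in> carrier_vec n"
proof -
  assume "g \<in> SL n"
  hence "dim_col g = n" using SL_carrier by blast
  thus ?thesis by (intro carrier_vecI) (simp add: lat_pt_def)
qed

lemma SL_transpose_inverse:
  assumes g: "g \<in> SL n" and v: "v \<in> carrier_vec n"
  shows "transpose_mat (adj_mat g) *\<^sub>v (transpose_mat g *\<^sub>v v) = v"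
proof -
  have gc: "g \<in> carrier_mat n n" "adj_mat g \<in> carrier_mat n n" using SL_carrier SL_adj(1) g by blast+
  have "transpose_mat (adj_mat g) *\<^sub>v (transpose_mat g *\<^sub>v v) = (transpose_mat (adj_mat g) * transpose_mat g) *\<^sub>v v"
    using gc v by (intro assoc_mult_mat_vec[symmetric]) auto
  also have "transpose_mat (adj_mat g) * transpose_mat g = transpose_mat (g * adj_mat g)"
    by (rule transpose_mult[OF gc, symmetric])
  also have "\<dots> = 1\<^sub>m n" unfolding SL_adj(2)[OF g] by simp
  finally show ?thesis using v by simp
qed

lemma abs_index_le_vec_len:
  assumes "v \<in> carrier_vec n" "i < n"
  shows "\<bar>v $ i\<bar> \<le> vec_len v"
proof -
  have "\<bar>v $ i\<bar> \<le> L2_set (\<lambda>i. \<bar>v $ i\<bar>) {..<n}" using assms by (intro member_le_L2_set) auto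
  thus ?thesis unfolding vec_len_L2_set[OF assms(1)] by (simp add: L2_set_def)
qed

text \<open>Coordinates are recovered with the inverse basis. Used with radii of order p^(1/n):
  coordinates, and for n at least 3 also two-by-two minors, are then smaller than p, so p divides
  them only if they vanish.\<close>

lemma abs_coord_le:
  assumes g: "g \<in> SL n" and z: "z \<in> carrier_vec n" and i: "i < n"
  shows "\<bar>real_of_int (z $ i)\<bar> \<le> mat_norm (adj_mat g) * vec_len (lat_pt g z)"
proof -
  have ac: "adj_mat g \<in> carrier_mat n n" using SL_carrier SL_adj(1) g by blast
  have vc: "lat_pt g z \<in> carrier_vec n" by (rule lat_pt_carrier[OF g])
  have "map_vec real_of_int z = transpose_mat (adj_mat g) *\<^sub>v lat_pt g z"
    unfolding lat_pt_def by (rule SL_transpose_inverse[OF g, symmetric]) (use z in simp)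
  hence "real_of_int (z $ i) = (transpose_mat (adj_mat g) *\<^sub>v lat_pt g z) $ i" using z i by (metis index_map_vec(1) carrier_vecD)
  also have "\<dots> = (\<Sum>j<n. adj_mat g $$ (j,i) * lat_pt g z $ j)" by (rule transpose_mult_vec_index[OF ac vc i])
  finally have "\<bar>real_of_int (z $ i)\<bar> \<le> (\<Sum>j<n. \<bar>adj_mat g $$ (j,i) * lat_pt g z $ j\<bar>)" by (simp add: sum_abs)
  also have "\<dots> \<le> (\<Sum>j<n. \<bar>adj_mat g $$ (j,i)\<bar> * vec_len (lat_pt g z))"
    unfolding abs_mult using abs_index_le_vec_len[OF vc] by (intro sum_mono mult_left_mono) auto
  also have "\<dots> = (\<Sum>j<n. \<bar>adj_mat g $$ (j,i)\<bar>) * vec_len (lat_pt g z)" by (simp add: sum_distrib_right)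
  also have "\<dots> \<le> mat_norm (adj_mat g) * vec_len (lat_pt g z)"
  proof (rule mult_right_mono)
    have "(\<Sum>j<n. \<bar>adj_mat g $$ (j,i)\<bar>) \<le> (\<Sum>j<n. \<Sum>i<n. \<bar>adj_mat g $$ (j,i)\<bar>)"
      using i by (intro sum_mono member_le_sum[of i "{..<n}" "\<lambda>i. \<bar>adj_mat g $$ (_,i)\<bar>"]) auto
    thus "(\<Sum>j<n. \<bar>adj_mat g $$ (j,i)\<bar>) \<le> mat_norm (adj_mat g)" unfolding mat_norm_def using ac by simp
    show "0 \<le> vec_len (lat_pt g z)" unfolding vec_len_L2_set[OF vc] by (rule L2_set_nonneg)
  qed
  finally show ?thesis .
qed

lemma inj_on_lat_pt:
  assumes g: "g \<in> SL n"
  shows "inj_on (lat_pt g) (carrier_vec n)"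
proof (rule inj_onI)
  fix z w :: "int vec" assume zw: "z \<in> carrier_vec n" "w \<in> carrier_vec n" "lat_pt g z = lat_pt g w"
  have "map_vec real_of_int z = map_vec real_of_int w"
  proof -
    have "map_vec real_of_int z = transpose_mat (adj_mat g) *\<^sub>v lat_pt g z"
      unfolding lat_pt_def by (rule SL_transpose_inverse[OF g, symmetric]) (use zw(1) in simp)
    also have "\<dots> = map_vec real_of_int w"
      unfolding zw(3) unfolding lat_pt_def by (rule SL_transpose_inverse[OF g]) (use zw(2) in simp)
    finally show ?thesis .
  qed
  thus "z = w" by (rule of_int_hom.vec_hom_inj)
qed

lemma lat_pt_zero: "g \<in> SL n \<Longrightarrow> lat_pt g (0\<^sub>v n) = 0\<^sub>v n"
  using SL_carrier[of g n] by (intro eq_vecI) (auto simp: lat_pt_def scalar_prod_def)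

lemma lat_pt_eq_zero_iff:
  assumes "g \<in> SL n" "z \<in> carrier_vec n"
  shows "lat_pt g z = 0\<^sub>v n \<longleftrightarrow> z = 0\<^sub>v n"
  using inj_onD[OF inj_on_lat_pt[OF assms(1)], of z "0\<^sub>v n"] lat_pt_zero[OF assms(1)] assms(2) by auto

lemma countable_int_vecs: "countable (carrier_vec n :: int vec set)"
proof -
  have "carrier_vec n \<subseteq> range (vec_of_list :: int list \<Rightarrow> int vec)"
    by (metis subsetI rangeI vec_list)
  thus ?thesis by (rule countable_subset) (intro countable_image countableI_type)
qed

lemma bij_betw_lat_pt:
  assumes "g \<in> SL n"
  shows "bij_betw (lat_pt g) (carrier_vec n - {0\<^sub>v n}) (row_lattice g - {0\<^sub>v n})"
  unfolding bij_betw_def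
proof
  show "inj_on (lat_pt g) (carrier_vec n - {0\<^sub>v n})"
    by (rule inj_on_subset[OF inj_on_lat_pt[OF assms]]) auto
  show "lat_pt g ` (carrier_vec n - {0\<^sub>v n}) = row_lattice g - {0\<^sub>v n}"
    unfolding row_lattice_eq_lat_pt[OF assms] using lat_pt_eq_zero_iff[OF assms] lat_pt_zero[OF assms] by auto
qed

definition lattice_sum :: "nat \<Rightarrow> (real \<Rightarrow> ennreal) \<Rightarrow> real vec set \<Rightarrow> ennreal" where
  "lattice_sum n f L = (\<integral>\<^sup>+v. f (vec_len v) \<partial>count_space (L - {0\<^sub>v n}))"

lemma lattice_sum_row_lattice:
  assumes "g \<in> SL n"
  shows "lattice_sum n f (row_lattice g) = (\<integral>\<^sup>+z. f (vec_len (lat_pt g z)) \<partial>count_space (carrier_vec n - {0\<^sub>v n}))"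
  unfolding lattice_sum_def by (rule nn_integral_bij_count_space[OF bij_betw_lat_pt[OF assms], symmetric])

lemma measurable_vec_len_lat_pt:
  assumes z: "z \<in> carrier_vec n"
  shows "(\<lambda>g. vec_len (lat_pt g z)) \<in> borel_measurable (SL_borel n)"
proof -
  have "(\<lambda>g. sqrt (\<Sum>j<n. (\<Sum>i<n. g $$ (i,j) * real_of_int (z $ i))\<^sup>2)) \<in> borel_measurable (SL_borel n)"
    by (intro measurable_compose[OF _ borel_measurable_sqrt] borel_measurable_sum borel_measurable_power
        borel_measurable_times borel_measurable_const measurable_SL_entry) auto
  moreover
  have eq: "sqrt (\<Sum>j<n. (\<Sum>i<n. g $$ (i,j) * real_of_int (z $ i))\<^sup>2) = vec_len (lat_pt g z)" if g: "g \<in> SL n" for g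
    unfolding vec_len_L2_set[OF lat_pt_carrier[OF g]] L2_set_def
    unfolding lat_pt_def using transpose_mult_vec_index[OF SL_carrier[OF g], of "map_vec real_of_int z"] z
    by (auto intro!: sum.cong)
  hence "(\<lambda>g. sqrt (\<Sum>j<n. (\<Sum>i<n. g $$ (i,j) * real_of_int (z $ i))\<^sup>2)) \<in> borel_measurable (SL_borel n) \<longleftrightarrow>
    (\<lambda>g. vec_len (lat_pt g z)) \<in> borel_measurable (SL_borel n)"
    by (intro measurable_cong) simp
  ultimately show ?thesis by blast
qed

lemma measurable_lattice_sum:
  assumes f: "f \<in> borel_measurable borel"
  shows "lattice_sum n f \<in> borel_measurable (lattice_space n)"
proof (rule measurable_lattice_spaceI)
  let ?Z = "carrier_vec n - {0\<^sub>v n} :: int vec set"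
  have cZ: "countable ?Z" using countable_int_vecs by (rule countable_subset[rotated]) auto
  interpret sigma_finite_measure "count_space ?Z" by (rule sigma_finite_measure_count_space_countable[OF cZ])
  have "(\<lambda>(z, g). f (vec_len (lat_pt g z))) \<in> borel_measurable (count_space ?Z \<Otimes>\<^sub>M SL_borel n)"
  proof (rule measurable_pair_measure_countable1[OF cZ])
    fix z assume "z \<in> ?Z"
    hence "z \<in> carrier_vec n" by simp
    from measurable_compose[OF measurable_vec_len_lat_pt[OF this] f]
    show "(\<lambda>y. case (z, y) of (z, g) \<Rightarrow> f (vec_len (lat_pt g z))) \<in> borel_measurable (SL_borel n)" by simp
  qed
  from measurable_compose[OF measurable_pair_swap' this]
  have "(\<lambda>(g, z). f (vec_len (lat_pt g z))) \<in> borel_measurable (SL_borel n \<Otimes>\<^sub>M count_space ?Z)"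
    by (simp add: case_prod_beta)
  hence "(\<lambda>g. \<integral>\<^sup>+z. f (vec_len (lat_pt g z)) \<partial>count_space ?Z) \<in> borel_measurable (SL_borel n)"
    by (rule borel_measurable_nn_integral)
  thus "(\<lambda>g. lattice_sum n f (row_lattice g)) \<in> borel_measurable (SL_borel n)"
    by (subst measurable_cong[OF lattice_sum_row_lattice]) auto
qed auto

definition lattice_count :: "nat \<Rightarrow> real \<Rightarrow> real vec set \<Rightarrow> ennreal" where
  "lattice_count n \<rho> = lattice_sum n (indicator {..\<rho>})"

lemma measurable_lattice_count: "lattice_count n \<rho> \<in> borel_measurable (lattice_space n)"
  unfolding lattice_count_def by (rule measurable_lattice_sum) simp

lemma nn_integral_indicator_count:
  assumes "finite {x\<in>A. P x}"
  shows "(\<integral>\<^sup>+x. indicator {x. P x} x \<partial>count_space A) = of_nat (card {x\<in>A. P x})"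
proof -
  have "(\<integral>\<^sup>+x. indicator {x. P x} x \<partial>count_space A) = (\<integral>\<^sup>+x. indicator {x\<in>A. P x} x \<partial>count_space A)"
    by (intro nn_integral_cong) (auto simp: indicator_def)
  also have "\<dots> = emeasure (count_space A) {x\<in>A. P x}" by (intro nn_integral_indicator) auto
  finally show ?thesis using assms by simp
qed

lemma scale_vec_len: "0 \<le> c \<Longrightarrow> vec_len (c \<cdot>\<^sub>v v) = c * vec_len v"
proof -
  assume "0 \<le> c"
  have "scalar_prod (c \<cdot>\<^sub>v v) (c \<cdot>\<^sub>v v) = c\<^sup>2 * scalar_prod v v"
    by (auto simp: scalar_prod_def sum_distrib_left power2_eq_square intro!: sum.cong)
  thus ?thesis using \<open>0 \<le> c\<close> by (simp add: vec_len_def real_sqrt_mult)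
qed

lemma vec_len_nonneg: "0 \<le> vec_len v"
  by (auto simp: vec_len_def scalar_prod_def intro!: sum_nonneg)

text \<open>Undoing the scaling turns the count in a neighbour into a count of integer vectors in a
  ball of radius \<rho> p^(1/n) subject to one congruence; averaging over labels then becomes
  counting modulo p.\<close>

lemma lattice_count_hecke:
  assumes g: "g \<in> SL n" and p: "0 < p" and n: "0 < n" and \<rho>: "0 \<le> \<rho>"
  shows "lattice_count n \<rho> (hecke_nbr n p g a) =
    of_nat (card {z \<in> int_ball n g (\<rho> / hecke_scale n p). z \<noteq> 0\<^sub>v n \<and> int p dvd scalar_prod a z})"
proof -
  let ?s = "hecke_scale n p"
  have s: "0 < ?s" by (rule hecke_scale_power(2)[OF p n])
  let ?Z = "{z \<in> carrier_vec n. int p dvd scalar_prod a z} - {0\<^sub>v n}"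
  have z0: "?s \<cdot>\<^sub>v lat_pt g z = 0\<^sub>v n \<longleftrightarrow> z = 0\<^sub>v n" if "z \<in> carrier_vec n" for z
  proof
    assume e: "?s \<cdot>\<^sub>v lat_pt g z = 0\<^sub>v n"
    have "lat_pt g z = 0\<^sub>v n"
    proof (rule eq_vecI)
      fix i assume "i < dim_vec (0\<^sub>v n)"
      hence i: "i < n" by simp
      have "(?s \<cdot>\<^sub>v lat_pt g z) $ i = 0" using e i by simp
      thus "lat_pt g z $ i = 0\<^sub>v n $ i" using s i lat_pt_carrier[OF g, of z] by simp
    qed (use lat_pt_carrier[OF g, of z] in simp)
    thus "z = 0\<^sub>v n" using lat_pt_eq_zero_iff[OF g that] by simp
  qed (use lat_pt_zero[OF g] in \<open>auto intro!: eq_vecI\<close>)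
  have bij: "bij_betw (\<lambda>z. ?s \<cdot>\<^sub>v lat_pt g z) ?Z (hecke_nbr n p g a - {0\<^sub>v n})"
    unfolding bij_betw_def
  proof
    show "inj_on (\<lambda>z. ?s \<cdot>\<^sub>v lat_pt g z) ?Z"
    proof (rule inj_onI)
      fix z w assume zw: "z \<in> ?Z" "w \<in> ?Z" "?s \<cdot>\<^sub>v lat_pt g z = ?s \<cdot>\<^sub>v lat_pt g w"
      have "lat_pt g z = lat_pt g w"
      proof (rule eq_vecI)
        fix i assume "i < dim_vec (lat_pt g w)"
        hence i: "i < n" using lat_pt_carrier[OF g, of w] by simp
        have "(?s \<cdot>\<^sub>v lat_pt g z) $ i = (?s \<cdot>\<^sub>v lat_pt g w) $ i" using zw(3) by simp
        thus "lat_pt g z $ i = lat_pt g w $ i" using s i lat_pt_carrier[OF g, of z] lat_pt_carrier[OF g, of w] by simp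
      qed (use lat_pt_carrier[OF g, of z] lat_pt_carrier[OF g, of w] in simp)
      thus "z = w" using inj_onD[OF inj_on_lat_pt[OF g], of z w] zw by simp
    qed
    show "(\<lambda>z. ?s \<cdot>\<^sub>v lat_pt g z) ` ?Z = hecke_nbr n p g a - {0\<^sub>v n}"
      unfolding hecke_nbr_def lat_pt_def[symmetric] using z0 by (auto simp: image_iff)
  qed
  have "lattice_count n \<rho> (hecke_nbr n p g a) = (\<integral>\<^sup>+z. indicator {..\<rho>} (vec_len (?s \<cdot>\<^sub>v lat_pt g z)) \<partial>count_space ?Z)"
    unfolding lattice_count_def lattice_sum_def by (rule nn_integral_bij_count_space[OF bij, symmetric])
  also have "\<dots> = (\<integral>\<^sup>+z. indicator {z. vec_len (lat_pt g z) \<le> \<rho> / ?s} z \<partial>count_space ?Z)"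
    using s by (intro nn_integral_cong) (auto simp: indicator_def scale_vec_len field_simps)
  also have "\<dots> = of_nat (card {z\<in>?Z. vec_len (lat_pt g z) \<le> \<rho> / ?s})"
    by (rule nn_integral_indicator_count, rule finite_subset[OF _ int_ball_count(1)[OF g, of "\<rho> / ?s"]])
       (use s \<rho> in \<open>auto simp: int_ball_def\<close>)
  also have "{z\<in>?Z. vec_len (lat_pt g z) \<le> \<rho> / ?s} = {z \<in> int_ball n g (\<rho> / ?s). z \<noteq> 0\<^sub>v n \<and> int p dvd scalar_prod a z}"
    by (auto simp: int_ball_def)
  finally show ?thesis .
qed

subsection \<open>Counting solutions modulo a prime\<close>

text \<open>A minor that is nonzero modulo p makes \<open>a\<close> mapped to its two scalar
  products onto the pairs of residues. Translation by a solution of the linear system embeds each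
  fibre in any other, so all p^2 fibres have equal size.\<close>

lemma card_residue_fibres:
  assumes p: "prime p" and z: "z \<in> carrier_vec n" and w: "w \<in> carrier_vec n" and ij: "i < n" "j < n"
    and D: "\<not> int p dvd z $ i * w $ j - z $ j * w $ i"
    and st: "s \<in> {0..<int p}" "t \<in> {0..<int p}"
  shows "p\<^sup>2 * card {a \<in> residue_vecs n p. scalar_prod a z mod int p = s \<and> scalar_prod a w mod int p = t} = p ^ n"
proof -
  have p0: "0 < p" using p prime_gt_0_nat by blast
  let ?R = "residue_vecs n p"
  let ?f = "\<lambda>(s,t). {a \<in> ?R. scalar_prod a z mod int p = s \<and> scalar_prod a w mod int p = t}"
  let ?T = "{0..<int p} \<times> {0..<int p}"
  have "i \<noteq> j" using D by auto
  let ?D = "z $ i * w $ j - z $ j * w $ i"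
  have "coprime ?D (int p)" using p D prime_imp_coprime[of "int p" ?D] by (simp add: coprime_commute)
  then obtain u where u: "[?D * u = 1] (mod int p)" using cong_solve_coprime_int by blast
  \<comment> \<open>Cramer's rule in the coordinates i and j, with \<open>u\<close> the inverse of
    the minor modulo p.\<close>
  define b where "b = (\<lambda>s t. vec n (\<lambda>k. if k = i then u * (s * w $ j - t * z $ j) else if k = j then u * (t * z $ i - s * w $ i) else 0))"
  have b: "b s t \<in> carrier_vec n" for s t by (simp add: b_def)
  have sp: "scalar_prod (b s t) v = u * (s * w $ j - t * z $ j) * v $ i + u * (t * z $ i - s * w $ i) * v $ j"
    if v: "v \<in> carrier_vec n" for v s t
  proof -
    have "scalar_prod (b s t) v = (\<Sum>k<n. (if k = i then u * (s * w $ j - t * z $ j) * v $ i else 0) + (if k = j then u * (t * z $ i - s * w $ i) * v $ j else 0))"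
      unfolding int_scalar_prod_sum[OF v] using \<open>i \<noteq> j\<close> by (intro sum.cong) (auto simp: b_def)
    thus ?thesis using ij by (simp add: sum.distrib)
  qed
  have bz: "[scalar_prod (b s t) z = s] (mod int p)" for s t
  proof -
    have "scalar_prod (b s t) z = s * (?D * u)" unfolding sp[OF z] by (simp add: algebra_simps)
    also have "[\<dots> = s * 1] (mod int p)" by (intro cong_mult cong_refl u)
    finally show ?thesis by simp
  qed
  have bw: "[scalar_prod (b s t) w = t] (mod int p)" for s t
  proof -
    have "scalar_prod (b s t) w = t * (?D * u)" unfolding sp[OF w] by (simp add: algebra_simps)
    also have "[\<dots> = t * 1] (mod int p)" by (intro cong_mult cong_refl u)
    finally show ?thesis by simp
  qed
  have spm: "[scalar_prod (vec_mod p (a + c)) v = scalar_prod a v + scalar_prod c v] (mod int p)"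
    if "a \<in> carrier_vec n" "c \<in> carrier_vec n" "v \<in> carrier_vec n" for a c v
  proof -
    have "[scalar_prod (vec_mod p (a + c)) v = scalar_prod (a + c) v] (mod int p)"
      unfolding int_scalar_prod_sum[OF that(3)] using that
      by (intro cong_sum cong_mult cong_refl) (auto simp: vec_mod_def)
    thus ?thesis using add_scalar_prod_distrib[OF that] by simp
  qed
  have shift_in: "vec_mod p (a + b s t) \<in> ?f ((s0 + s) mod int p, (t0 + t) mod int p)" if a: "a \<in> ?f (s0, t0)" for a s t s0 t0
  proof -
    have ac: "a \<in> carrier_vec n" using a by (auto simp: residue_vecs_def)
    have "scalar_prod (vec_mod p (a + b s t)) z mod int p = (s0 + s) mod int p"
    proof -
      have "[scalar_prod (vec_mod p (a + b s t)) z = s0 + s] (mod int p)"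
        by (rule cong_trans[OF spm[OF ac b z]], rule cong_add[OF _ bz]) (use a in \<open>auto simp: cong_def\<close>)
      thus ?thesis by (simp add: cong_def)
    qed
    moreover have "scalar_prod (vec_mod p (a + b s t)) w mod int p = (t0 + t) mod int p"
    proof -
      have "[scalar_prod (vec_mod p (a + b s t)) w = t0 + t] (mod int p)"
        by (rule cong_trans[OF spm[OF ac b w]], rule cong_add[OF _ bw]) (use a in \<open>auto simp: cong_def\<close>)
      thus ?thesis by (simp add: cong_def)
    qed
    moreover have "vec_mod p (a + b s t) \<in> ?R" using ac b p0 by (intro vec_mod_residue) auto
    ultimately show ?thesis by simp
  qed
  have inj: "inj_on (\<lambda>a. vec_mod p (a + c)) ?R" if c: "c \<in> carrier_vec n" for c
  proof (rule inj_onI)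
    fix a a' assume a: "a \<in> ?R" "a' \<in> ?R" "vec_mod p (a + c) = vec_mod p (a' + c)"
    show "a = a'"
    proof (rule eq_vecI)
      fix k assume "k < dim_vec a'"
      hence k: "k < n" using a by (auto simp: residue_vecs_def)
      have ad: "dim_vec a = n" "dim_vec a' = n" using a by (auto simp: residue_vecs_def)
      have "vec_mod p (a + c) $ k = vec_mod p (a' + c) $ k" using a(3) by simp
      hence "(a $ k + c $ k) mod int p = (a' $ k + c $ k) mod int p"
        using k c ad by (simp add: vec_mod_def)
      hence "[a $ k = a' $ k] (mod int p)" by (simp add: cong_def[symmetric] cong_add_rcancel)
      moreover have "a $ k \<in> {0..<int p}" "a' $ k \<in> {0..<int p}" using a k by (auto simp: residue_vecs_def)
      ultimately show "a $ k = a' $ k" by (simp add: cong_def)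
    qed (use a in \<open>auto simp: residue_vecs_def\<close>)
  qed
  have fin: "finite (?f x)" for x using finite_residue_vecs[of n p] by (auto split: prod.splits)
  have le: "card (?f (s0, t0)) \<le> card (?f ((s0 + s) mod int p, (t0 + t) mod int p))" for s0 t0 s t
  proof (rule card_inj_on_le[OF _ _ fin])
    show "inj_on (\<lambda>a. vec_mod p (a + b s t)) (?f (s0, t0))" by (rule inj_on_subset[OF inj[OF b]]) auto
    show "(\<lambda>a. vec_mod p (a + b s t)) ` ?f (s0, t0) \<subseteq> ?f ((s0 + s) mod int p, (t0 + t) mod int p)"
      by (rule image_subsetI) (rule shift_in)
  qed
  have eq: "card (?f x) = card (?f (s,t))" if x: "x \<in> ?T" for x
  proof -
    obtain s' t' where x': "x = (s',t')" by (cases x)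
    have m: "s' mod int p = s'" "t' mod int p = t'" "s mod int p = s" "t mod int p = t" using x x' st by auto
    have "card (?f (s',t')) \<le> card (?f (s,t))" using le[of s' t' "s - s'" "t - t'"] m by simp
    moreover have "card (?f (s,t)) \<le> card (?f (s',t'))" using le[of s t "s' - s" "t' - t"] m by simp
    ultimately show ?thesis unfolding x' by simp
  qed
  have "card ?R = (\<Sum>a\<in>?R. 1)" by simp
  also have "\<dots> = (\<Sum>x\<in>?T. \<Sum>a\<in>{a\<in>?R. (scalar_prod a z mod int p, scalar_prod a w mod int p) = x}. 1)"
    using finite_residue_vecs p0 by (intro sum.group[symmetric]) auto
  also have "\<dots> = (\<Sum>x\<in>?T. card (?f x))" by (intro sum.cong refl) auto
  also have "\<dots> = (\<Sum>x\<in>?T. card (?f (s,t)))" by (intro sum.cong refl eq)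
  also have "\<dots> = p\<^sup>2 * card (?f (s,t))" by (simp add: power2_eq_square)
  finally show ?thesis unfolding card_residue_vecs by simp
qed

lemma card_residue_pair:
  assumes p: "prime p" and z: "z \<in> carrier_vec n" and w: "w \<in> carrier_vec n" and ij: "i < n" "j < n"
    and D: "\<not> int p dvd z $ i * w $ j - z $ j * w $ i"
  shows "real (card {a \<in> residue_vecs n p. int p dvd scalar_prod a z \<and> int p dvd scalar_prod a w}) = real p ^ n / (real p)\<^sup>2"
proof -
  have p0: "0 < p" using p prime_gt_0_nat by blast
  have "real (p\<^sup>2 * card {a \<in> residue_vecs n p. scalar_prod a z mod int p = 0 \<and> scalar_prod a w mod int p = 0}) = real (p ^ n)"
    using card_residue_fibres[OF p z w ij D, of 0 0] p0 by simp
  thus ?thesis using p0 by (simp add: dvd_eq_mod_eq_0 field_simps)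
qed

text \<open>Reduced to the two-vector count by adding a unit vector in another coordinate, which
  exists since n is at least 2, and summing over all values of its scalar product.\<close>

lemma card_residue_single:
  assumes p: "prime p" and n: "2 \<le> n" and z: "z \<in> carrier_vec n" and i: "i < n" and D: "\<not> int p dvd z $ i"
  shows "real (card {a \<in> residue_vecs n p. int p dvd scalar_prod a z}) = real p ^ n / real p"
proof -
  have p0: "0 < p" using p prime_gt_0_nat by blast
  define j where "j = (if i = 0 then 1 else 0 :: nat)"
  have j: "j < n" "j \<noteq> i" using n by (auto simp: j_def)
  define w :: "int vec" where "w = unit_vec n j"
  have w: "w \<in> carrier_vec n" by (simp add: w_def)
  have D': "\<not> int p dvd z $ i * w $ j - z $ j * w $ i" using D i j by (simp add: w_def)
  let ?R = "residue_vecs n p"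
  have "card {a \<in> ?R. int p dvd scalar_prod a z} = (\<Sum>a\<in>{a \<in> ?R. scalar_prod a z mod int p = 0}. 1)"
    by (simp add: dvd_eq_mod_eq_0)
  also have "\<dots> = (\<Sum>t\<in>{0..<int p}. \<Sum>a\<in>{a\<in>{a \<in> ?R. scalar_prod a z mod int p = 0}. scalar_prod a w mod int p = t}. 1)"
    using finite_residue_vecs[of n p] p0 by (intro sum.group[symmetric]) auto
  also have "\<dots> = (\<Sum>t\<in>{0..<int p}. card {a \<in> ?R. scalar_prod a z mod int p = 0 \<and> scalar_prod a w mod int p = t})"
    by (intro sum.cong refl) (simp add: conj_assoc)
  finally have "p\<^sup>2 * card {a \<in> ?R. int p dvd scalar_prod a z} = (\<Sum>t\<in>{0..<int p}. p\<^sup>2 * card {a \<in> ?R. scalar_prod a z mod int p = 0 \<and> scalar_prod a w mod int p = t})"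
    by (simp add: sum_distrib_left)
  also have "\<dots> = (\<Sum>t\<in>{0..<int p}. p ^ n)"
    using p0 by (intro sum.cong refl card_residue_fibres[OF p z w i j(1) D']) auto
  also have "\<dots> = p * p ^ n" by simp
  finally have "real (p\<^sup>2 * card {a \<in> ?R. int p dvd scalar_prod a z}) = real (p * p ^ n)" by simp
  hence "(real p)\<^sup>2 * real (card {a \<in> ?R. int p dvd scalar_prod a z}) = real p * real p ^ n" by simp
  thus ?thesis using p0 by (simp add: field_simps power2_eq_square)
qed

subsection \<open>Primitive integer vectors\<close>

definition int_primitive :: "nat \<Rightarrow> int vec \<Rightarrow> bool" where
  "int_primitive n z \<longleftrightarrow> z \<in> carrier_vec n \<and> (\<forall>m. (\<forall>i<n. m dvd z $ i) \<longrightarrow> is_unit m)"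

text \<open>Vanishing minors make the vectors rational multiples of each other; primitivity of each
  forces the ratio to be a unit. These pairs are exactly the exceptional ones in the second
  moment.\<close>

lemma int_primitive_dependent:
  assumes z: "int_primitive n z" and w: "int_primitive n w"
    and dep: "\<And>i j. i < n \<Longrightarrow> j < n \<Longrightarrow> z $ i * w $ j = z $ j * w $ i"
  shows "w = z \<or> w = - z"
proof -
  have zc: "z \<in> carrier_vec n" "w \<in> carrier_vec n" using z w by (auto simp: int_primitive_def)
  have "\<exists>i<n. z $ i \<noteq> 0"
  proof (rule ccontr)
    assume "\<not> ?thesis"
    hence "\<forall>i<n. 2 dvd z $ i" by auto
    hence "is_unit (2::int)" using z unfolding int_primitive_def by blast
    thus False by simp
  qed
  then obtain i where i: "i < n" "z $ i \<noteq> 0" by blast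
  define d where "d = gcd (z $ i) (w $ i)"
  have d0: "d \<noteq> 0" using i by (simp add: d_def)
  obtain a b where ab: "z $ i = a * d" "w $ i = b * d" "coprime a b"
    using gcd_coprime_exists[OF d0[unfolded d_def]] unfolding d_def by blast
  have "a dvd z $ j" if j: "j < n" for j
  proof -
    have "d * (a * w $ j) = d * (z $ j * b)" using dep[OF i(1) j] unfolding ab by (simp add: mult.commute mult.left_commute)
    hence "a * w $ j = z $ j * b" using d0 by simp
    hence "a dvd z $ j * b" by (metis dvd_triv_left)
    thus ?thesis using ab(3) by (simp add: coprime_dvd_mult_left_iff)
  qed
  hence "is_unit a" using z unfolding int_primitive_def by blast
  hence "\<bar>a\<bar> = 1" by (simp add: zdvd1_eq)
  hence a2: "a * a = 1" by (simp add: abs_if split: if_splits)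
  let ?k = "a * b"
  have k: "w $ j = ?k * z $ j" if j: "j < n" for j
  proof -
    have "d * (a * w $ j) = d * (b * z $ j)" using dep[OF i(1) j] unfolding ab by (simp add: mult.commute mult.left_commute)
    hence "a * w $ j = b * z $ j" using d0 by simp
    hence "a * (a * w $ j) = a * (b * z $ j)" by simp
    thus ?thesis using a2 by (simp add: mult.assoc[symmetric])
  qed
  hence "\<forall>j<n. ?k dvd w $ j" by auto
  hence "is_unit ?k" using w unfolding int_primitive_def by blast
  hence "\<bar>?k\<bar> = 1" by (simp add: zdvd1_eq)
  hence "?k = 1 \<or> ?k = -1" by linarith
  thus ?thesis
  proof
    assume k1: "?k = 1"
    have "w = z" using k zc unfolding k1 by (intro eq_vecI) auto
    thus ?thesis ..
  next
    assume k1: "?k = -1"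
    have "w = - z" using k zc unfolding k1 by (intro eq_vecI) auto
    thus ?thesis ..
  qed
qed

lemma int_primitive_factor:
  assumes z: "z \<in> carrier_vec n" "z \<noteq> 0\<^sub>v n"
  shows "\<exists>m w. 1 \<le> m \<and> int_primitive n w \<and> z = of_nat m \<cdot>\<^sub>v w"
proof -
  define d where "d = Gcd ((\<lambda>i. z $ i) ` {..<n})"
  obtain i where i: "i < n" "z $ i \<noteq> 0"
  proof (rule ccontr)
    assume "\<not> thesis"
    hence "\<forall>i<n. z $ i = 0" using that by blast
    hence "z = 0\<^sub>v n" using z by (intro eq_vecI) auto
    thus False using z by simp
  qed
  have dd: "d dvd z $ j" if "j < n" for j unfolding d_def using that by (intro Gcd_dvd) auto
  have d0: "d \<noteq> 0" using dd[OF i(1)] i(2) by auto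
  have "0 \<le> d" by (simp add: d_def)
  hence d1: "1 \<le> nat d" using d0 by simp
  define w where "w = vec n (\<lambda>j. z $ j div d)"
  have e: "z = int (nat d) \<cdot>\<^sub>v w"
    using z dd \<open>0 \<le> d\<close> by (intro eq_vecI) (auto simp: w_def)
  have "is_unit m" if m: "\<forall>j<n. m dvd w $ j" for m
  proof -
    have "d * m dvd z $ j" if j: "j < n" for j
    proof -
      have "d * m dvd d * w $ j" using m j by (intro mult_dvd_mono) auto
      also have "d * w $ j = z $ j" using dd[OF j] j by (simp add: w_def)
      finally show ?thesis .
    qed
    hence "d * m dvd d" unfolding d_def by (intro Gcd_greatest) (auto simp: d_def[symmetric])
    hence "d * m dvd d * 1" by simp
    thus ?thesis using d0 by (simp only: dvd_mult_cancel_left) simp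
  qed
  hence "int_primitive n w" by (simp add: int_primitive_def w_def)
  thus ?thesis using e d1 by blast
qed

section \<open>Hecke averages as p grows, and the first moment\<close>

lemma hecke_mean_le:
  assumes "\<And>L. F L \<le> K" "prime p" "0 < n"
  shows "hecke_mean n p F L \<le> K"
proof -
  have c: "0 < card (hecke_labels n p)" using card_hecke_labels_pos[OF prime_gt_1_nat] assms by blast
  have "(\<Sum>a\<in>hecke_labels n p. F (hecke_nbr n p (lattice_basis n L) a)) \<le> of_nat (card (hecke_labels n p)) * K"
    by (rule sum_bounded_above) (rule assms)
  thus ?thesis unfolding hecke_mean_def using c by (intro divide_le_posI_ennreal) auto
qed

text \<open>The threshold \<open>p0\<close> depends on the lattice, so the bound is transferred by
  dominated convergence along a sequence of primes, while the left-hand integral is the same for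
  every prime. This is why \<open>F\<close> must be bounded.\<close>

lemma hecke_limit_le:
  assumes M: "SL_invariant_prob n M" and n: "0 < n"
    and F: "F \<in> borel_measurable (lattice_space n)" and K: "\<And>L. F L \<le> ennreal K"
    and lim: "\<And>g. g \<in> SL n \<Longrightarrow> \<exists>p0. \<forall>p\<ge>p0. prime p \<longrightarrow> hecke_mean n p F (row_lattice g) \<le> ennreal c"
  shows "(\<integral>\<^sup>+L. F L \<partial>M) \<le> ennreal c"
proof -
  note MD = SL_invariantD[OF M]
  interpret prob_space M by (rule MD(1))
  have "\<forall>k::nat. \<exists>p. prime p \<and> k < p" using bigger_prime by blast
  then obtain p :: "nat \<Rightarrow> nat" where p: "\<And>k. prime (p k)" "\<And>k. k < p k" by metis
  \<comment> \<open>The maximum with c turns an eventual upper bound into convergence to c.\<close>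
  define h where "h k L = max (hecke_mean n (p k) F L) (ennreal c)" for k L
  have hm: "h k \<in> borel_measurable M" for k
    unfolding h_def using measurable_hecke_mean[OF p(1) n F, of k] MD(2)
    by (intro borel_measurable_max borel_measurable_const) (simp cong: measurable_cong_sets)
  have le: "(\<integral>\<^sup>+L. F L \<partial>M) \<le> (\<integral>\<^sup>+L. h k L \<partial>M)" for k
    unfolding nn_integral_hecke_mean[OF M p(1) n F, of k] h_def by (intro nn_integral_mono) simp
  have "(\<lambda>k. \<integral>\<^sup>+L. h k L \<partial>M) \<longlonglongrightarrow> (\<integral>\<^sup>+L. ennreal c \<partial>M)"
  proof (rule nn_integral_dominated_convergence[where w="\<lambda>_. max (ennreal K) (ennreal c)"])
    show "AE L in M. h j L \<le> max (ennreal K) (ennreal c)" for j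
      unfolding h_def by (intro AE_I2 max.mono hecke_mean_le K p n) auto
    show "(\<integral>\<^sup>+L. max (ennreal K) (ennreal c) \<partial>M) < \<infinity>" by (simp add: emeasure_space_1 max_def)
    show "AE L in M. (\<lambda>i. h i L) \<longlonglongrightarrow> ennreal c"
    proof (rule AE_I2)
      fix L assume "L \<in> space M"
      then obtain g where g: "g \<in> SL n" "L = row_lattice g" using MD(3) by auto
      obtain p0 where p0: "\<forall>p\<ge>p0. prime p \<longrightarrow> hecke_mean n p F (row_lattice g) \<le> ennreal c" using lim[OF g(1)] by blast
      have "\<forall>\<^sub>F i in sequentially. h i L = ennreal c"
        using eventually_ge_at_top[of p0]
      proof eventually_elim
        case (elim i)
        have "p0 \<le> p i" using p(2)[of i] elim by simp
        hence "hecke_mean n (p i) F L \<le> ennreal c" using p0 p(1)[of i] g(2) by blast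
        thus ?case by (simp add: h_def max_def)
      qed
      thus "(\<lambda>i. h i L) \<longlonglongrightarrow> ennreal c" by (rule tendsto_eventually)
    qed
  qed (use hm in auto)
  hence "(\<lambda>k. \<integral>\<^sup>+L. h k L \<partial>M) \<longlonglongrightarrow> ennreal c" by (simp add: emeasure_space_1)
  thus ?thesis by (rule LIMSEQ_le_const) (use le in blast)
qed

lemma inverse_hecke_scale:
  assumes "0 < p" "0 < n"
  shows "1 / hecke_scale n p = real p powr (1 / real n)" "(1 / hecke_scale n p) ^ n = real p"
proof -
  show "1 / hecke_scale n p = real p powr (1 / real n)"
    using assms by (simp add: hecke_scale_def powr_minus_divide)
  show "(1 / hecke_scale n p) ^ n = real p"
    using hecke_scale_power(1)[OF assms] by (simp add: power_one_over)
qed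

lemma hecke_scale_at_top:
  assumes n: "0 < n"
  shows "filterlim (\<lambda>p. real p powr (1 / real n)) at_top sequentially"
proof -
  have "filterlim (\<lambda>x::real. x powr (1 / real n)) at_top at_top" using n by (intro real_powr_at_top) auto
  thus ?thesis by (rule filterlim_compose[OF _ filterlim_real_sequentially])
qed

lemma int_ball_density:
  assumes g: "g \<in> SL n" and \<rho>: "0 < \<rho>"
  shows "((\<lambda>X. real (card (int_ball n g (\<rho> * X))) / X ^ n) \<longlongrightarrow> unit_ball_vol (real n) * \<rho> ^ n) at_top"
proof (rule tendsto_sandwich)
  let ?C = "mat_norm g + 1" and ?v = "unit_ball_vol (real n)"
  have C: "0 < ?C" using mat_norm_nonneg[of g] by simp
  have t0: "((\<lambda>X::real. ?C / X) \<longlongrightarrow> 0) at_top" by real_asymp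
  have "((\<lambda>X. ?v * (\<rho> - ?C / X) ^ n) \<longlongrightarrow> ?v * (\<rho> - 0) ^ n) at_top"
    by (intro tendsto_mult tendsto_power tendsto_diff tendsto_const t0)
  thus "((\<lambda>X. ?v * (\<rho> - ?C / X) ^ n) \<longlongrightarrow> ?v * \<rho> ^ n) at_top" by simp
  have "((\<lambda>X. ?v * (\<rho> + ?C / X) ^ n) \<longlongrightarrow> ?v * (\<rho> + 0) ^ n) at_top"
    by (intro tendsto_mult tendsto_power tendsto_add tendsto_const t0)
  thus "((\<lambda>X. ?v * (\<rho> + ?C / X) ^ n) \<longlongrightarrow> ?v * \<rho> ^ n) at_top" by simp
  show "\<forall>\<^sub>F X in at_top. real (card (int_ball n g (\<rho> * X))) / X ^ n \<le> ?v * (\<rho> + ?C / X) ^ n"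
    using eventually_gt_at_top[of 0]
  proof eventually_elim
    case (elim X)
    have "real (card (int_ball n g (\<rho> * X))) \<le> ?v * (\<rho> * X + ?C) ^ n"
      using elim \<rho> by (intro int_ball_count(2)[OF g]) auto
    also have "\<rho> * X + ?C = (\<rho> + ?C / X) * X" using elim by (simp add: field_simps)
    finally show ?case unfolding power_mult_distrib using elim by (simp add: pos_divide_le_eq mult.assoc)
  qed
  show "\<forall>\<^sub>F X in at_top. ?v * (\<rho> - ?C / X) ^ n \<le> real (card (int_ball n g (\<rho> * X))) / X ^ n"
    using eventually_gt_at_top[of "max 0 (?C / \<rho>)"]
  proof eventually_elim
    case (elim X)
    hence X: "0 < X" "?C < \<rho> * X" using \<rho> by (auto simp: field_simps)
    have "?v * (\<rho> * X - ?C) ^ n \<le> real (card (int_ball n g (\<rho> * X)))"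
      using X \<rho> by (intro int_ball_count(3)[OF g]) auto
    also have "\<rho> * X - ?C = (\<rho> - ?C / X) * X" using X by (simp add: field_simps)
    finally show ?case unfolding power_mult_distrib using X by (simp add: pos_le_divide_eq mult.assoc)
  qed
qed

lemma exists_coord_ge:
  assumes "z \<in> carrier_vec n" "z \<noteq> (0\<^sub>v n :: int vec)"
  shows "\<exists>i<n. z $ i \<noteq> 0"
proof (rule ccontr)
  assume "\<not> ?thesis"
  hence "z = 0\<^sub>v n" using assms by (intro eq_vecI) auto
  thus False using assms by simp
qed

lemma zero_in_int_ball: "g \<in> SL n \<Longrightarrow> 0 \<le> R \<Longrightarrow> 0\<^sub>v n \<in> int_ball n g R"
  by (simp add: int_ball_def lat_pt_zero vec_len_def)

lemma dvd_small: "int p dvd x \<Longrightarrow> \<bar>real_of_int x\<bar> < real p \<Longrightarrow> x = 0"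
  using dvd_imp_le_int[of x "int p"] by force

lemma card_double_count:
  assumes "finite A" "finite B"
  shows "(\<Sum>a\<in>A. card {z\<in>B. P a z}) = (\<Sum>z\<in>B. card {a\<in>A. P a z})"
proof -
  have "(\<Sum>a\<in>A. card {z\<in>B. P a z}) = (\<Sum>a\<in>A. \<Sum>z\<in>B. if P a z then 1 else 0)"
    using assms by (intro sum.cong refl) (simp add: sum.If_cases Int_def)
  also have "\<dots> = (\<Sum>z\<in>B. \<Sum>a\<in>A. if P a z then 1 else 0)" by (rule sum.swap)
  also have "\<dots> = (\<Sum>z\<in>B. card {a\<in>A. P a z})"
    using assms by (intro sum.cong refl) (simp add: sum.If_cases Int_def)
  finally show ?thesis .
qed

text \<open>A nonzero vector of the ball has a coordinate not divisible by p, so it satisfies the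
  congruence for p^(n-1) - 1 of the p^n - 1 labels, a proportion of at most 1/p.\<close>

lemma hecke_mean_count_le:
  assumes g: "g \<in> SL n" and p: "prime p" and n: "2 \<le> n" and \<rho>: "0 < \<rho>"
    and big: "mat_norm (adj_mat g) * (\<rho> / hecke_scale n p) < real p"
  shows "hecke_mean n p (lattice_count n \<rho>) (row_lattice g) \<le> ennreal (real (card (int_ball n g (\<rho> / hecke_scale n p))) / real p)"
proof -
  have p0: "0 < p" "1 < p" using p prime_gt_0_nat prime_gt_1_nat by blast+
  have n0: "0 < n" using n by simp
  let ?B = "int_ball n g (\<rho> / hecke_scale n p)"
  let ?Bz = "?B - {0\<^sub>v n}"
  let ?L = "hecke_labels n p"
  have s: "0 < hecke_scale n p" by (rule hecke_scale_power(2)[OF p0(1) n0])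
  have fB: "finite ?B" using s \<rho> by (intro int_ball_count(1)[OF g]) auto
  have cL: "real (card ?L) = real p ^ n - 1"
    using card_hecke_labels[OF p0(1), of n] p0 by (simp add: of_nat_diff)
  have P1: "1 < real p ^ n" using p0(2) n0 one_less_power[of "real p" n] by simp
  have cz: "real (card {a\<in>?L. int p dvd scalar_prod a z}) = real p ^ n / real p - 1" if z: "z \<in> ?Bz" for z
  proof -
    have zc: "z \<in> carrier_vec n" "vec_len (lat_pt g z) \<le> \<rho> / hecke_scale n p" "z \<noteq> 0\<^sub>v n" using z by (auto simp: int_ball_def)
    obtain i where i: "i < n" "z $ i \<noteq> 0" using exists_coord_ge[OF zc(1,3)] by blast
    have "\<bar>real_of_int (z $ i)\<bar> \<le> mat_norm (adj_mat g) * vec_len (lat_pt g z)" by (rule abs_coord_le[OF g zc(1) i(1)])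
    also have "\<dots> \<le> mat_norm (adj_mat g) * (\<rho> / hecke_scale n p)"
      using zc(2) mat_norm_nonneg by (intro mult_left_mono) auto
    finally have "\<bar>real_of_int (z $ i)\<bar> < real p" using big by simp
    hence nd: "\<not> int p dvd z $ i" using dvd_small i(2) by blast
    let ?R = "{a\<in>residue_vecs n p. int p dvd scalar_prod a z}"
    have "0\<^sub>v n \<in> ?R" using zero_residue_vecs[OF p0(1)] zc(1) by simp
    moreover have "{a\<in>?L. int p dvd scalar_prod a z} = ?R - {0\<^sub>v n}" by (auto simp: hecke_labels_def)
    moreover have "finite ?R" using finite_residue_vecs by simp
    ultimately have "card {a\<in>?L. int p dvd scalar_prod a z} = card ?R - 1" "0 < card ?R" by (auto simp: card_gt_0_iff)
    thus ?thesis using card_residue_single[OF p n zc(1) i(1) nd] by (simp add: of_nat_diff)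
  qed
  have "(\<Sum>a\<in>?L. lattice_count n \<rho> (hecke_nbr n p g a)) = (\<Sum>a\<in>?L. of_nat (card {z\<in>?Bz. int p dvd scalar_prod a z}))"
    using lattice_count_hecke[OF g p0(1) n0, of \<rho>] \<rho> by (intro sum.cong refl) (auto intro!: arg_cong[of _ _ card])
  also have "\<dots> = of_nat (\<Sum>a\<in>?L. card {z\<in>?Bz. int p dvd scalar_prod a z})" by simp
  also have "(\<Sum>a\<in>?L. card {z\<in>?Bz. int p dvd scalar_prod a z}) = (\<Sum>z\<in>?Bz. card {a\<in>?L. int p dvd scalar_prod a z})"
    using finite_hecke_labels fB by (intro card_double_count) auto
  finally have "(\<Sum>a\<in>?L. lattice_count n \<rho> (hecke_nbr n p g a)) = ennreal (\<Sum>z\<in>?Bz. real (card {a\<in>?L. int p dvd scalar_prod a z}))"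
    by (simp add: ennreal_of_nat_eq_real_of_nat)
  also have "(\<Sum>z\<in>?Bz. real (card {a\<in>?L. int p dvd scalar_prod a z})) = real (card ?Bz) * (real p ^ n / real p - 1)"
    using cz by simp
  finally have sum: "(\<Sum>a\<in>?L. lattice_count n \<rho> (hecke_nbr n p g a)) = ennreal (real (card ?Bz) * (real p ^ n / real p - 1))" .
  have "real (card ?Bz) * (real p ^ n / real p - 1) \<le> real (card ?B) * ((real p ^ n - 1) / real p)"
  proof (rule mult_mono)
    show "real (card ?Bz) \<le> real (card ?B)" using fB by (intro of_nat_mono card_mono) auto
    show "real p ^ n / real p - 1 \<le> (real p ^ n - 1) / real p" using p0 by (simp add: field_simps)
    show "0 \<le> real p ^ n / real p - 1"
    proof -
      have "real p ^ 1 \<le> real p ^ n" using p0 n0 by (intro power_increasing) auto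
      thus ?thesis using p0 by (simp add: field_simps)
    qed
  qed auto
  hence "ennreal (real (card ?Bz) * (real p ^ n / real p - 1)) \<le> ennreal (real (card ?L)) * ennreal (real (card ?B) / real p)"
    using P1 by (subst ennreal_mult[symmetric]) (auto simp: cL field_simps intro!: ennreal_leI)
  thus ?thesis unfolding hecke_mean_row_lattice[OF p0(1) g] sum
    using card_hecke_labels_pos[OF p0(2) n0] by (intro divide_le_posI_ennreal) (auto simp: ennreal_of_nat_eq_real_of_nat)
qed

lemma hecke_mean_mono: "(\<And>L. F L \<le> G L) \<Longrightarrow> hecke_mean n p F L \<le> hecke_mean n p G L"
  unfolding hecke_mean_def by (intro divide_right_mono_ennreal sum_mono) auto

text \<open>Applied with k = 1 to single coordinates and k = 2 to two-by-two minors; this is where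
  the first moment requires n at least 2 and the second n at least 3.\<close>

lemma powr_le_linear_at_top:
  assumes "0 < n" "real n > k" "0 \<le> k"
  shows "\<forall>\<^sub>F p in sequentially. c * (real p powr (1 / real n)) powr k < real p"
proof -
  have "filterlim (\<lambda>x::real. x powr (1 - k / real n)) at_top at_top"
    using assms by (intro real_powr_at_top) (auto simp: field_simps)
  hence "filterlim (\<lambda>p. real p powr (1 - k / real n)) at_top sequentially"
    by (rule filterlim_compose[OF _ filterlim_real_sequentially])
  hence "\<forall>\<^sub>F p in sequentially. c < real p powr (1 - k / real n)" by (simp add: filterlim_at_top_dense)
  thus ?thesis using eventually_gt_at_top[of 0]
  proof eventually_elim
    case (elim p)
    have "c * (real p powr (1 / real n)) powr k = c * real p powr (k / real n)" by (simp add: powr_powr)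
    also have "\<dots> < real p powr (1 - k / real n) * real p powr (k / real n)"
      using elim by (intro mult_strict_right_mono) auto
    also have "\<dots> = real p" using elim by (simp add: powr_add[symmetric])
    finally show ?case .
  qed
qed

text \<open>The upper half of Siegel's mean value theorem: the integral does not change when the count is
  averaged over the Hecke neighbours of prime index \<open>p\<close>, and that average is bounded by the volume in
  the limit.\<close>

theorem lattice_count_mean_le:
  assumes M: "SL_invariant_prob n M" and n: "2 \<le> n" and \<rho>: "0 < \<rho>"
  shows "(\<integral>\<^sup>+L. lattice_count n \<rho> L \<partial>M) \<le> ennreal (unit_ball_vol (real n) * \<rho> ^ n)"
proof (rule ennreal_le_epsilon)
  fix e :: real assume e: "0 < e"
  note MD = SL_invariantD[OF M]
  have n0: "0 < n" using n by simp
  let ?V = "unit_ball_vol (real n) * \<rho> ^ n"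
  have V0: "0 \<le> ?V" using \<rho> by simp
  \<comment> \<open>The count is truncated at K to make it bounded; monotone convergence removes K
    at the end.\<close>
  have bd: "(\<integral>\<^sup>+L. min (of_nat K) (lattice_count n \<rho> L) \<partial>M) \<le> ennreal (?V + e)" for K :: nat
  proof (rule hecke_limit_le[OF M n0, where K="real K"])
    show "(\<lambda>L. min (of_nat K) (lattice_count n \<rho> L)) \<in> borel_measurable (lattice_space n)"
      by (intro borel_measurable_min borel_measurable_const measurable_lattice_count)
    show "min (of_nat K) (lattice_count n \<rho> L) \<le> ennreal (real K)" for L
      by (simp add: ennreal_of_nat_eq_real_of_nat)
    fix g assume g: "g \<in> SL n"
    have "\<forall>\<^sub>F X in at_top. real (card (int_ball n g (\<rho> * X))) / X ^ n < ?V + e"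
      using int_ball_density[OF g \<rho>] e by (intro order_tendstoD) auto
    hence "\<forall>\<^sub>F p in sequentially. real (card (int_ball n g (\<rho> * real p powr (1 / real n)))) / (real p powr (1 / real n)) ^ n < ?V + e"
      by (rule eventually_compose_filterlim[OF _ hecke_scale_at_top[OF n0]])
    moreover have "\<forall>\<^sub>F p in sequentially. (mat_norm (adj_mat g) * \<rho>) * (real p powr (1 / real n)) powr 1 < real p"
      using n by (intro powr_le_linear_at_top) auto
    ultimately have "\<forall>\<^sub>F p in sequentially. prime p \<longrightarrow> hecke_mean n p (\<lambda>L. min (of_nat K) (lattice_count n \<rho> L)) (row_lattice g) \<le> ennreal (?V + e)"
      using eventually_gt_at_top[of 0]
    proof eventually_elim
      case (elim p)
      show ?case
      proof
        assume p: "prime p"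
        have X: "\<rho> / hecke_scale n p = \<rho> * real p powr (1 / real n)" "(real p powr (1 / real n)) ^ n = real p"
          using inverse_hecke_scale[of p n] elim(3) n0 by (simp_all add: divide_inverse)
        have "hecke_mean n p (\<lambda>L. min (of_nat K) (lattice_count n \<rho> L)) (row_lattice g) \<le> hecke_mean n p (lattice_count n \<rho>) (row_lattice g)"
          by (intro hecke_mean_mono) simp
        also have "\<dots> \<le> ennreal (real (card (int_ball n g (\<rho> / hecke_scale n p))) / real p)"
          using elim(2,3) by (intro hecke_mean_count_le[OF g p n \<rho>]) (simp add: X mult.assoc)
        also have "\<dots> \<le> ennreal (?V + e)" using elim(1) unfolding X by (intro ennreal_leI) simp
        finally show "hecke_mean n p (\<lambda>L. min (of_nat K) (lattice_count n \<rho> L)) (row_lattice g) \<le> ennreal (?V + e)" .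
      qed
    qed
    thus "\<exists>p0. \<forall>p\<ge>p0. prime p \<longrightarrow> hecke_mean n p (\<lambda>L. min (of_nat K) (lattice_count n \<rho> L)) (row_lattice g) \<le> ennreal (?V + e)"
      by (simp add: eventually_sequentially)
  qed
  have cm: "lattice_count n \<rho> \<in> borel_measurable M"
    using measurable_lattice_count MD(2) by (simp cong: measurable_cong_sets)
  have "(\<integral>\<^sup>+L. lattice_count n \<rho> L \<partial>M) = (\<integral>\<^sup>+L. (SUP K. min (of_nat K) (lattice_count n \<rho> L)) \<partial>M)"
  proof (rule nn_integral_cong)
    fix L
    have "(SUP K. min (of_nat K) (lattice_count n \<rho> L)) = min (SUP K. of_nat K) (lattice_count n \<rho> L)"
      using inf_SUP[of "lattice_count n \<rho> L" of_nat UNIV] by (simp add: inf_min min.commute)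
    thus "lattice_count n \<rho> L = (SUP K. min (of_nat K) (lattice_count n \<rho> L))"
      by (simp add: ennreal_SUP_of_nat_eq_top min_def top_unique)
  qed
  also have "\<dots> = (SUP K. \<integral>\<^sup>+L. min (of_nat K) (lattice_count n \<rho> L) \<partial>M)"
    using cm by (intro nn_integral_monotone_convergence_SUP) (auto simp: incseq_def le_fun_def min_le_iff_disj intro!: min.mono)
  also have "\<dots> \<le> ennreal (?V + e)" by (intro SUP_least bd)
  finally show "(\<integral>\<^sup>+L. lattice_count n \<rho> L \<partial>M) \<le> ennreal ?V + ennreal e" using e V0 by simp
qed

subsection \<open>Density of primitive vectors\<close>

lemma lat_pt_smult:
  assumes "g \<in> SL n" "w \<in> carrier_vec n"
  shows "lat_pt g (of_nat m \<cdot>\<^sub>v w) = real m \<cdot>\<^sub>v lat_pt g w"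
proof -
  have "map_vec real_of_int (of_nat m \<cdot>\<^sub>v w) = real m \<cdot>\<^sub>v map_vec real_of_int w" by (intro eq_vecI) auto
  thus ?thesis unfolding lat_pt_def using SL_carrier[OF assms(1)] assms(2) by (simp add: mult_mat_vec[of _ n n])
qed

text \<open>The series is zeta(n) - 1; for n at least 3 it is dominated by half of a telescoping
  series with sum 1.\<close>

lemma sum_inverse_power_le_half:
  assumes n: "3 \<le> n"
  shows "summable (\<lambda>k. 1 / (real k + 2) ^ n)" "(\<Sum>k. 1 / (real k + 2) ^ n) \<le> 1 / 2"
proof -
  have le: "1 / (real k + 2) ^ n \<le> (1 / (real k + 1) - 1 / (real (Suc k) + 1)) / 2" for k
  proof -
    have "2 * ((real k + 1) * (real k + 2)) \<le> (real k + 2) ^ 3"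
      by (simp add: power3_eq_cube algebra_simps)
    also have "\<dots> \<le> (real k + 2) ^ n" using n by (intro power_increasing) auto
    finally have "1 / (real k + 2) ^ n \<le> 1 / (2 * ((real k + 1) * (real k + 2)))"
      by (intro divide_left_mono) auto
    also have "\<dots> = (1 / (real k + 1) - 1 / (real (Suc k) + 1)) / 2" by (simp add: field_simps)
    finally show ?thesis .
  qed
  have "(\<lambda>k. 1 / (real k + 1)) \<longlonglongrightarrow> 0" by real_asymp
  from telescope_sums'[OF this]
  have "(\<lambda>k. 1 / (real k + 1) - 1 / (real (Suc k) + 1)) sums 1" by simp
  from sums_divide[OF this, of 2]
  have s: "(\<lambda>k. (1 / (real k + 1) - 1 / (real (Suc k) + 1)) / 2) sums (1/2)" by simp
  show sm: "summable (\<lambda>k. 1 / (real k + 2) ^ n)"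
    by (rule summable_comparison_test'[OF sums_summable[OF s], of 0]) (use le in auto)
  show "(\<Sum>k. 1 / (real k + 2) ^ n) \<le> 1 / 2"
    using suminf_le[OF le sm sums_summable[OF s]] sums_unique[OF s] by simp
qed

text \<open>A nonzero vector that is not primitive is k + 2 times a nonzero vector of a smaller
  ball. In the limit these account for at most zeta(n) - 1, hence one half, of the volume. Tannery's
  theorem exchanges limit and sum over k; the constant 1/4 leaves slack for the limit.\<close>

lemma primitive_density:
  assumes g: "g \<in> SL n" and n: "3 \<le> n" and \<rho>: "0 < \<rho>"
  shows "\<forall>\<^sub>F X in at_top. unit_ball_vol (real n) * \<rho> ^ n / 4 * X ^ n \<le> real (card {z \<in> int_ball n g (\<rho> * X). int_primitive n z})"
proof -
  let ?v = "unit_ball_vol (real n)" and ?C = "mat_norm g + 1" and ?\<kappa> = "mat_norm (adj_mat g)"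
  have v0: "0 < ?v" by simp
  have C: "0 < ?C" using mat_norm_nonneg[of g] by simp
  have \<kappa>: "0 \<le> ?\<kappa>" by (rule mat_norm_nonneg)
  define a where "a k X = (real (card (int_ball n g (\<rho> / (real k + 2) * X))) - 1) / X ^ n" for k :: nat and X
  define b where "b k = ?v * (\<rho> / (real k + 2)) ^ n" for k :: nat
  \<comment> \<open>The dominating constant. A ball that is too small contains only zero and
    contributes nothing; otherwise \<open>?\<kappa> * ?R\<close> is at least 1, and the additive
    error \<open>?C\<close> of the cube count is absorbed into a factor of the radius.\<close>
  define B where "B = ?v * (\<rho> * (1 + ?C * ?\<kappa>)) ^ n"
  have fin: "finite (int_ball n g R)" if "0 \<le> R" for R by (rule int_ball_count(1)[OF g that])
  have card1: "1 \<le> card (int_ball n g R)" if "0 \<le> R" for R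
    using fin[OF that] zero_in_int_ball[OF g that] by (simp add: Suc_le_eq card_gt_0_iff) blast
  have trivial_ball: "int_ball n g R = {0\<^sub>v n}" if R: "0 \<le> R" "?\<kappa> * R < 1" for R
  proof (intro equalityI subsetI)
    fix z assume z: "z \<in> int_ball n g R"
    hence zc: "z \<in> carrier_vec n" "vec_len (lat_pt g z) \<le> R" by (auto simp: int_ball_def)
    show "z \<in> {0\<^sub>v n}"
    proof (rule ccontr)
      assume "z \<notin> {0\<^sub>v n}"
      then obtain i where i: "i < n" "z $ i \<noteq> 0" using exists_coord_ge[OF zc(1)] by auto
      have "1 \<le> \<bar>real_of_int (z $ i)\<bar>" using i(2) by linarith
      also have "\<dots> \<le> ?\<kappa> * vec_len (lat_pt g z)" by (rule abs_coord_le[OF g zc(1) i(1)])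
      also have "\<dots> \<le> ?\<kappa> * R" using zc(2) \<kappa> by (intro mult_left_mono)
      finally show False using R by simp
    qed
  qed (use zero_in_int_ball[OF g R(1)] in auto)
  have abd: "0 \<le> a k X" "a k X \<le> B * (1 / (real k + 2) ^ n)" if X: "0 < X" for k X
  proof -
    let ?R = "\<rho> / (real k + 2) * X"
    have R: "0 < ?R" using \<rho> X by simp
    show "0 \<le> a k X" using card1[of ?R] R X by (simp add: a_def)
    show "a k X \<le> B * (1 / (real k + 2) ^ n)"
    proof (cases "?\<kappa> * ?R < 1")
      case True
      have "a k X = 0" unfolding a_def using trivial_ball[OF _ True] R by simp
      moreover have "0 \<le> B" unfolding B_def using \<rho> C \<kappa> by simp
      ultimately show ?thesis by simp
    next
      case False
      have "real (card (int_ball n g ?R)) - 1 \<le> ?v * (?R + ?C) ^ n"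
        using int_ball_count(2)[OF g, of ?R] R by simp
      also have "\<dots> \<le> ?v * (?R * (1 + ?C * ?\<kappa>)) ^ n"
      proof (intro mult_left_mono power_mono)
        have "?C * 1 \<le> ?C * (?\<kappa> * ?R)" using False C by (intro mult_left_mono) auto
        thus "?R + ?C \<le> ?R * (1 + ?C * ?\<kappa>)" by (simp add: algebra_simps)
      qed (use R C in auto)
      also have "\<dots> = B * (1 / (real k + 2) ^ n) * X ^ n"
        unfolding B_def by (simp add: power_mult_distrib power_divide)
      finally show ?thesis using X unfolding a_def by (simp add: divide_le_eq)
    qed
  qed
  have lim: "((\<lambda>X. a k X) \<longlongrightarrow> b k) at_top" for k
  proof -
    have "((\<lambda>X. real (card (int_ball n g (\<rho> / (real k + 2) * X))) / X ^ n - 1 / X ^ n) \<longlongrightarrow> b k - 0) at_top"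
    proof (rule tendsto_diff)
      show "((\<lambda>X. real (card (int_ball n g (\<rho> / (real k + 2) * X))) / X ^ n) \<longlongrightarrow> b k) at_top"
        unfolding b_def using \<rho> by (intro int_ball_density[OF g]) auto
      have "filterlim (\<lambda>X::real. X ^ n) at_top at_top" using n by (intro filterlim_pow_at_top filterlim_ident) auto
      thus "((\<lambda>X::real. 1 / X ^ n) \<longlongrightarrow> 0) at_top"
        by (intro tendsto_divide_0[OF tendsto_const] filterlim_at_top_imp_at_infinity)
    qed
    thus ?thesis unfolding a_def by (simp add: diff_divide_distrib)
  qed
  note hs = sum_inverse_power_le_half[OF n]
  have "\<forall>\<^sub>F (k, X) in at_top \<times>\<^sub>F at_top. norm (a k X) \<le> B * (1 / (real k + 2) ^ n)"
  proof -
    have "\<forall>\<^sub>F x in at_top \<times>\<^sub>F (at_top :: real filter). 0 < snd x"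
      by (rule eventually_compose_filterlim[OF eventually_gt_at_top filterlim_snd])
    thus ?thesis by eventually_elim (use abd in \<open>auto simp: case_prod_beta\<close>)
  qed
  from tannerys_theorem[OF lim this summable_mult[OF hs(1)]]
  have T: "\<forall>\<^sub>F X in at_top. summable (\<lambda>k. norm (a k X))" "((\<lambda>X. \<Sum>k. a k X) \<longlongrightarrow> (\<Sum>k. b k)) at_top"
    by (auto simp: eventually_conj_iff)
  have "(\<Sum>k. b k) = ?v * \<rho> ^ n * (\<Sum>k. 1 / (real k + 2) ^ n)"
    unfolding b_def by (subst suminf_mult[OF hs(1), symmetric]) (simp add: power_divide)
  also have "\<dots> \<le> ?v * \<rho> ^ n * (1/2)" using hs(2) v0 \<rho> by (intro mult_left_mono) auto
  finally have bsum: "(\<Sum>k. b k) \<le> ?v * \<rho> ^ n / 2" by simp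
  have "((\<lambda>X. real (card (int_ball n g (\<rho> * X))) / X ^ n - 1 / X ^ n - (\<Sum>k. a k X)) \<longlongrightarrow> ?v * \<rho> ^ n - 0 - (\<Sum>k. b k)) at_top"
  proof (intro tendsto_diff int_ball_density[OF g \<rho>] T(2))
    have "filterlim (\<lambda>X::real. X ^ n) at_top at_top" using n by (intro filterlim_pow_at_top filterlim_ident) auto
    thus "((\<lambda>X::real. 1 / X ^ n) \<longlongrightarrow> 0) at_top"
      by (intro tendsto_divide_0[OF tendsto_const] filterlim_at_top_imp_at_infinity)
  qed
  moreover have "?v * \<rho> ^ n / 4 < ?v * \<rho> ^ n - 0 - (\<Sum>k. b k)"
  proof -
    have "0 < ?v * \<rho> ^ n" using v0 \<rho> by simp
    thus ?thesis using bsum by linarith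
  qed
  ultimately have "\<forall>\<^sub>F X in at_top. ?v * \<rho> ^ n / 4 < real (card (int_ball n g (\<rho> * X))) / X ^ n - 1 / X ^ n - (\<Sum>k. a k X)"
    by (intro order_tendstoD(1))
  thus ?thesis using T(1) eventually_gt_at_top[of 0]
  proof eventually_elim
    case (elim X)
    let ?R = "\<rho> * X"
    have R: "0 < ?R" using elim \<rho> by simp
    have sa: "summable (\<lambda>k. a k X)" by (rule summable_norm_cancel[OF elim(2)])
    let ?S = "{z \<in> int_ball n g ?R. int_primitive n z}"
    let ?J = "\<lambda>k. int_ball n g (\<rho> / (real k + 2) * X) - {0\<^sub>v n}"
    let ?I = "\<lambda>k. (\<lambda>w. of_nat (k + 2) \<cdot>\<^sub>v w) ` ?J k"
    \<comment> \<open>Only finitely many k occur: a multiple by k + 2 has a coordinate of size at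
      least k + 2, and coordinates are at most \<open>?\<kappa> * ?R\<close>.\<close>
    define m0 where "m0 = nat \<lceil>?\<kappa> * ?R\<rceil>"
    have "int_ball n g ?R \<subseteq> insert (0\<^sub>v n) (?S \<union> (\<Union>k<m0. ?I k))"
    proof
      fix z assume z: "z \<in> int_ball n g ?R"
      hence zc: "z \<in> carrier_vec n" "vec_len (lat_pt g z) \<le> ?R" by (auto simp: int_ball_def)
      show "z \<in> insert (0\<^sub>v n) (?S \<union> (\<Union>k<m0. ?I k))"
      proof (cases "z = 0\<^sub>v n \<or> int_primitive n z")
        case True thus ?thesis using z by auto
      next
        case False
        then obtain m w where m: "1 \<le> m" "int_primitive n w" "z = of_nat m \<cdot>\<^sub>v w"
          using int_primitive_factor[OF zc(1)] by blast
        have wc: "w \<in> carrier_vec n" using m by (simp add: int_primitive_def)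
        have "m \<noteq> 1" using m False wc by auto
        then obtain k where k: "m = k + 2" using m(1) by (metis add_2_eq_Suc' le_neq_implies_less less_iff_Suc_add plus_1_eq_Suc add.commute)
        have w0: "w \<noteq> 0\<^sub>v n" using m(3) False by auto
        have vl: "vec_len (lat_pt g z) = (real k + 2) * vec_len (lat_pt g w)"
          unfolding m(3) lat_pt_smult[OF g wc] k by (simp add: scale_vec_len)
        hence "vec_len (lat_pt g w) \<le> \<rho> / (real k + 2) * X" using zc(2) by (simp add: field_simps)
        hence wb: "w \<in> ?J k" using wc w0 by (simp add: int_ball_def)
        obtain i where i: "i < n" "w $ i \<noteq> 0" using exists_coord_ge[OF wc w0] by blast
        have "real k + 2 \<le> (real k + 2) * \<bar>real_of_int (w $ i)\<bar>" using i(2) by (simp add: mult_le_cancel_left1)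
        also have "\<dots> \<le> (real k + 2) * (?\<kappa> * vec_len (lat_pt g w))"
          by (intro mult_left_mono abs_coord_le[OF g wc i(1)]) auto
        also have "\<dots> = ?\<kappa> * vec_len (lat_pt g z)" unfolding vl by simp
        also have "\<dots> \<le> ?\<kappa> * ?R" using zc(2) \<kappa> by (intro mult_left_mono)
        finally have "k < m0" unfolding m0_def by linarith
        thus ?thesis using wb m(3) k by blast
      qed
    qed
    hence "card (int_ball n g ?R) \<le> card (insert (0\<^sub>v n) (?S \<union> (\<Union>k<m0. ?I k)))"
      using fin R elim(3) \<rho> by (intro card_mono) auto
    also have "\<dots> \<le> 1 + card (?S \<union> (\<Union>k<m0. ?I k))"
      by (simp add: card_insert_le_m1 card_insert_if)
    also have "\<dots> \<le> 1 + (card ?S + (\<Sum>k<m0. card (?J k)))"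
    proof -
      have "card (\<Union>k<m0. ?I k)
        \<le> (\<Sum>k<m0. card (?I k))"
        by (intro card_UN_le) simp
      also have "\<dots> \<le> (\<Sum>k<m0. card (?J k))"
        using fin elim(3) \<rho> by (intro sum_mono card_image_le) auto
      finally show ?thesis using card_Un_le[of ?S "\<Union>k<m0. ?I k"] by linarith
    qed
    finally have c1: "card (int_ball n g ?R) \<le> 1 + (card ?S + (\<Sum>k<m0. card (?J k)))" .
    have c2: "real (card (?J k)) = a k X * X ^ n" for k
    proof -
      have R': "0 \<le> \<rho> / (real k + 2) * X" using elim(3) \<rho> by simp
      have "card (?J k) = card (int_ball n g (\<rho> / (real k + 2) * X)) - 1"
        using zero_in_int_ball[OF g R'] fin[OF R'] by simp
      thus ?thesis using card1[OF R'] elim(3) by (simp add: a_def of_nat_diff)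
    qed
    have "real (card (int_ball n g ?R)) \<le> real (1 + (card ?S + (\<Sum>k<m0. card (?J k))))"
      using c1 by (rule of_nat_mono)
    also have "\<dots> = 1 + (real (card ?S) + (\<Sum>k<m0. a k X) * X ^ n)" by (simp only: of_nat_add of_nat_sum of_nat_1 c2 sum_distrib_right)
    also have "\<dots> \<le> 1 + (real (card ?S) + (\<Sum>k. a k X) * X ^ n)"
      using elim(3) abd(1)[OF elim(3)] by (intro add_left_mono mult_right_mono sum_le_suminf sa) auto
    finally have "real (card (int_ball n g ?R)) - 1 - (\<Sum>k. a k X) * X ^ n \<le> real (card ?S)" by simp
    moreover have "?v * \<rho> ^ n / 4 * X ^ n \<le> (real (card (int_ball n g ?R)) / X ^ n - 1 / X ^ n - (\<Sum>k. a k X)) * X ^ n"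
      using elim by (intro mult_right_mono) auto
    moreover have "(real (card (int_ball n g ?R)) / X ^ n - 1 / X ^ n - (\<Sum>k. a k X)) * X ^ n = real (card (int_ball n g ?R)) - 1 - (\<Sum>k. a k X) * X ^ n"
      using elim(3) by (simp add: field_simps)
    ultimately show ?case by linarith
  qed
qed


subsection \<open>Second moment\<close>

text \<open>Chebyshev over a uniform label. Solutions at z and w are pairwise independent unless w =
  z or w = - z, so the variance is at most twice the mean \<mu>; falling below \<mu>/2 then has
  probability at most 2\<mu> / (\<mu>/2)^2 = 8/\<mu>.\<close>

lemma residue_second_moment:
  assumes p: "prime p" and n: "2 \<le> n" and fS: "finite S"
    and prim: "\<And>z. z \<in> S \<Longrightarrow> int_primitive n z"
    and small: "\<And>z w i j. z \<in> S \<Longrightarrow> w \<in> S \<Longrightarrow> i < n \<Longrightarrow> j < n \<Longrightarrow> \<bar>real_of_int (z $ i * w $ j - z $ j * w $ i)\<bar> < real p"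
    and \<mu>: "\<mu> = real (card S) / real p" "0 < \<mu>"
  shows "real (card {a \<in> residue_vecs n p. real (card {z\<in>S. int p dvd scalar_prod a z}) < \<mu> / 2}) \<le> 8 * real p ^ n / \<mu>"
proof -
  have p0: "0 < p" "1 < p" using p prime_gt_0_nat prime_gt_1_nat by blast+
  let ?R = "residue_vecs n p" and ?P = "real p ^ n"
  have fR: "finite ?R" by (rule finite_residue_vecs)
  define Z where "Z a = real (card {z\<in>S. int p dvd scalar_prod a z})" for a
  have zc: "z \<in> carrier_vec n" if "z \<in> S" for z using prim[OF that] by (simp add: int_primitive_def)
  have single: "real (card {a\<in>?R. int p dvd scalar_prod a z}) = ?P / real p" if z: "z \<in> S" for z
  proof -
    have "\<not> is_unit (int p)" using p0 by simp
    hence "\<exists>i<n. \<not> int p dvd z $ i" using prim[OF z] unfolding int_primitive_def by blast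
    thus ?thesis using card_residue_single[OF p n zc[OF z]] by blast
  qed
  have pair: "real (card {a\<in>?R. int p dvd scalar_prod a z \<and> int p dvd scalar_prod a w}) \<le>
      ?P / (real p)\<^sup>2 + (if w = z then ?P / real p else 0) + (if w = - z then ?P / real p else 0)"
    if zw: "z \<in> S" "w \<in> S" for z w
  proof (cases "w = z \<or> w = - z")
    case True
    have "card {a\<in>?R. int p dvd scalar_prod a z \<and> int p dvd scalar_prod a w} \<le> card {a\<in>?R. int p dvd scalar_prod a z}"
      using fR by (intro card_mono) auto
    hence le: "real (card {a\<in>?R. int p dvd scalar_prod a z \<and> int p dvd scalar_prod a w}) \<le> ?P / real p"
      using single[OF zw(1)] by linarith
    have gen: "x \<le> v + (if P then u else 0) + (if Q then u else 0)"
      if "x \<le> u" "0 \<le> v" "0 \<le> u" "P \<or> Q" for x u v :: real and P Q using that by auto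
    show ?thesis by (rule gen[OF le _ _ True]) auto
  next
    case False
    have "\<exists>i j. i < n \<and> j < n \<and> z $ i * w $ j \<noteq> z $ j * w $ i"
      using int_primitive_dependent[OF prim[OF zw(1)] prim[OF zw(2)]] False by blast
    then obtain i j where ij: "i < n" "j < n" "z $ i * w $ j - z $ j * w $ i \<noteq> 0" by auto
    have "\<not> int p dvd z $ i * w $ j - z $ j * w $ i"
      using dvd_small[OF _ small[OF zw ij(1,2)]] ij(3) by blast
    from card_residue_pair[OF p zc[OF zw(1)] zc[OF zw(2)] ij(1,2) this] show ?thesis using False by simp
  qed
  have sum1: "(\<Sum>a\<in>?R. Z a) = ?P * \<mu>"
  proof -
    have "(\<Sum>a\<in>?R. Z a) = real (\<Sum>a\<in>?R. card {z\<in>S. int p dvd scalar_prod a z})" by (simp add: Z_def)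
    also have "\<dots> = (\<Sum>z\<in>S. real (card {a\<in>?R. int p dvd scalar_prod a z}))"
      unfolding card_double_count[OF fR fS] by simp
    also have "\<dots> = ?P * \<mu>" using single by (simp add: \<mu>(1))
    finally show ?thesis .
  qed
  have sum2: "(\<Sum>a\<in>?R. (Z a)\<^sup>2) \<le> 2 * (?P * \<mu>) + ?P * \<mu>\<^sup>2"
  proof -
    have Z2: "(Z a)\<^sup>2 = real (card {x\<in>S\<times>S. int p dvd scalar_prod a (fst x) \<and> int p dvd scalar_prod a (snd x)})" for a
    proof -
      have "{x\<in>S\<times>S. int p dvd scalar_prod a (fst x) \<and> int p dvd scalar_prod a (snd x)} =
        {z\<in>S. int p dvd scalar_prod a z} \<times> {z\<in>S. int p dvd scalar_prod a z}" by auto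
      thus ?thesis by (simp add: Z_def card_cartesian_product power2_eq_square)
    qed
    have "(\<Sum>a\<in>?R. (Z a)\<^sup>2) = real (\<Sum>a\<in>?R. card {x\<in>S\<times>S. int p dvd scalar_prod a (fst x) \<and> int p dvd scalar_prod a (snd x)})"
      by (simp add: Z2)
    also have "\<dots> = (\<Sum>x\<in>S\<times>S. real (card {a\<in>?R. int p dvd scalar_prod a (fst x) \<and> int p dvd scalar_prod a (snd x)}))"
      using card_double_count[OF fR finite_cartesian_product[OF fS fS]] by simp
    also have "\<dots> = (\<Sum>z\<in>S. \<Sum>w\<in>S. real (card {a\<in>?R. int p dvd scalar_prod a z \<and> int p dvd scalar_prod a w}))"
      by (simp add: sum.cartesian_product case_prod_beta)
    also have "\<dots> \<le> (\<Sum>z\<in>S. \<Sum>w\<in>S. ?P / (real p)\<^sup>2 + (if w = z then ?P / real p else 0) + (if w = - z then ?P / real p else 0))"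
      by (intro sum_mono pair)
    also have "\<dots> \<le> (\<Sum>z\<in>S. real (card S) * (?P / (real p)\<^sup>2) + ?P / real p + ?P / real p)"
      using fS by (intro sum_mono) (auto simp: sum.distrib intro!: divide_right_mono)
    also have "\<dots> = 2 * (?P * \<mu>) + ?P * \<mu>\<^sup>2"
      by (simp add: \<mu>(1) power2_eq_square field_simps)
    finally show ?thesis .
  qed
  have card_R: "real (card ?R) = ?P" by (simp add: card_residue_vecs)
  let ?A = "{a\<in>?R. Z a < \<mu> / 2}"
  have "real (card ?A) * (\<mu>\<^sup>2 / 4) = (\<Sum>a\<in>?A. (\<mu> / 2)\<^sup>2)" by (simp add: power_divide)
  also have "\<dots> \<le> (\<Sum>a\<in>?A. (Z a - \<mu>)\<^sup>2)"
  proof (rule sum_mono)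
    fix a assume a: "a \<in> ?A"
    have "(\<mu> / 2)\<^sup>2 \<le> (\<mu> - Z a)\<^sup>2" using a \<mu>(2) by (intro power_mono) auto
    thus "(\<mu> / 2)\<^sup>2 \<le> (Z a - \<mu>)\<^sup>2" by (simp add: power2_commute)
  qed
  also have "\<dots> \<le> (\<Sum>a\<in>?R. (Z a - \<mu>)\<^sup>2)" using fR by (intro sum_mono2) auto
  also have "\<dots> = (\<Sum>a\<in>?R. (Z a)\<^sup>2) - 2 * \<mu> * (\<Sum>a\<in>?R. Z a) + ?P * \<mu>\<^sup>2"
    by (simp add: power2_diff sum.distrib sum_subtractf sum_distrib_left card_R algebra_simps)
  also have "\<dots> \<le> 2 * (?P * \<mu>)" using sum2 unfolding sum1 by (simp add: power2_eq_square algebra_simps)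
  finally have "real (card ?A) * (\<mu>\<^sup>2 / 4) \<le> 2 * (?P * \<mu>)" .
  hence "real (card ?A) * \<mu> * \<mu> \<le> 8 * ?P * \<mu>" by (simp add: power2_eq_square algebra_simps)
  hence "real (card ?A) * \<mu> \<le> 8 * ?P" using \<mu>(2) by (simp only: mult_le_cancel_right)
  thus ?thesis unfolding Z_def using \<mu>(2) by (simp add: pos_le_divide_eq)
qed

lemma sum_indicator_ennreal: "finite A \<Longrightarrow> (\<Sum>x\<in>A. indicator B x :: ennreal) = of_nat (card (A \<inter> B))"
  by (simp add: indicator_def sum.If_cases Int_def)

text \<open>Only primitive vectors are counted, to have pairwise independence. Writing V for the
  volume, their density gives a mean of at least V/4, so half the mean is at least V/8 and Chebyshev
  gives 32/V; a further factor 2 pays for excluding the zero label.\<close>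

theorem lattice_count_lower_tail:
  assumes M: "SL_invariant_prob n M" and n: "3 \<le> n" and \<rho>: "0 < \<rho>"
  shows "emeasure M {L \<in> space M. lattice_count n \<rho> L < ennreal (unit_ball_vol (real n) * \<rho> ^ n / 8)}
    \<le> ennreal (64 / (unit_ball_vol (real n) * \<rho> ^ n))"
proof -
  note MD = SL_invariantD[OF M]
  have n0: "0 < n" "2 \<le> n" using n by auto
  define V where "V = unit_ball_vol (real n) * \<rho> ^ n"
  have V0: "0 < V" unfolding V_def using \<rho> by simp
  define B where "B = {L \<in> row_lattice ` SL n. lattice_count n \<rho> L < ennreal (V / 8)}"
  have B: "B \<in> sets (lattice_space n)"
  proof -
    have "B = {L \<in> space (lattice_space n). lattice_count n \<rho> L < ennreal (V / 8)}" by (simp add: B_def)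
    also have "\<dots> \<in> sets (lattice_space n)" using measurable_lattice_count[of n \<rho>] by measurable
    finally show ?thesis .
  qed
  have "(\<integral>\<^sup>+L. indicator B L \<partial>M) \<le> ennreal (64 / V)"
  proof (rule hecke_limit_le[OF M n0(1), where K=1])
    show "indicator B \<in> borel_measurable (lattice_space n)" using B by simp
    show "indicator B L \<le> ennreal 1" for L by (simp add: indicator_def)
    fix g assume g: "g \<in> SL n"
    let ?\<kappa> = "mat_norm (adj_mat g)"
    have "\<forall>\<^sub>F p in sequentially. unit_ball_vol (real n) * \<rho> ^ n / 4 * (real p powr (1 / real n)) ^ n \<le> real (card {z \<in> int_ball n g (\<rho> * real p powr (1 / real n)). int_primitive n z})"
      by (rule eventually_compose_filterlim[OF primitive_density[OF g n \<rho>] hecke_scale_at_top[OF n0(1)]])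
    moreover have "\<forall>\<^sub>F p in sequentially. (2 * (?\<kappa> * \<rho>)\<^sup>2) * (real p powr (1 / real n)) powr 2 < real p"
      using n by (intro powr_le_linear_at_top) auto
    ultimately have "\<forall>\<^sub>F p in sequentially. prime p \<longrightarrow> hecke_mean n p (indicator B) (row_lattice g) \<le> ennreal (64 / V)"
      using eventually_gt_at_top[of 0]
    proof eventually_elim
      case (elim p)
      show ?case
      proof
        assume p: "prime p"
        have p1: "1 < p" using p prime_gt_1_nat by blast
        let ?X = "real p powr (1 / real n)"
        have X: "\<rho> / hecke_scale n p = \<rho> * ?X" "?X ^ n = real p"
          using inverse_hecke_scale[of p n] elim(3) n0 by (simp_all add: divide_inverse)
        have X0: "0 < ?X" using elim(3) by simp
        define S where "S = {z \<in> int_ball n g (\<rho> * ?X). int_primitive n z}"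
        have fin: "finite (int_ball n g (\<rho> * ?X))" using X0 \<rho> by (intro int_ball_count(1)[OF g]) auto
        have fS: "finite S" unfolding S_def using fin by simp
        define \<mu> where "\<mu> = real (card S) / real p"
        have \<mu>: "V / 4 \<le> \<mu>" using elim(1,3) unfolding X V_def \<mu>_def S_def by (simp add: pos_le_divide_eq)
        have \<mu>0: "0 < \<mu>" using \<mu> V0 by simp
        have small: "\<bar>real_of_int (z $ i * w $ j - z $ j * w $ i)\<bar> < real p"
          if "z \<in> S" "w \<in> S" "i < n" "j < n" for z w i j
        proof -
          have c: "\<bar>real_of_int (z $ i)\<bar> \<le> ?\<kappa> * (\<rho> * ?X)" if zS: "z \<in> S" and i: "i < n" for z i
          proof -
            have z: "z \<in> carrier_vec n" "vec_len (lat_pt g z) \<le> \<rho> * ?X" using zS by (auto simp: S_def int_ball_def)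
            have "\<bar>real_of_int (z $ i)\<bar> \<le> ?\<kappa> * vec_len (lat_pt g z)" by (rule abs_coord_le[OF g z(1) i])
            also have "\<dots> \<le> ?\<kappa> * (\<rho> * ?X)" using z(2) mat_norm_nonneg by (intro mult_left_mono) auto
            finally show ?thesis .
          qed
          let ?K = "?\<kappa> * (\<rho> * ?X)"
          have K0: "0 \<le> ?K" using mat_norm_nonneg[of "adj_mat g"] \<rho> X0 by simp
          have "\<bar>real_of_int (z $ i * w $ j - z $ j * w $ i)\<bar> \<le> \<bar>real_of_int (z $ i)\<bar> * \<bar>real_of_int (w $ j)\<bar> + \<bar>real_of_int (z $ j)\<bar> * \<bar>real_of_int (w $ i)\<bar>"
            by (simp add: abs_mult[symmetric])
          also have "\<dots> \<le> ?K * ?K + ?K * ?K"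
            using K0 by (intro add_mono mult_mono c that) auto
          also have "\<dots> = (2 * (?\<kappa> * \<rho>)\<^sup>2) * ?X powr 2"
            using X0 by (simp add: power2_eq_square powr_numeral)
          also have "\<dots> < real p" by (rule elim(2))
          finally show ?thesis .
        qed
        let ?A = "{a \<in> residue_vecs n p. real (card {z\<in>S. int p dvd scalar_prod a z}) < \<mu> / 2}"
        have A: "real (card ?A) \<le> 8 * real p ^ n / \<mu>"
          by (rule residue_second_moment[OF p n0(2) fS _ small \<mu>_def \<mu>0]) (auto simp: S_def)
        have P: "1 < real p ^ n" using p1 n0 one_less_power[of "real p" n] by simp
        have P2: "real p ^ n \<le> 2 * (real p ^ n - 1)"
        proof -
          have "2 \<le> real p ^ 1" using p1 by simp
          also have "real p ^ 1 \<le> real p ^ n" using p1 n0 by (intro power_increasing) auto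
          finally show ?thesis by simp
        qed
        have cL: "real (card (hecke_labels n p)) = real p ^ n - 1"
          using card_hecke_labels[of p n] p1 by (simp add: of_nat_diff)
        have "(\<Sum>a\<in>hecke_labels n p. indicator B (hecke_nbr n p g a)) \<le> (\<Sum>a\<in>hecke_labels n p. indicator ?A a :: ennreal)"
        proof (rule sum_mono)
          fix a assume a: "a \<in> hecke_labels n p"
          show "indicator B (hecke_nbr n p g a) \<le> (indicator ?A a :: ennreal)"
          proof (cases "hecke_nbr n p g a \<in> B")
            case True
            let ?T = "{z \<in> int_ball n g (\<rho> * ?X). z \<noteq> 0\<^sub>v n \<and> int p dvd scalar_prod a z}"
            have "lattice_count n \<rho> (hecke_nbr n p g a) < ennreal (V / 8)" using True by (simp add: B_def)
            hence "ennreal (real (card ?T)) < ennreal (V / 8)"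
              using lattice_count_hecke[OF g elim(3) n0(1), of \<rho> a] \<rho> unfolding X by (simp add: ennreal_of_nat_eq_real_of_nat)
            hence "real (card ?T) < V / 8" by (simp add: ennreal_less_iff)
            moreover have "card {z\<in>S. int p dvd scalar_prod a z} \<le> card ?T"
            proof (rule card_mono)
              show "finite ?T" using fin by simp
              have "\<not> int_primitive n (0\<^sub>v n)"
              proof
                assume "int_primitive n (0\<^sub>v n)"
                hence "is_unit (2::int)" unfolding int_primitive_def by (elim conjE allE[of _ 2]) simp
                thus False by simp
              qed
              thus "{z\<in>S. int p dvd scalar_prod a z} \<subseteq> ?T" unfolding S_def by auto
            qed
            ultimately have "real (card {z\<in>S. int p dvd scalar_prod a z}) < \<mu> / 2" using \<mu> by linarith
            hence "a \<in> ?A" using a by (simp add: hecke_labels_def)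
            thus ?thesis by (auto simp: indicator_def)
          qed simp
        qed
        also have "\<dots> = of_nat (card (hecke_labels n p \<inter> ?A))" by (rule sum_indicator_ennreal[OF finite_hecke_labels])
        also have "\<dots> \<le> of_nat (card ?A)" using finite_residue_vecs[of n p] by (intro of_nat_mono card_mono) auto
        also have "\<dots> \<le> ennreal (8 * real p ^ n / \<mu>)" using A by (simp add: ennreal_of_nat_eq_real_of_nat ennreal_leI)
        also have "\<dots> \<le> ennreal ((real p ^ n - 1) * (64 / V))"
        proof (rule ennreal_leI)
          have "8 * real p ^ n / \<mu> \<le> 8 * real p ^ n / (V / 4)" using \<mu> V0 by (intro divide_left_mono) auto
          also have "\<dots> = 32 / V * real p ^ n" by simp
          also have "\<dots> \<le> 32 / V * (2 * (real p ^ n - 1))" using P2 V0 by (intro mult_left_mono) auto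
          finally show "8 * real p ^ n / \<mu> \<le> (real p ^ n - 1) * (64 / V)" by (simp add: mult.commute)
        qed
        also have "\<dots> = of_nat (card (hecke_labels n p)) * ennreal (64 / V)"
          unfolding ennreal_of_nat_eq_real_of_nat cL using P V0 by (intro ennreal_mult) auto
        finally show "hecke_mean n p (indicator B) (row_lattice g) \<le> ennreal (64 / V)"
          unfolding hecke_mean_row_lattice[OF elim(3) g]
          using card_hecke_labels_pos[OF p1 n0(1)] by (intro divide_le_posI_ennreal) auto
      qed
    qed
    thus "\<exists>p0. \<forall>p\<ge>p0. prime p \<longrightarrow> hecke_mean n p (indicator B) (row_lattice g) \<le> ennreal (64 / V)"
      by (simp add: eventually_sequentially)
  qed
  moreover have "{L \<in> space M. lattice_count n \<rho> L < ennreal (unit_ball_vol (real n) * \<rho> ^ n / 8)} = B"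
    by (simp add: B_def V_def MD(3))
  ultimately show ?thesis using B MD(2) by (simp add: V_def)
qed

subsection \<open>Theta series\<close>

definition theta :: "real vec set \<Rightarrow> real \<Rightarrow> ennreal" where
  "theta L s = (\<integral>\<^sup>+v. ennreal (gauss_weight s v) \<partial>count_space L)"

lemma bij_betw_lat_pt_full:
  assumes "g \<in> SL n"
  shows "bij_betw (lat_pt g) (carrier_vec n) (row_lattice g)"
  unfolding bij_betw_def row_lattice_eq_lat_pt[OF assms] using inj_on_lat_pt[OF assms] by simp

lemma theta_row_lattice:
  assumes "g \<in> SL n"
  shows "theta (row_lattice g) s = (\<integral>\<^sup>+z. ennreal (gauss_weight s (lat_pt g z)) \<partial>count_space (carrier_vec n))"
  unfolding theta_def by (rule nn_integral_bij_count_space[OF bij_betw_lat_pt_full[OF assms], symmetric])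

lemma parallelogram_lat_pt:
  assumes g: "g \<in> SL n" and uv: "u \<in> carrier_vec n" "v \<in> carrier_vec n"
  shows "(vec_len (lat_pt g (u + v)))\<^sup>2 + (vec_len (lat_pt g (u - v)))\<^sup>2 = 2 * (vec_len (lat_pt g u))\<^sup>2 + 2 * (vec_len (lat_pt g v))\<^sup>2"
proof -
  have sq: "(vec_len x)\<^sup>2 = (\<Sum>i<n. (x $ i)\<^sup>2)" if "x \<in> carrier_vec n" for x
    unfolding vec_len_L2_set[OF that] L2_set_def by (simp add: sum_nonneg)
  have gc: "g \<in> carrier_mat n n" by (rule SL_carrier[OF g])
  have p: "lat_pt g (u + v) $ i = lat_pt g u $ i + lat_pt g v $ i" "lat_pt g (u - v) $ i = lat_pt g u $ i - lat_pt g v $ i"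
    if i: "i < n" for i
    unfolding lat_pt_def using uv i transpose_mult_vec_index[OF gc _ i]
    by (auto simp: algebra_simps sum.distrib[symmetric] sum_subtractf[symmetric] intro!: sum.cong)
  show ?thesis
    unfolding sq[OF lat_pt_carrier[OF g]]
    by (simp add: p sum.distrib[symmetric] sum_distrib_left power2_eq_square algebra_simps)
qed

lemma ennreal_two_mult_le: "2 * (x * y) \<le> x * x + y * (y::ennreal)"
proof (cases x; cases y)
  fix a b :: real assume ab: "0 \<le> a" "x = ennreal a" "0 \<le> b" "y = ennreal b"
  have "2 * (a * b) \<le> a * a + b * b" using sum_squares_bound[of a b] by (simp add: power2_eq_square)
  hence "ennreal (2 * (a * b)) \<le> ennreal (a * a + b * b)" by (rule ennreal_leI)
  thus ?thesis using ab by (simp add: ennreal_mult)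
qed (auto simp: ennreal_mult_eq_top_iff)

text \<open>Cauchy-Schwarz against the constant 1, in a form that allows infinite values.\<close>

lemma ennreal_square_sum_le:
  fixes S :: "'a \<Rightarrow> ennreal"
  assumes "finite K"
  shows "(\<Sum>k\<in>K. S k) * (\<Sum>k\<in>K. S k) \<le> of_nat (card K) * (\<Sum>k\<in>K. S k * S k)"
proof -
  have "2 * ((\<Sum>k\<in>K. S k) * (\<Sum>k\<in>K. S k)) = (\<Sum>k\<in>K. \<Sum>l\<in>K. 2 * (S k * S l))"
    unfolding sum_product by (simp only: sum_distrib_left)
  also have "\<dots> \<le> (\<Sum>k\<in>K. \<Sum>l\<in>K. S k * S k + S l * S l)" by (intro sum_mono ennreal_two_mult_le)
  also have "\<dots> = 2 * (of_nat (card K) * (\<Sum>k\<in>K. S k * S k))"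
    by (simp add: sum.distrib sum_distrib_left[symmetric] mult_2)
  finally show ?thesis by (subst (asm) ennreal_mult_le_mult_iff) auto
qed

text \<open>The parallelogram law turns \<open>theta L s\<^sup>2\<close> into the sum of the squares of the
  contributions of the \<open>2\<^sup>n\<close> classes of \<open>L/2L\<close> to \<open>theta L (\<surd>2 s)\<close>.\<close>

lemma theta_doubling:
  assumes g: "g \<in> SL n" and s: "0 < s"
  shows "theta (row_lattice g) (sqrt 2 * s) * theta (row_lattice g) (sqrt 2 * s) \<le> ennreal (2 ^ n) * (theta (row_lattice g) s * theta (row_lattice g) s)"
proof -
  let ?Z = "carrier_vec n :: int vec set"
  define q where "q z = (vec_len (lat_pt g z))\<^sup>2" for z
  define f where "f z = ennreal (exp (- pi * q z / (2 * s\<^sup>2))) * indicator ?Z z" for z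
  let ?K = "residue_vecs n 2"
  define cls where "cls k = {z \<in> ?Z. vec_mod 2 z = k}" for k
  define S where "S k = (\<integral>\<^sup>+a. f a * indicator (cls k) a \<partial>count_space UNIV)" for k
  define h where "h z = ennreal (exp (- pi * q z / s\<^sup>2)) * indicator ?Z z" for z
  have fK: "finite ?K" by (rule finite_residue_vecs)
  have T2: "theta (row_lattice g) (sqrt 2 * s) = (\<integral>\<^sup>+a. f a \<partial>count_space UNIV)"
    unfolding theta_row_lattice[OF g] f_def
    by (subst nn_integral_count_space_indicator, simp, intro nn_integral_cong)
       (simp add: gauss_weight_def q_def power_mult_distrib)
  have T1: "theta (row_lattice g) s = (\<integral>\<^sup>+a. h a \<partial>count_space UNIV)"
    unfolding theta_row_lattice[OF g] h_def
    by (subst nn_integral_count_space_indicator, simp, intro nn_integral_cong)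
       (simp add: gauss_weight_def q_def)
  have split: "indicator ?Z a = (\<Sum>k\<in>?K. indicator (cls k) a :: ennreal)" for a
  proof (cases "a \<in> ?Z")
    case True
    have "vec_mod 2 a \<in> ?K" using True by (intro vec_mod_residue) auto
    have "(\<Sum>k\<in>?K. indicator (cls k) a :: ennreal) = (\<Sum>k\<in>?K. if k = vec_mod 2 a then 1 else 0)"
      using True by (intro sum.cong) (auto simp: cls_def indicator_def)
    thus ?thesis using True \<open>vec_mod 2 a \<in> ?K\<close> fK by simp
  next
    case False
    thus ?thesis by (simp add: cls_def)
  qed
  have fi: "f a = f a * indicator ?Z a" for a by (simp add: f_def indicator_def)
  have "(\<integral>\<^sup>+a. f a \<partial>count_space UNIV) = (\<integral>\<^sup>+a. (\<Sum>k\<in>?K. f a * indicator (cls k) a) \<partial>count_space UNIV)"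
    by (subst fi, subst split) (simp add: sum_distrib_left)
  also have "\<dots> = (\<Sum>k\<in>?K. S k)" unfolding S_def by (intro nn_integral_sum) simp
  finally have sumS: "(\<integral>\<^sup>+a. f a \<partial>count_space UNIV) = (\<Sum>k\<in>?K. S k)" .
  let ?P = "{(a,b). a \<in> ?Z \<and> b \<in> ?Z \<and> vec_mod 2 a = vec_mod 2 b}"
  \<comment> \<open>Two integer vectors are the sum and the difference of two integer vectors
    exactly when they agree modulo 2.\<close>
  have bij: "bij_betw (\<lambda>(u,v). (u + v, u - v)) (?Z \<times> ?Z) ?P"
  proof (rule bij_betw_byWitness[where f'="\<lambda>(a,b). (vec n (\<lambda>i. (a $ i + b $ i) div 2), vec n (\<lambda>i. (a $ i - b $ i) div 2))"])
    show "\<forall>x\<in>?Z \<times> ?Z. (case case x of (u, v) \<Rightarrow> (u + v, u - v) of (a, b) \<Rightarrow>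
        (vec n (\<lambda>i. (a $ i + b $ i) div 2), vec n (\<lambda>i. (a $ i - b $ i) div 2))) = x"
      by (auto intro!: eq_vecI)
    show "\<forall>x\<in>?P. (case case x of (a, b) \<Rightarrow> (vec n (\<lambda>i. (a $ i + b $ i) div 2), vec n (\<lambda>i. (a $ i - b $ i) div 2)) of
        (u, v) \<Rightarrow> (u + v, u - v)) = x"
    proof
      fix x assume "x \<in> ?P"
      then obtain a b where x: "x = (a,b)" "a \<in> ?Z" "b \<in> ?Z" "vec_mod 2 a = vec_mod 2 b" by auto
      have par: "even (a $ i + b $ i)" "even (a $ i - b $ i)" if "i < n" for i
      proof -
        have "vec_mod 2 a $ i = vec_mod 2 b $ i" using x(4) by simp
        hence "a $ i mod 2 = b $ i mod 2" using x that by (simp add: vec_mod_def)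
        thus "even (a $ i + b $ i)" "even (a $ i - b $ i)" by presburger+
      qed
      have d: "(a $ i + b $ i) div 2 + (a $ i - b $ i) div 2 = a $ i" "(a $ i + b $ i) div 2 - (a $ i - b $ i) div 2 = b $ i" if "i < n" for i
        using par[OF that] by presburger+
      have "vec n (\<lambda>i. (a $ i + b $ i) div 2) + vec n (\<lambda>i. (a $ i - b $ i) div 2) = a"
        using x d by (intro eq_vecI) auto
      moreover have "vec n (\<lambda>i. (a $ i + b $ i) div 2) - vec n (\<lambda>i. (a $ i - b $ i) div 2) = b"
        using x d by (intro eq_vecI) auto
      ultimately show "(case case x of (a, b) \<Rightarrow> (vec n (\<lambda>i. (a $ i + b $ i) div 2), vec n (\<lambda>i. (a $ i - b $ i) div 2)) of
        (u, v) \<Rightarrow> (u + v, u - v)) = x" unfolding x(1) by simp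
    qed
    show "(\<lambda>(u,v). (u + v, u - v)) ` (?Z \<times> ?Z) \<subseteq> ?P"
    proof clarify
      fix u v :: "int vec" assume uv: "u \<in> ?Z" "v \<in> ?Z"
      have "vec_mod 2 (u + v) = vec_mod 2 (u - v)"
      proof (rule eq_vecI)
        fix i assume "i < dim_vec (vec_mod 2 (u - v))"
        hence i: "i < n" using uv by (simp add: vec_mod_def)
        have "(u $ i + v $ i) mod 2 = (u $ i - v $ i) mod 2" by presburger
        thus "vec_mod 2 (u + v) $ i = vec_mod 2 (u - v) $ i" using uv i by (simp add: vec_mod_def)
      qed (use uv in \<open>simp add: vec_mod_def\<close>)
      thus "u + v \<in> ?Z \<and> u - v \<in> ?Z \<and> vec_mod 2 (u + v) = vec_mod 2 (u - v)" using uv by simp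
    qed
    show "(\<lambda>(a,b). (vec n (\<lambda>i. (a $ i + b $ i) div 2), vec n (\<lambda>i. (a $ i - b $ i) div 2))) ` ?P \<subseteq> ?Z \<times> ?Z" by auto
  qed
  have "theta (row_lattice g) s * theta (row_lattice g) s = (\<integral>\<^sup>+u. \<integral>\<^sup>+v. h u * h v \<partial>count_space UNIV \<partial>count_space UNIV)"
    unfolding T1 by (simp add: nn_integral_cmult nn_integral_multc)
  also have "\<dots> = (\<integral>\<^sup>+x. h (fst x) * h (snd x) \<partial>count_space UNIV)"
    using nn_integral_fst_count_space[of "\<lambda>x. h (fst x) * h (snd x)"] by simp
  also have "\<dots> = (\<integral>\<^sup>+x. h (fst x) * h (snd x) \<partial>count_space (?Z \<times> ?Z))"
    by (subst nn_integral_count_space_indicator[of "?Z \<times> ?Z"], simp, intro nn_integral_cong)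
       (auto simp: h_def indicator_def)
  also have "\<dots> = (\<integral>\<^sup>+x. (case (case x of (u,v) \<Rightarrow> (u + v, u - v)) of (a,b) \<Rightarrow> f a * f b) \<partial>count_space (?Z \<times> ?Z))"
  proof (intro nn_integral_cong)
    fix x assume "x \<in> space (count_space (?Z \<times> ?Z))"
    then obtain u v where x: "x = (u,v)" "u \<in> ?Z" "v \<in> ?Z" by auto
    have e: "- pi * q u / s\<^sup>2 + - pi * q v / s\<^sup>2 = - pi * q (u + v) / (2 * s\<^sup>2) + - pi * q (u - v) / (2 * s\<^sup>2)"
    proof -
      have "- pi * q (u + v) / (2 * s\<^sup>2) + - pi * q (u - v) / (2 * s\<^sup>2) = - pi * (q (u + v) + q (u - v)) / (2 * s\<^sup>2)"
        by (simp add: add_divide_distrib[symmetric] algebra_simps)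
      also have "\<dots> = - pi * (2 * q u + 2 * q v) / (2 * s\<^sup>2)"
        unfolding q_def parallelogram_lat_pt[OF g x(2,3)] ..
      also have "\<dots> = - pi * q u / s\<^sup>2 + - pi * q v / s\<^sup>2" using s by (simp add: field_simps)
      finally show ?thesis ..
    qed
    have "h u * h v = ennreal (exp (- pi * q u / s\<^sup>2 + - pi * q v / s\<^sup>2))"
      unfolding exp_add using x by (simp add: h_def ennreal_mult)
    also have "\<dots> = f (u + v) * f (u - v)"
      unfolding e exp_add using x by (simp add: f_def ennreal_mult)
    finally show "h (fst x) * h (snd x) = (case (case x of (u,v) \<Rightarrow> (u + v, u - v)) of (a,b) \<Rightarrow> f a * f b)" unfolding x(1) by simp
  qed
  also have "\<dots> = (\<integral>\<^sup>+x. (case x of (a,b) \<Rightarrow> f a * f b) \<partial>count_space ?P)"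
    by (rule nn_integral_bij_count_space[OF bij])
  also have "\<dots> = (\<integral>\<^sup>+x. (\<Sum>k\<in>?K. (f (fst x) * indicator (cls k) (fst x)) * (f (snd x) * indicator (cls k) (snd x))) \<partial>count_space UNIV)"
  proof (subst nn_integral_count_space_indicator[of ?P], simp, intro nn_integral_cong)
    fix x :: "int vec \<times> int vec"
    obtain a b where x: "x = (a,b)" by (cases x)
    have ind: "(\<Sum>k\<in>?K. indicator (cls k) a * indicator (cls k) b) = (indicator ?P x :: ennreal)"
    proof (cases "x \<in> ?P")
      case True
      have "vec_mod 2 a \<in> ?K" using True x by (intro vec_mod_residue) auto
      have "(\<Sum>k\<in>?K. indicator (cls k) a * indicator (cls k) b :: ennreal) = (\<Sum>k\<in>?K. if k = vec_mod 2 a then 1 else 0)"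
        using True x by (intro sum.cong) (auto simp: cls_def indicator_def)
      thus ?thesis using True \<open>vec_mod 2 a \<in> ?K\<close> fK by simp
    next
      case False
      have z: "indicator (cls k) a * indicator (cls k) b = (0::ennreal)" for k
        using False x by (auto simp: cls_def indicator_def)
      show ?thesis unfolding z using False by simp
    qed
    have "(\<Sum>k\<in>?K. (f a * indicator (cls k) a) * (f b * indicator (cls k) b)) = f a * f b * (\<Sum>k\<in>?K. indicator (cls k) a * indicator (cls k) b)"
      by (simp add: sum_distrib_left mult_ac)
    thus "(case x of (a,b) \<Rightarrow> f a * f b) * indicator ?P x = (\<Sum>k\<in>?K. (f (fst x) * indicator (cls k) (fst x)) * (f (snd x) * indicator (cls k) (snd x)))"
      unfolding ind x by simp
  qed
  also have "\<dots> = (\<Sum>k\<in>?K. \<integral>\<^sup>+x. (f (fst x) * indicator (cls k) (fst x)) * (f (snd x) * indicator (cls k) (snd x)) \<partial>count_space UNIV)"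
    by (intro nn_integral_sum) simp
  also have "\<dots> = (\<Sum>k\<in>?K. S k * S k)"
  proof (intro sum.cong refl)
    fix k
    have "(\<integral>\<^sup>+x. (f (fst x) * indicator (cls k) (fst x)) * (f (snd x) * indicator (cls k) (snd x)) \<partial>count_space UNIV)
      = (\<integral>\<^sup>+u. \<integral>\<^sup>+v. (f u * indicator (cls k) u) * (f v * indicator (cls k) v) \<partial>count_space UNIV \<partial>count_space UNIV)"
      using nn_integral_fst_count_space[of "\<lambda>x. (f (fst x) * indicator (cls k) (fst x)) * (f (snd x) * indicator (cls k) (snd x))"] by simp
    also have "\<dots> = S k * S k" unfolding S_def by (simp add: nn_integral_cmult nn_integral_multc)
    finally show "(\<integral>\<^sup>+x. (f (fst x) * indicator (cls k) (fst x)) * (f (snd x) * indicator (cls k) (snd x)) \<partial>count_space UNIV) = S k * S k" .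
  qed
  finally have "theta (row_lattice g) s * theta (row_lattice g) s = (\<Sum>k\<in>?K. S k * S k)" .
  moreover have "ennreal (2 ^ n) = of_nat (card ?K)" by (simp add: card_residue_vecs ennreal_of_nat_eq_real_of_nat)
  ultimately show ?thesis unfolding T2 sumS using ennreal_square_sum_le[OF fK, of S] by simp
qed

lemma ennreal_square_le_imp_le:
  fixes x y :: ennreal
  assumes "x * x \<le> y * y"
  shows "x \<le> y"
proof (rule ccontr)
  assume "\<not> x \<le> y"
  hence yx: "y < x" by simp
  hence "y < \<infinity>" by (metis infinity_ennreal_def top.not_eq_extremum order_less_le_trans top_greatest)
  then obtain b where b: "y = ennreal b" "0 \<le> b" by (cases y) auto
  show False
  proof (cases x)
    case (real a)
    have "b < a" using yx b real by (simp add: ennreal_less_iff)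
    hence "b * b < a * a" using b by (intro mult_strict_mono) auto
    hence "ennreal (b * b) < ennreal (a * a)" using b by (simp add: ennreal_less_iff)
    thus False using assms b real by (simp add: ennreal_mult)
  next
    case top
    thus False using assms b by (simp add: ennreal_mult_top ennreal_mult[symmetric] top_unique)
  qed
qed

text \<open>A substitute for Poisson summation. By doubling, \<open>theta\<close> at s divided by
  s^n does not increase when s grows by a factor sqrt 2. At a large scale it is at least the density
  of lattice points in a ball of radius \<tau> times that scale, times the smallest weight on that
  ball.\<close>

lemma theta_lower_bound:
  assumes g: "g \<in> SL n" and s: "0 < s" and \<tau>: "0 < \<tau>" and n: "0 < n"
  shows "ennreal (s ^ n * (unit_ball_vol (real n) * \<tau> ^ n * exp (- pi * \<tau>\<^sup>2))) \<le> theta (row_lattice g) s"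
proof (cases "theta (row_lattice g) s")
  case (real t)
  let ?T = "\<lambda>s. theta (row_lattice g) s"
  define \<sigma> where "\<sigma> k = sqrt 2 ^ k * s" for k :: nat
  have \<sigma>0: "0 < \<sigma> k" for k using s by (simp add: \<sigma>_def)
  have up: "?T (\<sigma> k) \<le> ennreal ((sqrt 2 ^ n) ^ k) * ?T s" for k
  proof (induction k)
    case 0
    thus ?case by (simp add: \<sigma>_def)
  next
    case (Suc k)
    have "?T (\<sigma> (Suc k)) * ?T (\<sigma> (Suc k)) \<le> ennreal (2 ^ n) * (?T (\<sigma> k) * ?T (\<sigma> k))"
      using theta_doubling[OF g \<sigma>0[of k]] by (simp add: \<sigma>_def mult.assoc)
    also have "(2::real) ^ n = sqrt 2 ^ n * sqrt 2 ^ n" by (simp add: power_mult_distrib[symmetric])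
    also have "ennreal (sqrt 2 ^ n * sqrt 2 ^ n) * (?T (\<sigma> k) * ?T (\<sigma> k)) = (ennreal (sqrt 2 ^ n) * ?T (\<sigma> k)) * (ennreal (sqrt 2 ^ n) * ?T (\<sigma> k))"
      by (simp add: ennreal_mult mult_ac)
    finally have "?T (\<sigma> (Suc k)) \<le> ennreal (sqrt 2 ^ n) * ?T (\<sigma> k)" by (rule ennreal_square_le_imp_le)
    also have "\<dots> \<le> ennreal (sqrt 2 ^ n) * (ennreal ((sqrt 2 ^ n) ^ k) * ?T s)" by (intro mult_left_mono Suc.IH) simp
    also have "\<dots> = ennreal ((sqrt 2 ^ n) ^ Suc k) * ?T s" by (simp add: ennreal_mult mult.assoc)
    finally show ?case .
  qed
  have low: "real (card (int_ball n g (\<tau> * \<sigma> k))) * exp (- pi * \<tau>\<^sup>2) \<le> (sqrt 2 ^ n) ^ k * t" for k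
  proof -
    let ?B = "int_ball n g (\<tau> * \<sigma> k)"
    have fB: "finite ?B" using \<tau> \<sigma>0[of k] by (intro int_ball_count(1)[OF g]) auto
    have "ennreal (real (card ?B) * exp (- pi * \<tau>\<^sup>2)) = (\<integral>\<^sup>+z. ennreal (exp (- pi * \<tau>\<^sup>2)) \<partial>count_space ?B)"
    proof -
      have "(\<integral>\<^sup>+z. ennreal (exp (- pi * \<tau>\<^sup>2)) \<partial>count_space ?B) = (\<Sum>z\<in>?B. ennreal (exp (- pi * \<tau>\<^sup>2)))"
        by (rule nn_integral_count_space_finite[OF fB])
      also have "\<dots> = ennreal (\<Sum>z\<in>?B. exp (- pi * \<tau>\<^sup>2))" by (rule sum_ennreal) simp
      also have "(\<Sum>z\<in>?B. exp (- pi * \<tau>\<^sup>2)) = real (card ?B) * exp (- pi * \<tau>\<^sup>2)" by (rule sum_constant)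
      finally show ?thesis ..
    qed
    also have "\<dots> = (\<integral>\<^sup>+z. ennreal (exp (- pi * \<tau>\<^sup>2)) * indicator ?B z \<partial>count_space UNIV)"
      by (rule nn_integral_count_space_indicator) simp
    also have "\<dots> \<le> (\<integral>\<^sup>+z. ennreal (gauss_weight (\<sigma> k) (lat_pt g z)) * indicator (carrier_vec n) z \<partial>count_space UNIV)"
    proof (rule nn_integral_mono)
      fix z
      show "ennreal (exp (- pi * \<tau>\<^sup>2)) * indicator ?B z \<le> ennreal (gauss_weight (\<sigma> k) (lat_pt g z)) * indicator (carrier_vec n) z"
      proof (cases "z \<in> ?B")
        case True
        hence z: "z \<in> carrier_vec n" "vec_len (lat_pt g z) \<le> \<tau> * \<sigma> k" by (auto simp: int_ball_def)
        have "(vec_len (lat_pt g z))\<^sup>2 \<le> (\<tau> * \<sigma> k)\<^sup>2" using z(2) vec_len_nonneg by (intro power_mono) auto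
        hence "(vec_len (lat_pt g z))\<^sup>2 / (\<sigma> k)\<^sup>2 \<le> \<tau>\<^sup>2" using \<sigma>0[of k] by (simp add: power_mult_distrib divide_le_eq)
        hence "pi * ((vec_len (lat_pt g z))\<^sup>2 / (\<sigma> k)\<^sup>2) \<le> pi * \<tau>\<^sup>2" by (intro mult_left_mono) auto
        thus ?thesis using True z(1) by (auto simp: gauss_weight_def intro!: ennreal_leI)
      qed simp
    qed
    also have "\<dots> = ?T (\<sigma> k)"
      unfolding theta_row_lattice[OF g] by (rule nn_integral_count_space_indicator[symmetric]) simp
    also have "\<dots> \<le> ennreal ((sqrt 2 ^ n) ^ k * t)" using up[of k] real by (simp add: ennreal_mult)
    finally show ?thesis using real by (subst (asm) ennreal_le_iff) auto
  qed
  have "filterlim (\<lambda>k. \<sigma> k) at_top sequentially"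
  proof -
    have "filterlim (\<lambda>k. sqrt 2 ^ k :: real) at_top sequentially"
      using filterlim_realpow_sequentially_gt1[of "sqrt 2"]
      by (intro filterlim_at_infinity_imp_filterlim_at_top always_eventually) auto
    thus ?thesis unfolding \<sigma>_def using s by (intro filterlim_at_top_mult_tendsto_pos[OF tendsto_const]) auto
  qed
  from filterlim_compose[OF int_ball_density[OF g \<tau>] this]
  have "(\<lambda>k. real (card (int_ball n g (\<tau> * \<sigma> k))) / \<sigma> k ^ n) \<longlonglongrightarrow> unit_ball_vol (real n) * \<tau> ^ n" .
  hence "(\<lambda>k. real (card (int_ball n g (\<tau> * \<sigma> k))) / \<sigma> k ^ n * (s ^ n * exp (- pi * \<tau>\<^sup>2))) \<longlonglongrightarrow> unit_ball_vol (real n) * \<tau> ^ n * (s ^ n * exp (- pi * \<tau>\<^sup>2))"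
    by (intro tendsto_mult tendsto_const)
  hence "unit_ball_vol (real n) * \<tau> ^ n * (s ^ n * exp (- pi * \<tau>\<^sup>2)) \<le> t"
  proof (rule LIMSEQ_le_const2)
    have "real (card (int_ball n g (\<tau> * \<sigma> k))) / \<sigma> k ^ n * (s ^ n * exp (- pi * \<tau>\<^sup>2)) \<le> t" for k
    proof -
      have e: "\<sigma> k ^ n = (sqrt 2 ^ n) ^ k * s ^ n" unfolding \<sigma>_def by (simp add: power_mult_distrib power_mult[symmetric] mult.commute)
      have "real (card (int_ball n g (\<tau> * \<sigma> k))) / \<sigma> k ^ n * (s ^ n * exp (- pi * \<tau>\<^sup>2)) = (real (card (int_ball n g (\<tau> * \<sigma> k))) * exp (- pi * \<tau>\<^sup>2)) / (sqrt 2 ^ n) ^ k"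
        unfolding e using s by (simp add: field_simps)
      also have "\<dots> \<le> t" using low[of k] by (simp add: divide_le_eq mult.commute)
      finally show ?thesis .
    qed
    thus "\<exists>N. \<forall>k\<ge>N. real (card (int_ball n g (\<tau> * \<sigma> k))) / \<sigma> k ^ n * (s ^ n * exp (- pi * \<tau>\<^sup>2)) \<le> t" by blast
  qed
  thus ?thesis unfolding real(2) by (intro ennreal_leI) (simp add: mult_ac)
qed simp

section \<open>Normalisation by the Gaussian heuristic\<close>

lemma unit_ball_vol_nonzero: "unit_ball_vol (real n) \<noteq> 0"
  by (metis less_irrefl of_nat_0_le_iff unit_ball_vol_pos)

lemma GH_pos: "0 < GH n"
  by (simp add: GH_def unit_ball_vol_nonzero)

lemma GH_power: "0 < n \<Longrightarrow> unit_ball_vol (real n) * GH n ^ n = 1"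
proof -
  assume n: "0 < n"
  have "GH n ^ n = (unit_ball_vol (real n) powr (- 1 / real n)) powr real n"
    unfolding GH_def using n by (subst powr_realpow) (auto simp: unit_ball_vol_nonzero)
  also have "\<dots> = unit_ball_vol (real n) powr (- 1)" using n by (simp add: powr_powr)
  also have "\<dots> = inverse (unit_ball_vol (real n))" by (simp add: powr_minus)
  finally show ?thesis using right_inverse[OF unit_ball_vol_nonzero[of n]] by simp
qed

lemma s_param_square: "0 < c \<Longrightarrow> 0 < n \<Longrightarrow> (s_param n c)\<^sup>2 = 2 * pi * (GH n)\<^sup>2 / (c * real n)" 
  and s_param_pos: "0 < c \<Longrightarrow> 0 < n \<Longrightarrow> 0 < s_param n c"
  using GH_pos[of n] by (auto simp: s_param_def)

lemma gauss_weight_s_param: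
  assumes "0 < c" "0 < n"
  shows "gauss_weight (s_param n c) v = exp (- c * (vec_len v / GH n)\<^sup>2 / 2) ^ n"
proof -
  have e: "- pi * (vec_len v)\<^sup>2 / (s_param n c)\<^sup>2 = real n * (- c * (vec_len v / GH n)\<^sup>2 / 2)"
    unfolding s_param_square[OF assms] using assms GH_pos[of n] by (simp add: field_simps power2_eq_square)
  show ?thesis unfolding gauss_weight_def e by (rule exp_of_nat_mult)
qed

text \<open>The choice \<tau>^2 = n/(2 pi) maximises \<tau>^n exp(- pi \<tau>^2). With it the volume
  of the unit ball cancels against \<open>GH n ^ n\<close> and exactly an n-th power remains. The
  bound holds for every lattice, without an exceptional event.\<close>

lemma theta_ge:
  assumes L: "L \<in> row_lattice ` SL n" and c: "0 < c" and n: "0 < n"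
  shows "ennreal ((1 / sqrt (c * exp 1)) ^ n) \<le> theta L (s_param n c)"
proof -
  obtain g where g: "g \<in> SL n" "L = row_lattice g" using L by auto
  define \<tau> where "\<tau> = sqrt (real n / (2 * pi))"
  have \<tau>: "0 < \<tau>" using n by (simp add: \<tau>_def)
  have \<tau>2: "\<tau>\<^sup>2 = real n / (2 * pi)" by (simp add: \<tau>_def)
  have "s_param n c * \<tau> = GH n * sqrt (1 / c)"
  proof -
    have "(s_param n c * \<tau>)\<^sup>2 = (GH n * sqrt (1 / c))\<^sup>2"
      unfolding power_mult_distrib s_param_square[OF c n] \<tau>2 using c n by (simp add: field_simps)
    thus ?thesis using s_param_pos[OF c n] \<tau> GH_pos[of n] c by (simp add: power2_eq_iff_nonneg)
  qed
  hence "s_param n c ^ n * \<tau> ^ n = GH n ^ n * sqrt (1 / c) ^ n" by (simp add: power_mult_distrib[symmetric])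
  moreover have "exp (- pi * \<tau>\<^sup>2) = (1 / sqrt (exp 1)) ^ n"
  proof -
    have "exp (- pi * \<tau>\<^sup>2) = exp (real n * (- 1 / 2))" unfolding \<tau>2 by simp
    also have "\<dots> = exp (- 1 / 2) ^ n" by (rule exp_of_nat_mult)
    also have "exp (- 1 / 2 :: real) = 1 / sqrt (exp 1)"
      by (simp add: exp_minus inverse_eq_divide ln_sqrt[symmetric] exp_ln powr_half_sqrt[symmetric] powr_def)
    finally show ?thesis .
  qed
  ultimately have "s_param n c ^ n * (unit_ball_vol (real n) * \<tau> ^ n * exp (- pi * \<tau>\<^sup>2)) = (unit_ball_vol (real n) * GH n ^ n) * (sqrt (1 / c) ^ n * (1 / sqrt (exp 1)) ^ n)"
    by (simp only: mult_ac) (metis mult.assoc mult.commute)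
  also have "\<dots> = (1 / sqrt (c * exp 1)) ^ n"
    unfolding GH_power[OF n] by (simp add: power_mult_distrib[symmetric] real_sqrt_mult real_sqrt_divide)
  finally show ?thesis using theta_lower_bound[OF g(1) s_param_pos[OF c n] \<tau> n] unfolding g(2) by simp
qed

lemma zero_in_row_lattice: "L \<in> row_lattice ` SL n \<Longrightarrow> 0\<^sub>v n \<in> L"
proof -
  assume "L \<in> row_lattice ` SL n"
  then obtain g where g: "g \<in> SL n" "L = row_lattice g" by auto
  have "lat_pt g (0\<^sub>v n) \<in> L" unfolding g(2) row_lattice_eq_lat_pt[OF g(1)] by simp
  thus ?thesis using lat_pt_zero[OF g(1)] by simp
qed

lemma theta_eq_lattice_sum:
  assumes "L \<in> row_lattice ` SL n"
  shows "theta L s = 1 + lattice_sum n (\<lambda>r. ennreal (exp (- pi * r\<^sup>2 / s\<^sup>2))) L"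
proof -
  have z: "0\<^sub>v n \<in> L" by (rule zero_in_row_lattice[OF assms])
  have w0: "gauss_weight s (0\<^sub>v n) = 1" by (simp add: gauss_weight_def vec_len_def)
  have "theta L s = (\<integral>\<^sup>+v. ennreal (gauss_weight s v) * indicator L v \<partial>count_space UNIV)"
    unfolding theta_def by (rule nn_integral_count_space_indicator) simp
  also have "\<dots> = (\<integral>\<^sup>+v. ennreal (gauss_weight s v) * indicator {0\<^sub>v n} v + ennreal (gauss_weight s v) * indicator (L - {0\<^sub>v n}) v \<partial>count_space UNIV)"
    using z by (intro nn_integral_cong) (auto simp: indicator_def)
  also have "\<dots> = (\<integral>\<^sup>+v. ennreal (gauss_weight s v) * indicator {0\<^sub>v n} v \<partial>count_space UNIV) + (\<integral>\<^sup>+v. ennreal (gauss_weight s v) * indicator (L - {0\<^sub>v n}) v \<partial>count_space UNIV)"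
    by (rule nn_integral_add) auto
  also have "(\<integral>\<^sup>+v. ennreal (gauss_weight s v) * indicator {0\<^sub>v n} v \<partial>count_space UNIV) = (\<integral>\<^sup>+v. ennreal (gauss_weight s v) \<partial>count_space {0\<^sub>v n})"
    by (rule nn_integral_count_space_indicator[symmetric]) simp
  also have "\<dots> = 1" by (simp add: nn_integral_count_space_finite w0)
  also have "(\<integral>\<^sup>+v. ennreal (gauss_weight s v) * indicator (L - {0\<^sub>v n}) v \<partial>count_space UNIV) = lattice_sum n (\<lambda>r. ennreal (exp (- pi * r\<^sup>2 / s\<^sup>2))) L"
    unfolding lattice_sum_def gauss_weight_def by (rule nn_integral_count_space_indicator[symmetric]) simp
  finally show ?thesis .
qed

subsection \<open>Events of probability tending to one\<close>

text \<open>The property is only required on a measurable event, since it may quantify over all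
  histories or all c and need not be measurable itself. The shape is that of
  \<open>accurate\<close>, which can be used directly.\<close>

definition whp :: "(nat \<Rightarrow> 'a measure) \<Rightarrow> (nat \<Rightarrow> 'a \<Rightarrow> bool) \<Rightarrow> bool" where
  "whp M P \<longleftrightarrow> (\<exists>E. (\<forall>n>0. E n \<in> sets (M n)) \<and> (\<lambda>n. measure (M n) (E n)) \<longlonglongrightarrow> 1 \<and> (\<forall>n>0. \<forall>L\<in>E n. P n L))"

lemma whp_mono:
  assumes "whp M P" "\<And>n L. 0 < n \<Longrightarrow> L \<in> space (M n) \<Longrightarrow> P n L \<Longrightarrow> Q n L"
  shows "whp M Q"
proof -
  obtain E where E: "\<forall>n>0. E n \<in> sets (M n)" "(\<lambda>n. measure (M n) (E n)) \<longlonglongrightarrow> 1" "\<forall>n>0. \<forall>L\<in>E n. P n L"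
    using assms(1) unfolding whp_def by blast
  have "Q n L" if "0 < n" "L \<in> E n" for n L
  proof -
    have "L \<in> space (M n)" using E(1) that sets.sets_into_space[of "E n" "M n"] by auto
    thus ?thesis using E(3) that by (intro assms(2)) auto
  qed
  thus ?thesis unfolding whp_def using E(1,2) by (intro exI[of _ E]) simp
qed

locale prob_sequence =
  fixes M :: "nat \<Rightarrow> 'a measure"
  assumes prob: "0 < n \<Longrightarrow> prob_space (M n)"

lemma (in prob_sequence) whp_conj:
  assumes "whp M P" "whp M Q"
  shows "whp M (\<lambda>n L. P n L \<and> Q n L)"
proof -
  obtain E where E: "\<forall>n>0. E n \<in> sets (M n)" "(\<lambda>n. measure (M n) (E n)) \<longlonglongrightarrow> 1" "\<forall>n>0. \<forall>L\<in>E n. P n L"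
    using assms(1) unfolding whp_def by blast
  obtain F where F: "\<forall>n>0. F n \<in> sets (M n)" "(\<lambda>n. measure (M n) (F n)) \<longlonglongrightarrow> 1" "\<forall>n>0. \<forall>L\<in>F n. Q n L"
    using assms(2) unfolding whp_def by blast
  have "(\<lambda>n. measure (M n) (E n \<inter> F n)) \<longlonglongrightarrow> 1"
  proof (rule tendsto_sandwich)
    have "(\<lambda>n. measure (M n) (E n) + measure (M n) (F n) - 1) \<longlonglongrightarrow> 1 + 1 - 1" by (intro tendsto_intros E F)
    thus "(\<lambda>n. measure (M n) (E n) + measure (M n) (F n) - 1) \<longlonglongrightarrow> 1" by simp
    show "\<forall>\<^sub>F n in sequentially. measure (M n) (E n) + measure (M n) (F n) - 1 \<le> measure (M n) (E n \<inter> F n)"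
      using eventually_gt_at_top[of 0]
    proof eventually_elim
      case (elim n)
      interpret prob_space "M n" by (rule prob[OF elim])
      have "measure (M n) (E n \<union> F n) \<le> 1" by (rule prob_le_1)
      moreover have "measure (M n) (E n \<union> F n) = measure (M n) (E n) + measure (M n) (F n) - measure (M n) (E n \<inter> F n)"
        using E F elim by (intro measure_Un3) (auto simp: fmeasurable_eq_sets)
      ultimately show ?case by linarith
    qed
    show "\<forall>\<^sub>F n in sequentially. measure (M n) (E n \<inter> F n) \<le> 1"
      using eventually_gt_at_top[of 0] by eventually_elim (use prob prob_space.prob_le_1 in blast)
  qed auto
  thus ?thesis unfolding whp_def using E F by (intro exI[of _ "\<lambda>n. E n \<inter> F n"]) auto
qed

lemma (in prob_sequence) whp_eventually:
  assumes "\<forall>\<^sub>F n in sequentially. \<forall>L\<in>space (M n). P n L"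
  shows "whp M P"
  unfolding whp_def
proof (intro exI[of _ "\<lambda>n. if \<forall>L\<in>space (M n). P n L then space (M n) else {}"] conjI allI impI)
  have "\<forall>\<^sub>F n in sequentially. measure (M n) (if \<forall>L\<in>space (M n). P n L then space (M n) else {}) = 1"
    using assms eventually_gt_at_top[of 0]
    by eventually_elim (use prob prob_space.prob_space in auto)
  thus "(\<lambda>n. measure (M n) (if \<forall>L\<in>space (M n). P n L then space (M n) else {})) \<longlonglongrightarrow> 1"
    by (rule tendsto_eventually)
qed (auto split: if_splits)

lemma (in prob_sequence) whp_tail:
  assumes meas: "\<And>n. 0 < n \<Longrightarrow> {L \<in> space (M n). P n L} \<in> sets (M n)"
    and bd: "\<forall>\<^sub>F n in sequentially. emeasure (M n) {L \<in> space (M n). \<not> P n L} \<le> ennreal (b n)"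
    and b: "b \<longlonglongrightarrow> 0"
  shows "whp M P"
  unfolding whp_def
proof (intro exI[of _ "\<lambda>n. {L \<in> space (M n). P n L}"] conjI allI impI meas)
  show "(\<lambda>n. measure (M n) {L \<in> space (M n). P n L}) \<longlonglongrightarrow> 1"
  proof (rule tendsto_sandwich)
    have "(\<lambda>n. 1 - max 0 (b n)) \<longlonglongrightarrow> 1 - max 0 0" by (intro tendsto_intros b)
    thus "(\<lambda>n. 1 - max 0 (b n)) \<longlonglongrightarrow> 1" by simp
    show "\<forall>\<^sub>F n in sequentially. 1 - max 0 (b n) \<le> measure (M n) {L \<in> space (M n). P n L}"
      using bd eventually_gt_at_top[of 0]
    proof eventually_elim
      case (elim n)
      interpret prob_space "M n" by (rule prob[OF elim(2)])
      have e: "{L \<in> space (M n). \<not> P n L} = space (M n) - {L \<in> space (M n). P n L}" by auto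
      have "ennreal (measure (M n) {L \<in> space (M n). \<not> P n L}) \<le> ennreal (max 0 (b n))"
        using elim(1) by (simp add: emeasure_eq_measure max_def ennreal_neg order_trans[OF _ ennreal_leI])
      hence "measure (M n) {L \<in> space (M n). \<not> P n L} \<le> max 0 (b n)" by (subst (asm) ennreal_le_iff) auto
      thus ?case unfolding e using prob_compl[OF meas[OF elim(2)]] by simp
    qed
    show "\<forall>\<^sub>F n in sequentially. measure (M n) {L \<in> space (M n). P n L} \<le> 1"
      using eventually_gt_at_top[of 0] by eventually_elim (use prob prob_space.prob_le_1 in blast)
  qed auto
qed auto

text \<open>Markov's inequality; in the applications \<open>u\<close> is a geometric sequence with
  smaller ratio than \<open>a\<close>, so an exponential margin in the first moment
  suffices.\<close>

lemma (in prob_sequence) whp_markov: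
  fixes X :: "nat \<Rightarrow> 'a \<Rightarrow> ennreal"
  assumes meas: "\<And>n. 0 < n \<Longrightarrow> X n \<in> borel_measurable (M n)"
    and u: "\<forall>\<^sub>F n in sequentially. (\<integral>\<^sup>+L. X n L \<partial>M n) \<le> ennreal (u n)"
    and a: "\<And>n. 0 < a n" and lim: "(\<lambda>n. u n / a n) \<longlonglongrightarrow> 0"
  shows "whp M (\<lambda>n L. X n L \<le> ennreal (a n))"
proof (rule whp_tail[OF _ _ lim])
  fix n :: nat assume n: "0 < n"
  show "{L \<in> space (M n). X n L \<le> ennreal (a n)} \<in> sets (M n)" using meas[OF n] by measurable
next
  show "\<forall>\<^sub>F n in sequentially. emeasure (M n) {L \<in> space (M n). \<not> X n L \<le> ennreal (a n)} \<le> ennreal (u n / a n)"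
    using u eventually_gt_at_top[of 0]
  proof eventually_elim
    case (elim n)
    have i: "ennreal (1 / a n) * ennreal (a n) = 1" using a[of n] by (simp add: ennreal_mult[symmetric])
    have "emeasure (M n) {L \<in> space (M n). \<not> X n L \<le> ennreal (a n)} \<le> emeasure (M n) {L \<in> space (M n). 1 \<le> ennreal (1 / a n) * X n L}"
    proof (rule emeasure_mono)
      show "{L \<in> space (M n). \<not> X n L \<le> ennreal (a n)} \<subseteq> {L \<in> space (M n). 1 \<le> ennreal (1 / a n) * X n L}"
      proof clarsimp
        fix L assume "\<not> X n L \<le> ennreal (a n)"
        hence "ennreal (1 / a n) * ennreal (a n) \<le> ennreal (1 / a n) * X n L" by (intro mult_left_mono) auto
        thus "1 \<le> ennreal (1 / a n) * X n L" unfolding i .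
      qed
      have [measurable]: "X n \<in> borel_measurable (M n)" by (rule meas[OF elim(2)])
      show "{L \<in> space (M n). 1 \<le> ennreal (1 / a n) * X n L} \<in> sets (M n)" by measurable
    qed
    also have "\<dots> \<le> ennreal (1 / a n) * (\<integral>\<^sup>+L. X n L * indicator (space (M n)) L \<partial>M n)"
      by (rule nn_integral_Markov_inequality) (use meas[OF elim(2)] in auto)
    also have "(\<integral>\<^sup>+L. X n L * indicator (space (M n)) L \<partial>M n) = (\<integral>\<^sup>+L. X n L \<partial>M n)"
      by (intro nn_integral_cong) simp
    also have "ennreal (1 / a n) * (\<integral>\<^sup>+L. X n L \<partial>M n) \<le> ennreal (1 / a n) * ennreal (u n)"
      by (intro mult_left_mono elim(1)) simp
    also have "\<dots> = ennreal (u n / a n)" using a[of n] by (simp add: ennreal_mult'[symmetric])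
    finally show ?case .
  qed
qed

subsection \<open>Lattice sums of random lattices\<close>

text \<open>At the parameter of c the Gaussian weight is the n-th power of exp(- c x^2/2), where x
  is the length in units of \<open>GH n\<close>. The weights are written as n-th powers because
  exponential rates then reduce to one-variable suprema.\<close>

abbreviation gauss_sum :: "nat \<Rightarrow> real \<Rightarrow> real vec set \<Rightarrow> ennreal" where
  "gauss_sum n c L \<equiv> lattice_sum n (\<lambda>r. ennreal (exp (- c * (r / GH n)\<^sup>2 / 2) ^ n)) L"

abbreviation gauss_sum_trunc :: "nat \<Rightarrow> real \<Rightarrow> real \<Rightarrow> real vec set \<Rightarrow> ennreal" where
  "gauss_sum_trunc n c T L \<equiv> lattice_sum n (\<lambda>r. ennreal ((if r / GH n \<le> T then exp (- c * (r / GH n)\<^sup>2 / 2) else 0) ^ n)) L"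

text \<open>Each vector is charged to its shell of width \<delta>, with the weight at the inner
  radius, and a shell is counted by the whole ball up to its outer radius. The overcount does not
  change exponential rates.\<close>

lemma lattice_sum_shells:
  assumes \<psi>: "\<And>x. 0 \<le> \<psi> x" "\<And>x y. 0 \<le> x \<Longrightarrow> x \<le> y \<Longrightarrow> \<psi> y \<le> \<psi> x" and \<delta>: "0 < (\<delta>::real)"
  shows "lattice_sum n (\<lambda>r. ennreal (\<psi> (r / GH n) ^ n)) L \<le> (\<Sum>k. ennreal (\<psi> (real k * \<delta>) ^ n) * lattice_count n ((real k + 1) * \<delta> * GH n) L)"
proof -
  have "lattice_sum n (\<lambda>r. ennreal (\<psi> (r / GH n) ^ n)) L \<le>
     (\<integral>\<^sup>+v. (\<Sum>k. ennreal (\<psi> (real k * \<delta>) ^ n) * indicator {..(real k + 1) * \<delta> * GH n} (vec_len v)) \<partial>count_space (L - {0\<^sub>v n}))"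
    unfolding lattice_sum_def
  proof (rule nn_integral_mono)
    fix v
    define r where "r = vec_len v / GH n"
    define k where "k = nat \<lfloor>r / \<delta>\<rfloor>"
    have r0: "0 \<le> r" using vec_len_nonneg GH_pos[of n] by (simp add: r_def)
    have f: "real k \<le> r / \<delta>" "r / \<delta> < real k + 1" unfolding k_def using r0 \<delta> by (auto simp: of_nat_nat)
    have "real k * \<delta> \<le> r" "r \<le> (real k + 1) * \<delta>" using f \<delta> by (auto simp: field_simps)
    hence "vec_len v \<le> (real k + 1) * \<delta> * GH n" "\<psi> r \<le> \<psi> (real k * \<delta>)"
      using GH_pos[of n] \<psi>(2)[of "real k * \<delta>" r] \<delta> by (auto simp: r_def field_simps)
    hence "ennreal (\<psi> r ^ n) \<le> (\<Sum>k\<in>{k}. ennreal (\<psi> (real k * \<delta>) ^ n) * indicator {..(real k + 1) * \<delta> * GH n} (vec_len v))"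
      using \<psi>(1) by (auto intro!: ennreal_leI power_mono)
    also have "\<dots> \<le> (\<Sum>k. ennreal (\<psi> (real k * \<delta>) ^ n) * indicator {..(real k + 1) * \<delta> * GH n} (vec_len v))"
      by (intro sum_le_suminf) auto
    finally show "ennreal (\<psi> (vec_len v / GH n) ^ n) \<le> \<dots>" unfolding r_def .
  qed
  also have "\<dots> = (\<Sum>k. ennreal (\<psi> (real k * \<delta>) ^ n) * lattice_count n ((real k + 1) * \<delta> * GH n) L)"
    unfolding lattice_count_def lattice_sum_def by (simp add: nn_integral_suminf nn_integral_cmult)
  finally show ?thesis .
qed

text \<open>Shell k contributes at most the n-th power of \<psi>(k\<delta>) (k+1)\<delta>. All but
  one factor are bounded by \<open>H\<close>, and the last is kept to make the series converge to a
  constant that does not depend on n.\<close>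

lemma lattice_sum_mean_le:
  assumes M: "SL_invariant_prob n M" and n: "2 \<le> n"
    and \<psi>: "\<And>x. 0 \<le> \<psi> x" "\<And>x y. 0 \<le> x \<Longrightarrow> x \<le> y \<Longrightarrow> \<psi> y \<le> \<psi> x" and \<delta>: "0 < (\<delta>::real)"
    and H: "\<And>k::nat. \<psi> (real k * \<delta>) * ((real k + 1) * \<delta>) \<le> H"
    and sm: "summable (\<lambda>k. \<psi> (real k * \<delta>) * ((real k + 1) * \<delta>))"
  shows "(\<integral>\<^sup>+L. lattice_sum n (\<lambda>r. ennreal (\<psi> (r / GH n) ^ n)) L \<partial>M) \<le> ennreal (H ^ (n - 1) * (\<Sum>k. \<psi> (real k * \<delta>) * ((real k + 1) * \<delta>)))"
proof -
  note MD = SL_invariantD[OF M]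
  define q where "q k = \<psi> (real k * \<delta>) * ((real k + 1) * \<delta>)" for k :: nat
  have q0: "0 \<le> q k" for k using \<psi>(1) \<delta> by (simp add: q_def)
  have H0: "0 \<le> H" using q0[of 0] H[of 0] by (simp add: q_def)
  have cm: "lattice_count n \<rho> \<in> borel_measurable M" for \<rho>
    using measurable_lattice_count MD(2) by (simp cong: measurable_cong_sets)
  have "(\<integral>\<^sup>+L. lattice_sum n (\<lambda>r. ennreal (\<psi> (r / GH n) ^ n)) L \<partial>M)
      \<le> (\<integral>\<^sup>+L. (\<Sum>k. ennreal (\<psi> (real k * \<delta>) ^ n) * lattice_count n ((real k + 1) * \<delta> * GH n) L) \<partial>M)"
    by (intro nn_integral_mono lattice_sum_shells \<psi> \<delta>)
  also have "\<dots> = (\<Sum>k. ennreal (\<psi> (real k * \<delta>) ^ n) * (\<integral>\<^sup>+L. lattice_count n ((real k + 1) * \<delta> * GH n) L \<partial>M))"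
    using cm by (simp add: nn_integral_suminf nn_integral_cmult)
  also have "\<dots> \<le> (\<Sum>k. ennreal (H ^ (n - 1) * q k))"
  proof (intro suminf_le summableI)
    fix k
    have "0 < (real k + 1) * \<delta> * GH n" using \<delta> GH_pos[of n] by simp
    from lattice_count_mean_le[OF M n this]
    have "ennreal (\<psi> (real k * \<delta>) ^ n) * (\<integral>\<^sup>+L. lattice_count n ((real k + 1) * \<delta> * GH n) L \<partial>M)
      \<le> ennreal (\<psi> (real k * \<delta>) ^ n) * ennreal (unit_ball_vol (real n) * ((real k + 1) * \<delta> * GH n) ^ n)"
      by (intro mult_left_mono) auto
    also have "unit_ball_vol (real n) * ((real k + 1) * \<delta> * GH n) ^ n = ((real k + 1) * \<delta>) ^ n * (unit_ball_vol (real n) * GH n ^ n)"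
      by (simp add: power_mult_distrib)
    also have "unit_ball_vol (real n) * GH n ^ n = 1" using n by (intro GH_power) simp
    also have "ennreal (\<psi> (real k * \<delta>) ^ n) * ennreal (((real k + 1) * \<delta>) ^ n * 1) = ennreal (q k ^ n)"
      using \<psi>(1) \<delta> by (simp add: q_def power_mult_distrib ennreal_mult)
    also have "q k ^ n = q k ^ (n - 1) * q k" using n by (metis power_minus_mult less_le_trans pos2)
    also have "ennreal (q k ^ (n - 1) * q k) \<le> ennreal (H ^ (n - 1) * q k)"
      using H[of k] q0[of k] by (intro ennreal_leI mult_right_mono power_mono) (auto simp: q_def)
    finally show "ennreal (\<psi> (real k * \<delta>) ^ n) * (\<integral>\<^sup>+L. lattice_count n ((real k + 1) * \<delta> * GH n) L \<partial>M) \<le> ennreal (H ^ (n - 1) * q k)" .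
  qed
  also have "\<dots> = ennreal (\<Sum>k. H ^ (n - 1) * q k)"
    using q0 H0 sm by (intro suminf_ennreal2 summable_mult) (auto simp: q_def)
  also have "(\<Sum>k. H ^ (n - 1) * q k) = H ^ (n - 1) * (\<Sum>k. q k)"
    using sm by (intro suminf_mult) (simp add: q_def)
  finally show ?thesis unfolding q_def .
qed

lemma measurable_lattice_sum_psi:
  assumes "SL_invariant_prob n M" "\<psi> \<in> borel_measurable borel"
  shows "lattice_sum n (\<lambda>r. ennreal (\<psi> (r / GH n) ^ n)) \<in> borel_measurable M"
proof -
  have "(\<lambda>r. ennreal (\<psi> (r / GH n) ^ n)) \<in> borel_measurable borel"
    using assms(2) by measurable
  from measurable_lattice_sum[OF this, of n] show ?thesis
    using SL_invariantD(2)[OF assms(1)] by (simp cong: measurable_cong_sets)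
qed

locale random_lattices =
  fixes M :: "nat \<Rightarrow> real vec set measure"
  assumes inv: "0 < n \<Longrightarrow> SL_invariant_prob n (M n)"
begin

sublocale prob_sequence M
  by (rule prob_sequence.intro) (rule SL_invariantD(1)[OF inv])

lemma space_eq: "0 < n \<Longrightarrow> space (M n) = row_lattice ` SL n"
  by (rule SL_invariantD(3)[OF inv])

end

text \<open>A Laplace principle: about x^n vectors lie up to x, each of weight \<psi>(x)^n, so the
  sum grows at the rate of the supremum of x \<psi>(x). Discretisation raises \<open>H\<close> by at
  most \<delta>, half of the gap to \<open>A\<close>.\<close>

lemma (in random_lattices) whp_lattice_sum:
  assumes \<psi>: "\<And>x. 0 \<le> \<psi> x" "\<And>x. \<psi> x \<le> 1" "\<And>x y. 0 \<le> x \<Longrightarrow> x \<le> y \<Longrightarrow> \<psi> y \<le> \<psi> x" "\<psi> \<in> borel_measurable borel"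
    and H: "\<And>x. 0 \<le> x \<Longrightarrow> x * \<psi> x \<le> H" "H < A"
    and sm: "\<And>\<delta>. 0 < \<delta> \<Longrightarrow> summable (\<lambda>k. \<psi> (real k * \<delta>) * ((real k + 1) * \<delta>))"
  shows "whp M (\<lambda>n L. lattice_sum n (\<lambda>r. ennreal (\<psi> (r / GH n) ^ n)) L \<le> ennreal (A ^ n))"
proof -
  have H0: "0 \<le> H" using H(1)[of 0] by simp
  define \<delta> where "\<delta> = (A - H) / 2"
  have \<delta>: "0 < \<delta>" "H + \<delta> < A" using H(2) by (auto simp: \<delta>_def field_simps)
  define S where "S = (\<Sum>k. \<psi> (real k * \<delta>) * ((real k + 1) * \<delta>))"
  have Hk: "\<psi> (real k * \<delta>) * ((real k + 1) * \<delta>) \<le> H + \<delta>" for k :: nat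
  proof -
    have "\<psi> (real k * \<delta>) * ((real k + 1) * \<delta>) = (real k * \<delta>) * \<psi> (real k * \<delta>) + \<delta> * \<psi> (real k * \<delta>)"
      by (simp add: algebra_simps)
    also have "\<dots> \<le> H + \<delta> * 1" using \<delta> by (intro add_mono H(1) mult_left_mono \<psi>(2)) auto
    finally show ?thesis by simp
  qed
  show ?thesis
  proof (rule whp_markov[where u="\<lambda>n. (H + \<delta>) ^ (n - 1) * S"])
    show "\<And>n. 0 < n \<Longrightarrow> lattice_sum n (\<lambda>r. ennreal (\<psi> (r / GH n) ^ n)) \<in> borel_measurable (M n)"
      by (rule measurable_lattice_sum_psi[OF inv \<psi>(4)])
    show "\<forall>\<^sub>F n in sequentially. (\<integral>\<^sup>+L. lattice_sum n (\<lambda>r. ennreal (\<psi> (r / GH n) ^ n)) L \<partial>M n) \<le> ennreal ((H + \<delta>) ^ (n - 1) * S)"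
      using eventually_ge_at_top[of 2]
    proof eventually_elim
      case (elim n)
      show ?case unfolding S_def using elim
        by (intro lattice_sum_mean_le inv \<psi> \<delta> Hk sm) auto
    qed
    show "0 < A ^ n" for n using H0 H(2) by simp
    have A0: "0 < A" using H0 H(2) by simp
    have "(\<lambda>n. S / A * ((H + \<delta>) / A) ^ n) \<longlonglongrightarrow> S / A * 0"
      using H0 \<delta> A0 by (intro tendsto_mult tendsto_const LIMSEQ_realpow_zero) auto
    moreover have "(H + \<delta>) ^ (Suc n - 1) * S / A ^ Suc n = S / A * ((H + \<delta>) / A) ^ n" for n
      by (simp add: power_divide)
    ultimately have "(\<lambda>n. (H + \<delta>) ^ (Suc n - 1) * S / A ^ Suc n) \<longlonglongrightarrow> 0" by simp
    thus "(\<lambda>n. (H + \<delta>) ^ (n - 1) * S / A ^ n) \<longlonglongrightarrow> 0" by (rule LIMSEQ_imp_Suc)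
  qed
qed

lemma summable_gauss_shells:
  assumes "0 < c" "0 < \<delta>"
  shows "summable (\<lambda>k. exp (- c * (real k * \<delta>)\<^sup>2 / 2) * ((real k + 1) * \<delta>))"
proof (rule summable_comparison_test_bigo)
  show "summable (\<lambda>k. norm (1 / (real k)\<^sup>2))" using inverse_power_summable[of 2, where 'a=real] by (simp add: inverse_eq_divide)
  show "(\<lambda>k. exp (- c * (real k * \<delta>)\<^sup>2 / 2) * ((real k + 1) * \<delta>)) \<in> O(\<lambda>k. 1 / (real k)\<^sup>2)"
    using assms by real_asymp
qed

text \<open>The maximum is at x = 1/sqrt c; it follows from y at most exp(y - 1) with y = c
  x^2.\<close>

lemma gauss_times_le:
  fixes x c :: real
  assumes "0 \<le> x" "0 < c"
  shows "x * exp (- c * x\<^sup>2 / 2) \<le> 1 / sqrt (c * exp 1)"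
proof -
  have "c * x\<^sup>2 * exp (- (c * x\<^sup>2)) \<le> 1 / exp 1"
  proof -
    have "c * x\<^sup>2 \<le> exp (c * x\<^sup>2 - 1)" using exp_ge_add_one_self[of "c * x\<^sup>2 - 1"] by simp
    hence "c * x\<^sup>2 * exp (- (c * x\<^sup>2)) \<le> exp (c * x\<^sup>2 - 1) * exp (- (c * x\<^sup>2))" by (intro mult_right_mono) auto
    also have "\<dots> = exp (- 1)" by (simp only: exp_add[symmetric]) simp
    also have "\<dots> = 1 / exp 1" by (simp add: exp_minus inverse_eq_divide)
    finally show ?thesis .
  qed
  hence "x\<^sup>2 * exp (- (c * x\<^sup>2)) \<le> 1 / (c * exp 1)" using assms by (simp add: field_simps)
  moreover have "(x * exp (- c * x\<^sup>2 / 2))\<^sup>2 = x\<^sup>2 * exp (- (c * x\<^sup>2))"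
    by (simp add: power_mult_distrib power2_eq_square exp_add[symmetric])
  ultimately have "(x * exp (- c * x\<^sup>2 / 2))\<^sup>2 \<le> 1 / (c * exp 1)" by simp
  hence "x * exp (- c * x\<^sup>2 / 2) \<le> sqrt (1 / (c * exp 1))" by (rule real_le_rsqrt)
  thus ?thesis by (simp add: real_sqrt_divide)
qed

text \<open>The condition on T places [0,T] to the left of the maximiser 1/sqrt c, where the
  function increases.\<close>

lemma gauss_times_le_trunc:
  fixes x c T :: real
  assumes "0 \<le> x" "x \<le> T" "0 < c" "c * T\<^sup>2 \<le> 1"
  shows "x * exp (- c * x\<^sup>2 / 2) \<le> T * exp (- c * T\<^sup>2 / 2)"
proof (cases "x = 0")
  case True
  thus ?thesis using assms by simp
next
  case False
  hence x: "0 < x" "0 < T" using assms by auto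
  have "2 * (ln x - ln T) = ln (x\<^sup>2 / T\<^sup>2)" using x by (simp add: ln_div ln_realpow)
  also have "\<dots> \<le> x\<^sup>2 / T\<^sup>2 - 1" using x by (intro ln_le_minus_one) simp
  also have "\<dots> = (x\<^sup>2 - T\<^sup>2) / T\<^sup>2" using x by (simp add: field_simps)
  also have "\<dots> \<le> c * (x\<^sup>2 - T\<^sup>2)"
  proof -
    have "x\<^sup>2 - T\<^sup>2 \<le> 0" using assms x by (simp add: power_mono)
    moreover have "c \<le> 1 / T\<^sup>2" using assms x by (simp add: field_simps)
    ultimately have "1 / T\<^sup>2 * (x\<^sup>2 - T\<^sup>2) \<le> c * (x\<^sup>2 - T\<^sup>2)" by (intro mult_right_mono_neg)
    thus ?thesis by simp
  qed
  finally have "ln x - c * x\<^sup>2 / 2 \<le> ln T - c * T\<^sup>2 / 2" by (simp add: algebra_simps)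
  hence "exp (ln x - c * x\<^sup>2 / 2) \<le> exp (ln T - c * T\<^sup>2 / 2)" by simp
  moreover have "exp (ln y - c * z / 2) = y * exp (- c * z / 2)" if "0 < y" for y z :: real
  proof -
    have "ln y - c * z / 2 = ln y + - c * z / 2" by simp
    thus ?thesis using that by (simp only: exp_add exp_ln)
  qed
  ultimately show ?thesis using x by simp
qed

lemma (in random_lattices) whp_gauss_sum:
  assumes c: "0 < c" and A: "1 / sqrt (c * exp 1) < A"
  shows "whp M (\<lambda>n L. gauss_sum n c L \<le> ennreal (A ^ n))"
proof (rule whp_lattice_sum[where \<psi>="\<lambda>x. exp (- c * x\<^sup>2 / 2)" and H="1 / sqrt (c * exp 1)"])
  show "exp (- c * x\<^sup>2 / 2) \<le> 1" for x :: real using c by simp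
  show "exp (- c * y\<^sup>2 / 2) \<le> exp (- c * x\<^sup>2 / 2)" if "0 \<le> x" "x \<le> y" for x y :: real
    using c power_mono[OF that(2,1), of 2] by simp
  show "x * exp (- c * x\<^sup>2 / 2) \<le> 1 / sqrt (c * exp 1)" if "0 \<le> x" for x by (rule gauss_times_le[OF that c])
qed (use A c summable_gauss_shells in auto)

lemma (in random_lattices) whp_gauss_sum_trunc:
  assumes c: "0 < c" and T: "0 < T" "c * T\<^sup>2 \<le> 1"
    and A: "T * exp (- c * T\<^sup>2 / 2) < A"
  shows "whp M (\<lambda>n L. gauss_sum_trunc n c T L \<le> ennreal (A ^ n))"
proof (rule whp_lattice_sum[where \<psi>="\<lambda>x. if x \<le> T then exp (- c * x\<^sup>2 / 2) else 0" and H="T * exp (- c * T\<^sup>2 / 2)"])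
  show "(if x \<le> T then exp (- c * x\<^sup>2 / 2) else 0) \<le> 1" for x :: real using c by simp
  show "(if y \<le> T then exp (- c * y\<^sup>2 / 2) else 0) \<le> (if x \<le> T then exp (- c * x\<^sup>2 / 2) else 0)" if "0 \<le> x" "x \<le> y" for x y :: real
    using c power_mono[OF that(2,1), of 2] that by auto
  show "x * (if x \<le> T then exp (- c * x\<^sup>2 / 2) else 0) \<le> T * exp (- c * T\<^sup>2 / 2)" if "0 \<le> x" for x
    using gauss_times_le_trunc[OF that _ c T(2)] T by auto
  show "summable (\<lambda>k. (if real k * \<delta> \<le> T then exp (- c * (real k * \<delta>)\<^sup>2 / 2) else 0) * ((real k + 1) * \<delta>))" if "0 < \<delta>" for \<delta>
    by (rule summable_comparison_test'[OF summable_gauss_shells[OF c that], of 0]) (use that in auto)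
  show "(\<lambda>x. if x \<le> T then exp (- c * x\<^sup>2 / 2) else 0) \<in> borel_measurable borel" by measurable
qed (use A in auto)

section \<open>Point counts, shortest length and normalising constant of a random lattice\<close>

lemma lattice_count_GH_mean:
  assumes "SL_invariant_prob n M" "2 \<le> n" "0 < t"
  shows "(\<integral>\<^sup>+L. lattice_count n (t * GH n) L \<partial>M) \<le> ennreal (t ^ n)"
proof -
  have "unit_ball_vol (real n) * (t * GH n) ^ n = t ^ n * (unit_ball_vol (real n) * GH n ^ n)"
    by (simp add: power_mult_distrib)
  also have "\<dots> = t ^ n" using GH_power[of n] assms by simp
  finally show ?thesis using lattice_count_mean_le[OF assms(1,2), of "t * GH n"] assms GH_pos[of n] by simp
qed

lemma (in random_lattices) whp_many_points:
  assumes t: "1 < t"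
  shows "whp M (\<lambda>n L. ennreal (t ^ n / 8) \<le> lattice_count n (t * GH n) L)"
proof (rule whp_tail[where b="\<lambda>n. 64 * (1 / t) ^ n"])
  show "{L \<in> space (M n). ennreal (t ^ n / 8) \<le> lattice_count n (t * GH n) L} \<in> sets (M n)" if "0 < n" for n
  proof -
    have [measurable]: "lattice_count n (t * GH n) \<in> borel_measurable (M n)"
      using measurable_lattice_count SL_invariantD(2)[OF inv[OF that]] by (simp cong: measurable_cong_sets)
    show ?thesis by measurable
  qed
  show "\<forall>\<^sub>F n in sequentially. emeasure (M n) {L \<in> space (M n). \<not> ennreal (t ^ n / 8) \<le> lattice_count n (t * GH n) L} \<le> ennreal (64 * (1 / t) ^ n)"
    using eventually_ge_at_top[of 3]
  proof eventually_elim
    case (elim n)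
    have "unit_ball_vol (real n) * (t * GH n) ^ n = t ^ n * (unit_ball_vol (real n) * GH n ^ n)"
      by (simp add: power_mult_distrib)
    also have "\<dots> = t ^ n" using GH_power[of n] elim by simp
    finally have e: "unit_ball_vol (real n) * (t * GH n) ^ n = t ^ n" .
    have "0 < t * GH n" using t GH_pos[of n] by simp
    from lattice_count_lower_tail[OF inv elim this] elim
    show ?case unfolding e by (simp add: not_le power_one_over)
  qed
  have "(\<lambda>n. 64 * (1 / t) ^ n) \<longlonglongrightarrow> 64 * 0" using t by (intro tendsto_mult tendsto_const LIMSEQ_realpow_zero) auto
  thus "(\<lambda>n. 64 * (1 / t) ^ n) \<longlonglongrightarrow> 0" by simp
qed

text \<open>The mean number of such vectors is at most t^n. The count is an integer, so the
  threshold 1/2 of Markov's inequality means that there is none.\<close>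

lemma (in random_lattices) whp_no_short:
  assumes t: "0 < t" "t < 1"
  shows "whp M (\<lambda>n L. \<forall>v\<in>L - {0\<^sub>v n}. t * GH n < vec_len v)"
proof -
  have "whp M (\<lambda>n L. lattice_count n (t * GH n) L \<le> ennreal (1 / 2))"
  proof (rule whp_markov[where u="\<lambda>n. t ^ n"])
    show "lattice_count n (t * GH n) \<in> borel_measurable (M n)" if "0 < n" for n
      using measurable_lattice_count SL_invariantD(2)[OF inv[OF that]] by (simp cong: measurable_cong_sets)
    show "\<forall>\<^sub>F n in sequentially. (\<integral>\<^sup>+L. lattice_count n (t * GH n) L \<partial>M n) \<le> ennreal (t ^ n)"
      using eventually_ge_at_top[of 2] by eventually_elim (use t in \<open>auto intro!: lattice_count_GH_mean inv\<close>)
    have "(\<lambda>n. t ^ n * 2) \<longlonglongrightarrow> 0 * 2" using t by (intro tendsto_mult tendsto_const LIMSEQ_realpow_zero) auto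
    thus "(\<lambda>n. t ^ n / (1 / 2)) \<longlonglongrightarrow> 0" by simp
  qed auto
  thus ?thesis
  proof (rule whp_mono)
    fix n L assume L: "lattice_count n (t * GH n) L \<le> ennreal (1 / 2)"
    show "\<forall>v\<in>L - {0\<^sub>v n}. t * GH n < vec_len v"
    proof (rule ccontr)
      assume "\<not> ?thesis"
      then obtain v where v: "v \<in> L - {0\<^sub>v n}" "vec_len v \<le> t * GH n" by force
      have "(1::ennreal) = indicator {..t * GH n} (vec_len v)" using v by simp
      also have "\<dots> \<le> lattice_count n (t * GH n) L"
        unfolding lattice_count_def lattice_sum_def by (rule nn_integral_ge_point[OF v(1)])
      also have "\<dots> \<le> ennreal (1 / 2)" by (rule L)
      finally have "ennreal 1 \<le> ennreal (1 / 2)" by (simp only: ennreal_1)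
      hence "(1::real) \<le> 1 / 2" by (subst (asm) ennreal_le_iff) auto
      thus False by simp
    qed
  qed
qed

lemma lattice_count_eq_card:
  assumes L: "L \<in> row_lattice ` SL n" and \<rho>: "0 \<le> \<rho>"
  shows "finite {v \<in> L - {0\<^sub>v n}. vec_len v \<le> \<rho>}"
    "lattice_count n \<rho> L = ennreal (real (card {v \<in> L - {0\<^sub>v n}. vec_len v \<le> \<rho>}))"
proof -
  obtain g where g: "g \<in> SL n" "L = row_lattice g" using L by auto
  have "{v \<in> L - {0\<^sub>v n}. vec_len v \<le> \<rho>} \<subseteq> lat_pt g ` int_ball n g \<rho>"
    unfolding g(2) row_lattice_eq_lat_pt[OF g(1)] int_ball_def by auto
  thus f: "finite {v \<in> L - {0\<^sub>v n}. vec_len v \<le> \<rho>}"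
    using int_ball_count(1)[OF g(1) \<rho>] finite_surj by blast
  have "lattice_count n \<rho> L = (\<integral>\<^sup>+v. indicator {v. vec_len v \<le> \<rho>} v \<partial>count_space (L - {0\<^sub>v n}))"
    unfolding lattice_count_def lattice_sum_def by (intro nn_integral_cong) (simp add: indicator_def)
  also have "\<dots> = of_nat (card {v \<in> L - {0\<^sub>v n}. vec_len v \<le> \<rho>})" by (rule nn_integral_indicator_count[OF f])
  finally show "lattice_count n \<rho> L = ennreal (real (card {v \<in> L - {0\<^sub>v n}. vec_len v \<le> \<rho>}))"
    by (simp add: ennreal_of_nat_eq_real_of_nat)
qed

lemma lambda1:
  assumes L: "L \<in> row_lattice ` SL n" and n: "0 < n"
  shows "\<exists>v\<in>L - {0\<^sub>v n}. vec_len v = lambda1 n L" "\<And>v. v \<in> L - {0\<^sub>v n} \<Longrightarrow> lambda1 n L \<le> vec_len v"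
proof -
  obtain g where g: "g \<in> SL n" "L = row_lattice g" using L by auto
  have bdd: "bdd_below (vec_len ` (L - {0\<^sub>v n}))" by (rule bdd_belowI2[of _ 0]) (rule vec_len_nonneg)
  show le: "\<And>v. v \<in> L - {0\<^sub>v n} \<Longrightarrow> lambda1 n L \<le> vec_len v"
    unfolding lambda1_def by (intro cInf_lower bdd) auto
  define z :: "int vec" where "z = unit_vec n 0"
  have z: "z \<in> carrier_vec n" "z \<noteq> 0\<^sub>v n"
    using n arg_cong[of z "0\<^sub>v n" "\<lambda>v. v $ 0"] by (auto simp: z_def)
  define w where "w = lat_pt g z"
  have w: "w \<in> L - {0\<^sub>v n}"
    unfolding w_def g(2) row_lattice_eq_lat_pt[OF g(1)] using z lat_pt_eq_zero_iff[OF g(1) z(1)] by auto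
  let ?S = "{v \<in> L - {0\<^sub>v n}. vec_len v \<le> vec_len w}"
  have fS: "finite ?S" by (rule lattice_count_eq_card(1)[OF L vec_len_nonneg])
  have S0: "vec_len ` ?S \<noteq> {}" using w by auto
  obtain v where v: "v \<in> ?S" "vec_len v = Min (vec_len ` ?S)"
    using Min_in[OF finite_imageI[OF fS] S0] by auto
  have "vec_len v \<le> vec_len u" if u: "u \<in> L - {0\<^sub>v n}" for u
  proof (cases "vec_len u \<le> vec_len w")
    case True
    thus ?thesis unfolding v(2) using u fS by (intro Min_le) auto
  next
    case False
    thus ?thesis using v(1) by auto
  qed
  hence "vec_len v \<le> lambda1 n L" unfolding lambda1_def using w by (intro cInf_greatest) auto
  moreover have "lambda1 n L \<le> vec_len v" using v(1) by (intro le) auto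
  ultimately show "\<exists>v\<in>L - {0\<^sub>v n}. vec_len v = lambda1 n L" using v(1) by (intro bexI[of _ v]) auto
qed

lemma (in random_lattices) whp_lambda1:
  assumes t: "0 < t" "t < 1" "1 < T"
  shows "whp M (\<lambda>n L. t * GH n < lambda1 n L \<and> lambda1 n L \<le> T * GH n)"
proof (rule whp_conj)
  show "whp M (\<lambda>n L. t * GH n < lambda1 n L)"
  proof (rule whp_mono[OF whp_no_short[OF t(1,2)]])
    fix n L assume L: "0 < n" "L \<in> space (M n)" "\<forall>v\<in>L - {0\<^sub>v n}. t * GH n < vec_len v"
    have "L \<in> row_lattice ` SL n" using L(2) space_eq[OF L(1)] by simp
    from lambda1(1)[OF this L(1)] obtain v where "v \<in> L - {0\<^sub>v n}" "vec_len v = lambda1 n L" by blast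
    thus "t * GH n < lambda1 n L" using bspec[OF L(3), of v] by simp
  qed
  show "whp M (\<lambda>n L. lambda1 n L \<le> T * GH n)"
  proof (rule whp_mono[OF whp_many_points[OF t(3)]])
    fix n L assume L: "0 < n" "L \<in> space (M n)" "ennreal (T ^ n / 8) \<le> lattice_count n (T * GH n) L"
    have Ls: "L \<in> row_lattice ` SL n" using L(2) space_eq[OF L(1)] by simp
    have T0: "0 \<le> T * GH n" using t GH_pos[of n] by simp
    have "0 < ennreal (T ^ n / 8)" using t by simp
    also have "\<dots> \<le> ennreal (real (card {v \<in> L - {0\<^sub>v n}. vec_len v \<le> T * GH n}))"
      using L(3) unfolding lattice_count_eq_card(2)[OF Ls T0] .
    finally have "0 < real (card {v \<in> L - {0\<^sub>v n}. vec_len v \<le> T * GH n})" by (simp only: ennreal_less_zero_iff)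
    hence "card {v \<in> L - {0\<^sub>v n}. vec_len v \<le> T * GH n} \<noteq> 0" by linarith
    hence "{v \<in> L - {0\<^sub>v n}. vec_len v \<le> T * GH n} \<noteq> {}" by (metis card.empty)
    then obtain v where v: "v \<in> L - {0\<^sub>v n}" "vec_len v \<le> T * GH n" by blast
    show "lambda1 n L \<le> T * GH n" using lambda1(2)[OF Ls L(1) v(1)] v(2) by linarith
  qed
qed

lemma theta_s_param:
  assumes "L \<in> row_lattice ` SL n" "0 < c" "0 < n"
  shows "theta L (s_param n c) = 1 + gauss_sum n c L"
proof -
  have "lattice_sum n (\<lambda>r. ennreal (exp (- pi * r\<^sup>2 / (s_param n c)\<^sup>2))) L = gauss_sum n c L"
    unfolding lattice_sum_def using gauss_weight_s_param[OF assms(2,3)] by (simp add: gauss_weight_def)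
  thus ?thesis unfolding theta_eq_lattice_sum[OF assms(1)] by simp
qed

text \<open>One event serves all c: the sums decrease in c, so it suffices to treat c = 1/(j+1),
  where finiteness holds almost surely because the mean is finite.\<close>

lemma (in random_lattices) whp_theta_finite:
  shows "whp M (\<lambda>n L. \<forall>c>0. theta L (s_param n c) < \<infinity>)"
proof -
  define X where "X j n = lattice_sum n (\<lambda>r. ennreal (exp (- (1 / real (Suc j)) * (r / GH n)\<^sup>2 / 2) ^ n))" for j n :: nat
  have Xm: "X j n \<in> borel_measurable (M n)" if "0 < n" for j n
    unfolding X_def by (rule measurable_lattice_sum_psi[OF inv[OF that]]) measurable
  have fin: "AE L in M n. X j n L < \<infinity>" if n: "2 \<le> n" for j n
  proof -
    let ?c = "1 / real (Suc j)"
    have "(\<integral>\<^sup>+L. X j n L \<partial>M n) \<le> ennreal ((1 / sqrt (?c * exp 1) + 1) ^ (n - 1) * (\<Sum>k. exp (- ?c * (real k * 1)\<^sup>2 / 2) * ((real k + 1) * 1)))"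
      unfolding X_def
    proof (rule lattice_sum_mean_le)
      show "SL_invariant_prob n (M n)" using inv n by simp
      show "exp (- ?c * y\<^sup>2 / 2) \<le> exp (- ?c * x\<^sup>2 / 2)" if "0 \<le> x" "x \<le> y" for x y :: real
        using power_mono[OF that(2,1), of 2] by (simp add: divide_right_mono)
      show "summable (\<lambda>k. exp (- ?c * (real k * 1)\<^sup>2 / 2) * ((real k + 1) * 1))" by (rule summable_gauss_shells) auto
      fix k :: nat
      have "exp (- ?c * (real k * 1)\<^sup>2 / 2) * ((real k + 1) * 1) = real k * exp (- ?c * (real k)\<^sup>2 / 2) + exp (- ?c * (real k)\<^sup>2 / 2)"
        by (simp add: algebra_simps)
      also have "\<dots> \<le> 1 / sqrt (?c * exp 1) + 1" by (intro add_mono gauss_times_le) auto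
      finally show "exp (- ?c * (real k * 1)\<^sup>2 / 2) * ((real k + 1) * 1) \<le> 1 / sqrt (?c * exp 1) + 1" .
    qed (use n in auto)
    also have "\<dots> < \<infinity>" by simp
    finally have "(\<integral>\<^sup>+L. X j n L \<partial>M n) \<noteq> \<infinity>" by simp
    from nn_integral_noteq_infinite[OF Xm this] show ?thesis using n by (auto simp: top.not_eq_extremum)
  qed
  have "whp M (\<lambda>n L. \<forall>j. X j n L < \<infinity>)"
  proof (rule whp_tail[where b="\<lambda>_. 0"])
    show "{L \<in> space (M n). \<forall>j. X j n L < \<infinity>} \<in> sets (M n)" if "0 < n" for n
      using Xm[OF that] by measurable
    show "\<forall>\<^sub>F n in sequentially. emeasure (M n) {L \<in> space (M n). \<not> (\<forall>j. X j n L < \<infinity>)} \<le> ennreal 0"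
      using eventually_ge_at_top[of 2]
    proof eventually_elim
      case (elim n)
      have "AE L in M n. \<forall>j. X j n L < \<infinity>" using fin[OF elim] by (simp add: AE_all_countable)
      moreover have "{L \<in> space (M n). \<not> (\<forall>j. X j n L < \<infinity>)} \<in> sets (M n)"
      proof -
        have [measurable]: "X j n \<in> borel_measurable (M n)" for j using Xm elim by simp
        show ?thesis by measurable
      qed
      ultimately show ?case by (subst (asm) AE_iff_measurable) auto
    qed
  qed auto
  thus ?thesis
  proof (rule whp_mono)
    fix n L assume L: "0 < n" "L \<in> space (M n)" "\<forall>j. X j n L < \<infinity>"
    have Ls: "L \<in> row_lattice ` SL n" using L(2) space_eq[OF L(1)] by simp
    show "\<forall>c>0. theta L (s_param n c) < \<infinity>"
    proof (intro allI impI)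
      fix c :: real assume c: "0 < c"
      obtain j where j: "1 / real (Suc j) < c" using c nat_approx_posE by blast
      have "gauss_sum n c L \<le> X j n L"
        unfolding X_def lattice_sum_def
      proof (intro nn_integral_mono ennreal_leI power_mono)
        fix v
        have mono: "exp (- b * y / 2) \<le> exp (- a * y / 2)" if "a < b" "0 \<le> y" for a b y :: real
          using that by (simp add: mult_right_mono)
        show "exp (- c * (vec_len v / GH n)\<^sup>2 / 2) \<le> exp (- (1 / real (Suc j)) * (vec_len v / GH n)\<^sup>2 / 2)"
          by (rule mono[OF j]) simp
      qed auto
      also have "\<dots> < \<infinity>" using L(3) by blast
      finally show "theta L (s_param n c) < \<infinity>" unfolding theta_s_param[OF Ls c L(1)] by simp
    qed
  qed
qed

subsection \<open>Discrete Gaussians\<close>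

text \<open>Finiteness of \<open>theta\<close> makes the weights a genuine density, so that
  \<open>embed_pmf\<close> returns it; otherwise neither the infinite sum nor the law would have its
  intended meaning.\<close>

lemma disc_gauss:
  assumes z: "0\<^sub>v n \<in> L" and fin: "theta L s < \<infinity>"
  shows "0 < enn2real (theta L s)" "1 \<le> enn2real (theta L s)"
    "measure_pmf.prob (disc_gauss L s) A = enn2real (\<integral>\<^sup>+v. ennreal (gauss_weight s v) \<partial>count_space (A \<inter> L)) / enn2real (theta L s)"
    "set_pmf (disc_gauss L s) \<subseteq> L"
proof -
  let ?W = "\<lambda>A. \<integral>\<^sup>+v. ennreal (gauss_weight s v) \<partial>count_space (A \<inter> L)"
  define Z where "Z = enn2real (theta L s)"
  have Z: "theta L s = ennreal Z" using fin by (simp add: Z_def)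
  have w0: "gauss_weight s (0\<^sub>v n) = 1" by (simp add: gauss_weight_def vec_len_def)
  have "ennreal (gauss_weight s (0\<^sub>v n)) \<le> theta L s"
    unfolding theta_def by (rule nn_integral_ge_point[OF z])
  hence "ennreal 1 \<le> ennreal Z" unfolding w0 Z by simp
  moreover have "0 \<le> Z" by (simp add: Z_def)
  ultimately have Z1: "1 \<le> Z" by (subst (asm) ennreal_le_iff) auto
  thus "1 \<le> enn2real (theta L s)" "0 < enn2real (theta L s)" by (auto simp: Z_def)
  have nn: "0 \<le> gauss_weight s v" for v by (simp add: gauss_weight_def)
  have "integrable (count_space L) (gauss_weight s)"
    by (rule integrableI_nonneg) (use nn fin in \<open>auto simp: theta_def\<close>)
  hence as: "Infinite_Set_Sum.abs_summable_on (gauss_weight s) L"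
    by (simp add: Infinite_Set_Sum.abs_summable_on_def)
  have inf: "(\<Sum>\<^sub>\<infinity>w\<in>L. gauss_weight s w) = Z"
  proof -
    have "ennreal Z = ennreal (infsetsum (gauss_weight s) L)"
      unfolding Z[symmetric] theta_def by (rule nn_integral_conv_infsetsum[OF as nn])
    moreover have "0 \<le> infsetsum (gauss_weight s) L" by (intro infsetsum_nonneg nn)
    ultimately have "infsetsum (gauss_weight s) L = Z" using Z1 by simp
    thus ?thesis using infsetsum_infsum[OF as] by simp
  qed
  let ?f = "\<lambda>v. if v \<in> L then gauss_weight s v / Z else 0"
  have dg: "disc_gauss L s = embed_pmf ?f" unfolding disc_gauss_def inf ..
  have int_f: "(\<integral>\<^sup>+v. ennreal (?f v) \<partial>count_space A) = (?W A) / ennreal Z" for A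
  proof -
    have "(\<integral>\<^sup>+v. ennreal (?f v) \<partial>count_space A) = (\<integral>\<^sup>+v. ennreal (?f v) * indicator A v \<partial>count_space UNIV)"
      by (rule nn_integral_count_space_indicator) simp
    also have "\<dots> = (\<integral>\<^sup>+v. ennreal (gauss_weight s v) * indicator (A \<inter> L) v / ennreal Z \<partial>count_space UNIV)"
      using Z1 nn by (intro nn_integral_cong) (auto simp: indicator_def divide_ennreal)
    also have "\<dots> = (\<integral>\<^sup>+v. ennreal (gauss_weight s v) * indicator (A \<inter> L) v \<partial>count_space UNIV) / ennreal Z"
      by (rule nn_integral_divide) simp
    also have "(\<integral>\<^sup>+v. ennreal (gauss_weight s v) * indicator (A \<inter> L) v \<partial>count_space UNIV) = (?W A)"
      by (rule nn_integral_count_space_indicator[symmetric]) simp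
    finally show ?thesis .
  qed
  have f1: "(\<integral>\<^sup>+v. ennreal (?f v) \<partial>count_space UNIV) = 1"
    unfolding int_f using Z1 by (simp add: theta_def[symmetric] Z ennreal_divide_self)
  have f0: "0 \<le> ?f v" for v using nn Z1 by simp
  have pmf: "pmf (disc_gauss L s) v = ?f v" for v
    unfolding dg by (rule pmf_embed_pmf[OF f0 f1])
  have em: "emeasure (disc_gauss L s) A = (?W A) / ennreal Z"
    unfolding int_f[symmetric] nn_integral_pmf[symmetric] pmf ..
  show "measure_pmf.prob (disc_gauss L s) A = enn2real (?W A) / enn2real (theta L s)"
  proof -
    have "(?W A) = (\<integral>\<^sup>+v. ennreal (gauss_weight s v) * indicator (A \<inter> L) v \<partial>count_space UNIV)"
      by (rule nn_integral_count_space_indicator) simp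
    also have "\<dots> \<le> (\<integral>\<^sup>+v. ennreal (gauss_weight s v) * indicator L v \<partial>count_space UNIV)"
      by (intro nn_integral_mono) (auto simp: indicator_def)
    also have "\<dots> = theta L s" unfolding theta_def by (rule nn_integral_count_space_indicator[symmetric]) simp
    finally have "(?W A) < \<infinity>" using fin by (rule le_less_trans)
    then obtain y where y: "(?W A) = ennreal y" "0 \<le> y"
      by (cases "(?W A)") auto
    show ?thesis unfolding measure_def em y(1) Z using Z1 y(2) by (simp add: divide_ennreal)
  qed
  show "set_pmf (disc_gauss L s) \<subseteq> L"
    by (auto simp: set_pmf_iff pmf split: if_splits)
qed

lemma tv_dist_bound:
  assumes "tv_dist p q \<le> e"
  shows "\<bar>measure_pmf.prob p A - measure_pmf.prob q A\<bar> \<le> e"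
proof -
  have "bdd_above (range (\<lambda>A. \<bar>measure_pmf.prob p A - measure_pmf.prob q A\<bar>))"
  proof (rule bdd_aboveI2[of _ _ 1])
    fix A
    have "0 \<le> measure_pmf.prob p A" "measure_pmf.prob p A \<le> 1" "0 \<le> measure_pmf.prob q A" "measure_pmf.prob q A \<le> 1" by auto
    thus "\<bar>measure_pmf.prob p A - measure_pmf.prob q A\<bar> \<le> 1" by linarith
  qed
  hence "\<bar>measure_pmf.prob p A - measure_pmf.prob q A\<bar> \<le> tv_dist p q"
    unfolding tv_dist_def by (intro cSUP_upper) auto
  thus ?thesis using assms by linarith
qed

subsection \<open>Primitive parts\<close>

lemma smult_lat_pt_eq:
  assumes g: "g \<in> SL n" and z: "z \<in> carrier_vec n" "w \<in> carrier_vec n"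
    and e: "lat_pt g z = real m \<cdot>\<^sub>v lat_pt g w"
  shows "z = of_nat m \<cdot>\<^sub>v w"
  using inj_onD[OF inj_on_lat_pt[OF g], of z "of_nat m \<cdot>\<^sub>v w"] e lat_pt_smult[OF g z(2), of m] z by auto

lemma primitive_in_lat_pt:
  assumes g: "g \<in> SL n" and w: "w \<in> carrier_vec n" and n: "0 < n"
  shows "primitive_in n (row_lattice g) (lat_pt g w) \<longleftrightarrow> int_primitive n w"
proof
  assume P: "primitive_in n (row_lattice g) (lat_pt g w)"
  have w0: "w \<noteq> 0\<^sub>v n" using P lat_pt_zero[OF g] by (auto simp: primitive_in_def)
  obtain m u where m: "1 \<le> m" "int_primitive n u" "w = of_nat m \<cdot>\<^sub>v u"
    using int_primitive_factor[OF w w0] by blast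
  have u: "u \<in> carrier_vec n" using m by (simp add: int_primitive_def)
  have "lat_pt g u \<in> row_lattice g" unfolding row_lattice_eq_lat_pt[OF g] using u by simp
  moreover have "lat_pt g w = real m \<cdot>\<^sub>v lat_pt g u" unfolding m(3) by (rule lat_pt_smult[OF g u])
  ultimately have "m = 1" using P unfolding primitive_in_def by blast
  hence "w = u" using m(3) u by auto
  thus "int_primitive n w" using m by simp
next
  assume P: "int_primitive n w"
  have w0: "w \<noteq> 0\<^sub>v n"
  proof
    assume "w = 0\<^sub>v n"
    hence "\<forall>i<n. 2 dvd w $ i" by simp
    hence "is_unit (2::int)" using P unfolding int_primitive_def by blast
    thus False by simp
  qed
  show "primitive_in n (row_lattice g) (lat_pt g w)"
    unfolding primitive_in_def
  proof (intro conjI ballI allI impI)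
    show "lat_pt g w \<in> row_lattice g" unfolding row_lattice_eq_lat_pt[OF g] using w by simp
    show "lat_pt g w \<noteq> 0\<^sub>v n" using w0 lat_pt_eq_zero_iff[OF g w] by simp
    fix u m assume u: "u \<in> row_lattice g" "lat_pt g w = real m \<cdot>\<^sub>v u"
    then obtain z where z: "z \<in> carrier_vec n" "u = lat_pt g z" unfolding row_lattice_eq_lat_pt[OF g] by auto
    have "w = of_nat m \<cdot>\<^sub>v z" by (rule smult_lat_pt_eq[OF g w z(1)]) (use u z in simp)
    hence "\<forall>i<n. int m dvd w $ i" using z by auto
    hence "is_unit (int m)" using P unfolding int_primitive_def by blast
    thus "m = 1" by simp
  qed
qed

text \<open>The point is uniqueness in the definite description. From m w = m' w' with both vectors
  primitive, the cofactors of gcd(m, m') divide all coordinates of one of the vectors and are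
  therefore 1.\<close>

lemma prim_part:
  assumes L: "L \<in> row_lattice ` SL n" and n: "0 < n" and v: "v \<in> L" "v \<noteq> 0\<^sub>v n"
  shows "\<exists>m::nat. 1 \<le> m \<and> v = real m \<cdot>\<^sub>v prim_part n L v" "prim_part n L v \<in> L"
proof -
  obtain g where g: "g \<in> SL n" "L = row_lattice g" using L by auto
  obtain z where z: "z \<in> carrier_vec n" "v = lat_pt g z" using v(1) unfolding g(2) row_lattice_eq_lat_pt[OF g(1)] by auto
  have z0: "z \<noteq> 0\<^sub>v n" using v(2) z lat_pt_zero[OF g(1)] by auto
  obtain m w where m: "1 \<le> m" "int_primitive n w" "z = of_nat m \<cdot>\<^sub>v w"
    using int_primitive_factor[OF z(1) z0] by blast
  have w: "w \<in> carrier_vec n" using m by (simp add: int_primitive_def)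
  let ?P = "\<lambda>u. primitive_in n L u \<and> (\<exists>m::nat. 1 \<le> m \<and> v = real m \<cdot>\<^sub>v u)"
  have Pw: "?P (lat_pt g w)"
    using primitive_in_lat_pt[OF g(1) w n] m lat_pt_smult[OF g(1) w, of m] z g(2) by auto
  have uniq: "u = lat_pt g w" if Pu: "?P u" for u
  proof -
    obtain m' where m': "1 \<le> m'" "v = real m' \<cdot>\<^sub>v u" using Pu by blast
    have "u \<in> L" using Pu by (simp add: primitive_in_def)
    then obtain w' where w': "w' \<in> carrier_vec n" "u = lat_pt g w'" unfolding g(2) row_lattice_eq_lat_pt[OF g(1)] by auto
    have pw': "int_primitive n w'" using Pu primitive_in_lat_pt[OF g(1) w'(1) n] w' g(2) by simp
    have "z = of_nat m' \<cdot>\<^sub>v w'" by (rule smult_lat_pt_eq[OF g(1) z(1) w'(1)]) (use m' z w' in simp)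
    hence e: "int m * w $ i = int m' * w' $ i" if "i < n" for i
      using m(3) that w w' by (metis index_smult_vec(1) carrier_vecD)
    define d where "d = gcd m m'"
    have "d \<noteq> 0" using m(1) by (simp add: d_def)
    obtain a b where ab: "m = a * d" "m' = b * d" "coprime a b"
      using gcd_coprime_exists[OF \<open>d \<noteq> 0\<close>[unfolded d_def]] unfolding d_def by blast
    have e': "int a * w $ i = int b * w' $ i" if "i < n" for i
    proof -
      have "int d * (int a * w $ i) = int d * (int b * w' $ i)" using e[OF that] unfolding ab by (simp add: mult.commute mult.left_commute)
      thus ?thesis using \<open>d \<noteq> 0\<close> by simp
    qed
    have "int b dvd w $ i" if "i < n" for i
    proof -
      have "int b dvd int a * w $ i" unfolding e'[OF that] by simp
      thus ?thesis using ab(3) by (simp add: coprime_dvd_mult_right_iff coprime_commute)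
    qed
    hence "is_unit (int b)" using m(2) unfolding int_primitive_def by blast
    hence b1: "b = 1" by simp
    have "int a dvd w' $ i" if "i < n" for i
    proof -
      have "int a dvd int b * w' $ i" unfolding e'[OF that, symmetric] by simp
      thus ?thesis using b1 by simp
    qed
    hence "is_unit (int a)" using pw' unfolding int_primitive_def by blast
    hence a1: "a = 1" by simp
    have "w' = w" using e' a1 b1 w w' by (intro eq_vecI) auto
    thus ?thesis using w' by simp
  qed
  have "prim_part n L v = lat_pt g w"
    unfolding prim_part_def if_not_P[OF v(2)] by (rule the_equality[of ?P, OF Pw uniq])
  thus "\<exists>m::nat. 1 \<le> m \<and> v = real m \<cdot>\<^sub>v prim_part n L v" "prim_part n L v \<in> L"
    using Pw by (auto simp: primitive_in_def)
qed

subsection \<open>Rates\<close>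

text \<open>The maximum of log t - c t^2/2 over t up to \<gamma>: log t is the rate of the number of
  vectors of length t \<open>GH n\<close>, the rest that of their weight. The maximiser is \<gamma>
  or 1/sqrt c, whichever is smaller.\<close>

definition num_rate :: "real \<Rightarrow> real \<Rightarrow> real" where
  "num_rate \<gamma> c = (if c < 1 / \<gamma>\<^sup>2 then ln \<gamma> - c * \<gamma>\<^sup>2 / 2 else - (1 + ln c) / 2)"

text \<open>The rate of a probability is that of the denominator minus that of the numerator; in the
  denominator the 0 in the maximum comes from the zero vector.\<close>

lemma K_rate_num_rate:
  assumes "1 \<le> \<gamma>" "0 < c"
  shows "K_rate \<gamma> c = max 0 (- (1 + ln c) / 2) - num_rate \<gamma> c"
proof -
  have "ln (c * \<gamma>\<^sup>2) = ln c + 2 * ln \<gamma>" using assms by (simp add: ln_mult ln_realpow)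
  thus ?thesis unfolding K_rate_def D_rate_def num_rate_def by (simp add: max_def field_simps)
qed

lemma K_star_num_rate:
  assumes "1 \<le> \<gamma>"
  shows "K_star \<gamma> = - num_rate \<gamma> (exp (- 1))" "K_star \<gamma> = K_rate \<gamma> (exp (- 1))"
proof -
  have "\<gamma> < sqrt (exp 1) \<longleftrightarrow> \<gamma>\<^sup>2 < exp 1" using assms real_less_rsqrt[of \<gamma> "exp 1"] real_sqrt_less_iff[of "\<gamma>\<^sup>2" "exp 1"] by auto
  also have "\<dots> \<longleftrightarrow> exp (- 1) < 1 / \<gamma>\<^sup>2" using assms by (simp add: exp_minus field_simps)
  finally have "\<gamma> < sqrt (exp 1) \<longleftrightarrow> exp (- 1) < 1 / \<gamma>\<^sup>2" .
  thus "K_star \<gamma> = - num_rate \<gamma> (exp (- 1))" unfolding K_star_def num_rate_def by (simp add: exp_minus field_simps ln_div)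
  thus "K_star \<gamma> = K_rate \<gamma> (exp (- 1))" using K_rate_num_rate[OF assms, of "exp (- 1)"] by simp
qed

lemma exp_rate_split: "exp (real n * a) = exp a ^ n"
  by (rule exp_of_nat_mult)

lemma inverse_sqrt_eq_exp:
  assumes "0 < c"
  shows "1 / sqrt (c * exp 1) = exp (- (1 + ln c) / 2)"
proof -
  have "sqrt (c * exp 1) = exp ((1 + ln c) / 2)"
  proof (rule real_sqrt_unique)
    have "(exp ((1 + ln c) / 2))\<^sup>2 = exp (1 + ln c)" by (simp add: power2_eq_square exp_add[symmetric])
    also have "\<dots> = c * exp 1" using assms by (simp add: exp_add)
    finally show "(exp ((1 + ln c) / 2))\<^sup>2 = c * exp 1" .
  qed simp
  moreover have "- (1 + ln c) / 2 = - ((1 + ln c) / 2)" by (rule minus_divide_left[symmetric])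
  ultimately show ?thesis by (simp only: exp_minus inverse_eq_divide)
qed

section \<open>Gaussian mass of short vectors\<close>

definition short_mass :: "nat \<Rightarrow> real \<Rightarrow> real \<Rightarrow> real vec set \<Rightarrow> ennreal" where
  "short_mass n \<gamma> c L = (\<integral>\<^sup>+v. ennreal (gauss_weight (s_param n c) v) \<partial>count_space ({v. short_vec n \<gamma> L v} \<inter> L))"

lemma short_mass_eq:
  "short_mass n \<gamma> c L = (\<integral>\<^sup>+v. ennreal (gauss_weight (s_param n c) v) \<partial>count_space {v \<in> L - {0\<^sub>v n}. vec_len v \<le> \<gamma> * lambda1 n L})"
  unfolding short_mass_def by (rule arg_cong[of _ _ "\<lambda>S. nn_integral (count_space S) _"]) (auto simp: short_vec_def)

lemma nn_integral_count_space_subset_le: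
  fixes f :: "'a \<Rightarrow> ennreal"
  assumes "A \<subseteq> B" "\<And>x. x \<in> A \<Longrightarrow> f x \<le> h x"
  shows "(\<integral>\<^sup>+x. f x \<partial>count_space A) \<le> (\<integral>\<^sup>+x. h x \<partial>count_space B)"
proof -
  have "(\<integral>\<^sup>+x. f x \<partial>count_space A) = (\<integral>\<^sup>+x. f x * indicator A x \<partial>count_space UNIV)"
    by (rule nn_integral_count_space_indicator) simp
  also have "\<dots> \<le> (\<integral>\<^sup>+x. h x * indicator B x \<partial>count_space UNIV)"
    using assms by (intro nn_integral_mono) (auto simp: indicator_def)
  also have "\<dots> = (\<integral>\<^sup>+x. h x \<partial>count_space B)"
    by (rule nn_integral_count_space_indicator[symmetric]) simp
  finally show ?thesis .
qed

text \<open>The shortest length is random, so the cut-off at \<gamma> times it is replaced by a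
  fixed T slightly above \<gamma>, at a cost of at most \<eta> by continuity. T is exported with its
  strict inequality, which the analysis of adaptive parameters needs.\<close>

lemma (in random_lattices) whp_short_sum_le:
  assumes \<gamma>: "1 \<le> \<gamma>" and c: "0 < c" "c < 1 / \<gamma>\<^sup>2" and \<eta>: "0 < \<eta>"
  shows "\<exists>T>\<gamma>. c * T\<^sup>2 < 1 \<and> whp M (\<lambda>n L. \<gamma> * lambda1 n L \<le> T * GH n \<and>
    gauss_sum_trunc n c T L \<le> ennreal (exp (real n * (num_rate \<gamma> c + \<eta>))))"
proof -
  have c1: "c * \<gamma>\<^sup>2 < 1" using c \<gamma> by (simp add: field_simps)
  have t1: "((\<lambda>T. c * T\<^sup>2) \<longlongrightarrow> c * \<gamma>\<^sup>2) (at_right \<gamma>)" by (intro tendsto_intros)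
  have t2: "((\<lambda>T. T * exp (- c * T\<^sup>2 / 2)) \<longlongrightarrow> \<gamma> * exp (- c * \<gamma>\<^sup>2 / 2)) (at_right \<gamma>)" by (intro tendsto_intros) simp
  have v: "\<gamma> * exp (- c * \<gamma>\<^sup>2 / 2) = exp (num_rate \<gamma> c)"
  proof -
    have "exp (num_rate \<gamma> c) = exp (ln \<gamma> + - c * \<gamma>\<^sup>2 / 2)" using c(2) by (simp add: num_rate_def)
    thus ?thesis using \<gamma> by (simp only: exp_add exp_ln)
  qed
  have "\<gamma> * exp (- c * \<gamma>\<^sup>2 / 2) < exp (num_rate \<gamma> c + \<eta>)" unfolding v using \<eta> by simp
  from order_tendstoD(2)[OF t1 c1] order_tendstoD(2)[OF t2 this] eventually_at_right_less[of \<gamma>]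
  have "\<forall>\<^sub>F T in at_right \<gamma>. c * T\<^sup>2 < 1 \<and> T * exp (- c * T\<^sup>2 / 2) < exp (num_rate \<gamma> c + \<eta>) \<and> \<gamma> < T"
    by eventually_elim auto
  hence "\<exists>T. c * T\<^sup>2 < 1 \<and> T * exp (- c * T\<^sup>2 / 2) < exp (num_rate \<gamma> c + \<eta>) \<and> \<gamma> < T"
    by (rule eventually_happens'[rotated]) simp
  then obtain T where T: "c * T\<^sup>2 < 1" "T * exp (- c * T\<^sup>2 / 2) < exp (num_rate \<gamma> c + \<eta>)" "\<gamma> < T" by blast
  have "whp M (\<lambda>n L. (1/2) * GH n < lambda1 n L \<and> lambda1 n L \<le> T / \<gamma> * GH n)"
    using T \<gamma> by (intro whp_lambda1) simp_all
  hence w1: "whp M (\<lambda>n L. \<gamma> * lambda1 n L \<le> T * GH n)"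
  proof (rule whp_mono, elim conjE)
    fix n L assume "lambda1 n L \<le> T / \<gamma> * GH n"
    hence "\<gamma> * lambda1 n L \<le> \<gamma> * (T / \<gamma> * GH n)" using \<gamma> by (intro mult_left_mono) auto
    thus "\<gamma> * lambda1 n L \<le> T * GH n" using \<gamma> by simp
  qed
  have w2: "whp M (\<lambda>n L. gauss_sum_trunc n c T L \<le> ennreal (exp (real n * (num_rate \<gamma> c + \<eta>))))"
    unfolding exp_rate_split using T \<gamma> c by (intro whp_gauss_sum_trunc) auto
  show ?thesis using T whp_conj[OF w1 w2] by blast
qed

text \<open>For c at least 1/\<gamma>^2 the dominant radius 1/sqrt c is already within reach, and
  the full Gaussian sum has the right rate; otherwise truncation is essential.\<close>

lemma (in random_lattices) whp_short_mass_le: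
  assumes \<gamma>: "1 \<le> \<gamma>" and c: "0 < c" and \<eta>: "0 < \<eta>"
  shows "whp M (\<lambda>n L. short_mass n \<gamma> c L \<le> ennreal (exp (real n * (num_rate \<gamma> c + \<eta>))))"
proof (cases "c < 1 / \<gamma>\<^sup>2")
  case True
  obtain T where T: "whp M (\<lambda>n L. \<gamma> * lambda1 n L \<le> T * GH n \<and>
    gauss_sum_trunc n c T L \<le> ennreal (exp (real n * (num_rate \<gamma> c + \<eta>))))"
    using whp_short_sum_le[OF \<gamma> c True \<eta>] by blast
  show ?thesis
  proof (rule whp_mono[OF T], elim conjE)
    fix n L assume n: "0 < n" and l: "\<gamma> * lambda1 n L \<le> T * GH n"
      and s: "gauss_sum_trunc n c T L \<le> ennreal (exp (real n * (num_rate \<gamma> c + \<eta>)))"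
    have "short_mass n \<gamma> c L \<le> gauss_sum_trunc n c T L"
      unfolding short_mass_eq lattice_sum_def
    proof (rule nn_integral_count_space_subset_le)
      fix v assume "v \<in> {v \<in> L - {0\<^sub>v n}. vec_len v \<le> \<gamma> * lambda1 n L}"
      hence "vec_len v / GH n \<le> T" using l GH_pos[of n] by (simp add: divide_le_eq)
      thus "ennreal (gauss_weight (s_param n c) v) \<le> ennreal ((if vec_len v / GH n \<le> T then exp (- c * (vec_len v / GH n)\<^sup>2 / 2) else 0) ^ n)"
        by (simp add: gauss_weight_s_param[OF c n])
    qed auto
    thus "short_mass n \<gamma> c L \<le> ennreal (exp (real n * (num_rate \<gamma> c + \<eta>)))" using s by (rule order_trans)
  qed
next
  case False
  have "whp M (\<lambda>n L. gauss_sum n c L \<le> ennreal (exp (num_rate \<gamma> c + \<eta>) ^ n))"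
    by (rule whp_gauss_sum[OF c]) (use False \<eta> in \<open>simp_all add: inverse_sqrt_eq_exp[OF c] num_rate_def\<close>)
  thus ?thesis
  proof (rule whp_mono)
    fix n L assume n: "0 < n"
      and s: "gauss_sum n c L \<le> ennreal (exp (num_rate \<gamma> c + \<eta>) ^ n)"
    have "short_mass n \<gamma> c L \<le> gauss_sum n c L"
      unfolding short_mass_eq lattice_sum_def
      by (rule nn_integral_count_space_subset_le) (auto simp: gauss_weight_s_param[OF c n])
    thus "short_mass n \<gamma> c L \<le> ennreal (exp (real n * (num_rate \<gamma> c + \<eta>)))" using s unfolding exp_rate_split by (rule order_trans)
  qed
qed

text \<open>Many points are available only at radii t > 1. For \<gamma> = 1 there is no such room
  and a single shortest vector already gives the rate; for \<gamma> > 1 one takes t just below the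
  maximiser of the rate.\<close>

lemma (in random_lattices) whp_short_mass_ge:
  assumes \<gamma>: "1 \<le> \<gamma>" and c: "0 < c" "c < 1" and \<eta>: "0 < \<eta>"
  shows "whp M (\<lambda>n L. ennreal (exp (real n * (num_rate \<gamma> c - \<eta>))) \<le> short_mass n \<gamma> c L)"
proof -
  show ?thesis
  proof (cases "\<gamma> = 1")
    case True
    have nr: "num_rate \<gamma> c = - c / 2" using True c by (simp add: num_rate_def)
    have "((\<lambda>T. c * T\<^sup>2 / 2) \<longlongrightarrow> c * 1\<^sup>2 / 2) (at_right 1)" by (intro tendsto_intros) simp
    moreover have "c * 1\<^sup>2 / 2 < c / 2 + \<eta>" using \<eta> by simp
    ultimately have "\<forall>\<^sub>F T in at_right 1. c * T\<^sup>2 / 2 < c / 2 + \<eta>" by (rule order_tendstoD(2))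
    with eventually_at_right_less[of "1::real"] have "\<forall>\<^sub>F T in at_right 1. 1 < T \<and> c * T\<^sup>2 / 2 < c / 2 + \<eta>" by eventually_elim auto
    hence "\<exists>T. 1 < T \<and> c * T\<^sup>2 / 2 < c / 2 + \<eta>" by (rule eventually_happens'[rotated]) simp
    then obtain T where T: "1 < T" "c * T\<^sup>2 / 2 < c / 2 + \<eta>" by blast
    have "whp M (\<lambda>n L. (1/2) * GH n < lambda1 n L \<and> lambda1 n L \<le> T * GH n)"
      using T by (intro whp_lambda1) auto
    thus ?thesis
    proof (rule whp_mono, elim conjE)
      fix n L assume n: "0 < n" and Ls: "L \<in> space (M n)" and l: "lambda1 n L \<le> T * GH n"
      have "L \<in> row_lattice ` SL n" using Ls space_eq[OF n] by simp
      from lambda1(1)[OF this n] obtain v where v: "v \<in> L - {0\<^sub>v n}" "vec_len v = lambda1 n L" by blast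
      have r: "vec_len v / GH n \<le> T" using l v(2) GH_pos[of n] by (simp add: divide_le_eq)
      have "(vec_len v / GH n)\<^sup>2 \<le> T\<^sup>2" using r vec_len_nonneg[of v] GH_pos[of n] by (intro power_mono) auto
      hence "c * (vec_len v / GH n)\<^sup>2 \<le> c * T\<^sup>2" using c by (intro mult_left_mono) auto
      hence "num_rate \<gamma> c - \<eta> \<le> - c * (vec_len v / GH n)\<^sup>2 / 2" using T(2) unfolding nr by simp
      hence "exp (num_rate \<gamma> c - \<eta>) ^ n \<le> exp (- c * (vec_len v / GH n)\<^sup>2 / 2) ^ n" by (intro power_mono) auto
      hence "ennreal (exp (real n * (num_rate \<gamma> c - \<eta>))) \<le> ennreal (gauss_weight (s_param n c) v)"
        unfolding exp_rate_split gauss_weight_s_param[OF c(1) n] by (rule ennreal_leI)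
      also have "\<dots> \<le> short_mass n \<gamma> c L" unfolding short_mass_eq
        by (rule nn_integral_ge_point) (use v True in auto)
      finally show "ennreal (exp (real n * (num_rate \<gamma> c - \<eta>))) \<le> short_mass n \<gamma> c L" .
    qed
  next
    case False
    hence \<gamma>1: "1 < \<gamma>" using \<gamma> by simp
    \<comment> \<open>The maximiser in \<open>num_rate\<close>. It exceeds 1 because c < 1, so a
      radius t strictly between 1 and \<open>t0\<close> exists; t < \<gamma> lets the lower bound on
      the shortest length put all vectors up to t \<open>GH n\<close> among the short ones.\<close>
    define t0 where "t0 = (if c < 1 / \<gamma>\<^sup>2 then \<gamma> else 1 / sqrt c)"
    have t0: "1 < t0" "t0 \<le> \<gamma>" "ln t0 - c * t0\<^sup>2 / 2 = num_rate \<gamma> c"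
    proof -
      have "1 < 1 / sqrt c" using c by (simp add: field_simps)
      thus "1 < t0" using \<gamma>1 by (simp add: t0_def)
      show "t0 \<le> \<gamma>"
      proof (cases "c < 1 / \<gamma>\<^sup>2")
        case False
        hence "1 \<le> c * \<gamma>\<^sup>2" using \<gamma>1 by (simp add: field_simps)
        hence "sqrt 1 \<le> sqrt (c * \<gamma>\<^sup>2)" by (rule real_sqrt_le_mono)
        hence "1 \<le> sqrt c * \<gamma>" using \<gamma>1 by (simp add: real_sqrt_mult)
        thus ?thesis using False c by (simp add: t0_def field_simps)
      qed (simp add: t0_def)
      show "ln t0 - c * t0\<^sup>2 / 2 = num_rate \<gamma> c"
        using c by (simp add: t0_def num_rate_def ln_div ln_sqrt power_divide field_simps)
    qed
    have "((\<lambda>t. ln t - c * t\<^sup>2 / 2) \<longlongrightarrow> ln t0 - c * t0\<^sup>2 / 2) (at_left t0)" using t0(1) by (intro tendsto_intros) auto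
    moreover have "num_rate \<gamma> c - \<eta> / 2 < ln t0 - c * t0\<^sup>2 / 2" unfolding t0(3) using \<eta> by simp
    ultimately have "\<forall>\<^sub>F t in at_left t0. num_rate \<gamma> c - \<eta> / 2 < ln t - c * t\<^sup>2 / 2" by (rule order_tendstoD(1))
    with eventually_at_left[OF t0(1)] have "\<exists>t. 1 < t \<and> t < t0 \<and> num_rate \<gamma> c - \<eta> / 2 < ln t - c * t\<^sup>2 / 2"
    proof -
      have "\<forall>\<^sub>F t in at_left t0. t \<in> {1<..<t0}" using t0(1) by (intro eventually_at_leftI[of 1]) auto
      with \<open>\<forall>\<^sub>F t in at_left t0. num_rate \<gamma> c - \<eta> / 2 < ln t - c * t\<^sup>2 / 2\<close>
      have "\<forall>\<^sub>F t in at_left t0. 1 < t \<and> t < t0 \<and> num_rate \<gamma> c - \<eta> / 2 < ln t - c * t\<^sup>2 / 2" by eventually_elim auto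
      thus ?thesis by (rule eventually_happens'[rotated]) simp
    qed
    then obtain t where t: "1 < t" "t < t0" "num_rate \<gamma> c - \<eta> / 2 < ln t - c * t\<^sup>2 / 2" by blast
    have "whp M (\<lambda>n L. t / \<gamma> * GH n < lambda1 n L \<and> lambda1 n L \<le> 2 * GH n)"
      using t t0 \<gamma>1 by (intro whp_lambda1) (auto simp: field_simps)
    moreover have "whp M (\<lambda>n L. ennreal (t ^ n / 8) \<le> lattice_count n (t * GH n) L)"
      by (rule whp_many_points[OF t(1)])
    ultimately have "whp M (\<lambda>n L. (t / \<gamma> * GH n < lambda1 n L \<and> lambda1 n L \<le> 2 * GH n) \<and> ennreal (t ^ n / 8) \<le> lattice_count n (t * GH n) L)"
      by (rule whp_conj)
    moreover have "whp M (\<lambda>n L. 8 \<le> exp (real n * (\<eta> / 2)))"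
    proof (rule whp_eventually)
      have "filterlim (\<lambda>n. exp (real n * (\<eta> / 2))) at_top sequentially" using \<eta> by real_asymp
    hence "\<forall>\<^sub>F n in sequentially. 8 \<le> exp (real n * (\<eta> / 2))" unfolding filterlim_at_top by blast
    thus "\<forall>\<^sub>F n in sequentially. \<forall>L\<in>space (M n). 8 \<le> exp (real n * (\<eta> / 2))" by (rule eventually_mono) simp
    qed
    ultimately show ?thesis
    proof (rule whp_mono[OF whp_conj], elim conjE)
      fix n L assume n: "0 < n" and Ls: "L \<in> space (M n)" and l: "t / \<gamma> * GH n < lambda1 n L"
        and cnt: "ennreal (t ^ n / 8) \<le> lattice_count n (t * GH n) L" and e8: "8 \<le> exp (real n * (\<eta> / 2))"
      have L: "L \<in> row_lattice ` SL n" using Ls space_eq[OF n] by simp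
      have tG: "0 \<le> t * GH n" using t GH_pos[of n] by simp
      let ?S = "{v \<in> L - {0\<^sub>v n}. vec_len v \<le> t * GH n}"
      note card = lattice_count_eq_card[OF L tG]
      define w where "w = exp (- c * t\<^sup>2 / 2) ^ n"
      have w0: "0 \<le> w" by (simp add: w_def)
      have "exp (real n * (num_rate \<gamma> c - \<eta>)) \<le> t ^ n / 8 * w"
      proof -
        have "exp (real n * (num_rate \<gamma> c - \<eta>)) = exp (real n * (num_rate \<gamma> c - \<eta> / 2)) / exp (real n * (\<eta> / 2))"
          by (simp add: exp_diff[symmetric] algebra_simps)
        also have "\<dots> \<le> exp (real n * (num_rate \<gamma> c - \<eta> / 2)) / 8" using e8 by (intro divide_left_mono) auto
        also have "exp (real n * (num_rate \<gamma> c - \<eta> / 2)) \<le> exp (real n * (ln t + - c * t\<^sup>2 / 2))"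
          using t(3) by (simp add: mult_left_mono)
        also have "\<dots> = t ^ n * w" unfolding exp_rate_split exp_add w_def using t by (simp add: power_mult_distrib)
        finally show ?thesis by simp
      qed
      also have "t ^ n / 8 * w \<le> real (card ?S) * w"
      proof (rule mult_right_mono[OF _ w0])
        show "t ^ n / 8 \<le> real (card ?S)" using cnt unfolding card(2) by (subst (asm) ennreal_le_iff) auto
      qed
      finally have "ennreal (exp (real n * (num_rate \<gamma> c - \<eta>))) \<le> ennreal (real (card ?S) * w)" by (rule ennreal_leI)
      also have "\<dots> = (\<integral>\<^sup>+v. ennreal w \<partial>count_space ?S)"
      proof -
        have "(\<integral>\<^sup>+v. ennreal w \<partial>count_space ?S) = (\<Sum>v\<in>?S. ennreal w)" by (rule nn_integral_count_space_finite[OF card(1)])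
        also have "\<dots> = ennreal (\<Sum>v\<in>?S. w)" using w0 by (intro sum_ennreal)
        also have "(\<Sum>v\<in>?S. w) = real (card ?S) * w" by (rule sum_constant)
        finally show ?thesis ..
      qed
      also have "\<dots> \<le> short_mass n \<gamma> c L" unfolding short_mass_eq
      proof (rule nn_integral_count_space_subset_le)
        have "t * GH n \<le> \<gamma> * lambda1 n L" using l \<gamma>1 by (simp add: field_simps)
        thus "?S \<subseteq> {v \<in> L - {0\<^sub>v n}. vec_len v \<le> \<gamma> * lambda1 n L}" by auto
        fix v assume "v \<in> ?S"
        hence r: "vec_len v / GH n \<le> t" using GH_pos[of n] by (simp add: divide_le_eq)
        have "(vec_len v / GH n)\<^sup>2 \<le> t\<^sup>2" using r vec_len_nonneg[of v] GH_pos[of n] by (intro power_mono) auto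
        hence "c * (vec_len v / GH n)\<^sup>2 \<le> c * t\<^sup>2" using c by (intro mult_left_mono) auto
        hence "exp (- c * t\<^sup>2 / 2) \<le> exp (- c * (vec_len v / GH n)\<^sup>2 / 2)" by simp
        thus "ennreal w \<le> ennreal (gauss_weight (s_param n c) v)"
          unfolding w_def gauss_weight_s_param[OF c(1) n] by (intro ennreal_leI power_mono) auto
      qed
      finally show "ennreal (exp (real n * (num_rate \<gamma> c - \<eta>))) \<le> short_mass n \<gamma> c L" .
    qed
  qed
qed

lemma (in random_lattices) whp_theta_le:
  assumes c: "0 < c" and \<eta>: "0 < \<eta>"
  shows "whp M (\<lambda>n L. theta L (s_param n c) \<le> ennreal (exp (real n * (max 0 (- (1 + ln c) / 2) + \<eta>))))"
proof -
  let ?m = "max 0 (- (1 + ln c) / 2)"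
  have "whp M (\<lambda>n L. gauss_sum n c L \<le> ennreal (exp (?m + \<eta> / 2) ^ n))"
  proof (rule whp_gauss_sum[OF c])
    have "- (1 + ln c) / 2 \<le> ?m" by (rule max.cobounded2)
    hence "- (1 + ln c) / 2 < ?m + \<eta> / 2" using \<eta> by linarith
    thus "1 / sqrt (c * exp 1) < exp (?m + \<eta> / 2)" unfolding inverse_sqrt_eq_exp[OF c] by (simp only: exp_less_cancel_iff)
  qed
  moreover have "whp M (\<lambda>n L. 2 \<le> exp (real n * (\<eta> / 2)))"
  proof (rule whp_eventually)
    have "filterlim (\<lambda>n. exp (real n * (\<eta> / 2))) at_top sequentially" using \<eta> by real_asymp
    hence "\<forall>\<^sub>F n in sequentially. 2 \<le> exp (real n * (\<eta> / 2))" unfolding filterlim_at_top by blast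
    thus "\<forall>\<^sub>F n in sequentially. \<forall>L\<in>space (M n). 2 \<le> exp (real n * (\<eta> / 2))" by (rule eventually_mono) simp
  qed
  ultimately show ?thesis
  proof (rule whp_mono[OF whp_conj], elim conjE)
    fix n L assume n: "0 < n" and Ls: "L \<in> space (M n)" and e2: "2 \<le> exp (real n * (\<eta> / 2))"
      and s: "gauss_sum n c L \<le> ennreal (exp (?m + \<eta> / 2) ^ n)"
    have L: "L \<in> row_lattice ` SL n" using Ls space_eq[OF n] by simp
    have "theta L (s_param n c) \<le> 1 + ennreal (exp (?m + \<eta> / 2) ^ n)"
      unfolding theta_s_param[OF L c n] using s by (intro add_left_mono)
    also have "\<dots> = ennreal (1 + exp (real n * (?m + \<eta> / 2)))" by (simp add: exp_rate_split)
    also have "\<dots> \<le> ennreal (exp (real n * (?m + \<eta>)))"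
    proof (rule ennreal_leI)
      have "0 \<le> real n * (?m + \<eta> / 2)" using \<eta> by (intro mult_nonneg_nonneg) auto
      hence "1 \<le> exp (real n * (?m + \<eta> / 2))" by simp
      hence "1 + exp (real n * (?m + \<eta> / 2)) \<le> exp (real n * (?m + \<eta> / 2)) * 2" by simp
      also have "\<dots> \<le> exp (real n * (?m + \<eta> / 2)) * exp (real n * (\<eta> / 2))" by (intro mult_left_mono e2) simp
      also have "\<dots> = exp (real n * (?m + \<eta>))" by (simp add: exp_add[symmetric] algebra_simps)
      finally show "1 + exp (real n * (?m + \<eta> / 2)) \<le> exp (real n * (?m + \<eta>))" .
    qed
    finally show "theta L (s_param n c) \<le> ennreal (exp (real n * (?m + \<eta>)))" .
  qed
qed

text \<open>The zero vector gives the 0 in the maximum and \<open>theta_ge\<close> the other term.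
  It is deterministic and holds for every c.\<close>

lemma theta_ge_exp:
  assumes "L \<in> row_lattice ` SL n" "0 < c" "0 < n"
  shows "ennreal (exp (real n * max 0 (- (1 + ln c) / 2))) \<le> theta L (s_param n c)"
proof (cases "0 \<le> - (1 + ln c) / 2")
  case True
  thus ?thesis using theta_ge[OF assms] unfolding inverse_sqrt_eq_exp[OF assms(2)] exp_rate_split by (simp add: max_def)
next
  case False
  thus ?thesis unfolding theta_s_param[OF assms] by (simp add: max_def)
qed

lemma (in random_lattices) whp_gauss_prob:
  assumes \<gamma>: "1 \<le> \<gamma>" and c: "0 < c" "c < 1" and \<eta>: "0 < \<eta>"
  shows "whp M (\<lambda>n L. exp (- real n * (K_rate \<gamma> c + \<eta>)) \<le> measure_pmf.prob (disc_gauss L (s_param n c)) {v. short_vec n \<gamma> L v} \<and>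
    measure_pmf.prob (disc_gauss L (s_param n c)) {v. short_vec n \<gamma> L v} \<le> exp (- real n * (K_rate \<gamma> c - \<eta>)))"
proof -
  let ?m = "max 0 (- (1 + ln c) / 2)" and ?\<nu> = "num_rate \<gamma> c"
  have K: "K_rate \<gamma> c = ?m - ?\<nu>" by (rule K_rate_num_rate[OF \<gamma> c(1)])
  have \<eta>2: "0 < \<eta> / 2" using \<eta> by simp
  have w: "whp M (\<lambda>n L. (short_mass n \<gamma> c L \<le> ennreal (exp (real n * (?\<nu> + \<eta> / 2))) \<and>
      ennreal (exp (real n * (?\<nu> - \<eta> / 2))) \<le> short_mass n \<gamma> c L) \<and>
      theta L (s_param n c) \<le> ennreal (exp (real n * (?m + \<eta> / 2))))"
    by (intro whp_conj whp_short_mass_le[OF \<gamma> c(1) \<eta>2] whp_short_mass_ge[OF \<gamma> c \<eta>2] whp_theta_le[OF c(1) \<eta>2])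
  show ?thesis
  proof (rule whp_mono[OF w], elim conjE)
    fix n L assume n: "0 < n" and Ls: "L \<in> space (M n)"
      and up: "short_mass n \<gamma> c L \<le> ennreal (exp (real n * (?\<nu> + \<eta> / 2)))"
      and lo: "ennreal (exp (real n * (?\<nu> - \<eta> / 2))) \<le> short_mass n \<gamma> c L"
      and th: "theta L (s_param n c) \<le> ennreal (exp (real n * (?m + \<eta> / 2)))"
    have L: "L \<in> row_lattice ` SL n" using Ls space_eq[OF n] by simp
    have fin: "theta L (s_param n c) < \<infinity>" using le_less_trans[OF th ennreal_less_top] by simp
    note dg = disc_gauss[OF zero_in_row_lattice[OF L] fin]
    define Z where "Z = enn2real (theta L (s_param n c))"
    define S where "S = enn2real (short_mass n \<gamma> c L)"
    have Z: "theta L (s_param n c) = ennreal Z" "1 \<le> Z" using fin dg(2) by (simp_all add: Z_def)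
    have S: "short_mass n \<gamma> c L = ennreal S" "0 \<le> S" using le_less_trans[OF up ennreal_less_top] by (simp_all add: S_def)
    have b: "S \<le> exp (real n * (?\<nu> + \<eta> / 2))" "exp (real n * (?\<nu> - \<eta> / 2)) \<le> S" "Z \<le> exp (real n * (?m + \<eta> / 2))" "exp (real n * ?m) \<le> Z"
      using up lo th theta_ge_exp[OF L c(1) n] S(2) Z(2) unfolding S(1) Z(1) by simp_all
    have P: "measure_pmf.prob (disc_gauss L (s_param n c)) {v. short_vec n \<gamma> L v} = S / Z"
      unfolding dg(3) S_def Z_def short_mass_def ..
    have "S / Z \<le> exp (real n * (?\<nu> + \<eta> / 2)) / exp (real n * ?m)"
      using b S by (intro frac_le) auto
    also have "\<dots> = exp (real n * (?\<nu> + \<eta> / 2 - ?m))" by (simp add: exp_diff[symmetric] right_diff_distrib)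
    also have "\<dots> \<le> exp (- real n * (K_rate \<gamma> c - \<eta>))"
    proof -
      have "real n * (?\<nu> + \<eta> / 2 - ?m) \<le> real n * (?\<nu> + \<eta> - ?m)" using \<eta> by (intro mult_left_mono) auto
      thus ?thesis unfolding K by (simp add: algebra_simps)
    qed
    finally have u: "S / Z \<le> exp (- real n * (K_rate \<gamma> c - \<eta>))" .
    have "exp (- real n * (K_rate \<gamma> c + \<eta>)) = exp (real n * (?\<nu> - \<eta> / 2)) / exp (real n * (?m + \<eta> / 2))"
      unfolding K by (simp add: exp_diff[symmetric] algebra_simps)
    also have "\<dots> \<le> S / Z" using b S Z by (intro frac_le) auto
    finally show "exp (- real n * (K_rate \<gamma> c + \<eta>)) \<le> measure_pmf.prob (disc_gauss L (s_param n c)) {v. short_vec n \<gamma> L v} \<and>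
      measure_pmf.prob (disc_gauss L (s_param n c)) {v. short_vec n \<gamma> L v} \<le> exp (- real n * (K_rate \<gamma> c - \<eta>))"
      unfolding P using u by blast
  qed
qed


subsection \<open>Returning primitive parts\<close>

definition hit_set :: "nat \<Rightarrow> real \<Rightarrow> real vec set \<Rightarrow> real vec set" where
  "hit_set n \<gamma> L = {v \<in> L - {0\<^sub>v n}. short_vec n \<gamma> L v \<or> short_vec n \<gamma> L (prim_part n L v)}"

text \<open>The left-hand side bounds the mass of the multiples of a single vector under a Gaussian of
  parameter \<open>c = u / e\<close>; its maximum over \<open>c\<close> is attained at \<open>c = 1 / e\<close>.\<close>

lemma gauss_param_le:
  fixes u A :: real
  assumes "0 < u" "u \<le> 1" "A \<le> k" "0 \<le> k"
  shows "exp (- (u * A)) * exp (k * ln u) \<le> exp (- A)"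
proof -
  have "A * (1 - u) \<le> k * (1 - u)" using assms by (intro mult_right_mono) auto
  moreover have "k * ln u \<le> k * (u - 1)"
    using ln_le_minus_one[OF assms(1)] assms by (intro mult_left_mono) auto
  ultimately have "- (u * A) + k * ln u \<le> - A" by (simp add: algebra_simps)
  thus ?thesis by (simp add: exp_add[symmetric])
qed

text \<open>The m-th multiple has weight exp(- m^2 x), at most exp(- m x), so the multiples are
  dominated by a geometric series. Its factor 1/(1 - exp(-x)) is replaced by 1 + 1/x to make the
  behaviour at small x explicit.\<close>

lemma prob_multiples_le:
  assumes L: "L \<in> row_lattice ` SL n" and fin: "theta L s < \<infinity>" and s: "0 < s" and w: "w \<in> L" "w \<noteq> 0\<^sub>v n"
    and n: "0 < n" and x: "x = pi * (vec_len w)\<^sup>2 / s\<^sup>2" "0 < x"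
  shows "measure_pmf.prob (disc_gauss L s) {real (Suc m) \<cdot>\<^sub>v w | m. True} \<le> exp (- x) * (1 + 1 / x) / enn2real (theta L s)"
proof -
  note dg = disc_gauss[OF zero_in_row_lattice[OF L] fin]
  let ?Z = "enn2real (theta L s)" and ?p = "disc_gauss L s"
  have single: "measure_pmf.prob ?p {real (Suc m) \<cdot>\<^sub>v w} \<le> exp (- x) * exp (- x) ^ m / ?Z" for m
  proof -
    have "enn2real (\<integral>\<^sup>+v. ennreal (gauss_weight s v) \<partial>count_space ({real (Suc m) \<cdot>\<^sub>v w} \<inter> L)) \<le> gauss_weight s (real (Suc m) \<cdot>\<^sub>v w)"
    proof -
      have "(\<integral>\<^sup>+v. ennreal (gauss_weight s v) \<partial>count_space ({real (Suc m) \<cdot>\<^sub>v w} \<inter> L)) \<le> (\<integral>\<^sup>+v. ennreal (gauss_weight s v) \<partial>count_space {real (Suc m) \<cdot>\<^sub>v w})"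
        by (rule nn_integral_count_space_subset_le) auto
      also have "\<dots> = ennreal (gauss_weight s (real (Suc m) \<cdot>\<^sub>v w))" by (simp add: nn_integral_count_space_finite)
      finally show ?thesis by (rule enn2real_leI[rotated]) (simp add: gauss_weight_def)
    qed
    also have "gauss_weight s (real (Suc m) \<cdot>\<^sub>v w) \<le> exp (real (Suc m) * - x)"
    proof -
      have "real (Suc m) * x \<le> (real (Suc m))\<^sup>2 * x" using x(2) by (intro mult_right_mono) (auto simp: power2_eq_square)
      moreover have "- pi * (vec_len (real (Suc m) \<cdot>\<^sub>v w))\<^sup>2 / s\<^sup>2 = - ((real (Suc m))\<^sup>2 * x)"
        unfolding x(1) by (simp add: scale_vec_len power_mult_distrib del: of_nat_Suc)
      ultimately show ?thesis unfolding gauss_weight_def by simp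
    qed
    also have "\<dots> = exp (- x) * exp (- x) ^ m" unfolding exp_of_nat_mult by simp
    finally show ?thesis unfolding dg(3) using dg(1) by (intro divide_right_mono) auto
  qed
  have e1: "norm (exp (- x)) < 1" using x(2) by simp
  have sums: "(\<lambda>m. exp (- x) * exp (- x) ^ m / ?Z) sums (exp (- x) * (1 / (1 - exp (- x))) / ?Z)"
    by (intro sums_divide sums_mult geometric_sums e1)
  have "measure_pmf.prob ?p {real (Suc m) \<cdot>\<^sub>v w | m. True} = measure_pmf.prob ?p (\<Union>m. {real (Suc m) \<cdot>\<^sub>v w})"
    by (rule arg_cong[of _ _ "measure_pmf.prob ?p"]) auto
  also have "\<dots> \<le> (\<Sum>m. measure_pmf.prob ?p {real (Suc m) \<cdot>\<^sub>v w})"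
  proof (rule measure_pmf.finite_measure_subadditive_countably)
    show "summable (\<lambda>m. measure_pmf.prob ?p {real (Suc m) \<cdot>\<^sub>v w})"
      by (rule summable_comparison_test'[OF sums_summable[OF sums], of 0]) (use single in auto)
  qed auto
  also have "\<dots> \<le> (\<Sum>m. exp (- x) * exp (- x) ^ m / ?Z)"
    by (intro suminf_le single sums_summable[OF sums] summable_comparison_test'[OF sums_summable[OF sums], of 0])
       (use single in auto)
  also have "\<dots> = exp (- x) * (1 / (1 - exp (- x))) / ?Z" by (rule sums_unique[OF sums, symmetric])
  also have "\<dots> \<le> exp (- x) * (1 + 1 / x) / ?Z"
  proof (intro divide_right_mono mult_left_mono)
    have "1 + x \<le> exp x" by (rule exp_ge_add_one_self)
    hence "(1 + x) * exp (- x) \<le> exp x * exp (- x)" by (intro mult_right_mono) auto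
    hence "(1 + x) * exp (- x) \<le> 1" by (simp add: exp_add[symmetric])
    hence "x \<le> (1 + x) * (1 - exp (- x))" by (simp add: algebra_simps)
    moreover have "0 < 1 - exp (- x)" using x(2) by simp
    ultimately show "1 / (1 - exp (- x)) \<le> 1 + 1 / x" using x(2) by (simp add: field_simps)
  qed (use dg(1) in auto)
  finally show ?thesis .
qed

text \<open>Every success comes from a multiple of a short vector w. With A its exponent at 1/e and
  c = u/e, its multiples have probability at most a constant times exp(-A) for every u. If u is at
  least 1, the weight only drops and the denominator is at least 1; if u < 1, the weight grows but
  the denominator is at least u^(-n/2). Summing over w leaves the truncated sum at 1/e, which no
  longer involves c.\<close>

lemma (in random_lattices) whp_hit_prob:
  assumes \<gamma>: "1 \<le> \<gamma>" "\<gamma> < sqrt (exp 1)" and \<eta>: "0 < \<eta>"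
  shows "whp M (\<lambda>n L. \<forall>c>0. measure_pmf.prob (disc_gauss L (s_param n c)) (hit_set n \<gamma> L) \<le> exp (- real n * (K_star \<gamma> - \<eta>)))"
proof -
  let ?e = "exp (- 1) :: real" and ?\<nu> = "num_rate \<gamma> (exp (- 1))"
  have "\<gamma>\<^sup>2 < (sqrt (exp 1))\<^sup>2" using \<gamma> by (intro power_strict_mono) auto
  hence c1: "?e < 1 / \<gamma>\<^sup>2" using \<gamma> by (simp add: exp_minus field_simps)
  have \<eta>2: "0 < \<eta> / 2" using \<eta> by simp
  obtain T where T: "\<gamma> < T" "?e * T\<^sup>2 < 1" "whp M (\<lambda>n L. \<gamma> * lambda1 n L \<le> T * GH n \<and>
    gauss_sum_trunc n ?e T L \<le> ennreal (exp (real n * (?\<nu> + \<eta> / 2))))"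
    using whp_short_sum_le[OF \<gamma>(1) _ c1 \<eta>2] by auto
  \<comment> \<open>Lengths above \<open>GH n / 2\<close> give A at least exp(-1)/8, so 1/A is at
    most 8 exp 1; this constant bounds the loss from summing over multiples.\<close>
  define C where "C = 1 + 8 * exp (1::real)"
  have C0: "0 < C" by (simp add: C_def add_pos_pos)
  \<comment> \<open>For u < 1 the factor 1/x of the multiples costs an extra 1/u, which lowers the
    exponent of u from n/2 to (n - 2)/2. The strict inequality for T leaves room for this loss once
    n is large.\<close>
  have w1: "whp M (\<lambda>n L. real n * (?e * T\<^sup>2 / 2) \<le> (real n - 2) / 2 \<and> 2 \<le> n \<and> C \<le> exp (real n * (\<eta> / 2)))"
  proof (rule whp_eventually)
    have "filterlim (\<lambda>n. exp (real n * (\<eta> / 2))) at_top sequentially" using \<eta> by real_asymp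
    hence 1: "\<forall>\<^sub>F n in sequentially. C \<le> exp (real n * (\<eta> / 2))" unfolding filterlim_at_top by blast
    have "\<forall>\<^sub>F n in sequentially. 2 / (1 - ?e * T\<^sup>2) \<le> real n"
      using filterlim_real_sequentially unfolding filterlim_at_top by blast
    hence 2: "\<forall>\<^sub>F n in sequentially. real n * (?e * T\<^sup>2 / 2) \<le> (real n - 2) / 2"
      by eventually_elim (use T(2) in \<open>simp add: field_simps\<close>)
    have "\<forall>\<^sub>F n in sequentially. real n * (?e * T\<^sup>2 / 2) \<le> (real n - 2) / 2 \<and> 2 \<le> n \<and> C \<le> exp (real n * (\<eta> / 2))"
      using 1 2 eventually_ge_at_top[of 2] by eventually_elim simp
    thus "\<forall>\<^sub>F n in sequentially. \<forall>L\<in>space (M n). real n * (?e * T\<^sup>2 / 2) \<le> (real n - 2) / 2 \<and> 2 \<le> n \<and> C \<le> exp (real n * (\<eta> / 2))"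
      by (rule eventually_mono) simp
  qed
  have w2: "whp M (\<lambda>n L. 1 / 2 * GH n < lambda1 n L \<and> lambda1 n L \<le> 2 * GH n)"
    by (intro whp_lambda1) auto
  show ?thesis
  proof (rule whp_mono[OF whp_conj[OF whp_conj[OF T(3) w1] whp_conj[OF w2 whp_theta_finite]]], elim conjE, intro allI impI)
    fix n L and c :: real
    assume n: "0 < n" and Ls: "L \<in> space (M n)" and c: "0 < c" and l: "\<gamma> * lambda1 n L \<le> T * GH n"
      and s: "gauss_sum_trunc n ?e T L \<le> ennreal (exp (real n * (?\<nu> + \<eta> / 2)))"
      and nT: "real n * (?e * T\<^sup>2 / 2) \<le> (real n - 2) / 2" and n2: "2 \<le> n" and Cn: "C \<le> exp (real n * (\<eta> / 2))"
      and l1: "1 / 2 * GH n < lambda1 n L" and th: "\<forall>c>0. theta L (s_param n c) < \<infinity>"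
    have L: "L \<in> row_lattice ` SL n" using Ls space_eq[OF n] by simp
    have fin: "theta L (s_param n c) < \<infinity>" using th c by blast
    have sp: "0 < s_param n c" by (rule s_param_pos[OF c n])
    note dg = disc_gauss[OF zero_in_row_lattice[OF L] fin]
    let ?Z = "enn2real (theta L (s_param n c))" and ?p = "disc_gauss L (s_param n c)"
    define W where "W = {v \<in> L - {0\<^sub>v n}. vec_len v \<le> \<gamma> * lambda1 n L}"
    have l0: "0 \<le> \<gamma> * lambda1 n L" using l1 GH_pos[of n] \<gamma> by (intro mult_nonneg_nonneg) (auto intro: less_imp_le less_trans[rotated])
    have fW: "finite W" unfolding W_def by (rule lattice_count_eq_card(1)[OF L l0])
    define A where "A w = real n * (?e * (vec_len w / GH n)\<^sup>2 / 2)" for w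
    have sub: "hit_set n \<gamma> L \<subseteq> (\<Union>w\<in>W. {real (Suc m) \<cdot>\<^sub>v w | m. True})"
    proof
      fix v assume v: "v \<in> hit_set n \<gamma> L"
      hence vL: "v \<in> L" "v \<noteq> 0\<^sub>v n" by (auto simp: hit_set_def)
      show "v \<in> (\<Union>w\<in>W. {real (Suc m) \<cdot>\<^sub>v w | m. True})"
      proof (cases "short_vec n \<gamma> L v")
        case True
        have "v = real (Suc 0) \<cdot>\<^sub>v v" by simp
        moreover have "v \<in> W" using True vL by (auto simp: W_def short_vec_def)
        ultimately show ?thesis by blast
      next
        case False
        hence sh: "short_vec n \<gamma> L (prim_part n L v)" using v by (simp add: hit_set_def)
        obtain m :: nat where m: "1 \<le> m" "v = real m \<cdot>\<^sub>v prim_part n L v" using prim_part(1)[OF L n vL] by blast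
        obtain k where "m = Suc k" using m(1) by (cases m) auto
        moreover have "prim_part n L v \<in> W" using sh prim_part(2)[OF L n vL] by (auto simp: W_def short_vec_def)
        ultimately show ?thesis using m(2) by blast
      qed
    qed
    have mult_bd: "measure_pmf.prob ?p {real (Suc m) \<cdot>\<^sub>v w | m. True} \<le> C * exp (- A w)" if w: "w \<in> W" for w
    proof -
      have wL: "w \<in> L" "w \<noteq> 0\<^sub>v n" "vec_len w \<le> \<gamma> * lambda1 n L" using w by (auto simp: W_def)
      define \<tau> where "\<tau> = vec_len w / GH n"
      have "1 / 2 * GH n < vec_len w" using l1 lambda1(2)[OF L n, of w] wL by auto
      hence \<tau>1: "1 / 2 \<le> \<tau>" using GH_pos[of n] by (simp add: \<tau>_def field_simps)
      have \<tau>2: "\<tau> \<le> T" using wL(3) l GH_pos[of n] by (simp add: \<tau>_def field_simps)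
      have Aw: "A w = real n * (?e * \<tau>\<^sup>2 / 2)" by (simp add: A_def \<tau>_def)
      have "\<tau>\<^sup>2 \<le> T\<^sup>2" using \<tau>1 \<tau>2 by (intro power_mono) auto
      hence "real n * (?e * \<tau>\<^sup>2 / 2) \<le> real n * (?e * T\<^sup>2 / 2)" by (intro mult_left_mono divide_right_mono) auto
      hence A2: "A w \<le> (real n - 2) / 2" using nT unfolding Aw by linarith
      have "(1/2)\<^sup>2 \<le> \<tau>\<^sup>2" using \<tau>1 by (intro power_mono) auto
      hence "1 * (?e * (1/4) / 2) \<le> real n * (?e * \<tau>\<^sup>2 / 2)" using n by (intro mult_mono divide_right_mono mult_left_mono) (auto simp: power2_eq_square)
      hence A1: "?e / 8 \<le> A w" unfolding Aw by simp
      hence A0: "0 < A w" by (rule less_le_trans[rotated]) simp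
      have iA: "1 / A w \<le> 8 * exp 1"
      proof -
        have "1 / A w \<le> 1 / (?e / 8)" using A1 A0 by (intro divide_left_mono) auto
        also have "1 / (?e / 8) = 8 * exp 1" by (simp add: exp_minus field_simps)
        finally show ?thesis .
      qed
      define u where "u = c * exp 1"
      have u0: "0 < u" using c by (simp add: u_def)
      define x where "x = pi * (vec_len w)\<^sup>2 / (s_param n c)\<^sup>2"
      have x: "x = u * A w"
      proof -
        have "x = real n * (c * \<tau>\<^sup>2 / 2)" unfolding x_def s_param_square[OF c n] \<tau>_def using c n GH_pos[of n]
          by (simp add: field_simps power2_eq_square)
        also have "\<dots> = u * A w" unfolding Aw u_def by (simp add: exp_minus)
        finally show ?thesis .
      qed
      have x0: "0 < x" unfolding x using u0 A0 by simp
      have "measure_pmf.prob ?p {real (Suc m) \<cdot>\<^sub>v w | m. True} \<le> exp (- x) * (1 + 1 / x) / ?Z"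
        by (rule prob_multiples_le[OF L fin sp wL(1,2) n x_def x0])
      also have "\<dots> \<le> C * exp (- A w)"
      proof (cases "1 \<le> u")
        case True
        have "1 * A w \<le> u * A w" using True A0 by (intro mult_right_mono) auto
        hence Ax: "A w \<le> x" unfolding x by simp
        have "1 / x \<le> 1 / A w" using Ax A0 by (intro divide_left_mono) auto
        hence x8: "1 + 1 / x \<le> C" using iA by (simp add: C_def)
        have "exp (- x) * (1 + 1 / x) / ?Z \<le> exp (- x) * (1 + 1 / x) / 1"
          using dg(2) x0 by (intro divide_left_mono) auto
        also have "\<dots> \<le> exp (- A w) * C" using Ax x8 x0 by (auto intro!: mult_mono)
        finally show ?thesis by (simp add: mult.commute)
      next
        case False
        hence u1: "u < 1" by simp
        \<comment> \<open>Since 1 + log c = log u, the deterministic lower bound on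
          \<open>theta\<close> is u^(-n/2).\<close>
        have Zl: "exp (- (real n / 2) * ln u) \<le> ?Z"
        proof -
          have "1 + ln c = ln u" using c by (simp add: u_def ln_mult)
          hence "- ln u / 2 \<le> max 0 (- (1 + ln c) / 2)" by simp
          hence "real n * (- ln u / 2) \<le> real n * max 0 (- (1 + ln c) / 2)" by (rule mult_left_mono) simp
          hence 1: "exp (real n * (- ln u / 2)) \<le> exp (real n * max 0 (- (1 + ln c) / 2))" by (rule iffD2[OF exp_le_cancel_iff])
          have "ennreal (exp (real n * max 0 (- (1 + ln c) / 2))) \<le> ennreal ?Z"
            using theta_ge_exp[OF L c n] fin by simp
          hence "exp (real n * max 0 (- (1 + ln c) / 2)) \<le> ?Z" by (rule ennreal_le_iff[THEN iffD1, rotated]) simp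
          with 1 have "exp (real n * (- ln u / 2)) \<le> ?Z" by (rule order_trans)
          thus ?thesis by (simp add: mult.commute)
        qed
        have "1 / x = 1 / A w / u" unfolding x by simp
        also have "\<dots> \<le> 8 * exp 1 / u" using iA u0 by (intro divide_right_mono) auto
        finally have "1 + 1 / x \<le> 1 / u + 8 * exp 1 / u" using u0 u1 by (intro add_mono) auto
        hence x8: "1 + 1 / x \<le> C / u" by (simp add: C_def add_divide_distrib)
        have "exp (- x) * (1 + 1 / x) / ?Z \<le> exp (- x) * (C / u) / exp (- (real n / 2) * ln u)"
          using x8 Zl x0 C0 u0 by (intro frac_le mult_left_mono mult_nonneg_nonneg) auto
        also have "\<dots> = C * (exp (- (u * A w)) * exp ((real n - 2) / 2 * ln u))"
        proof -
          have "1 / u / exp (- (real n / 2) * ln u) = exp (- ln u) / exp (- (real n / 2) * ln u)"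
            using u0 by (simp add: exp_minus inverse_eq_divide)
          also have "\<dots> = exp (- ln u - - (real n / 2) * ln u)" by (rule exp_diff[symmetric])
          also have "- ln u - - (real n / 2) * ln u = (real n - 2) / 2 * ln u" by (simp add: field_simps)
          finally have e: "1 / u / exp (- (real n / 2) * ln u) = exp ((real n - 2) / 2 * ln u)" .
          have "exp (- x) * (C / u) / exp (- (real n / 2) * ln u) = C * (exp (- x) * (1 / u / exp (- (real n / 2) * ln u)))" by simp
          thus ?thesis unfolding e x .
        qed
        also have "\<dots> \<le> C * exp (- A w)"
          using u0 u1 A2 C0 n2 by (intro mult_left_mono gauss_param_le) auto
        finally show ?thesis .
      qed
      finally show ?thesis .
    qed
    have sumA: "(\<Sum>w\<in>W. exp (- A w)) \<le> exp (real n * (?\<nu> + \<eta> / 2))"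
    proof -
      have "ennreal (\<Sum>w\<in>W. exp (- A w)) = (\<Sum>w\<in>W. ennreal (exp (- A w)))" by (rule sum_ennreal[symmetric]) simp
      also have "\<dots> = (\<integral>\<^sup>+w. ennreal (exp (- A w)) \<partial>count_space W)" by (rule nn_integral_count_space_finite[OF fW, symmetric])
      also have "\<dots> \<le> gauss_sum_trunc n ?e T L"
        unfolding lattice_sum_def
      proof (rule nn_integral_count_space_subset_le)
        fix w assume "w \<in> W"
        hence "vec_len w / GH n \<le> T" using l GH_pos[of n] by (simp add: W_def divide_le_eq)
        moreover have "exp (- A w) = exp (- ?e * (vec_len w / GH n)\<^sup>2 / 2) ^ n"
          unfolding A_def exp_of_nat_mult[symmetric] by simp
        ultimately show "ennreal (exp (- A w)) \<le> ennreal ((if vec_len w / GH n \<le> T then exp (- ?e * (vec_len w / GH n)\<^sup>2 / 2) else 0) ^ n)"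
          by simp
      qed (auto simp: W_def)
      also have "\<dots> \<le> ennreal (exp (real n * (?\<nu> + \<eta> / 2)))" by (rule s)
      finally show ?thesis by (subst (asm) ennreal_le_iff) auto
    qed
    have "measure_pmf.prob ?p (hit_set n \<gamma> L) \<le> measure_pmf.prob ?p (\<Union>w\<in>W. {real (Suc m) \<cdot>\<^sub>v w | m. True})"
      by (rule measure_pmf.finite_measure_mono[OF sub]) simp
    also have "\<dots> \<le> (\<Sum>w\<in>W. measure_pmf.prob ?p {real (Suc m) \<cdot>\<^sub>v w | m. True})"
      by (rule measure_pmf.finite_measure_subadditive_finite[OF fW]) simp
    also have "\<dots> \<le> (\<Sum>w\<in>W. C * exp (- A w))" by (intro sum_mono mult_bd)
    also have "\<dots> = C * (\<Sum>w\<in>W. exp (- A w))" by (simp add: sum_distrib_left)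
    also have "\<dots> \<le> exp (real n * (\<eta> / 2)) * exp (real n * (?\<nu> + \<eta> / 2))"
      using Cn sumA C0 by (intro mult_mono) (auto intro: sum_nonneg)
    also have "\<dots> = exp (- real n * (K_star \<gamma> - \<eta>))"
      unfolding K_star_num_rate(1)[OF \<gamma>(1)] by (simp add: exp_add[symmetric] algebra_simps)
    finally show "measure_pmf.prob ?p (hit_set n \<gamma> L) \<le> exp (- real n * (K_star \<gamma> - \<eta>))" .
  qed
qed

section \<open>Transcripts of a query procedure\<close>

lemma query_historyI:
  assumes "set h \<subseteq> L" "length h < N" "\<forall>k<length h. \<not> halt L \<omega> (take k h)" "\<not> halt L \<omega> h"
  shows "query_history N halt L \<omega> h"
  using assms by (auto simp: query_history_def le_less)

lemma query_history_never_halt: "query_history N never_halt L \<omega> h \<longleftrightarrow> set h \<subseteq> L \<and> length h < N"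
  by (auto simp: query_history_def never_halt_def)

text \<open>Transcripts only extend legal histories, so hypotheses on the query laws at such
  histories are enough. That the starting samples persist is used to see that an early hit is never
  lost.\<close>

lemma set_pmf_transcript:
  assumes Q: "\<And>h. query_history N halt L \<omega> h \<Longrightarrow> set_pmf (Q L \<omega> h) \<subseteq> L"
  shows "set h \<subseteq> L \<Longrightarrow> length h + k = N \<Longrightarrow> \<forall>i<length h. \<not> halt L \<omega> (take i h) \<Longrightarrow>
    l \<in> set_pmf (transcript halt Q L \<omega> k h) \<Longrightarrow> set h \<subseteq> set l \<and> set l \<subseteq> L \<and> length l \<le> N"
proof (induction k arbitrary: h)
  case 0
  thus ?case by simp
next
  case (Suc k)
  show ?case
  proof (cases "halt L \<omega> h")
    case True
    thus ?thesis using Suc.prems by simp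
  next
    case False
    have qh: "query_history N halt L \<omega> h" using Suc.prems False by (intro query_historyI) auto
    obtain v where v: "v \<in> set_pmf (Q L \<omega> h)" "l \<in> set_pmf (transcript halt Q L \<omega> k (h @ [v]))"
      using Suc.prems(4) False by auto
    have "set (h @ [v]) \<subseteq> set l \<and> set l \<subseteq> L \<and> length l \<le> N"
      using Suc.prems False Q[OF qh] v by (intro Suc.IH) (auto simp: less_Suc_eq)
    thus ?thesis by auto
  qed
qed

text \<open>The union bound for adaptive queries, by recursion on the number of remaining queries: a
  hit now is charged to the current law, a later one to the induction hypothesis.\<close>

lemma emeasure_transcript_hit_le:
  assumes Q: "\<And>h. query_history N halt L \<omega> h \<Longrightarrow> set_pmf (Q L \<omega> h) \<subseteq> L"
    and b: "\<And>h. query_history N halt L \<omega> h \<Longrightarrow> measure_pmf.prob (Q L \<omega> h) H \<le> b" "0 \<le> b"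
  shows "set h \<subseteq> L \<Longrightarrow> length h + k = N \<Longrightarrow> \<forall>i<length h. \<not> halt L \<omega> (take i h) \<Longrightarrow> set h \<inter> H = {} \<Longrightarrow>
    emeasure (measure_pmf (transcript halt Q L \<omega> k h)) {l. \<exists>v\<in>set l. v \<in> H} \<le> ennreal (real k * b)"
proof (induction k arbitrary: h)
  case 0
  hence "h \<notin> {l. \<exists>v\<in>set l. v \<in> H}" by auto
  thus ?case by simp
next
  case (Suc k)
  let ?A = "{l. \<exists>v\<in>set l. v \<in> H}"
  show ?case
  proof (cases "halt L \<omega> h")
    case True
    have "h \<notin> ?A" using Suc.prems by auto
    thus ?thesis using True by simp
  next
    case False
    have qh: "query_history N halt L \<omega> h" using Suc.prems False by (intro query_historyI) auto
    let ?q = "measure_pmf (Q L \<omega> h)"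
    have "emeasure (measure_pmf (transcript halt Q L \<omega> (Suc k) h)) ?A
      = (\<integral>\<^sup>+v. emeasure (measure_pmf (transcript halt Q L \<omega> k (h @ [v]))) ?A \<partial>?q)" using False by simp
    also have "\<dots> \<le> (\<integral>\<^sup>+v. indicator H v + ennreal (real k * b) \<partial>?q)"
    \<comment> \<open>Only samples in the support are known to lie in the lattice and to continue a
      legal history.\<close>
    proof (rule nn_integral_mono_AE, rule AE_pmfI)
      fix v assume v: "v \<in> set_pmf (Q L \<omega> h)"
      show "emeasure (measure_pmf (transcript halt Q L \<omega> k (h @ [v]))) ?A \<le> indicator H v + ennreal (real k * b)"
      proof (cases "v \<in> H")
        case True
        have "emeasure (measure_pmf (transcript halt Q L \<omega> k (h @ [v]))) ?A \<le> 1" by (rule measure_pmf.emeasure_le_1)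
        also have "\<dots> \<le> indicator H v + ennreal (real k * b)" using True by simp
        finally show ?thesis .
      next
        case vH: False
        have "emeasure (measure_pmf (transcript halt Q L \<omega> k (h @ [v]))) ?A \<le> ennreal (real k * b)"
          using Suc.prems False Q[OF qh] v vH by (intro Suc.IH) (auto simp: less_Suc_eq)
        thus ?thesis using vH by simp
      qed
    qed
    also have "\<dots> = emeasure ?q H + ennreal (real k * b)" by (subst nn_integral_add) (auto simp: measure_pmf.emeasure_space_1)
    also have "\<dots> \<le> ennreal b + ennreal (real k * b)"
      using b(1)[OF qh] by (intro add_right_mono) (simp add: measure_pmf.emeasure_eq_measure ennreal_leI)
    also have "\<dots> = ennreal (real (Suc k) * b)" using b(2) by (simp add: ennreal_plus[symmetric] algebra_simps del: ennreal_plus)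
    finally show ?thesis .
  qed
qed

text \<open>After a sample in \<open>H\<close> the missing event has probability 0; after any other
  sample the induction hypothesis applies. Hence each query contributes a factor 1 - b, whatever the
  dependence on the past.\<close>

lemma emeasure_transcript_miss_le:
  assumes Q: "\<And>h. query_history N never_halt L \<omega> h \<Longrightarrow> set_pmf (Q L \<omega> h) \<subseteq> L"
    and b: "\<And>h. query_history N never_halt L \<omega> h \<Longrightarrow> b \<le> measure_pmf.prob (Q L \<omega> h) H" "0 \<le> b" "b \<le> 1"
  shows "set h \<subseteq> L \<Longrightarrow> length h + k = N \<Longrightarrow>
    emeasure (measure_pmf (transcript never_halt Q L \<omega> k h)) {l. \<forall>v\<in>set l. v \<notin> H} \<le> ennreal ((1 - b) ^ k)"
proof (induction k arbitrary: h)
  case 0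
  show ?case using measure_pmf.emeasure_le_1 by (simp add: indicator_def)
next
  case (Suc k)
  let ?A = "{l. \<forall>v\<in>set l. v \<notin> H}"
  have qh: "query_history N never_halt L \<omega> h" using Suc.prems by (simp add: query_history_never_halt)
  let ?q = "measure_pmf (Q L \<omega> h)"
  have "emeasure (measure_pmf (transcript never_halt Q L \<omega> (Suc k) h)) ?A
    = (\<integral>\<^sup>+v. emeasure (measure_pmf (transcript never_halt Q L \<omega> k (h @ [v]))) ?A \<partial>?q)" by (simp add: never_halt_def)
  also have "\<dots> \<le> (\<integral>\<^sup>+v. ennreal ((1 - b) ^ k) * indicator (- H) v \<partial>?q)"
  proof (rule nn_integral_mono_AE, rule AE_pmfI)
    fix v assume v: "v \<in> set_pmf (Q L \<omega> h)"
    have hv: "set (h @ [v]) \<subseteq> L" "length (h @ [v]) + k = N" using Suc.prems Q[OF qh] v by auto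
    show "emeasure (measure_pmf (transcript never_halt Q L \<omega> k (h @ [v]))) ?A \<le> ennreal ((1 - b) ^ k) * indicator (- H) v"
    proof (cases "v \<in> H")
      case True
      have "set (h @ [v]) \<subseteq> set l" if "l \<in> set_pmf (transcript never_halt Q L \<omega> k (h @ [v]))" for l
        using set_pmf_transcript[where N=N and Q=Q and halt=never_halt and L=L and \<omega>=\<omega>, OF Q hv _ that] by (auto simp: never_halt_def)
      hence "set_pmf (transcript never_halt Q L \<omega> k (h @ [v])) \<inter> ?A = {}" using True by fastforce
      hence "emeasure (measure_pmf (transcript never_halt Q L \<omega> k (h @ [v]))) ?A = 0"
        by (subst emeasure_Int_set_pmf[symmetric]) (simp add: Int_commute)
      thus ?thesis by simp
    next
      case False
      thus ?thesis using Suc.IH[OF hv] by simp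
    qed
  qed
  also have "\<dots> = ennreal ((1 - b) ^ k) * emeasure ?q (- H)" by (simp add: nn_integral_cmult_indicator)
  also have "\<dots> \<le> ennreal ((1 - b) ^ k) * ennreal (1 - b)"
  proof (intro mult_left_mono)
    have "measure_pmf.prob (Q L \<omega> h) (- H) = 1 - measure_pmf.prob (Q L \<omega> h) H"
      using measure_pmf.prob_compl[of H "Q L \<omega> h"] by (simp add: Compl_eq_Diff_UNIV)
    also have "\<dots> \<le> 1 - b" using b(1)[OF qh] by simp
    finally show "emeasure ?q (- H) \<le> ennreal (1 - b)" by (simp add: measure_pmf.emeasure_eq_measure ennreal_leI)
  qed simp
  also have "\<dots> = ennreal ((1 - b) ^ Suc k)" using b by (subst ennreal_mult[symmetric]) (auto simp: mult.commute)
  finally show ?case .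
qed

section \<open>Measurability of the success probability\<close>

text \<open>A pmf lives on the power set, while joint measurability is about \<open>S\<close>. The
  pmf is restricted to \<open>space S\<close> and pushed to \<open>S\<close>, giving a
  subprobability kernel; the indicator accounts for mass that may lie outside.\<close>

lemma measurable_nn_integral_pmf_kernel:
  assumes p: "\<And>B. B \<in> sets S \<Longrightarrow> (\<lambda>x. measure_pmf.prob (p x) B) \<in> borel_measurable X"
    and S: "space S \<noteq> {}" and f: "(\<lambda>(x, y). f x y) \<in> borel_measurable (X \<Otimes>\<^sub>M S)"
  shows "(\<lambda>x. \<integral>\<^sup>+y. f x y * indicator (space S) y \<partial>measure_pmf (p x)) \<in> borel_measurable X"
proof -
  define K where "K x = distr (restrict_space (measure_pmf (p x)) (space S)) S (\<lambda>y. y)" for x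
  have m: "(\<lambda>y. y) \<in> restrict_space (measure_pmf (p x)) (space S) \<rightarrow>\<^sub>M S" for x
  proof (rule measurableI)
    show "y \<in> space S" if "y \<in> space (restrict_space (measure_pmf (p x)) (space S))" for y
      using that by (simp add: space_restrict_space)
    show "(\<lambda>y. y) -` A \<inter> space (restrict_space (measure_pmf (p x)) (space S)) \<in> sets (restrict_space (measure_pmf (p x)) (space S))" for A
      by (auto simp: sets_restrict_space space_restrict_space)
  qed
  have K: "emeasure (K x) B = ennreal (measure_pmf.prob (p x) B)" if "B \<in> sets S" for x B
  proof -
    have "emeasure (K x) B = emeasure (restrict_space (measure_pmf (p x)) (space S)) (B \<inter> space S)"
      unfolding K_def using that by (subst emeasure_distr[OF m]) (auto simp: space_restrict_space)
    also have "\<dots> = emeasure (measure_pmf (p x)) (B \<inter> space S)" by (rule emeasure_restrict_space) auto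
    also have "B \<inter> space S = B" using sets.sets_into_space[OF that] by auto
    finally show ?thesis by (simp add: measure_pmf.emeasure_eq_measure)
  qed
  have "K \<in> X \<rightarrow>\<^sub>M subprob_algebra S"
  proof (rule measurable_subprob_algebra)
    show "subprob_space (K x)" for x
    proof (rule subprob_spaceI)
      have "emeasure (K x) (space (K x)) = ennreal (measure_pmf.prob (p x) (space S))" using K[of "space S" x] by (simp add: K_def)
      thus "emeasure (K x) (space (K x)) \<le> 1" by simp
      show "space (K x) \<noteq> {}" using S by (simp add: K_def)
    qed
    show "sets (K x) = sets S" for x by (simp add: K_def)
    show "(\<lambda>x. emeasure (K x) A) \<in> borel_measurable X" if "A \<in> sets S" for A
      unfolding K[OF that] using p[OF that] by measurable
  qed
  from nn_integral_measurable_subprob_algebra2[OF f this]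
  have "(\<lambda>x. \<integral>\<^sup>+y. f x y \<partial>K x) \<in> borel_measurable X" .
  also have "?this \<longleftrightarrow> ?thesis"
  proof (rule measurable_cong)
    fix x assume x: "x \<in> space X"
    have "f x \<in> borel_measurable S" using measurable_compose[OF measurable_Pair1'[OF x] f] by simp
    thus "(\<integral>\<^sup>+y. f x y \<partial>K x) = (\<integral>\<^sup>+y. f x y * indicator (space S) y \<partial>measure_pmf (p x))"
      unfolding K_def by (subst nn_integral_distr[OF m]) (auto simp: nn_integral_restrict_space)
  qed
  finally show ?thesis .
qed

lemma space_vec_borel [simp]: "space (vec_borel n) = carrier_vec n"
  by (simp add: vec_borel_def)

lemma measurable_vec_index:
  assumes "i < n"
  shows "(\<lambda>v. v $ i) \<in> borel_measurable (vec_borel n)"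
proof -
  have 1: "(\<lambda>v. \<lambda>i\<in>{..<n}. v $ i) \<in> vec_borel n \<rightarrow>\<^sub>M (Pi\<^sub>M {..<n} (\<lambda>_. borel :: real measure))"
    unfolding vec_borel_def by (rule measurable_vimage_algebra1) (auto simp: space_PiM)
  have "(\<lambda>v. (\<lambda>i\<in>{..<n}. v $ i) i) \<in> borel_measurable (vec_borel n)"
    by (rule measurable_compose[OF 1 measurable_component_singleton]) (use assms in auto)
  thus ?thesis using assms by simp
qed

lemma measurable_vec_len: "vec_len \<in> borel_measurable (vec_borel n)"
proof -
  have "(\<lambda>v. sqrt (\<Sum>i<n. v $ i * v $ i)) \<in> borel_measurable (vec_borel n)"
    by (intro measurable_compose[OF _ borel_measurable_sqrt] borel_measurable_sum borel_measurable_times measurable_vec_index) auto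
  also have "?this \<longleftrightarrow> ?thesis"
    by (rule measurable_cong) (auto simp: vec_len_def scalar_prod_def lessThan_atLeast0)
  finally show ?thesis .
qed

text \<open>Since the infimum is attained, it is at most a exactly when the count of nonzero vectors
  up to a is nonzero.\<close>

lemma measurable_lambda1:
  assumes n: "0 < n"
  shows "lambda1 n \<in> borel_measurable (lattice_space n)"
  unfolding borel_measurable_iff_le
proof
  fix a
  show "{L \<in> space (lattice_space n). lambda1 n L \<le> a} \<in> sets (lattice_space n)"
  proof (cases "0 \<le> a")
    case True
    have "lambda1 n L \<le> a \<longleftrightarrow> lattice_count n a L \<noteq> 0" if L: "L \<in> row_lattice ` SL n" for L
    proof -
      have "lattice_count n a L \<noteq> 0 \<longleftrightarrow> {v \<in> L - {0\<^sub>v n}. vec_len v \<le> a} \<noteq> {}"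
        using lattice_count_eq_card[OF L True] by simp
      also have "\<dots> \<longleftrightarrow> lambda1 n L \<le> a" using lambda1[OF L n] by force
      finally show ?thesis by simp
    qed
    hence "{L \<in> space (lattice_space n). lambda1 n L \<le> a} = {L \<in> space (lattice_space n). lattice_count n a L \<noteq> 0}"
      by auto
    also have "\<dots> \<in> sets (lattice_space n)" using measurable_lattice_count[of n a] by measurable
    finally show ?thesis .
  next
    case False
    have "\<not> lambda1 n L \<le> a" if L: "L \<in> row_lattice ` SL n" for L
    proof -
      obtain v where "vec_len v = lambda1 n L" using lambda1(1)[OF L n] by blast
      thus ?thesis using False vec_len_nonneg[of v] by linarith
    qed
    hence empty: "{L \<in> space (lattice_space n). lambda1 n L \<le> a} = {}" by auto
    show ?thesis unfolding empty by (rule sets.empty_sets)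
  qed
qed

lemma pred_short_vec:
  assumes M: "SL_invariant_prob n M" and n: "0 < n"
    and [measurable]: "f \<in> X \<rightarrow>\<^sub>M M" "g \<in> X \<rightarrow>\<^sub>M vec_borel n"
  shows "Measurable.pred X (\<lambda>x. short_vec n \<gamma> (f x) (g x))"
proof -
  have "lambda1 n \<in> borel_measurable M"
    using measurable_lambda1[OF n] SL_invariantD(2)[OF M] by (simp cong: measurable_cong_sets)
  hence [measurable]: "(\<lambda>x. lambda1 n (f x)) \<in> borel_measurable X" by (rule measurable_compose[OF assms(3)])
  have [measurable]: "(\<lambda>x. vec_len (g x)) \<in> borel_measurable X" by (rule measurable_compose[OF assms(4) measurable_vec_len])
  have "Measurable.pred X (\<lambda>x. vec_len (g x) \<noteq> 0 \<and> vec_len (g x) \<le> \<gamma> * lambda1 n (f x))" by measurable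
  also have "?this \<longleftrightarrow> ?thesis"
  proof (rule measurable_cong)
    fix x assume "x \<in> space X"
    hence "g x \<in> carrier_vec n" using measurable_space[OF assms(4)] by simp
    hence "vec_len (g x) = 0 \<longleftrightarrow> g x = 0\<^sub>v n" by (auto simp: vec_len_L2_set L2_set_eq_0_iff intro!: eq_vecI)
    thus "(vec_len (g x) \<noteq> 0 \<and> vec_len (g x) \<le> \<gamma> * lambda1 n (f x)) = short_vec n \<gamma> (f x) (g x)"
      by (auto simp: short_vec_def)
  qed
  finally show ?thesis .
qed

lemma measurable_append_query:
  "(\<lambda>((L, \<omega>, h), v). (L, \<omega>, h(k := v))) \<in> hist_space M R n k \<Otimes>\<^sub>M vec_borel n \<rightarrow>\<^sub>M hist_space M R n (Suc k)"
proof -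
  have "(\<lambda>x. (snd (snd (fst x)))(k := snd x)) \<in> hist_space M R n k \<Otimes>\<^sub>M vec_borel n \<rightarrow>\<^sub>M Pi\<^sub>M {..<Suc k} (\<lambda>_. vec_borel n)"
    unfolding hist_space_def by (rule measurable_fun_upd[where J="{..<k}"]) (auto simp: lessThan_Suc)
  hence "(\<lambda>x. (fst (fst x), fst (snd (fst x)), (snd (snd (fst x)))(k := snd x))) \<in> hist_space M R n k \<Otimes>\<^sub>M vec_borel n \<rightarrow>\<^sub>M hist_space M R n (Suc k)"
    unfolding hist_space_def by measurable
  thus ?thesis by (simp add: case_prod_beta')
qed

text \<open>A query law need not be supported on \<open>carrier_vec n\<close> after a history that leaves the lattice, so
  its recursion is only shown to agree with a measurable function on histories inside the lattice.\<close>

lemma measurable_transcript_miss_aux: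
  assumes M: "SL_invariant_prob n M" and n: "0 < n" and Q: "query_kernels n N M R never_halt Q"
  shows "j \<le> N \<Longrightarrow> \<exists>g\<in>borel_measurable (hist_space M R n (N - j)). \<forall>L\<in>space M. \<forall>\<omega>\<in>space R. \<forall>h.
    h \<in> space (Pi\<^sub>M {..<N - j} (\<lambda>_. vec_borel n)) \<longrightarrow> h ` {..<N - j} \<subseteq> L \<longrightarrow>
    g (L, \<omega>, h) = emeasure (measure_pmf (transcript never_halt Q L \<omega> j (map h [0..<N - j]))) {l. \<forall>v\<in>set l. \<not> short_vec n \<gamma> L v}"
proof (induction j)
  case 0
  have [measurable]: "Measurable.pred (hist_space M R n N) (\<lambda>x. short_vec n \<gamma> (fst x) (snd (snd x) i))" if "i < N" for i
    unfolding hist_space_def using that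
    by (intro pred_short_vec[OF M n] measurable_fst measurable_compose[OF measurable_snd measurable_compose[OF measurable_snd measurable_component_singleton]]) auto
  let ?P = "\<lambda>x. \<forall>i\<in>{..<N}. \<not> short_vec n \<gamma> (fst x) (snd (snd x) i)"
  have P: "Measurable.pred (hist_space M R n N) ?P" by measurable
  show ?case
  proof (intro bexI[of _ "\<lambda>x. indicator {x. ?P x} x"] ballI allI impI)
    have "Collect ?P \<inter> space (hist_space M R n N) \<in> sets (hist_space M R n N)"
      using P unfolding Measurable.pred_def by (simp add: Int_def conj_commute)
    thus "(\<lambda>x. indicator {x. ?P x} x) \<in> borel_measurable (hist_space M R n (N - 0))"
      using borel_measurable_indicator_iff[of "Collect ?P" "hist_space M R n N"] by simp
  qed (auto simp: indicator_def)
next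
  case (Suc j)
  obtain g where g: "g \<in> borel_measurable (hist_space M R n (N - j))"
    and ge: "\<forall>L\<in>space M. \<forall>\<omega>\<in>space R. \<forall>h. h \<in> space (Pi\<^sub>M {..<N - j} (\<lambda>_. vec_borel n)) \<longrightarrow> h ` {..<N - j} \<subseteq> L \<longrightarrow>
    g (L, \<omega>, h) = emeasure (measure_pmf (transcript never_halt Q L \<omega> j (map h [0..<N - j]))) {l. \<forall>v\<in>set l. \<not> short_vec n \<gamma> L v}"
    using Suc by auto
  define k where "k = N - Suc j"
  have k: "N - j = Suc k" "k < N" using Suc.prems by (auto simp: k_def)
  define G where "G x v = g (fst x, fst (snd x), (snd (snd x))(k := v))" for x v
  have "(\<lambda>y. g ((\<lambda>((L, \<omega>, h), v). (L, \<omega>, h(k := v))) y)) \<in> borel_measurable (hist_space M R n k \<Otimes>\<^sub>M vec_borel n)"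
    using measurable_compose[OF measurable_append_query g[unfolded k(1)]] .
  also have "(\<lambda>y. g ((\<lambda>((L, \<omega>, h), v). (L, \<omega>, h(k := v))) y)) = (\<lambda>(x, v). G x v)" by (auto simp: G_def fun_eq_iff)
  finally have Gm: "(\<lambda>(x, v). G x v) \<in> borel_measurable (hist_space M R n k \<Otimes>\<^sub>M vec_borel n)" .
  define q where "q x = Q (fst x) (fst (snd x)) (map (snd (snd x)) [0..<k])" for x
  have qm: "(\<lambda>x. measure_pmf.prob (q x) B) \<in> borel_measurable (hist_space M R n k)" if "B \<in> sets (vec_borel n)" for B
    using Q k(2) that unfolding query_kernels_def q_def by (simp add: case_prod_beta')
  have "(\<lambda>x. \<integral>\<^sup>+v. G x v * indicator (space (vec_borel n)) v \<partial>measure_pmf (q x)) \<in> borel_measurable (hist_space M R n k)"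
    by (rule measurable_nn_integral_pmf_kernel[OF qm _ Gm]) (use zero_carrier_vec[of n] in \<open>auto simp del: zero_carrier_vec\<close>)
  thus ?case unfolding k_def[symmetric]
  proof (rule bexI[rotated], intro ballI allI impI)
    fix L \<omega> h assume L: "L \<in> space M" and \<omega>: "\<omega> \<in> space R" and h: "h \<in> space (Pi\<^sub>M {..<k} (\<lambda>_. vec_borel n))" and hL: "h ` {..<k} \<subseteq> L"
    let ?l = "map h [0..<k]" and ?A = "{l. \<forall>v\<in>set l. \<not> short_vec n \<gamma> L v}"
    have LC: "L \<subseteq> carrier_vec n"
    proof -
      obtain g where "g \<in> SL n" "L = row_lattice g" using L SL_invariantD(3)[OF M] by auto
      thus ?thesis by (auto simp: row_lattice_def SL_def)
    qed
    have "query_history N never_halt L \<omega> ?l" using hL k(2) by (auto simp: query_history_never_halt)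
    hence sub: "set_pmf (Q L \<omega> ?l) \<subseteq> L" using Q L \<omega> by (auto simp: query_kernels_def)
    have "(\<integral>\<^sup>+v. G (L, \<omega>, h) v * indicator (space (vec_borel n)) v \<partial>measure_pmf (q (L, \<omega>, h)))
      = (\<integral>\<^sup>+v. emeasure (measure_pmf (transcript never_halt Q L \<omega> j (?l @ [v]))) ?A \<partial>measure_pmf (Q L \<omega> ?l))"
      unfolding q_def fst_conv snd_conv
    proof (rule nn_integral_cong_AE, rule AE_pmfI)
      fix v assume v: "v \<in> set_pmf (Q L \<omega> ?l)"
      hence vL: "v \<in> L" "v \<in> carrier_vec n" using sub LC by auto
      have "h(k := v) \<in> space (Pi\<^sub>M {..<Suc k} (\<lambda>_. vec_borel n))"
        using h vL by (auto simp: space_PiM PiE_def extensional_def Pi_def less_Suc_eq)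
      moreover have "(h(k := v)) ` {..<Suc k} \<subseteq> L" using hL vL by (auto simp: less_Suc_eq)
      ultimately have "g (L, \<omega>, h(k := v)) = emeasure (measure_pmf (transcript never_halt Q L \<omega> j (map (h(k := v)) [0..<Suc k]))) ?A"
        using ge L \<omega> unfolding k(1) by blast
      moreover have "map (h(k := v)) [0..<Suc k] = ?l @ [v]" by simp
      ultimately show "G (L, \<omega>, h) v * indicator (space (vec_borel n)) v = emeasure (measure_pmf (transcript never_halt Q L \<omega> j (?l @ [v]))) ?A"
        using vL by (simp add: G_def del: upt_Suc)
    qed
    also have "\<dots> = emeasure (measure_pmf (transcript never_halt Q L \<omega> (Suc j) ?l)) ?A" by (simp add: never_halt_def)
    finally show "(\<integral>\<^sup>+v. G (L, \<omega>, h) v * indicator (space (vec_borel n)) v \<partial>measure_pmf (q (L, \<omega>, h)))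
       = emeasure (measure_pmf (transcript never_halt Q L \<omega> (Suc j) ?l)) ?A" .
  qed
qed

text \<open>Without measurability the integral in \<open>joint_prob\<close> would be 0 by
  convention, so no limit 1 could be proved.\<close>

lemma measurable_transcript_hit:
  assumes M: "SL_invariant_prob n M" and n: "0 < n" and Q: "query_kernels n N M R never_halt Q"
  shows "(\<lambda>(L, \<omega>). measure_pmf.prob (transcript never_halt Q L \<omega> N []) {l. \<exists>v\<in>set l. short_vec n \<gamma> L v}) \<in> borel_measurable (M \<Otimes>\<^sub>M R)"
proof -
  obtain g where g: "g \<in> borel_measurable (hist_space M R n 0)" and ge: "\<forall>L\<in>space M. \<forall>\<omega>\<in>space R. \<forall>h.
    h \<in> space (Pi\<^sub>M {} (\<lambda>_. vec_borel n)) \<longrightarrow> g (L, \<omega>, h) = emeasure (measure_pmf (transcript never_halt Q L \<omega> N [])) {l. \<forall>v\<in>set l. \<not> short_vec n \<gamma> L v}"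
    using measurable_transcript_miss_aux[OF M n Q, of N \<gamma>] unfolding Bex_def by force
  have "(\<lambda>x. (fst x, snd x, \<lambda>_. undefined)) \<in> M \<Otimes>\<^sub>M R \<rightarrow>\<^sub>M hist_space M R n 0"
    unfolding hist_space_def by (intro measurable_Pair measurable_fst measurable_snd measurable_const) (auto simp: space_PiM)
  from measurable_compose[OF this g]
  have "(\<lambda>x. g (fst x, snd x, \<lambda>_. undefined)) \<in> borel_measurable (M \<Otimes>\<^sub>M R)" .
  hence "(\<lambda>x. 1 - enn2real (g (fst x, snd x, \<lambda>_. undefined))) \<in> borel_measurable (M \<Otimes>\<^sub>M R)" by measurable
  also have "?this \<longleftrightarrow> ?thesis"
  proof (rule measurable_cong)
    fix x assume "x \<in> space (M \<Otimes>\<^sub>M R)"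
    then obtain L \<omega> where x: "x = (L, \<omega>)" "L \<in> space M" "\<omega> \<in> space R" by (auto simp: space_pair_measure)
    let ?p = "transcript never_halt Q L \<omega> N []"
    have "g (L, \<omega>, \<lambda>_. undefined) = emeasure (measure_pmf ?p) {l. \<forall>v\<in>set l. \<not> short_vec n \<gamma> L v}"
      using ge x by (auto simp: space_PiM)
    hence "enn2real (g (L, \<omega>, \<lambda>_. undefined)) = measure_pmf.prob ?p (UNIV - {l. \<exists>v\<in>set l. short_vec n \<gamma> L v})"
      by (simp add: measure_pmf.emeasure_eq_measure set_diff_eq)
    also have "\<dots> = 1 - measure_pmf.prob ?p {l. \<exists>v\<in>set l. short_vec n \<gamma> L v}"
      using measure_pmf.prob_compl[of "{l. \<exists>v\<in>set l. short_vec n \<gamma> L v}" ?p] by simp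
    finally show "1 - enn2real (g (fst x, snd x, \<lambda>_. undefined)) = (case x of (L, \<omega>) \<Rightarrow> measure_pmf.prob (transcript never_halt Q L \<omega> N []) {l. \<exists>v\<in>set l. short_vec n \<gamma> L v})"
      using x by simp
  qed
  finally show ?thesis .
qed

section \<open>From high-probability bounds to expectations\<close>

lemma pair_integral_indicator_Times:
  assumes "prob_space M" "prob_space R" "G \<in> sets M"
  shows "integrable (M \<Otimes>\<^sub>M R) (indicator (G \<times> space R) :: _ \<Rightarrow> real)"
    "(\<integral>x. indicator (G \<times> space R) x \<partial>(M \<Otimes>\<^sub>M R)) = measure M G"
proof -
  interpret M: prob_space M by fact
  interpret R: prob_space R by fact
  interpret pair_prob_space M R ..
  have s: "G \<times> space R \<in> sets (M \<Otimes>\<^sub>M R)" using assms(3) by auto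
  show "integrable (M \<Otimes>\<^sub>M R) (indicator (G \<times> space R) :: _ \<Rightarrow> real)"
    using s by (intro integrable_real_indicator) (auto simp: less_top[symmetric])
  have "(\<integral>x. indicator (G \<times> space R) x \<partial>(M \<Otimes>\<^sub>M R)) = measure (M \<Otimes>\<^sub>M R) (G \<times> space R)"
    using s sets.sets_into_space[OF s] by (simp add: Int_absorb2)
  also have "\<dots> = measure M G" unfolding Sigma_Algebra.measure_def
    using assms(3) by (simp add: R.emeasure_pair_measure_Times R.emeasure_space_1)
  finally show "(\<integral>x. indicator (G \<times> space R) x \<partial>(M \<Otimes>\<^sub>M R)) = measure M G" .
qed

text \<open>Off the good event the integrand is bounded by 1. If it is not integrable, its integral
  is 0 and satisfies the same upper bound.\<close>

lemma (in prob_sequence) tendsto_0_expectation_whp: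
  fixes f :: "nat \<Rightarrow> 'a \<Rightarrow> 'b \<Rightarrow> real"
  assumes R: "\<And>n. 0 < n \<Longrightarrow> prob_space (R n)"
    and f: "\<And>n L \<omega>. 0 \<le> f n L \<omega>" "\<And>n L \<omega>. f n L \<omega> \<le> 1"
    and w: "whp M (\<lambda>n L. \<forall>\<omega>\<in>space (R n). f n L \<omega> \<le> b n)" and b: "b \<longlonglongrightarrow> 0" "\<And>n. 0 \<le> b n"
  shows "(\<lambda>n. \<integral>(L, \<omega>). f n L \<omega> \<partial>(M n \<Otimes>\<^sub>M R n)) \<longlonglongrightarrow> 0"
proof -
  let ?I = "\<lambda>n. \<integral>(L, \<omega>). f n L \<omega> \<partial>(M n \<Otimes>\<^sub>M R n)"
  obtain G where G: "\<forall>n>0. G n \<in> sets (M n)" "(\<lambda>n. measure (M n) (G n)) \<longlonglongrightarrow> 1"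
    "\<forall>n>0. \<forall>L\<in>G n. \<forall>\<omega>\<in>space (R n). f n L \<omega> \<le> b n" using w unfolding whp_def by auto
  have up: "?I n \<le> (1 - measure (M n) (G n)) + b n" if n: "0 < n" for n
  proof (cases "integrable (M n \<Otimes>\<^sub>M R n) (\<lambda>(L, \<omega>). f n L \<omega>)")
    case True
    interpret M: prob_space "M n" by (rule prob[OF n])
    interpret R: prob_space "R n" by (rule R[OF n])
    interpret pair_prob_space "M n" "R n" ..
    have Gn: "G n \<in> sets (M n)" using G(1) n by blast
    note I = pair_integral_indicator_Times[OF prob[OF n] R[OF n] Gn]
    have "?I n \<le> (\<integral>x. (1 - indicator (G n \<times> space (R n)) x) + b n \<partial>(M n \<Otimes>\<^sub>M R n))"
    proof (rule integral_mono[OF True])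
      show "integrable (M n \<Otimes>\<^sub>M R n) (\<lambda>x. (1 - indicator (G n \<times> space (R n)) x) + b n)" using I(1) by simp
      fix x assume "x \<in> space (M n \<Otimes>\<^sub>M R n)"
      then obtain L \<omega> where x: "x = (L, \<omega>)" "\<omega> \<in> space (R n)" by (auto simp: space_pair_measure)
      have "f n L \<omega> \<le> (1 - indicator (G n) L) + b n"
        using f(2)[of n L \<omega>] b(2)[of n] G(3) n x(2) by (cases "L \<in> G n") auto
      thus "(case x of (L, \<omega>) \<Rightarrow> f n L \<omega>) \<le> (1 - indicator (G n \<times> space (R n)) x) + b n" using x by (simp add: indicator_times)
    qed
    also have "\<dots> = (1 - measure (M n) (G n)) + b n" using I by (simp add: prob_space)
    finally show ?thesis .
  next
    case False
    hence "?I n = 0" by (rule not_integrable_integral_eq)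
    thus ?thesis using prob_space.prob_le_1[OF prob[OF n], of "G n"] b(2)[of n] by simp
  qed
  have low: "0 \<le> ?I n" for n
    by (rule Bochner_Integration.integral_nonneg) (use f in auto)
  have "(\<lambda>n. (1 - measure (M n) (G n)) + b n) \<longlonglongrightarrow> (1 - 1) + 0" by (intro tendsto_intros G(2) b(1))
  hence "(\<lambda>n. (1 - measure (M n) (G n)) + b n) \<longlonglongrightarrow> 0" by simp
  thus ?thesis
  proof (rule tendsto_sandwich[OF _ _ tendsto_const, rotated 2])
    show "\<forall>\<^sub>F n in sequentially. 0 \<le> ?I n" using low by simp
    show "\<forall>\<^sub>F n in sequentially. ?I n \<le> (1 - measure (M n) (G n)) + b n"
      using eventually_gt_at_top[of 0] by eventually_elim (rule up)
  qed
qed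

lemma (in prob_sequence) tendsto_1_expectation_whp:
  fixes f :: "nat \<Rightarrow> 'a \<Rightarrow> 'b \<Rightarrow> real"
  assumes R: "\<And>n. 0 < n \<Longrightarrow> prob_space (R n)"
    and f: "\<And>n L \<omega>. 0 \<le> f n L \<omega>" "\<And>n L \<omega>. f n L \<omega> \<le> 1"
    and m: "\<And>n. 0 < n \<Longrightarrow> (\<lambda>(L, \<omega>). f n L \<omega>) \<in> borel_measurable (M n \<Otimes>\<^sub>M R n)"
    and w: "whp M (\<lambda>n L. \<forall>\<omega>\<in>space (R n). 1 - b n \<le> f n L \<omega>)" and b: "b \<longlonglongrightarrow> 0" "\<And>n. 0 \<le> b n"
  shows "(\<lambda>n. \<integral>(L, \<omega>). f n L \<omega> \<partial>(M n \<Otimes>\<^sub>M R n)) \<longlonglongrightarrow> 1"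
proof -
  have "whp M (\<lambda>n L. \<forall>\<omega>\<in>space (R n). 1 - f n L \<omega> \<le> b n)"
    by (rule whp_mono[OF w]) (auto simp: algebra_simps)
  hence "(\<lambda>n. \<integral>(L, \<omega>). 1 - f n L \<omega> \<partial>(M n \<Otimes>\<^sub>M R n)) \<longlonglongrightarrow> 0"
    by (intro tendsto_0_expectation_whp[OF R _ _ _ b]) (use f in auto)
  hence "(\<lambda>n. 1 - (\<integral>(L, \<omega>). 1 - f n L \<omega> \<partial>(M n \<Otimes>\<^sub>M R n))) \<longlonglongrightarrow> 1 - 0" by (intro tendsto_intros)
  moreover have "1 - (\<integral>(L, \<omega>). 1 - f n L \<omega> \<partial>(M n \<Otimes>\<^sub>M R n)) = (\<integral>(L, \<omega>). f n L \<omega> \<partial>(M n \<Otimes>\<^sub>M R n))" if n: "0 < n" for n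
  proof -
    interpret M: prob_space "M n" by (rule prob[OF n])
    interpret R: prob_space "R n" by (rule R[OF n])
    interpret pair_prob_space "M n" "R n" ..
    have "integrable (M n \<Otimes>\<^sub>M R n) (\<lambda>(L, \<omega>). f n L \<omega>)"
      by (rule integrable_const_bound[OF _ m[OF n], where B=1]) (use f in auto)
    thus ?thesis by (simp add: case_prod_beta' prob_space)
  qed
  ultimately show ?thesis
    by (subst tendsto_cong[where g="\<lambda>n. 1 - (\<integral>(L, \<omega>). 1 - f n L \<omega> \<partial>(M n \<Otimes>\<^sub>M R n))"])
       (auto intro!: eventually_mono[OF eventually_gt_at_top[of "0::nat"]])
qed

section \<open>Query counts against rates, and limits of joint probabilities\<close>

lemma query_count_tendsto_0:
  assumes N: "\<And>n. 0 < N n" and lim: "(\<lambda>n. ln (real (N n)) / real n) \<longlonglongrightarrow> r" and r: "r < K - \<eta>"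
  shows "(\<lambda>n. real (N n) * (2 * exp (- real n * (K - \<eta>)))) \<longlonglongrightarrow> 0"
proof -
  define \<theta> where "\<theta> = (K - \<eta> - r) / 2"
  have \<theta>: "0 < \<theta>" using r by (simp add: \<theta>_def)
  have "\<forall>\<^sub>F n in sequentially. ln (real (N n)) / real n < r + \<theta>" using lim \<theta> by (intro order_tendstoD) auto
  hence up: "\<forall>\<^sub>F n in sequentially. real (N n) * (2 * exp (- real n * (K - \<eta>))) \<le> 2 * exp (- real n * \<theta>)"
    using eventually_gt_at_top[of 0]
  proof eventually_elim
    fix n assume "ln (real (N n)) / real n < r + \<theta>" "0 < n"
    hence "ln (real (N n)) \<le> real n * (r + \<theta>)" by (simp add: field_simps)
    hence "real (N n) \<le> exp (real n * (r + \<theta>))" using N[of n] by (metis exp_le_cancel_iff exp_ln of_nat_0_less_iff)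
    hence "real (N n) * (2 * exp (- real n * (K - \<eta>))) \<le> exp (real n * (r + \<theta>)) * (2 * exp (- real n * (K - \<eta>)))"
      by (rule mult_right_mono) simp
    also have "\<dots> = 2 * exp (real n * (r + \<theta>) + - real n * (K - \<eta>))" unfolding exp_add by simp
    also have "real n * (r + \<theta>) + - real n * (K - \<eta>) = - real n * \<theta>" by (simp add: \<theta>_def field_simps)
    finally show "real (N n) * (2 * exp (- real n * (K - \<eta>))) \<le> 2 * exp (- real n * \<theta>)" .
  qed
  have lim0: "(\<lambda>n. 2 * exp (- real n * \<theta>)) \<longlonglongrightarrow> 0" using \<theta> by real_asymp
  show ?thesis by (rule tendsto_sandwich[OF _ up tendsto_const lim0]) simp
qed

text \<open>The expected number of hits, \<open>N n\<close> times the hit probability of one query,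
  grows exponentially, so the probability of missing decays doubly exponentially.\<close>

lemma query_count_miss_tendsto_0:
  assumes N: "\<And>n. 0 < N n" and lim: "(\<lambda>n. ln (real (N n)) / real n) \<longlonglongrightarrow> r" and r: "K + \<eta> < r"
  shows "(\<lambda>n. exp (- real (N n) * (exp (- real n * (K + \<eta>)) / 2))) \<longlonglongrightarrow> 0"
proof -
  define \<theta> where "\<theta> = (r - (K + \<eta>)) / 2"
  have \<theta>: "0 < \<theta>" using r by (simp add: \<theta>_def)
  have "\<forall>\<^sub>F n in sequentially. r - \<theta> < ln (real (N n)) / real n" using lim \<theta> by (intro order_tendstoD) auto
  hence up: "\<forall>\<^sub>F n in sequentially. exp (- real (N n) * (exp (- real n * (K + \<eta>)) / 2)) \<le> exp (- (exp (real n * \<theta>) / 2))"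
    using eventually_gt_at_top[of 0]
  proof eventually_elim
    fix n assume "r - \<theta> < ln (real (N n)) / real n" "0 < n"
    hence "real n * (r - \<theta>) \<le> ln (real (N n))" by (simp add: field_simps)
    hence "exp (real n * (r - \<theta>)) \<le> real (N n)" using N[of n] by (metis exp_le_cancel_iff exp_ln of_nat_0_less_iff)
    hence "exp (real n * (r - \<theta>)) * (exp (- real n * (K + \<eta>)) / 2) \<le> real (N n) * (exp (- real n * (K + \<eta>)) / 2)"
      by (rule mult_right_mono) simp
    also have "exp (real n * (r - \<theta>)) * (exp (- real n * (K + \<eta>)) / 2) = exp (real n * (r - \<theta>) + - real n * (K + \<eta>)) / 2"
      unfolding exp_add by simp
    also have "real n * (r - \<theta>) + - real n * (K + \<eta>) = real n * \<theta>" by (simp add: \<theta>_def field_simps)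
    finally show "exp (- real (N n) * (exp (- real n * (K + \<eta>)) / 2)) \<le> exp (- (exp (real n * \<theta>) / 2))" by simp
  qed
  have lim0: "(\<lambda>n. exp (- (exp (real n * \<theta>) / 2))) \<longlonglongrightarrow> 0" using \<theta> by real_asymp
  show ?thesis by (rule tendsto_sandwich[OF _ up tendsto_const lim0]) simp
qed

lemma (in random_lattices) whp_accurate_prob:
  assumes \<epsilon>: "\<epsilon> \<in> o(\<lambda>n. exp (- real n * (K + \<delta>)))" and acc: "accurate M R N \<epsilon> halt par Q"
  shows "whp M (\<lambda>n L. \<forall>\<omega>\<in>space (R n). \<forall>h. query_history (N n) (halt n) L \<omega> h \<longrightarrow>
    (\<forall>A. \<bar>measure_pmf.prob (Q n L \<omega> h) A - measure_pmf.prob (disc_gauss L (s_param n (par n L \<omega> h))) A\<bar> \<le> exp (- real n * (K + \<delta>)) / 2))"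
proof -
  have w1: "whp M (\<lambda>n L. \<forall>\<omega>\<in>space (R n). \<forall>h. query_history (N n) (halt n) L \<omega> h \<longrightarrow>
           tv_dist (Q n L \<omega> h) (disc_gauss L (s_param n (par n L \<omega> h))) \<le> \<epsilon> n)"
    using acc unfolding accurate_def whp_def .
  have ev: "\<forall>\<^sub>F n in sequentially. \<epsilon> n \<le> exp (- real n * (K + \<delta>)) / 2"
    using landau_o.smallD[OF \<epsilon>, of "1 / 2"] by (auto elim!: eventually_mono)
  have w2: "whp M (\<lambda>n L. \<epsilon> n \<le> exp (- real n * (K + \<delta>)) / 2)"
    by (rule whp_eventually) (use ev in \<open>auto elim!: eventually_mono\<close>)
  show ?thesis
  proof (rule whp_mono[OF whp_conj[OF w1 w2]], elim conjE, intro ballI allI impI)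
    fix n L \<omega> h A
    assume *: "\<forall>\<omega>\<in>space (R n). \<forall>h. query_history (N n) (halt n) L \<omega> h \<longrightarrow>
           tv_dist (Q n L \<omega> h) (disc_gauss L (s_param n (par n L \<omega> h))) \<le> \<epsilon> n"
      and e: "\<epsilon> n \<le> exp (- real n * (K + \<delta>)) / 2" and "\<omega> \<in> space (R n)" "query_history (N n) (halt n) L \<omega> h"
    hence "tv_dist (Q n L \<omega> h) (disc_gauss L (s_param n (par n L \<omega> h))) \<le> exp (- real n * (K + \<delta>)) / 2" by fastforce
    thus "\<bar>measure_pmf.prob (Q n L \<omega> h) A - measure_pmf.prob (disc_gauss L (s_param n (par n L \<omega> h))) A\<bar> \<le> exp (- real n * (K + \<delta>)) / 2"
      by (rule tv_dist_bound)
  qed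
qed

text \<open>Because \<eta> is at most \<delta>, the total variation error is at most half of the
  Gaussian lower bound, and both estimates survive with factors 1/2 and 2.\<close>

lemma (in random_lattices) whp_query_prob:
  assumes \<gamma>: "1 \<le> \<gamma>" and c: "0 < c" "c < 1" and \<eta>: "0 < \<eta>" "\<eta> \<le> \<delta>"
    and \<epsilon>: "\<epsilon> \<in> o(\<lambda>n. exp (- real n * (K_rate \<gamma> c + \<delta>)))"
    and acc: "accurate M R N \<epsilon> (\<lambda>n. never_halt) (\<lambda>n L \<omega> h. c) Q"
  shows "whp M (\<lambda>n L. \<forall>\<omega>\<in>space (R n). \<forall>h. query_history (N n) never_halt L \<omega> h \<longrightarrow>
    exp (- real n * (K_rate \<gamma> c + \<eta>)) / 2 \<le> measure_pmf.prob (Q n L \<omega> h) {v. short_vec n \<gamma> L v} \<and>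
    measure_pmf.prob (Q n L \<omega> h) {v. short_vec n \<gamma> L v} \<le> 2 * exp (- real n * (K_rate \<gamma> c - \<eta>)))"
proof -
  show ?thesis
  proof (rule whp_mono[OF whp_conj[OF whp_gauss_prob[OF \<gamma> c \<eta>(1)] whp_accurate_prob[OF \<epsilon> acc]]], elim conjE, intro ballI allI impI)
    fix n L \<omega> h
    let ?S = "{v. short_vec n \<gamma> L v}" and ?K = "K_rate \<gamma> c"
    let ?d = "measure_pmf.prob (disc_gauss L (s_param n c)) ?S"
    assume d: "exp (- real n * (?K + \<eta>)) \<le> ?d" "?d \<le> exp (- real n * (?K - \<eta>))"
      and *: "\<forall>\<omega>\<in>space (R n). \<forall>h. query_history (N n) never_halt L \<omega> h \<longrightarrow>
    (\<forall>A. \<bar>measure_pmf.prob (Q n L \<omega> h) A - measure_pmf.prob (disc_gauss L (s_param n c)) A\<bar> \<le> exp (- real n * (?K + \<delta>)) / 2)"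
      and qh: "\<omega> \<in> space (R n)" "query_history (N n) never_halt L \<omega> h"
    have "\<bar>measure_pmf.prob (Q n L \<omega> h) ?S - ?d\<bar> \<le> exp (- real n * (?K + \<delta>)) / 2" using * qh by blast
    moreover have "exp (- real n * (?K + \<delta>)) \<le> exp (- real n * (?K + \<eta>))" using \<eta> by (simp add: mult_left_mono)
    moreover have "exp (- real n * (?K + \<eta>)) \<le> exp (- real n * (?K - \<eta>))" using \<eta> by (simp add: mult_left_mono)
    ultimately show "exp (- real n * (?K + \<eta>)) / 2 \<le> measure_pmf.prob (Q n L \<omega> h) ?S \<and> measure_pmf.prob (Q n L \<omega> h) ?S \<le> 2 * exp (- real n * (?K - \<eta>))"
      using d by linarith
  qed
qed

text \<open>\<open>H\<close> is the set of samples from which success is possible: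
  \<open>hit_set\<close> for search procedures, the short vectors for a fixed parameter.\<close>

lemma (in random_lattices) joint_prob_tendsto_0:
  assumes R: "\<And>n. 0 < n \<Longrightarrow> prob_space (R n)"
    and N: "\<And>n. 0 < N n" and lim: "(\<lambda>n. ln (real (N n)) / real n) \<longlonglongrightarrow> r" and r: "r < K - \<eta>"
    and Q: "\<forall>n>0. query_kernels n (N n) (M n) (R n) (halt n) (Q n)"
    and w: "whp M (\<lambda>n L. \<forall>\<omega>\<in>space (R n). \<forall>h. query_history (N n) (halt n) L \<omega> h \<longrightarrow>
      measure_pmf.prob (Q n L \<omega> h) (H n L) \<le> 2 * exp (- real n * (K - \<eta>)))"
    and E: "\<And>n L \<omega> l. 0 < n \<Longrightarrow> L \<in> space (M n) \<Longrightarrow> \<omega> \<in> space (R n) \<Longrightarrow> set l \<subseteq> L \<Longrightarrow> length l \<le> N n \<Longrightarrow> E n L \<omega> l \<Longrightarrow> \<exists>v\<in>set l. v \<in> H n L"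
  shows "(\<lambda>n. joint_prob (M n) (R n) (N n) (halt n) (Q n) (E n)) \<longlonglongrightarrow> 0"
  unfolding joint_prob_def
proof (rule tendsto_0_expectation_whp[OF R _ _ _ query_count_tendsto_0[OF N lim r]])
  show "whp M (\<lambda>n L. \<forall>\<omega>\<in>space (R n). measure_pmf.prob (transcript (halt n) (Q n) L \<omega> (N n) []) {h. E n L \<omega> h} \<le> real (N n) * (2 * exp (- real n * (K - \<eta>))))"
  proof (rule whp_mono[OF w], intro ballI)
    fix n L \<omega>
    assume n: "0 < n" and L: "L \<in> space (M n)" and \<omega>: "\<omega> \<in> space (R n)"
      and b: "\<forall>\<omega>\<in>space (R n). \<forall>h. query_history (N n) (halt n) L \<omega> h \<longrightarrow> measure_pmf.prob (Q n L \<omega> h) (H n L) \<le> 2 * exp (- real n * (K - \<eta>))"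
    let ?p = "transcript (halt n) (Q n) L \<omega> (N n) []"
    have sub: "\<And>h. query_history (N n) (halt n) L \<omega> h \<Longrightarrow> set_pmf (Q n L \<omega> h) \<subseteq> L"
      using Q n L \<omega> unfolding query_kernels_def by blast
    have "measure_pmf.prob ?p {h. E n L \<omega> h} = measure_pmf.prob ?p ({h. E n L \<omega> h} \<inter> set_pmf ?p)" by (rule measure_Int_set_pmf[symmetric])
    also have "\<dots> \<le> measure_pmf.prob ?p {l. \<exists>v\<in>set l. v \<in> H n L}"
    proof (rule measure_pmf.finite_measure_mono)
      show "{h. E n L \<omega> h} \<inter> set_pmf ?p \<subseteq> {l. \<exists>v\<in>set l. v \<in> H n L}"
        using E[OF n L \<omega>] set_pmf_transcript[where N="N n" and h="[]" and k="N n" and halt="halt n" and Q="Q n" and L=L and \<omega>=\<omega>, OF sub] by auto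
    qed simp
    also have "\<dots> \<le> real (N n) * (2 * exp (- real n * (K - \<eta>)))"
    proof -
      have "emeasure (measure_pmf ?p) {l. \<exists>v\<in>set l. v \<in> H n L} \<le> ennreal (real (N n) * (2 * exp (- real n * (K - \<eta>))))"
        by (rule emeasure_transcript_hit_le[where N="N n" and halt="halt n" and Q="Q n" and L=L and \<omega>=\<omega>, OF sub]) (use b \<omega> in auto)
      thus ?thesis by (simp add: measure_pmf.emeasure_eq_measure)
    qed
    finally show "measure_pmf.prob ?p {h. E n L \<omega> h} \<le> real (N n) * (2 * exp (- real n * (K - \<eta>)))" .
  qed
qed auto

lemma (in random_lattices) joint_prob_tendsto_1:
  assumes R: "\<And>n. 0 < n \<Longrightarrow> prob_space (R n)"
    and N: "\<And>n. 0 < N n" and lim: "(\<lambda>n. ln (real (N n)) / real n) \<longlonglongrightarrow> r" and r: "K + \<eta> < r"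
    and Q: "\<forall>n>0. query_kernels n (N n) (M n) (R n) never_halt (Q n)"
    and w: "whp M (\<lambda>n L. \<forall>\<omega>\<in>space (R n). \<forall>h. query_history (N n) never_halt L \<omega> h \<longrightarrow>
      exp (- real n * (K + \<eta>)) / 2 \<le> measure_pmf.prob (Q n L \<omega> h) {v. short_vec n \<gamma> L v})"
  shows "(\<lambda>n. joint_prob (M n) (R n) (N n) never_halt (Q n) (\<lambda>L \<omega> l. \<exists>v\<in>set l. short_vec n \<gamma> L v)) \<longlonglongrightarrow> 1"
  unfolding joint_prob_def
proof (rule tendsto_1_expectation_whp[OF R _ _ _ _ query_count_miss_tendsto_0[OF N lim r]])
  show "(\<lambda>(L, \<omega>). measure_pmf.prob (transcript never_halt (Q n) L \<omega> (N n) []) {h. \<exists>v\<in>set h. short_vec n \<gamma> L v}) \<in> borel_measurable (M n \<Otimes>\<^sub>M R n)"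
    if "0 < n" for n using that Q by (intro measurable_transcript_hit[OF inv]) auto
  show "whp M (\<lambda>n L. \<forall>\<omega>\<in>space (R n). 1 - exp (- real (N n) * (exp (- real n * (K + \<eta>)) / 2))
    \<le> measure_pmf.prob (transcript never_halt (Q n) L \<omega> (N n) []) {h. \<exists>v\<in>set h. short_vec n \<gamma> L v})"
  proof (rule whp_mono[OF w], intro ballI)
    fix n L \<omega>
    assume n: "0 < n" and L: "L \<in> space (M n)" and \<omega>: "\<omega> \<in> space (R n)"
      and b: "\<forall>\<omega>\<in>space (R n). \<forall>h. query_history (N n) never_halt L \<omega> h \<longrightarrow> exp (- real n * (K + \<eta>)) / 2 \<le> measure_pmf.prob (Q n L \<omega> h) {v. short_vec n \<gamma> L v}"
    let ?p = "transcript never_halt (Q n) L \<omega> (N n) []" and ?b = "exp (- real n * (K + \<eta>)) / 2" and ?S = "{v. short_vec n \<gamma> L v}"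
    have sub: "\<And>h. query_history (N n) never_halt L \<omega> h \<Longrightarrow> set_pmf (Q n L \<omega> h) \<subseteq> L"
      using Q n L \<omega> unfolding query_kernels_def by blast
    have "query_history (N n) never_halt L \<omega> []" using N[of n] by (simp add: query_history_never_halt)
    hence "?b \<le> measure_pmf.prob (Q n L \<omega> []) ?S" using b \<omega> by blast
    also have "\<dots> \<le> 1" by (rule measure_pmf.prob_le_1)
    finally have b1: "?b \<le> 1" .
    have "emeasure (measure_pmf ?p) {l. \<forall>v\<in>set l. v \<notin> ?S} \<le> ennreal ((1 - ?b) ^ N n)"
      by (rule emeasure_transcript_miss_le[where N="N n" and Q="Q n" and L=L and \<omega>=\<omega>, OF sub]) (use b \<omega> b1 in auto)
    hence "measure_pmf.prob ?p {l. \<forall>v\<in>set l. v \<notin> ?S} \<le> (1 - ?b) ^ N n" using b1 by (simp add: measure_pmf.emeasure_eq_measure)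
    also have "\<dots> \<le> exp (- ?b) ^ N n" using b1 exp_ge_add_one_self[of "- ?b"] by (intro power_mono) auto
    also have "\<dots> = exp (- real (N n) * ?b)" by (simp add: exp_of_nat_mult[symmetric])
    finally have 1: "measure_pmf.prob ?p {l. \<forall>v\<in>set l. v \<notin> ?S} \<le> exp (- real (N n) * ?b)" .
    have "{l. \<forall>v\<in>set l. v \<notin> ?S} = UNIV - {h. \<exists>v\<in>set h. short_vec n \<gamma> L v}" by auto
    hence "measure_pmf.prob ?p {l. \<forall>v\<in>set l. v \<notin> ?S} = 1 - measure_pmf.prob ?p {h. \<exists>v\<in>set h. short_vec n \<gamma> L v}"
      using measure_pmf.prob_compl[of "{h. \<exists>v\<in>set h. short_vec n \<gamma> L v}" ?p] by simp
    thus "1 - exp (- real (N n) * ?b) \<le> measure_pmf.prob ?p {h. \<exists>v\<in>set h. short_vec n \<gamma> L v}" using 1 by linarith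
  qed
qed auto

lemma succeeds_hit_set:
  assumes ds: "direct_search n N M R halt par ret" and L: "L \<in> space M" and \<omega>: "\<omega> \<in> space R"
    and h: "set h \<subseteq> L" "length h \<le> N" and s: "succeeds n \<gamma> ret L \<omega> h"
  shows "\<exists>v\<in>set h. v \<in> hit_set n \<gamma> L"
proof -
  obtain v where v: "returned n ret L \<omega> h = Some v" "short_vec n \<gamma> L v" using s unfolding succeeds_def by blast
  obtain j b where jb: "ret L \<omega> h = Some (j, b)" "v = (if b then prim_part n L (h ! j) else h ! j)"
    using v(1) unfolding returned_def by (auto split: option.splits)
  have j: "j < length h" "h ! j \<noteq> 0\<^sub>v n" using ds L \<omega> h jb(1) unfolding direct_search_def by blast+
  have hj: "h ! j \<in> set h" using j by simp
  moreover have "h ! j \<in> hit_set n \<gamma> L" using hj h j(2) v(2) jb(2) unfolding hit_set_def by (auto split: if_splits)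
  ultimately show ?thesis by blast
qed

text \<open>If some sample is short, then so is the shortest nonzero one; so returning the latter
  loses nothing.\<close>

lemma succeeds_returns_shortest:
  assumes rs: "returns_shortest n N M R ret" and L: "L \<in> space M" and \<omega>: "\<omega> \<in> space R"
    and h: "set h \<subseteq> L" "length h \<le> N"
  shows "succeeds n \<gamma> ret L \<omega> h \<longleftrightarrow> (\<exists>v\<in>set h. short_vec n \<gamma> L v)"
proof (cases "set h \<subseteq> {0\<^sub>v n}")
  case True
  hence "ret L \<omega> h = None" using rs L \<omega> h unfolding returns_shortest_def by simp
  thus ?thesis using True by (auto simp: succeeds_def returned_def short_vec_def)
next
  case False
  hence "\<exists>j<length h. ret L \<omega> h = Some (j, False) \<and> h ! j \<noteq> 0\<^sub>v n \<and> (\<forall>v\<in>set h. v \<noteq> 0\<^sub>v n \<longrightarrow> vec_len (h ! j) \<le> vec_len v)"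
    using rs L \<omega> h unfolding returns_shortest_def by simp
  then obtain j where j: "j < length h" "ret L \<omega> h = Some (j, False)" "h ! j \<noteq> 0\<^sub>v n" "\<forall>v\<in>set h. v \<noteq> 0\<^sub>v n \<longrightarrow> vec_len (h ! j) \<le> vec_len v"
    by auto
  have "succeeds n \<gamma> ret L \<omega> h \<longleftrightarrow> short_vec n \<gamma> L (h ! j)" by (simp add: succeeds_def returned_def j(2))
  also have "\<dots> \<longleftrightarrow> (\<exists>v\<in>set h. short_vec n \<gamma> L v)"
  proof
    assume "\<exists>v\<in>set h. short_vec n \<gamma> L v"
    then obtain v where "v \<in> set h" "v \<noteq> 0\<^sub>v n" "vec_len v \<le> \<gamma> * lambda1 n L" by (auto simp: short_vec_def)
    thus "short_vec n \<gamma> L (h ! j)" using j(3,4) by (force simp: short_vec_def)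
  qed (use j(1) in auto)
  finally show ?thesis .
qed

text \<open>All mass of a transcript lies on lists inside the lattice of length at most
  \<open>N\<close>, and only there must the two events agree.\<close>

lemma joint_prob_cong:
  assumes Q: "query_kernels n N M R halt Q"
    and E: "\<And>L \<omega> l. L \<in> space M \<Longrightarrow> \<omega> \<in> space R \<Longrightarrow> set l \<subseteq> L \<Longrightarrow> length l \<le> N \<Longrightarrow> E L \<omega> l \<longleftrightarrow> F L \<omega> l"
  shows "joint_prob M R N halt Q E = joint_prob M R N halt Q F"
  unfolding joint_prob_def
proof (rule Bochner_Integration.integral_cong[OF refl])
  fix x assume "x \<in> space (M \<Otimes>\<^sub>M R)"
  then obtain L \<omega> where x: "x = (L, \<omega>)" "L \<in> space M" "\<omega> \<in> space R" by (auto simp: space_pair_measure)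
  let ?p = "transcript halt Q L \<omega> N []"
  have sub: "\<And>h. query_history N halt L \<omega> h \<Longrightarrow> set_pmf (Q L \<omega> h) \<subseteq> L"
    using Q x unfolding query_kernels_def by blast
  have "{l. E L \<omega> l} \<inter> set_pmf ?p = {l. F L \<omega> l} \<inter> set_pmf ?p"
    using E[OF x(2,3)] set_pmf_transcript[where N=N and h="[]" and k=N and halt=halt and Q=Q and L=L and \<omega>=\<omega>, OF sub] by auto
  hence "measure_pmf.prob ?p {l. E L \<omega> l} = measure_pmf.prob ?p {l. F L \<omega> l}"
    by (metis measure_Int_set_pmf)
  thus "(case x of (L, \<omega>) \<Rightarrow> measure_pmf.prob (transcript halt Q L \<omega> N []) {l. E L \<omega> l}) =
    (case x of (L, \<omega>) \<Rightarrow> measure_pmf.prob (transcript halt Q L \<omega> N []) {l. F L \<omega> l})" using x by simp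
qed

lemma ln_rate_bounds:
  fixes q K \<eta> :: real
  assumes n: "0 < n" and \<eta>: "ln 2 < real n * (\<eta> - \<theta>)"
    and q: "exp (- real n * (K + \<theta>)) / 2 \<le> q" "q \<le> 2 * exp (- real n * (K - \<theta>))"
  shows "0 < q \<and> \<bar>- (1 / real n) * ln q - K\<bar> < \<eta>"
proof -
  have q0: "0 < q" using q(1) by (rule less_le_trans[rotated]) simp
  have "ln (exp (- real n * (K + \<theta>)) / 2) \<le> ln q" using q(1) q0 by (subst ln_le_cancel_iff) auto
  hence 1: "- real n * (K + \<theta>) - ln 2 \<le> ln q" by (simp add: ln_div)
  have "ln q \<le> ln (2 * exp (- real n * (K - \<theta>)))" using q(2) q0 by (subst ln_le_cancel_iff) auto
  hence 2: "ln q \<le> ln 2 - real n * (K - \<theta>)" by (simp add: ln_mult)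
  have "- ln q < real n * (K + \<eta>)" "real n * (K - \<eta>) < - ln q" using 1 2 \<eta> by (auto simp: algebra_simps)
  hence "- ln q / real n < K + \<eta>" "K - \<eta> < - ln q / real n" using n by (simp_all add: field_simps)
  thus ?thesis using q0 by (simp add: abs_less_iff)
qed

theorem corollary5p3:
  fixes \<gamma> r :: real
    and N :: "nat \<Rightarrow> nat"
    and M :: "nat \<Rightarrow> real vec set measure"
    and R :: "nat \<Rightarrow> 'w measure"
  assumes "1 \<le> \<gamma>"
    and "\<And>n. 0 < n \<Longrightarrow> SL_invariant_prob n (M n)"
    and "\<And>n. 0 < n \<Longrightarrow> prob_space (R n)"
    and "\<And>n. 0 < N n"
    and "(\<lambda>n. ln (real (N n)) / real n) \<longlonglongrightarrow> r"
  shows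
    "(\<forall>(\<epsilon> :: nat \<Rightarrow> real) \<delta> halt par ret Q.
        0 < \<delta> \<longrightarrow> \<epsilon> \<in> o(\<lambda>n. exp (- real n * (K_star \<gamma> + \<delta>))) \<longrightarrow>
        (\<forall>n>0. direct_search n (N n) (M n) (R n) (halt n) (par n) (ret n)) \<longrightarrow>
        (\<forall>n>0. query_kernels n (N n) (M n) (R n) (halt n) (Q n)) \<longrightarrow>
        accurate M R N \<epsilon> halt par Q \<longrightarrow>
        (r < K_star \<gamma> \<longrightarrow>
           (\<lambda>n. joint_prob (M n) (R n) (N n) (halt n) (Q n) (succeeds n \<gamma> (ret n))) \<longlonglongrightarrow> 0) \<and>
        (K_star \<gamma> < r \<longrightarrow>
           (\<forall>n>0. halt n = never_halt \<and> par n = (\<lambda>L \<omega> h. exp (- 1)) \<and>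
              returns_shortest n (N n) (M n) (R n) (ret n)) \<longrightarrow>
           (\<lambda>n. joint_prob (M n) (R n) (N n) (halt n) (Q n) (succeeds n \<gamma> (ret n))) \<longlonglongrightarrow> 1))
     \<and>
     (\<forall>c (\<epsilon> :: nat \<Rightarrow> real) \<delta> Q.
        0 < c \<longrightarrow> c < 1 \<longrightarrow>
        0 < \<delta> \<longrightarrow> \<epsilon> \<in> o(\<lambda>n. exp (- real n * (K_rate \<gamma> c + \<delta>))) \<longrightarrow>
        (\<forall>n>0. query_kernels n (N n) (M n) (R n) never_halt (Q n)) \<longrightarrow>
        accurate M R N \<epsilon> (\<lambda>n. never_halt) (\<lambda>n L \<omega> h. c) Q \<longrightarrow>
        (\<forall>\<eta>>0. \<exists>E. (\<forall>n>0. E n \<in> sets (M n)) \<and> (\<lambda>n. measure (M n) (E n)) \<longlonglongrightarrow> 1 \<and>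
           (\<forall>n>0. \<forall>L\<in>E n. \<forall>\<omega>\<in>space (R n). \<forall>h. query_history (N n) never_halt L \<omega> h \<longrightarrow>
              (let q = measure_pmf.prob (Q n L \<omega> h) {v. short_vec n \<gamma> L v}
               in 0 < q \<and> \<bar>- (1 / real n) * ln q - K_rate \<gamma> c\<bar> < \<eta>))) \<and>
        (r < K_rate \<gamma> c \<longrightarrow>
           (\<lambda>n. joint_prob (M n) (R n) (N n) never_halt (Q n)
              (\<lambda>L \<omega> h. \<exists>v\<in>set h. short_vec n \<gamma> L v)) \<longlonglongrightarrow> 0) \<and>
        (K_rate \<gamma> c < r \<longrightarrow>
           (\<lambda>n. joint_prob (M n) (R n) (N n) never_halt (Q n)
              (\<lambda>L \<omega> h. \<exists>v\<in>set h. short_vec n \<gamma> L v)) \<longlonglongrightarrow> 1))"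
proof -
  interpret random_lattices M by standard (rule assms(2))
  have R: "\<And>n. 0 < n \<Longrightarrow> prob_space (R n)"
    and N: "\<And>n. 0 < N n" and lim: "(\<lambda>n. ln (real (N n)) / real n) \<longlonglongrightarrow> r" and \<gamma>: "1 \<le> \<gamma>"
    using assms by blast+
  let ?J = "\<lambda>(Q :: nat \<Rightarrow> 'w query_fun) n. joint_prob (M n) (R n) (N n) never_halt (Q n) (\<lambda>L \<omega> h. \<exists>v\<in>set h. short_vec n \<gamma> L v)"
  let ?q = "\<lambda>(Q :: nat \<Rightarrow> 'w query_fun) n L \<omega> h. measure_pmf.prob (Q n L \<omega> h) {v. short_vec n \<gamma> L v}"
  have rates: "(?J Q) \<longlonglongrightarrow> 1"
    if c: "0 < c" "c < 1" and \<delta>: "0 < \<delta>" and \<epsilon>: "\<epsilon> \<in> o(\<lambda>n. exp (- real n * (K_rate \<gamma> c + \<delta>)))"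
      and Q: "\<forall>n>0. query_kernels n (N n) (M n) (R n) never_halt (Q n)"
      and acc: "accurate M R N \<epsilon> (\<lambda>n. never_halt) (\<lambda>n L \<omega> h. c) Q" and r: "K_rate \<gamma> c < r"
    for c \<epsilon> \<delta> and Q :: "nat \<Rightarrow> 'w query_fun"
  proof -
    define \<eta> where "\<eta> = min \<delta> ((r - K_rate \<gamma> c) / 2)"
    have "\<eta> \<le> (r - K_rate \<gamma> c) / 2" unfolding \<eta>_def by (rule min.cobounded2)
    hence \<eta>: "0 < \<eta>" "\<eta> \<le> \<delta>" "K_rate \<gamma> c + \<eta> < r" using r \<delta> by (auto simp: \<eta>_def)
    have w: "whp M (\<lambda>n L. \<forall>\<omega>\<in>space (R n). \<forall>h. query_history (N n) never_halt L \<omega> h \<longrightarrow>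
      exp (- real n * (K_rate \<gamma> c + \<eta>)) / 2 \<le> ?q Q n L \<omega> h)"
      by (rule whp_mono[OF whp_query_prob[OF \<gamma> c \<eta>(1,2) \<epsilon> acc]]) blast+
    show ?thesis by (rule joint_prob_tendsto_1[OF R N lim \<eta>(3) Q w])
  qed
  have short: "(?J Q) \<longlonglongrightarrow> 0"
    if c: "0 < c" "c < 1" and \<delta>: "0 < \<delta>" and \<epsilon>: "\<epsilon> \<in> o(\<lambda>n. exp (- real n * (K_rate \<gamma> c + \<delta>)))"
      and Q: "\<forall>n>0. query_kernels n (N n) (M n) (R n) never_halt (Q n)"
      and acc: "accurate M R N \<epsilon> (\<lambda>n. never_halt) (\<lambda>n L \<omega> h. c) Q" and r: "r < K_rate \<gamma> c"
    for c \<epsilon> \<delta> and Q :: "nat \<Rightarrow> 'w query_fun"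
  proof -
    define \<eta> where "\<eta> = min \<delta> ((K_rate \<gamma> c - r) / 2)"
    have "\<eta> \<le> (K_rate \<gamma> c - r) / 2" unfolding \<eta>_def by (rule min.cobounded2)
    hence \<eta>: "0 < \<eta>" "\<eta> \<le> \<delta>" "r < K_rate \<gamma> c - \<eta>" using r \<delta> by (auto simp: \<eta>_def)
    have w: "whp M (\<lambda>n L. \<forall>\<omega>\<in>space (R n). \<forall>h. query_history (N n) never_halt L \<omega> h \<longrightarrow>
      ?q Q n L \<omega> h \<le> 2 * exp (- real n * (K_rate \<gamma> c - \<eta>)))"
      by (rule whp_mono[OF whp_query_prob[OF \<gamma> c \<eta>(1,2) \<epsilon> acc]]) blast+
    show ?thesis by (rule joint_prob_tendsto_0[OF R N lim \<eta>(3) Q w]) auto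
  qed
  have log_prob: "whp M (\<lambda>n L. \<forall>\<omega>\<in>space (R n). \<forall>h. query_history (N n) never_halt L \<omega> h \<longrightarrow>
      (let q = ?q Q n L \<omega> h in 0 < q \<and> \<bar>- (1 / real n) * ln q - K_rate \<gamma> c\<bar> < \<eta>))"
    if c: "0 < c" "c < 1" and \<delta>: "0 < \<delta>" and \<epsilon>: "\<epsilon> \<in> o(\<lambda>n. exp (- real n * (K_rate \<gamma> c + \<delta>)))"
      and acc: "accurate M R N \<epsilon> (\<lambda>n. never_halt) (\<lambda>n L \<omega> h. c) Q" and \<eta>: "0 < \<eta>"
    for c \<epsilon> \<delta> \<eta> and Q :: "nat \<Rightarrow> 'w query_fun"
  proof -
    \<comment> \<open>Strictly less than \<eta>, so that the factors 1/2 and 2 in the bounds on q,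
      which cost (log 2)/n after taking logarithms, fit into the difference.\<close>
    define \<theta> where "\<theta> = min \<delta> (\<eta> / 2)"
    have \<theta>: "0 < \<theta>" "\<theta> \<le> \<delta>" "\<theta> < \<eta>" using \<delta> \<eta> by (auto simp: \<theta>_def min_def)
    have "filterlim (\<lambda>n. real n * (\<eta> - \<theta>)) at_top sequentially" using \<theta>(3) by real_asymp
    hence "\<forall>\<^sub>F n in sequentially. ln 2 < real n * (\<eta> - \<theta>)" unfolding filterlim_at_top_dense by blast
    hence w1: "whp M (\<lambda>n L. ln 2 < real n * (\<eta> - \<theta>))" by (intro whp_eventually) (auto elim!: eventually_mono)
    show ?thesis
    proof (rule whp_mono[OF whp_conj[OF w1 whp_query_prob[OF \<gamma> c \<theta>(1,2) \<epsilon> acc]]], elim conjE, unfold Let_def, intro ballI allI impI)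
      fix n L \<omega> h
      assume n: "0 < n" "ln 2 < real n * (\<eta> - \<theta>)" and qh: "\<omega> \<in> space (R n)" "query_history (N n) never_halt L \<omega> h"
        and *: "\<forall>\<omega>\<in>space (R n). \<forall>h. query_history (N n) never_halt L \<omega> h \<longrightarrow>
          exp (- real n * (K_rate \<gamma> c + \<theta>)) / 2 \<le> ?q Q n L \<omega> h \<and>
          ?q Q n L \<omega> h \<le> 2 * exp (- real n * (K_rate \<gamma> c - \<theta>))"
      show "0 < ?q Q n L \<omega> h \<and>
        \<bar>- (1 / real n) * ln (?q Q n L \<omega> h) - K_rate \<gamma> c\<bar> < \<eta>"
        by (rule ln_rate_bounds[OF n]) (use * qh in blast)+
    qed
  qed
  have search_0: "(\<lambda>n. joint_prob (M n) (R n) (N n) (halt n) (Q n) (succeeds n \<gamma> (ret n))) \<longlonglongrightarrow> 0"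
    if \<delta>: "0 < \<delta>" and \<epsilon>: "\<epsilon> \<in> o(\<lambda>n. exp (- real n * (K_star \<gamma> + \<delta>)))"
      and ds: "\<forall>n>0. direct_search n (N n) (M n) (R n) (halt n) (par n) (ret n)"
      and Q: "\<forall>n>0. query_kernels n (N n) (M n) (R n) (halt n) (Q n)"
      and acc: "accurate M R N \<epsilon> halt par Q" and r: "r < K_star \<gamma>"
    for \<epsilon> \<delta> and halt :: "nat \<Rightarrow> 'w halt_fun" and par :: "nat \<Rightarrow> 'w choice_fun" and ret :: "nat \<Rightarrow> 'w return_fun"
      and Q :: "nat \<Rightarrow> 'w query_fun"
  proof -
    \<comment> \<open>At least one query is allowed, so r is nonnegative; r <
      \<open>K_star \<gamma>\<close> then forces a positive rate, that is \<gamma> < sqrt e, the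
      range of \<open>whp_hit_prob\<close>.\<close>
    have "0 \<le> ln (real (N n)) / real n" for n using N[of n] by simp
    hence "0 \<le> r" by (intro LIMSEQ_le_const[OF lim]) auto
    hence \<gamma>e: "\<gamma> < sqrt (exp 1)" using r unfolding K_star_def by (auto split: if_splits)
    define \<eta> where "\<eta> = (K_star \<gamma> - r) / 2"
    have \<eta>: "0 < \<eta>" "r < K_star \<gamma> - \<eta>" using r by (auto simp: \<eta>_def field_simps)
    show ?thesis
    proof (rule joint_prob_tendsto_0[OF R N lim \<eta>(2) Q, where H="\<lambda>n L. hit_set n \<gamma> L"])
      show "whp M (\<lambda>n L. \<forall>\<omega>\<in>space (R n). \<forall>h. query_history (N n) (halt n) L \<omega> h \<longrightarrow>
        measure_pmf.prob (Q n L \<omega> h) (hit_set n \<gamma> L) \<le> 2 * exp (- real n * (K_star \<gamma> - \<eta>)))"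
      proof (rule whp_mono[OF whp_conj[OF whp_hit_prob[OF \<gamma> \<gamma>e \<eta>(1)] whp_accurate_prob[OF \<epsilon> acc]]], elim conjE, intro ballI allI impI)
        fix n L \<omega> h
        let ?d = "measure_pmf.prob (disc_gauss L (s_param n (par n L \<omega> h))) (hit_set n \<gamma> L)"
        assume n: "0 < n" and L: "L \<in> space (M n)" and qh: "\<omega> \<in> space (R n)" "query_history (N n) (halt n) L \<omega> h"
          and d: "\<forall>c>0. measure_pmf.prob (disc_gauss L (s_param n c)) (hit_set n \<gamma> L) \<le> exp (- real n * (K_star \<gamma> - \<eta>))"
          and *: "\<forall>\<omega>\<in>space (R n). \<forall>h. query_history (N n) (halt n) L \<omega> h \<longrightarrow>
        (\<forall>A. \<bar>measure_pmf.prob (Q n L \<omega> h) A - measure_pmf.prob (disc_gauss L (s_param n (par n L \<omega> h))) A\<bar> \<le> exp (- real n * (K_star \<gamma> + \<delta>)) / 2)"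
        have "0 < par n L \<omega> h" using ds n L qh unfolding direct_search_def by blast
        hence 1: "?d \<le> exp (- real n * (K_star \<gamma> - \<eta>))" using d by blast
        have 2: "\<bar>measure_pmf.prob (Q n L \<omega> h) (hit_set n \<gamma> L) - ?d\<bar> \<le> exp (- real n * (K_star \<gamma> + \<delta>)) / 2"
          using * qh by blast
        have 3: "exp (- real n * (K_star \<gamma> + \<delta>)) \<le> exp (- real n * (K_star \<gamma> - \<eta>))"
          using \<eta> \<delta> by (simp add: mult_left_mono)
        have "0 < exp (- real n * (K_star \<gamma> - \<eta>))" by simp
        with 1 2 3 show "measure_pmf.prob (Q n L \<omega> h) (hit_set n \<gamma> L) \<le> 2 * exp (- real n * (K_star \<gamma> - \<eta>))" by linarith
      qed
      show "\<exists>v\<in>set l. v \<in> hit_set n \<gamma> L" if "0 < n" "L \<in> space (M n)" "\<omega> \<in> space (R n)" "set l \<subseteq> L" "length l \<le> N n" "succeeds n \<gamma> (ret n) L \<omega> l" for n L \<omega> l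
        using that ds by (intro succeeds_hit_set[OF _ that(2-6)]) blast
    qed
  qed
  have search_1: "(\<lambda>n. joint_prob (M n) (R n) (N n) (halt n) (Q n) (succeeds n \<gamma> (ret n))) \<longlonglongrightarrow> 1"
    if \<delta>: "0 < \<delta>" and \<epsilon>: "\<epsilon> \<in> o(\<lambda>n. exp (- real n * (K_star \<gamma> + \<delta>)))"
      and Q: "\<forall>n>0. query_kernels n (N n) (M n) (R n) (halt n) (Q n)"
      and acc: "accurate M R N \<epsilon> halt par Q" and r: "K_star \<gamma> < r"
      and proc: "\<forall>n>0. halt n = never_halt \<and> par n = (\<lambda>L \<omega> h. exp (- 1)) \<and> returns_shortest n (N n) (M n) (R n) (ret n)"
    for \<epsilon> \<delta> and halt :: "nat \<Rightarrow> 'w halt_fun" and par :: "nat \<Rightarrow> 'w choice_fun" and ret :: "nat \<Rightarrow> 'w return_fun"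
      and Q :: "nat \<Rightarrow> 'w query_fun"
  proof -
    have Q': "\<forall>n>0. query_kernels n (N n) (M n) (R n) never_halt (Q n)" using Q proc by simp
    have acc': "accurate M R N \<epsilon> (\<lambda>n. never_halt) (\<lambda>n L \<omega> h. exp (- 1)) Q"
      using acc proc unfolding accurate_def by (elim exE, intro exI) auto
    note K = K_star_num_rate(2)[OF \<gamma>]
    have "(?J Q) \<longlonglongrightarrow> 1"
      by (rule rates[OF _ _ \<delta> \<epsilon>[unfolded K] Q' acc' r[unfolded K]]) auto
    moreover have "joint_prob (M n) (R n) (N n) (halt n) (Q n) (succeeds n \<gamma> (ret n)) =
      ?J Q n" if n: "0 < n" for n
    proof -
      have "halt n = never_halt" "returns_shortest n (N n) (M n) (R n) (ret n)" using proc n by auto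
      moreover have "query_kernels n (N n) (M n) (R n) never_halt (Q n)" using Q' n by blast
      ultimately show ?thesis by (simp only:) (intro joint_prob_cong succeeds_returns_shortest, assumption+)
    qed
    ultimately show ?thesis
      by (subst tendsto_cong[where g="?J Q"])
         (auto intro!: eventually_mono[OF eventually_gt_at_top[of "0::nat"]])
  qed
  show ?thesis
  proof (intro conjI allI impI)
    fix \<epsilon> :: "nat \<Rightarrow> real" and \<delta> :: real and halt :: "nat \<Rightarrow> 'w halt_fun" and par :: "nat \<Rightarrow> 'w choice_fun"
      and ret :: "nat \<Rightarrow> 'w return_fun" and Q :: "nat \<Rightarrow> 'w query_fun"
    assume a: "0 < \<delta>" "\<epsilon> \<in> o(\<lambda>n. exp (- real n * (K_star \<gamma> + \<delta>)))"
      "\<forall>n>0. direct_search n (N n) (M n) (R n) (halt n) (par n) (ret n)"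
      "\<forall>n>0. query_kernels n (N n) (M n) (R n) (halt n) (Q n)" "accurate M R N \<epsilon> halt par Q"
    show "(\<lambda>n. joint_prob (M n) (R n) (N n) (halt n) (Q n) (succeeds n \<gamma> (ret n))) \<longlonglongrightarrow> 0" if "r < K_star \<gamma>"
      by (rule search_0[OF a that])
    show "(\<lambda>n. joint_prob (M n) (R n) (N n) (halt n) (Q n) (succeeds n \<gamma> (ret n))) \<longlonglongrightarrow> 1" if "K_star \<gamma> < r"
      "\<forall>n>0. halt n = never_halt \<and> par n = (\<lambda>L \<omega> h. exp (- 1)) \<and> returns_shortest n (N n) (M n) (R n) (ret n)"
      by (rule search_1[OF a(1,2,4,5) that])
  next
    fix c :: real and \<epsilon> :: "nat \<Rightarrow> real" and \<delta> :: real and Q :: "nat \<Rightarrow> 'w query_fun"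
    assume a: "0 < c" "c < 1" "0 < \<delta>" "\<epsilon> \<in> o(\<lambda>n. exp (- real n * (K_rate \<gamma> c + \<delta>)))"
      "\<forall>n>0. query_kernels n (N n) (M n) (R n) never_halt (Q n)"
      "accurate M R N \<epsilon> (\<lambda>n. never_halt) (\<lambda>n L \<omega> h. c) Q"
    show "\<exists>E. (\<forall>n>0. E n \<in> sets (M n)) \<and> (\<lambda>n. measure (M n) (E n)) \<longlonglongrightarrow> 1 \<and>
           (\<forall>n>0. \<forall>L\<in>E n. \<forall>\<omega>\<in>space (R n). \<forall>h. query_history (N n) never_halt L \<omega> h \<longrightarrow>
              (let q = ?q Q n L \<omega> h
               in 0 < q \<and> \<bar>- (1 / real n) * ln q - K_rate \<gamma> c\<bar> < \<eta>))" if "0 < \<eta>" for \<eta>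
      using log_prob[OF a(1-4,6) that] unfolding whp_def .
    show "?J Q \<longlonglongrightarrow> 0" if "r < K_rate \<gamma> c"
      by (rule short[OF a that])
    show "?J Q \<longlonglongrightarrow> 1" if "K_rate \<gamma> c < r"
      by (rule rates[OF a that])
  qed
qed

end
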